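(* Let $\mu\in\mathcal{M}_0(\mathbb{R}^N)$. The following assertions are equivalent. (1) $w_\mu\in L^1(\mathbb{R}^N)$. (2) $H^1_\mu\subset L^1(\mathbb{R}^N)$ with continuous injection. Moreover, if one of the two assertions above holds, then the embedding $H^1_\mu\hookrightarrow L^1(\mathbb{R}^N)$ is compact.
   Context: Capacity: for $E\subset\mathbb{R}^N$, $\operatorname{cap}(E)=\inf\{\int_{\mathbb{R}^N}|\nabla u|^2+u^2\,dx : u\in H^1(\mathbb{R}^N),\ u\ge 1 \text{ a.e. in a neighbourhood of } E\}$. "Quasi-everywhere" (q.e.) means except on a set of capacity zero. Every $u\in H^1(\mathbb{R}^N)$ is identified with its quasi-continuous representative, which is unique up to sets of capacity zero. $\mathcal{M}_0(\mathbb{R}^N)$ is the family of all nonnegative regular Borel measures on $\mathbb{R}^N$, possibly $+\infty$ valued (not necessarily finite or $\sigma$-finite), that vanish on all sets of capacity zero. For $\mu\in\mathcal{M}_0(\mathbb{R}^N)$, $H^1_\mu=\{u\in H^1(\mathbb{R}^N): \|u\|_{1,\mu}<+\infty\}$, with Hilbert norm $\|u\|_{1,\mu}^2=\int_{\mathbb{R}^N}(|\nabla u|^2+|u|^2)\,dx+\int_{\mathbb{R}^N}|u|^2\,d\mu$. For $S\subset\mathbb{R}^N$, $\infty_S$ is the measure with $\infty_S(B)=0$ if $\operatorname{cap}(B\cap S)=0$ and $\infty_S(B)=+\infty$ otherwise. The Dirichlet restriction is $\mu\lceil\Omega=\mu+\infty_{\mathbb{R}^N\setminus\Omega}$, so $H^1_{\mu\lceil\Omega}=\{u\in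 H^1_\mu: u=0\text{ q.e. on }\mathbb{R}^N\setminus\Omega\}$. $B_R$ is the ball of radius $R$ centred at the origin. For $R>0$, $\mathcal{R}_{\mu\lceil B_R}(1)$ is the unique $u\in H^1_{\mu\lceil B_R}$ with $\int_{\mathbb{R}^N}(\nabla u\cdot\nabla\phi+u\phi)\,dx+\int_{\mathbb{R}^N}u\phi\,d\mu=\int_{\mathbb{R}^N}\phi\,dx$ for all $\phi\in H^1_{\mu\lceil B_R}$. These functions take values in $[0,1]$ and are nondecreasing in $R$, and $w_\mu=\lim_{R\to+\infty}\mathcal{R}_{\mu\lceil B_R}(1)$ (pointwise monotone limit), so $0\le w_\mu\le 1$. *)

theory Defs
  imports "HOL-Analysis.Analysis"
begin

text \<open>The space $\mathbb{R}^N$ is an arbitrary type \<open>'a :: euclidean_space\<close>, with \<open>N = DIM('a) \<ge> 1\<close>.\<close>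

section \<open>Lebesgue and Sobolev spaces\<close>

primrec C_k :: "nat \<Rightarrow> ('a::euclidean_space \<Rightarrow> real) \<Rightarrow> bool" where
  "C_k 0 f \<longleftrightarrow> continuous_on UNIV f"
| "C_k (Suc k) f \<longleftrightarrow> (\<forall>x. f differentiable at x) \<and>
     (\<forall>i\<in>Basis. C_k k (\<lambda>x. frechet_derivative f (at x) i))"

definition test_function :: "('a::euclidean_space \<Rightarrow> real) \<Rightarrow> bool" where
  "test_function \<phi> \<longleftrightarrow> (\<forall>k. C_k k \<phi>) \<and> compact (closure {x. \<phi> x \<noteq> 0})"

definition L1 :: "('a::euclidean_space \<Rightarrow> real) set" where
  "L1 = {f. integrable lebesgue f}"

definition L1_norm :: "('a::euclidean_space \<Rightarrow> real) \<Rightarrow> real" where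
  "L1_norm f = (LINT x|lebesgue. \<bar>f x\<bar>)"

definition L2 :: "('a::euclidean_space \<Rightarrow> 'b::euclidean_space) set" where
  "L2 = {f \<in> borel_measurable lebesgue. integrable lebesgue (\<lambda>x. (norm (f x))\<^sup>2)}"

definition weak_gradient :: "('a::euclidean_space \<Rightarrow> real) \<Rightarrow> ('a \<Rightarrow> 'a) \<Rightarrow> bool" where
  "weak_gradient u g \<longleftrightarrow> (\<forall>\<phi>. test_function \<phi> \<longrightarrow> (\<forall>i\<in>Basis.
     (LINT x|lebesgue. u x * frechet_derivative \<phi> (at x) i) = - (LINT x|lebesgue. (g x \<bullet> i) * \<phi> x)))"

definition H1 :: "('a::euclidean_space \<Rightarrow> real) set" where
  "H1 = {u \<in> L2. \<exists>g\<in>L2. weak_gradient u g}"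

text \<open>The choice only matters up to Lebesgue-null sets, and is meaningful for \<open>u \<in> H1\<close>.\<close>

definition grad :: "('a::euclidean_space \<Rightarrow> real) \<Rightarrow> 'a \<Rightarrow> 'a" where
  "grad u = (SOME g. g \<in> L2 \<and> weak_gradient u g)"

definition H1_energy :: "('a::euclidean_space \<Rightarrow> real) \<Rightarrow> ennreal" where
  "H1_energy u = (\<integral>\<^sup>+x. ennreal ((norm (grad u x))\<^sup>2 + (u x)\<^sup>2) \<partial>lebesgue)"


section \<open>Capacity\<close>

definition cap :: "'a::euclidean_space set \<Rightarrow> ennreal" where
  "cap E = (INF u\<in>{u \<in> H1. \<exists>U. open U \<and> E \<subseteq> U \<and> (AE x in lebesgue. x \<in> U \<longrightarrow> 1 \<le> u x)}. H1_energy u)"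

definition quasi_everywhere :: "('a::euclidean_space \<Rightarrow> bool) \<Rightarrow> bool" where
  "quasi_everywhere P \<longleftrightarrow> cap {x. \<not> P x} = 0"

definition quasi_continuous :: "('a::euclidean_space \<Rightarrow> real) \<Rightarrow> bool" where
  "quasi_continuous u \<longleftrightarrow> (\<forall>e>0. \<exists>A. open A \<and> cap A < e \<and> continuous_on (- A) u)"

definition quasi_open :: "'a::euclidean_space set \<Rightarrow> bool" where
  "quasi_open U \<longleftrightarrow> (\<forall>e>0. \<exists>A. open A \<and> cap A < e \<and> open (U \<union> A))"


section \<open>Measures vanishing on sets of capacity zero\<close>

text \<open>
  Regularity is outer regularity with respect to quasi-open sets, as is usual for this class: it
  is satisfied by every $\infty_S$ with \<open>S\<close> closed, for which in general outer regularity
  with respect to open sets fails. Every quasi-open set is contained in a Borel quasi-open set that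
  differs from it by a set of capacity zero, so only Borel ones are needed in the infimum.
\<close>

definition M0 :: "'a::euclidean_space measure set" where
  "M0 = {\<mu>. sets \<mu> = sets borel \<and>
     (\<forall>B\<in>sets borel. cap B = 0 \<longrightarrow> emeasure \<mu> B = 0) \<and>
     (\<forall>B\<in>sets borel. emeasure \<mu> B = (INF U\<in>{U \<in> sets borel. quasi_open U \<and> B \<subseteq> U}. emeasure \<mu> U))}"

definition infty_on :: "'a::euclidean_space set \<Rightarrow> 'a measure" where
  "infty_on S = measure_of UNIV (sets borel) (\<lambda>B. if cap (B \<inter> S) = 0 then 0 else \<infinity>)"

definition dirichlet_restriction :: "'a::euclidean_space measure \<Rightarrow> 'a set \<Rightarrow> 'a measure" where
  "dirichlet_restriction \<mu> \<Omega> =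
     measure_of UNIV (sets borel) (\<lambda>B. emeasure \<mu> B + emeasure (infty_on (- \<Omega>)) B)"


section \<open>The space $H^1_\mu$\<close>

text \<open>
  Elements of $H^1_\mu$ are represented by their quasi-continuous representatives; two of them are
  the same element iff they agree quasi-everywhere. A quasi-continuous function agrees
  quasi-everywhere with a Borel function and is therefore measurable for the completion of any
  \<open>\<mu> \<in> M0\<close>, though not necessarily for \<open>\<mu>\<close> itself.
\<close>

definition H1_mu_norm_sq :: "'a::euclidean_space measure \<Rightarrow> ('a \<Rightarrow> real) \<Rightarrow> ennreal" where
  "H1_mu_norm_sq \<mu> u = H1_energy u + (\<integral>\<^sup>+x. ennreal ((u x)\<^sup>2) \<partial>completion \<mu>)"

definition H1_mu :: "'a::euclidean_space measure \<Rightarrow> ('a \<Rightarrow> real) set" where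
  "H1_mu \<mu> = {u \<in> H1. quasi_continuous u \<and> H1_mu_norm_sq \<mu> u < \<infinity>}"

definition H1_mu_norm :: "'a::euclidean_space measure \<Rightarrow> ('a \<Rightarrow> real) \<Rightarrow> real" where
  "H1_mu_norm \<mu> u = sqrt (enn2real (H1_mu_norm_sq \<mu> u))"

definition continuously_embedded_L1 :: "'a::euclidean_space measure \<Rightarrow> bool" where
  "continuously_embedded_L1 \<mu> \<longleftrightarrow>
     H1_mu \<mu> \<subseteq> L1 \<and> (\<exists>C. \<forall>u\<in>H1_mu \<mu>. L1_norm u \<le> C * H1_mu_norm \<mu> u)"

definition compactly_embedded_L1 :: "'a::euclidean_space measure \<Rightarrow> bool" where
  "compactly_embedded_L1 \<mu> \<longleftrightarrow> H1_mu \<mu> \<subseteq> L1 \<and>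
     (\<forall>u. (\<forall>n::nat. u n \<in> H1_mu \<mu>) \<and> (\<exists>M. \<forall>n. H1_mu_norm \<mu> (u n) \<le> M) \<longrightarrow>
       (\<exists>r v. strict_mono r \<and> v \<in> L1 \<and> (\<lambda>n. L1_norm (\<lambda>x. u (r n) x - v x)) \<longlonglongrightarrow> 0))"


section \<open>The torsion function\<close>

text \<open>The (quasi-everywhere unique) function $\mathcal{R}_{\mu\lceil\Omega}(1)$.\<close>

definition resolvent_one :: "'a::euclidean_space measure \<Rightarrow> 'a set \<Rightarrow> 'a \<Rightarrow> real" where
  "resolvent_one \<mu> \<Omega> = (SOME u. u \<in> H1_mu (dirichlet_restriction \<mu> \<Omega>) \<and>
     (\<forall>\<phi>\<in>H1_mu (dirichlet_restriction \<mu> \<Omega>).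
        (LINT x|lebesgue. grad u x \<bullet> grad \<phi> x + u x * \<phi> x) + (LINT x|completion \<mu>. u x * \<phi> x)
          = (LINT x|lebesgue. \<phi> x)))"

text \<open>
  For each radius the resolvent is determined only quasi-everywhere, so the limit as the radius
  tends to infinity is taken along every sequence of radii, quasi-everywhere for each sequence;
  exceptional sets for uncountably many radii are thus never collected. Since the resolvents are
  monotone in the radius, this determines \<open>w_mu \<mu>\<close> quasi-everywhere.
\<close>

definition w_mu :: "'a::euclidean_space measure \<Rightarrow> 'a \<Rightarrow> real" where
  "w_mu \<mu> = (SOME w. \<forall>R::nat \<Rightarrow> real. (\<forall>n. 0 < R n) \<and> filterlim R at_top sequentially \<longrightarrow>
     quasi_everywhere (\<lambda>x. (\<lambda>n. resolvent_one \<mu> (ball 0 (R n)) x) \<longlonglongrightarrow> w x))"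

end

theory Submission
  imports Defs "HOL-Complex_Analysis.Great_Picard" "HOL-Library.Diagonal_Subsequence"
begin

text \<open>A function \<open>\<phi>\<close> of $H^1_\mu$ that vanishes outside a ball satisfies $\int\phi = \langle u, \phi\rangle$, where
  $u$ is the resolvent of \<open>1\<close> on that ball, and $\|u\|^2 = \int u \le \int w_\mu$. Applied to \<open>\<bar>\<phi>\<bar>\<close> this
  bounds the $L^1$ norm of \<open>\<phi>\<close> if $w_\mu$ is integrable, and cutoff functions extend the bound to
  $H^1_\mu$. Conversely, the embedding inequality for $u$ itself reads $\|u\|^2 = \int u \le C \|u\|$, which
  bounds $\int u$ independently of the ball.

  For compactness, the embedding makes $\phi \mapsto \int\phi$ a bounded functional on $H^1_\mu$, represented by
  some $W$. Testing with $(1 - \eta)|\phi|$, where $\eta$ is a cutoff function, bounds the mass of $|\phi|$ near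
  infinity by $\|\phi\|$ times the energy of $W$ near infinity, so that the local compactness given by
  Rellich's theorem suffices.\<close>

text \<open>The measure \<open>\<mu>\<close> may be infinite on every nonempty open set and need not
  be sigma-finite, so nothing can be smoothed with respect to it: mollification and Fubini are
  applied to Lebesgue measure only, and \<open>\<mu>\<close> enters through Hilbert space arguments
  and pointwise domination. The link between the two measures is quasi-everywhere convergence. A
  sequence that is Cauchy in the energy norm has a subsequence converging quasi-everywhere, hence
  also \<open>\<mu>\<close>-almost everywhere; this makes \<open>H1_mu \<mu>\<close> and its
  Dirichlet subspaces complete, and completeness gives the resolvents and \<open>W\<close> by
  minimisation. The order of the resolvents must hold quasi-everywhere as well, so the maximum
  principle tests with a truncation and concludes by \<open>qc_null\<close> that a quasi-continuous
  function of zero energy vanishes quasi-everywhere. The tail estimate is uniform because the factor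
  \<open>1 - \<eta>\<close> is moved from the test function onto the fixed function
  \<open>W\<close>, whose tails vanish by dominated convergence; the remaining term has the size of
  the gradient of \<open>\<eta>\<close>, that is \<open>1/n\<close>.\<close>

lemma quadratic_nonneg_imp:
  fixes a b c :: real
  assumes "\<And>t. 0 \<le> a + 2 * t * b + t\<^sup>2 * c" and "0 \<le> c"
  shows "b\<^sup>2 \<le> a * c"
proof (cases "c = 0")
  case True
  have "b = 0"
  proof (rule ccontr)
    assume "b \<noteq> 0"
    \<comment> \<open>For \<open>c = 0\<close> the expression is affine in \<open>t\<close>; this
      choice of \<open>t\<close> gives it the value -1.\<close>
    have "0 \<le> a + 2 * (-(a+1)/(2*b)) * b + (-(a+1)/(2*b))\<^sup>2 * c"
      by (rule assms(1))
    with \<open>b \<noteq> 0\<close> True show False by (simp add: field_simps)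
  qed
  then show ?thesis using True by simp
next
  case False
  then have "c > 0" using assms by simp
  have "0 \<le> a + 2 * (-b/c) * b + (-b/c)\<^sup>2 * c" by (rule assms(1))
  also have "\<dots> = a - b\<^sup>2/c" using \<open>c > 0\<close> by (simp add: power2_eq_square field_simps)
  finally show ?thesis using \<open>c > 0\<close> by (simp add: field_simps)
qed

section \<open>Spaces of functions with a semi-inner product\<close>

text \<open>A vector space of functions given as a set, with a form that is only positive
  semidefinite. Functions that agree almost or quasi everywhere stay different elements and no
  quotient is formed, so limits and Riesz representatives are not unique. Instances are
  \<open>H1\<close> and all the spaces \<open>H1_mu0 \<mu> \<Omega>\<close>.\<close>

locale prehilbert =
  fixes V :: "('x \<Rightarrow> real) set" and B :: "('x \<Rightarrow> real) \<Rightarrow> ('x \<Rightarrow> real) \<Rightarrow> real"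
  assumes zero_mem: "(\<lambda>x. 0) \<in> V"
    and lincomb_mem: "u \<in> V \<Longrightarrow> v \<in> V \<Longrightarrow> (\<lambda>x. u x + c * v x) \<in> V"
    and B_sym: "u \<in> V \<Longrightarrow> v \<in> V \<Longrightarrow> B u v = B v u"
    and B_lincomb: "u \<in> V \<Longrightarrow> v \<in> V \<Longrightarrow> w \<in> V \<Longrightarrow>
      B (\<lambda>x. u x + c * v x) w = B u w + c * B v w"
    and B_nonneg: "u \<in> V \<Longrightarrow> 0 \<le> B u u"
begin

definition nrm :: "('x \<Rightarrow> real) \<Rightarrow> real" where "nrm u = sqrt (B u u)"

lemma nrm_nonneg [simp]: "u \<in> V \<Longrightarrow> 0 \<le> nrm u"
  by (simp add: nrm_def B_nonneg)

lemma nrm_sq: "u \<in> V \<Longrightarrow> (nrm u)\<^sup>2 = B u u"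
  by (simp add: nrm_def B_nonneg)

lemma scale_mem: "u \<in> V \<Longrightarrow> (\<lambda>x. c * u x) \<in> V"
  using lincomb_mem[OF zero_mem, of u c] by simp

lemma add_mem: "u \<in> V \<Longrightarrow> v \<in> V \<Longrightarrow> (\<lambda>x. u x + v x) \<in> V"
  using lincomb_mem[of u v 1] by simp

lemma diff_mem: "u \<in> V \<Longrightarrow> v \<in> V \<Longrightarrow> (\<lambda>x. u x - v x) \<in> V"
  using lincomb_mem[of u v "-1"] by simp

lemma sum_mem: "finite I \<Longrightarrow> (\<And>i. i \<in> I \<Longrightarrow> u i \<in> V) \<Longrightarrow> (\<lambda>x. \<Sum>i\<in>I. u i x) \<in> V"
  by (induction I rule: finite_induct) (auto intro: add_mem zero_mem)

lemma B_zero: "w \<in> V \<Longrightarrow> B (\<lambda>x. 0) w = 0"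
  using B_lincomb[OF zero_mem zero_mem, of w "-1"] by simp

lemma B_scale: "u \<in> V \<Longrightarrow> w \<in> V \<Longrightarrow> B (\<lambda>x. c * u x) w = c * B u w"
  using B_lincomb[OF zero_mem, of u w c] by (simp add: B_zero)

lemma B_diff: "u \<in> V \<Longrightarrow> v \<in> V \<Longrightarrow> w \<in> V \<Longrightarrow> B (\<lambda>x. u x - v x) w = B u w - B v w"
  using B_lincomb[of u v w "-1"] by simp

lemma B_lincomb_sq:
  assumes "u \<in> V" "v \<in> V"
  shows "B (\<lambda>x. u x + c * v x) (\<lambda>x. u x + c * v x) = B u u + 2 * c * B u v + c\<^sup>2 * B v v"
proof -
  let ?w = "\<lambda>x. u x + c * v x"
  have w: "?w \<in> V" using assms by (rule lincomb_mem)
  have "B ?w ?w = B u ?w + c * B v ?w" by (rule B_lincomb[OF assms w])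
  also have "B u ?w = B u u + c * B v u"
    using B_sym[OF assms(1) w] B_lincomb[OF assms assms(1)] by simp
  also have "B v ?w = B u v + c * B v v"
    using B_sym[OF assms(2) w] B_lincomb[OF assms assms(2)] by simp
  finally show ?thesis using B_sym[OF assms]
    by (simp add: algebra_simps power2_eq_square)
qed

lemma cauchy_schwarz:
  assumes "u \<in> V" "v \<in> V"
  shows "\<bar>B u v\<bar> \<le> nrm u * nrm v"
proof -
  have "(B u v)\<^sup>2 \<le> B u u * B v v"
  proof (rule quadratic_nonneg_imp)
    fix t
    show "0 \<le> B u u + 2 * t * B u v + t\<^sup>2 * B v v"
      using B_nonneg[OF lincomb_mem[OF assms, of t]] by (simp add: B_lincomb_sq assms)
  qed (use assms B_nonneg in auto)
  then have "sqrt ((B u v)\<^sup>2) \<le> sqrt (B u u * B v v)" by (rule real_sqrt_le_mono)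
  then show ?thesis by (simp add: nrm_def real_sqrt_mult)
qed

lemma nrm_triangle:
  assumes "u \<in> V" "v \<in> V"
  shows "nrm (\<lambda>x. u x + v x) \<le> nrm u + nrm v"
proof (rule power2_le_imp_le)
  have "(nrm (\<lambda>x. u x + v x))\<^sup>2 = B u u + 2 * B u v + B v v"
    using B_lincomb_sq[OF assms, of 1] nrm_sq[OF add_mem[OF assms]] by simp
  also have "\<dots> \<le> (nrm u + nrm v)\<^sup>2"
    using cauchy_schwarz[OF assms] nrm_sq[OF assms(1)] nrm_sq[OF assms(2)]
    by (simp add: power2_sum)
  finally show "(nrm (\<lambda>x. u x + v x))\<^sup>2 \<le> (nrm u + nrm v)\<^sup>2" .
qed (use assms in auto)

lemma nrm_scale: "u \<in> V \<Longrightarrow> nrm (\<lambda>x. c * u x) = \<bar>c\<bar> * nrm u"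
  using B_lincomb_sq[OF zero_mem, of u c]
  by (simp add: nrm_def B_zero zero_mem real_sqrt_mult)

lemma nrm_minus_commute: "u \<in> V \<Longrightarrow> v \<in> V \<Longrightarrow> nrm (\<lambda>x. u x - v x) = nrm (\<lambda>x. v x - u x)"
  using nrm_scale[OF diff_mem, of u v "-1"] by simp

lemma nrm_triangle_diff:
  assumes "u \<in> V" "v \<in> V" "w \<in> V"
  shows "nrm (\<lambda>x. u x - w x) \<le> nrm (\<lambda>x. u x - v x) + nrm (\<lambda>x. v x - w x)"
  using nrm_triangle[OF diff_mem[OF assms(1,2)] diff_mem[OF assms(2,3)]] by simp

lemma nrm_le_add:
  assumes "u \<in> V" "v \<in> V"
  shows "nrm u \<le> nrm v + nrm (\<lambda>x. u x - v x)"
  using nrm_triangle[OF assms(2) diff_mem[OF assms]] by simp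

lemma nrm_zero: "nrm (\<lambda>x. 0) = 0"
  by (simp add: nrm_def B_zero zero_mem)

lemma nrm_sum:
  assumes "finite I" "\<And>i. i \<in> I \<Longrightarrow> u i \<in> V"
  shows "nrm (\<lambda>x. \<Sum>i\<in>I. u i x) \<le> (\<Sum>i\<in>I. nrm (u i))"
  using assms
proof (induction I rule: finite_induct)
  case (insert i I)
  have "nrm (\<lambda>x. u i x + (\<Sum>i\<in>I. u i x)) \<le> nrm (u i) + nrm (\<lambda>x. \<Sum>i\<in>I. u i x)"
    by (rule nrm_triangle) (use insert in \<open>auto intro: sum_mem\<close>)
  with insert show ?case by simp
qed (simp add: nrm_zero)

definition cauchy :: "(nat \<Rightarrow> 'x \<Rightarrow> real) \<Rightarrow> bool" where
  "cauchy s \<longleftrightarrow> (\<forall>n. s n \<in> V) \<and> (\<forall>e>0. \<exists>N. \<forall>m\<ge>N. \<forall>n\<ge>N. nrm (\<lambda>x. s m x - s n x) < e)"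

text \<open>Telescoping bounds the distance of two members by a block of the series, which is small
  by the Cauchy criterion.\<close>

lemma cauchyI_summable:
  assumes s: "\<And>n. s n \<in> V" and b: "\<And>n. nrm (\<lambda>x. s (Suc n) x - s n x) \<le> b n" and "summable b"
  shows "cauchy s"
  unfolding cauchy_def
proof (intro conjI allI impI s)
  have b0: "0 \<le> b n" for n using b[of n] nrm_nonneg[OF diff_mem[OF s s, of "Suc n" n]] by linarith
  fix e :: real assume "e > 0"
  have tele: "nrm (\<lambda>x. s (m + k) x - s m x) \<le> (\<Sum>i\<in>{m..<m+k}. b i)" for m k
  proof (induction k)
    case (Suc k)
    have "nrm (\<lambda>x. s (m + Suc k) x - s m x)
        \<le> nrm (\<lambda>x. s (Suc (m + k)) x - s (m+k) x) + nrm (\<lambda>x. s (m + k) x - s m x)"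
      using nrm_triangle_diff[OF s s s] by simp
    with Suc b[of "m+k"] show ?case by simp
  qed (simp add: nrm_zero)
  obtain N where N: "\<And>m n. m \<ge> N \<Longrightarrow> norm (sum b {m..<n}) < e"
    using \<open>summable b\<close> \<open>e > 0\<close> unfolding summable_Cauchy by blast
  have *: "nrm (\<lambda>x. s n x - s m x) < e" if "N \<le> m" "m \<le> n" for m n
    using tele[of m "n - m"] N[of m n] that by simp
  have "nrm (\<lambda>x. s m x - s n x) < e" if "N \<le> m" "N \<le> n" for m n
    using *[of m n] *[of n m] that nrm_minus_commute[OF s s, of m n] by (cases "m \<le> n") auto
  then show "\<exists>N. \<forall>m\<ge>N. \<forall>n\<ge>N. nrm (\<lambda>x. s m x - s n x) < e" by blast
qed

text \<open>The direct method: a minimising sequence of \<open>J u = B u u - 2 * L u\<close> is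
  Cauchy by uniform convexity, its limit is a minimiser, and the first variation of \<open>J\<close>
  there is the equation. Asking for completeness in the seminorm makes this work for a semidefinite
  form.\<close>

lemma riesz:
  assumes complete: "\<And>s. cauchy s \<Longrightarrow> \<exists>u\<in>V. (\<lambda>n. nrm (\<lambda>x. s n x - u x)) \<longlonglongrightarrow> 0"
    and L_lin: "\<And>u v c. u \<in> V \<Longrightarrow> v \<in> V \<Longrightarrow> L (\<lambda>x. u x + c * v x) = L u + c * L v"
    and L_bd: "\<And>u. u \<in> V \<Longrightarrow> \<bar>L u\<bar> \<le> C * nrm u"
  shows "\<exists>u\<in>V. \<forall>\<phi>\<in>V. B u \<phi> = (L \<phi> :: real)"
proof -
  define J where "J u = B u u - 2 * L u" for u
  define m where "m = Inf (J ` V)"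
  have J_lincomb: "J (\<lambda>x. u x + c * v x) = J u + 2 * c * (B u v - L v) + c\<^sup>2 * B v v"
    if "u \<in> V" "v \<in> V" for u v c
    using that by (simp add: J_def B_lincomb_sq L_lin algebra_simps)
  have J_lower: "- C\<^sup>2 \<le> J u" if "u \<in> V" for u
  proof -
    \<comment> \<open>Completing the square bounds \<open>J\<close> from below, so its infimum is
      finite.\<close>
    have "0 \<le> (nrm u - C)\<^sup>2" by simp
    also have "\<dots> = B u u - 2 * (C * nrm u) + C\<^sup>2"
      using nrm_sq[OF that] by (simp add: power2_diff)
    finally show ?thesis using L_bd[OF that] by (simp add: J_def)
  qed
  have bdd: "bdd_below (J ` V)" using J_lower by (intro bdd_belowI2)
  have m_le: "m \<le> J u" if "u \<in> V" for u
    unfolding m_def by (rule cINF_lower[OF bdd that])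
  have "\<exists>u\<in>V. J u < m + e" if "e > 0" for e
  proof -
    have "Inf (J ` V) < m + e" using that by (simp add: m_def)
    then show ?thesis using cINF_less_iff[OF _ bdd, of "m+e"] zero_mem by auto
  qed
  then have "\<exists>u\<in>V. J u < m + 1 / real (Suc n)" for n by simp
  then obtain s where s: "\<And>n. s n \<in> V" and Js: "\<And>n. J (s n) < m + 1 / real (Suc n)" by metis
  have par: "B (\<lambda>x. u x - v x) (\<lambda>x. u x - v x) \<le> 2 * (J u - m) + 2 * (J v - m)"
    if u: "u \<in> V" and v: "v \<in> V" for u v
  proof -
    have d: "(\<lambda>x. u x - v x) \<in> V" by (rule diff_mem[OF u v])
    let ?d = "\<lambda>x. u x - v x"
    \<comment> \<open>The argument is the midpoint of \<open>u\<close> and \<open>v\<close>;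
      comparing its value with \<open>m\<close> controls the square of their distance.\<close>
    have "m \<le> J (\<lambda>x. v x + 1/2 * ?d x)" by (rule m_le, rule lincomb_mem[OF v d])
    also have "\<dots> = J v + (B v ?d - L ?d) + 1/4 * B ?d ?d"
      using J_lincomb[OF v d, of "1/2"] by (simp add: power2_eq_square)
    finally have 1: "m \<le> J v + (B v ?d - L ?d) + 1/4 * B ?d ?d" .
    have 2: "J u = J v + 2 * (B v ?d - L ?d) + B ?d ?d"
      using J_lincomb[OF v d, of 1] by simp
    define a b where "a = B v ?d - L ?d" and "b = B ?d ?d"
    then have "m \<le> J v + a + 1/4 * b" "J u = J v + 2 * a + b" using 1 2 by simp_all
    then have "b \<le> 2 * (J u - m) + 2 * (J v - m)" by (simp add: field_simps)
    then show ?thesis unfolding b_def .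
  qed
  have lim0: "(\<lambda>n. 1 / real (Suc n)) \<longlonglongrightarrow> 0" by (rule LIMSEQ_Suc[OF lim_1_over_n])
  have "cauchy s" unfolding cauchy_def
  proof (intro conjI allI impI s)
    fix e :: real assume "e > 0"
    then have "e\<^sup>2 / 4 > 0" by simp
    from order_tendstoD(2)[OF lim0 this] obtain N where N: "\<And>n. n \<ge> N \<Longrightarrow> 1 / real (Suc n) < e\<^sup>2/4"
      unfolding eventually_sequentially by blast
    have "nrm (\<lambda>x. s k x - s n x) < e" if "k \<ge> N" "n \<ge> N" for k n
    proof (rule power2_less_imp_less)
      have "(nrm (\<lambda>x. s k x - s n x))\<^sup>2 \<le> 2 * (J (s k) - m) + 2 * (J (s n) - m)"
        using par[OF s s, of k n] nrm_sq[OF diff_mem[OF s s, of k n]] by simp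
      also have "\<dots> < e\<^sup>2" using Js[of k] Js[of n] N[OF that(1)] N[OF that(2)] by argo
      finally show "(nrm (\<lambda>x. s k x - s n x))\<^sup>2 < e\<^sup>2" .
    qed (use \<open>e > 0\<close> in simp)
    then show "\<exists>N. \<forall>m\<ge>N. \<forall>n\<ge>N. nrm (\<lambda>x. s m x - s n x) < e" by blast
  qed
  from complete[OF this] obtain u where u: "u \<in> V" and lim: "(\<lambda>n. nrm (\<lambda>x. s n x - u x)) \<longlonglongrightarrow> 0"
    by blast
  \<comment> \<open>Expanding \<open>J (s n)\<close> at \<open>u\<close> and dropping the
    nonnegative quadratic term leaves an error that is linear in the distance of \<open>s n\<close>
    and \<open>u\<close>.\<close>
  have "J u \<le> m"
  proof (rule LIMSEQ_le_const)
    define r where "r n = nrm (\<lambda>x. s n x - u x)" for n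
    have "(\<lambda>n. m + 1 / real (Suc n) + 2 * (nrm u + C) * r n) \<longlonglongrightarrow> m + 0 + 2 * (nrm u + C) * 0"
      using lim0 lim unfolding r_def by (intro tendsto_intros)
    then show "(\<lambda>n. m + 1 / real (Suc n) + 2 * (nrm u + C) * r n) \<longlonglongrightarrow> m" by simp
    have "J u \<le> m + 1 / real (Suc n) + 2 * (nrm u + C) * r n" for n
    proof -
      let ?d = "\<lambda>x. s n x - u x"
      have d: "?d \<in> V" by (rule diff_mem[OF s u])
      have "J (s n) = J u + 2 * (B u ?d - L ?d) + B ?d ?d"
        using J_lincomb[OF u d, of 1] by simp
      then have "J u \<le> J (s n) + 2 * (\<bar>B u ?d\<bar> + \<bar>L ?d\<bar>)" using B_nonneg[OF d] by (smt (verit))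
      also have "\<bar>B u ?d\<bar> \<le> nrm u * r n" using cauchy_schwarz[OF u d] by (simp add: r_def)
      also have "\<bar>L ?d\<bar> \<le> C * r n" using L_bd[OF d] by (simp add: r_def)
      finally show ?thesis using Js[of n] by (simp add: algebra_simps)
    qed
    then show "\<exists>N. \<forall>n\<ge>N. J u \<le> m + 1 / real (Suc n) + 2 * (nrm u + C) * r n" by blast
  qed
  have "B u \<phi> = L \<phi>" if \<phi>: "\<phi> \<in> V" for \<phi>
  proof -
    \<comment> \<open>For a minimiser, the change of \<open>J\<close> in the direction
      \<open>\<phi>\<close> is a nonnegative quadratic in \<open>t\<close> without constant term, so
      its linear coefficient vanishes.\<close>
    have "(B u \<phi> - L \<phi>)\<^sup>2 \<le> 0 * B \<phi> \<phi>"
    proof (rule quadratic_nonneg_imp)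
      fix t
      have "J u \<le> J (\<lambda>x. u x + t * \<phi> x)"
        using \<open>J u \<le> m\<close> m_le[OF lincomb_mem[OF u \<phi>, of t]] by linarith
      then show "0 \<le> 0 + 2 * t * (B u \<phi> - L \<phi>) + t\<^sup>2 * B \<phi> \<phi>"
        by (simp add: J_lincomb[OF u \<phi>])
    qed (rule B_nonneg[OF \<phi>])
    then show ?thesis by simp
  qed
  with u show ?thesis by blast
qed

end

section \<open>Square-integrable functions\<close>

text \<open>Square integrability over an arbitrary measure and with vector values: it serves for
  functions and gradients over \<open>lebesgue\<close>, for Borel functions over
  \<open>lborel\<close>, where translations and Fubini act, and for functions over
  \<open>completion \<mu>\<close>.\<close>

definition sqint :: "'x measure \<Rightarrow> ('x \<Rightarrow> 'b::euclidean_space) \<Rightarrow> bool" where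
  "sqint M f \<longleftrightarrow> f \<in> borel_measurable M \<and> integrable M (\<lambda>x. (norm (f x))\<^sup>2)"

lemma L2_iff: "f \<in> L2 \<longleftrightarrow> sqint lebesgue f"
  by (simp add: L2_def sqint_def)

lemma sqintD [measurable_dest]: "sqint M f \<Longrightarrow> f \<in> borel_measurable M"
  by (simp add: sqint_def)

lemma sqint_int: "sqint M f \<Longrightarrow> integrable M (\<lambda>x. (norm (f x))\<^sup>2)"
  by (simp add: sqint_def)

lemma sqint_iff_nn:
  "sqint M f \<longleftrightarrow> f \<in> borel_measurable M \<and> (\<integral>\<^sup>+x. ennreal ((norm (f x))\<^sup>2) \<partial>M) < \<infinity>"
  unfolding sqint_def integrable_iff_bounded by (auto simp: )

lemma sqint_real: "sqint M f \<longleftrightarrow> f \<in> borel_measurable M \<and> integrable M (\<lambda>x. (f x)\<^sup>2)"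
  for f :: "'x \<Rightarrow> real"
  by (simp add: sqint_def)

lemma sqint_bound:
  assumes "sqint M f" "g \<in> borel_measurable M" "AE x in M. norm (g x) \<le> c * norm (f x)"
  shows "sqint M g"
  unfolding sqint_def
proof
  show "integrable M (\<lambda>x. (norm (g x))\<^sup>2)"
  proof (rule Bochner_Integration.integrable_bound)
    show "integrable M (\<lambda>x. c\<^sup>2 * (norm (f x))\<^sup>2)" using assms(1) by (simp add: sqint_def)
    show "AE x in M. norm ((norm (g x))\<^sup>2) \<le> norm (c\<^sup>2 * (norm (f x))\<^sup>2)"
      using assms(3)
    proof eventually_elim
      case (elim x)
      then have "(norm (g x))\<^sup>2 \<le> (c * norm (f x))\<^sup>2" by (intro power_mono) auto
      then show ?case by (simp add: power_mult_distrib)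
    qed
  qed (use assms(2) in measurable)
qed (use assms in simp)

lemma sqint_norm_mult:
  assumes f: "sqint M f" and g: "sqint M g"
  shows "integrable M (\<lambda>x. norm (f x) * norm (g x))"
proof (rule Bochner_Integration.integrable_bound)
  show "integrable M (\<lambda>x. (norm (f x))\<^sup>2 + (norm (g x))\<^sup>2)" using f g by (simp add: sqint_def)
  have "\<bar>norm (f x) * norm (g x)\<bar> \<le> \<bar>(norm (f x))\<^sup>2 + (norm (g x))\<^sup>2\<bar>" for x
  proof -
    have "2 * norm (f x) * norm (g x) \<le> (norm (f x))\<^sup>2 + (norm (g x))\<^sup>2"
      by (rule sum_squares_bound)
    moreover have "0 \<le> norm (f x) * norm (g x)" by simp
    ultimately have "norm (f x) * norm (g x) \<le> (norm (f x))\<^sup>2 + (norm (g x))\<^sup>2" by linarith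
    then show ?thesis by (simp add: abs_mult)
  qed
  then show "AE x in M. norm (norm (f x) * norm (g x)) \<le> norm ((norm (f x))\<^sup>2 + (norm (g x))\<^sup>2)"
    by auto
  show "(\<lambda>x. norm (f x) * norm (g x)) \<in> borel_measurable M"
    using sqintD[OF f] sqintD[OF g] by measurable
qed

lemma sqint_inner:
  assumes f: "sqint M f" and g: "sqint M g"
  shows "integrable M (\<lambda>x. f x \<bullet> g x)"
proof (rule Bochner_Integration.integrable_bound[OF sqint_norm_mult[OF f g]])
  show "(\<lambda>x. f x \<bullet> g x) \<in> borel_measurable M"
    using sqintD[OF f] sqintD[OF g] by measurable
qed (auto simp: Cauchy_Schwarz_ineq2)

lemma sqint_mult: "sqint M f \<Longrightarrow> sqint M g \<Longrightarrow> integrable M (\<lambda>x. f x * g x)"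
  for f g :: "'x \<Rightarrow> real"
  using sqint_inner[of M f g] by simp

lemma sqint_scaleR: "sqint M f \<Longrightarrow> sqint M (\<lambda>x. c *\<^sub>R f x)"
  by (rule sqint_bound[where c="\<bar>c\<bar>"]) (auto dest: sqintD)

lemma sqint_zero [simp]: "sqint M (\<lambda>x. 0)" by (simp add: sqint_def)

lemma sqint_add:
  assumes f: "sqint M f" and g: "sqint M g"
  shows "sqint M (\<lambda>x. f x + g x)"
proof -
  have "integrable M (\<lambda>x. (norm (f x))\<^sup>2 + 2 * (f x \<bullet> g x) + (norm (g x))\<^sup>2)"
    using f g by (intro Bochner_Integration.integrable_add integrable_mult_right sqint_inner)
      (auto simp: sqint_def)
  also have "(\<lambda>x. (norm (f x))\<^sup>2 + 2 * (f x \<bullet> g x) + (norm (g x))\<^sup>2) = (\<lambda>x. (norm (f x + g x))\<^sup>2)"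
    by (simp add: power2_norm_eq_inner inner_add inner_commute algebra_simps)
  finally show ?thesis using sqintD[OF f] sqintD[OF g] by (simp add: sqint_def)
qed

lemma sqint_diff: "sqint M f \<Longrightarrow> sqint M g \<Longrightarrow> sqint M (\<lambda>x. f x - g x)"
  using sqint_add[of M f "\<lambda>x. (-1) *\<^sub>R g x"] sqint_scaleR[of M g "-1"] by simp

lemma sqint_cong_AE:
  "AE x in M. f x = g x \<Longrightarrow> f \<in> borel_measurable M \<Longrightarrow> sqint M g \<Longrightarrow> sqint M f"
  by (rule sqint_bound[where c=1 and f=g]) auto

lemma sqint_inner_const: "sqint M f \<Longrightarrow> sqint M (\<lambda>x. f x \<bullet> b)"
  by (rule sqint_bound[where c="norm b"])
    (auto dest: sqintD simp: mult.commute[of "norm b"] intro!: Cauchy_Schwarz_ineq2)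

lemma sqint_norm: "sqint M f \<Longrightarrow> sqint M (\<lambda>x. norm (f x))"
  by (rule sqint_bound[where c="1"]) (auto dest: sqintD)

definition l2n :: "'x measure \<Rightarrow> ('x \<Rightarrow> 'b::euclidean_space) \<Rightarrow> real" where
  "l2n M f = sqrt (LINT x|M. (norm (f x))\<^sup>2)"

lemma l2n_nonneg [simp]: "0 \<le> l2n M f" by (simp add: l2n_def)

lemma l2n_sq: "(l2n M f)\<^sup>2 = (LINT x|M. (norm (f x))\<^sup>2)" by (simp add: l2n_def)

lemma nn_integral_l2n: "sqint M f \<Longrightarrow> (\<integral>\<^sup>+x. ennreal ((norm (f x))\<^sup>2) \<partial>M) = ennreal ((l2n M f)\<^sup>2)"
  by (simp add: l2n_sq sqint_def nn_integral_eq_integral)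

text \<open>The integral of the square of \<open>norm (f x) + t * norm (g x)\<close> is a
  nonnegative quadratic in \<open>t\<close>.\<close>

lemma l2_cauchy_schwarz:
  assumes f: "sqint M f" and g: "sqint M g"
  shows "(LINT x|M. norm (f x) * norm (g x)) \<le> l2n M f * l2n M g"
proof -
  let ?F = "LINT x|M. (norm (f x))\<^sup>2" and ?G = "LINT x|M. (norm (g x))\<^sup>2"
  let ?H = "LINT x|M. norm (f x) * norm (g x)"
  have "?H\<^sup>2 \<le> ?F * ?G"
  proof (rule quadratic_nonneg_imp)
    fix t :: real
    have "0 \<le> (LINT x|M. (norm (f x) + t * norm (g x))\<^sup>2)" by simp
    also have "\<dots> = (LINT x|M. (norm (f x))\<^sup>2 + (2 * t) * (norm (f x) * norm (g x))
        + t\<^sup>2 * (norm (g x))\<^sup>2)"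
      by (intro Bochner_Integration.integral_cong) (auto simp: power2_sum power_mult_distrib)
    also have "\<dots> = ?F + 2 * t * ?H + t\<^sup>2 * ?G"
      using sqint_int[OF f] sqint_int[OF g] sqint_norm_mult[OF f g] by simp
    finally show "0 \<le> ?F + 2 * t * ?H + t\<^sup>2 * ?G" .
  qed simp
  then have "sqrt (?H\<^sup>2) \<le> sqrt (?F * ?G)" by (rule real_sqrt_le_mono)
  moreover have "0 \<le> ?H" by simp
  ultimately show ?thesis by (simp add: l2n_def real_sqrt_mult)
qed

lemma l2_cauchy_schwarz_inner:
  assumes f: "sqint M f" and g: "sqint M g"
  shows "\<bar>LINT x|M. f x \<bullet> g x\<bar> \<le> l2n M f * l2n M g"
proof -
  have "\<bar>LINT x|M. f x \<bullet> g x\<bar> \<le> (LINT x|M. \<bar>f x \<bullet> g x\<bar>)" by (rule integral_abs_bound)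
  also have "\<dots> \<le> (LINT x|M. norm (f x) * norm (g x))"
    by (rule integral_mono)
      (auto intro: integrable_abs[OF sqint_inner[OF f g]] sqint_norm_mult f g Cauchy_Schwarz_ineq2)
  also have "\<dots> \<le> l2n M f * l2n M g" by (rule l2_cauchy_schwarz[OF f g])
  finally show ?thesis .
qed

lemma l2n_triangle:
  assumes f: "sqint M f" and g: "sqint M g"
  shows "l2n M (\<lambda>x. f x + g x) \<le> l2n M f + l2n M g"
proof (rule power2_le_imp_le)
  have "(l2n M (\<lambda>x. f x + g x))\<^sup>2 = (LINT x|M. (norm (f x))\<^sup>2 + 2 * (f x \<bullet> g x) + (norm (g x))\<^sup>2)"
    unfolding l2n_sq
    by (intro Bochner_Integration.integral_cong)
      (auto simp: power2_norm_eq_inner inner_add inner_commute algebra_simps)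
  also have "\<dots> = (l2n M f)\<^sup>2 + 2 * (LINT x|M. f x \<bullet> g x) + (l2n M g)\<^sup>2"
    using sqint_int[OF f] sqint_int[OF g] sqint_inner[OF f g] by (simp add: l2n_sq)
  also have "\<dots> \<le> (l2n M f + l2n M g)\<^sup>2"
    using l2_cauchy_schwarz_inner[OF f g] by (simp add: power2_sum)
  finally show "(l2n M (\<lambda>x. f x + g x))\<^sup>2 \<le> (l2n M f + l2n M g)\<^sup>2" .
qed auto

lemma l2n_scaleR: "l2n M (\<lambda>x. c *\<^sub>R f x) = \<bar>c\<bar> * l2n M f"
  by (simp add: l2n_def power_mult_distrib real_sqrt_mult)

lemma l2n_minus_commute: "l2n M (\<lambda>x. f x - g x) = l2n M (\<lambda>x. g x - f x)"
  by (simp add: l2n_def norm_minus_commute)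

lemma l2n_triangle_diff:
  assumes "sqint M f" "sqint M g" "sqint M h"
  shows "l2n M (\<lambda>x. f x - h x) \<le> l2n M (\<lambda>x. f x - g x) + l2n M (\<lambda>x. g x - h x)"
  using l2n_triangle[OF sqint_diff[OF assms(1,2)] sqint_diff[OF assms(2,3)]] by simp

lemma l2n_mono:
  assumes "sqint M g" "f \<in> borel_measurable M" "AE x in M. norm (f x) \<le> norm (g x)"
  shows "l2n M f \<le> l2n M g"
proof -
  have "sqint M f" by (rule sqint_bound[OF assms(1,2), where c=1]) (use assms in simp)
  from sqint_int[OF this] sqint_int[OF assms(1)] show ?thesis unfolding l2n_def using assms(3)
    by (intro real_sqrt_le_mono integral_mono_AE) (auto elim!: eventually_mono intro: power_mono)
qed

lemma l2n_eq_0_AE: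
  assumes "sqint M f" "l2n M f = 0"
  shows "AE x in M. f x = 0"
proof -
  have "(LINT x|M. (norm (f x))\<^sup>2) = 0" using assms(2) by (simp add: l2n_def)
  then have "AE x in M. (norm (f x))\<^sup>2 = 0"
    using integral_nonneg_eq_0_iff_AE[OF sqint_int[OF assms(1)]] by simp
  then show ?thesis by simp
qed

lemma l2n_cong_AE:
  "AE x in M. f x = g x \<Longrightarrow> f \<in> borel_measurable M \<Longrightarrow> g \<in> borel_measurable M \<Longrightarrow> l2n M f = l2n M g"
  unfolding l2n_def by (subst integral_cong_AE[of "\<lambda>x. (norm (f x))\<^sup>2" _ "\<lambda>x. (norm (g x))\<^sup>2"]) auto

text \<open>Strong convergence implies weak convergence; in this form it passes to the limit in
  integrals against a fixed test function.\<close>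

lemma integral_inner_tendsto:
  assumes "\<And>n. sqint M (f n)" "sqint M f'" "sqint M g"
    and "(\<lambda>n. l2n M (\<lambda>x. f n x - f' x)) \<longlonglongrightarrow> 0"
  shows "(\<lambda>n. LINT x|M. f n x \<bullet> g x) \<longlonglongrightarrow> (LINT x|M. f' x \<bullet> g x)"
proof (rule Lim_null[THEN iffD2], rule tendsto_rabs_zero_cancel, rule tendsto_sandwich[where f="\<lambda>_.
    0"])
  show "(\<lambda>n. l2n M (\<lambda>x. f n x - f' x) * l2n M g) \<longlonglongrightarrow> 0"
    using tendsto_mult_left_zero[OF assms(4)] .
  show "\<forall>\<^sub>F n in sequentially. \<bar>(LINT x|M. f n x \<bullet> g x) - (LINT x|M. f' x \<bullet> g x)\<bar>
      \<le> l2n M (\<lambda>x. f n x - f' x) * l2n M g"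
  proof (rule always_eventually, rule allI)
    fix n
    have "(LINT x|M. f n x \<bullet> g x) - (LINT x|M. f' x \<bullet> g x) = (LINT x|M. (f n x - f' x) \<bullet> g x)"
      using sqint_inner[OF assms(1,3)] sqint_inner[OF assms(2,3)] by (simp add: inner_diff_left)
    then show "\<bar>(LINT x|M. f n x \<bullet> g x) - (LINT x|M. f' x \<bullet> g x)\<bar>
      \<le> l2n M (\<lambda>x. f n x - f' x) * l2n M g"
      using l2_cauchy_schwarz_inner[OF sqint_diff[OF assms(1,2)] assms(3)] by simp
  qed
qed auto

section \<open>Completeness of Lebesgue spaces\<close>

text \<open>Weighting the increments by \<open>2^n\<close> still leaves a convergent series of
  integrals, so the weighted sum is finite almost everywhere. There the increments decay
  geometrically, with ratio \<open>root p (1/2)\<close>, and telescoping gives convergence. The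
  exponent stays general because both 1 and 2 occur later.\<close>

lemma AE_convergent_of_fast_cauchy:
  fixes f :: "nat \<Rightarrow> 'x \<Rightarrow> 'b::euclidean_space"
  assumes [measurable]: "\<And>n. f n \<in> borel_measurable M" and p: "p > 0"
    and fast: "\<And>n. (\<integral>\<^sup>+x. ennreal (norm (f (Suc n) x - f n x) ^ p) \<partial>M) \<le> ennreal ((1/4)^n)"
  shows "AE x in M. convergent (\<lambda>n. f n x)"
proof -
  let ?a = "\<lambda>n x. ennreal (2^n) * ennreal (norm (f (Suc n) x - f n x) ^ p)"
  have "(\<integral>\<^sup>+x. (\<Sum>n. ?a n x) \<partial>M) = (\<Sum>n. \<integral>\<^sup>+x. ?a n x \<partial>M)"
    by (rule nn_integral_suminf) measurable
  also have "\<dots> \<le> (\<Sum>n. ennreal ((1/2)^n))"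
  proof (intro suminf_le allI summableI)
    fix n
    have "(\<integral>\<^sup>+x. ?a n x \<partial>M) = ennreal (2^n) * (\<integral>\<^sup>+x. ennreal (norm (f (Suc n) x - f n x) ^ p) \<partial>M)"
      by (rule nn_integral_cmult) measurable
    also have "\<dots> \<le> ennreal (2^n) * ennreal ((1/4)^n)" by (intro mult_left_mono fast) auto
    also have "\<dots> = ennreal ((1/2)^n)"
      by (subst ennreal_mult[symmetric]) (auto simp flip: power_mult_distrib)
    finally show "(\<integral>\<^sup>+x. ?a n x \<partial>M) \<le> ennreal ((1/2)^n)" .
  qed
  also have "\<dots> = ennreal (\<Sum>n. (1/2)^n)"
    by (rule suminf_ennreal2) (auto intro: summable_geometric)
  finally have "(\<integral>\<^sup>+x. (\<Sum>n. ?a n x) \<partial>M) \<noteq> \<infinity>" by (auto simp: top_unique)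
  then have "AE x in M. (\<Sum>n. ?a n x) \<noteq> \<infinity>" by (intro nn_integral_PInf_AE) measurable
  then show ?thesis
  proof eventually_elim
    case (elim x)
    define d where "d n = norm (f (Suc n) x - f n x)" for n
    obtain C where C: "C \<ge> 0" "(\<Sum>n. ?a n x) = ennreal C" using elim by (cases "\<Sum>n. ?a n x") auto
    have b: "d n \<le> root p C * (root p (1/2))^n" for n
    proof -
      have "?a n x \<le> (\<Sum>n. ?a n x)"
        using sum_le_suminf[of "\<lambda>n. ?a n x" "{n}"] by simp
      then have "ennreal (2^n * d n ^ p) \<le> ennreal C"
        by (simp add: C d_def ennreal_mult)
      then have "2^n * d n ^ p \<le> C" using C(1) by (simp add: ennreal_le_iff)
      then have "d n ^ p \<le> C * (1/2)^n" by (simp add: field_simps power_divide)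
      then have "root p (d n ^ p) \<le> root p (C * (1/2)^n)" using p by simp
      then show ?thesis using p by (simp add: real_root_mult real_root_power real_root_power_cancel
          d_def)
    qed
    have "summable (\<lambda>n. root p C * (root p (1/2))^n)"
      using p real_root_lt_1_iff[of p "1/2"] by (intro summable_mult summable_geometric) simp
    then have "summable d"
      by (rule summable_comparison_test') (use b in \<open>auto simp: d_def\<close>)
    then have "summable (\<lambda>n. f (Suc n) x - f n x)"
      unfolding d_def by (rule summable_norm_cancel)
    then have "convergent (\<lambda>n. \<Sum>i<n. f (Suc i) x - f i x)"
      by (simp add: summable_iff_convergent)
    then have "convergent (\<lambda>n. f n x - f 0 x)"
      by (simp only: sum_lessThan_telescope[of "\<lambda>n. f n x"])
    then have "convergent (\<lambda>n. (f n x - f 0 x) + f 0 x)"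
      by (intro convergent_add convergent_const)
    then show ?case by simp
  qed
qed

lemma fast_subsequence:
  fixes d :: "nat \<Rightarrow> nat \<Rightarrow> 'c::linorder"
  assumes "\<And>k. \<exists>N. \<forall>m\<ge>N. \<forall>n\<ge>N. d m n < e (k::nat)"
  shows "\<exists>r. strict_mono r \<and> (\<forall>k. \<forall>m\<ge>r k. \<forall>n\<ge>r k. d m n < e k)"
proof -
  obtain N where N: "\<And>k m n. m \<ge> N k \<Longrightarrow> n \<ge> N k \<Longrightarrow> d m n < e k" using assms by metis
  \<comment> \<open>Summing all thresholds up to \<open>k\<close> makes \<open>r k\<close> at least
    \<open>N k\<close>, and the summand \<open>k\<close> makes \<open>r\<close> strictly
    increasing.\<close>
  define r where "r k = (\<Sum>i\<le>k. N i) + k" for k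
  have "strict_mono r" by (rule strict_monoI_Suc) (simp add: r_def)
  moreover have "N k \<le> r k" for k
    using member_le_sum[of k "{..k}" N] by (simp add: r_def)
  ultimately show ?thesis using N by (meson le_trans)
qed

text \<open>Riesz-Fischer in terms of the integral of the p-th power, which avoids the norm and its
  triangle inequality: the pointwise limit exists along a fast subsequence, and Fatou's lemma turns
  the Cauchy bound into a bound of the distance to that limit.\<close>

lemma Lp_complete:
  fixes f :: "nat \<Rightarrow> 'x \<Rightarrow> 'b::euclidean_space"
  assumes [measurable]: "\<And>n. f n \<in> borel_measurable M" and p: "p > 0"
    and cau: "\<And>e::real. e > 0 \<Longrightarrow>
      \<exists>N. \<forall>m\<ge>N. \<forall>n\<ge>N. (\<integral>\<^sup>+x. ennreal (norm (f m x - f n x) ^ p) \<partial>M) < ennreal e"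
  shows "\<exists>g r. g \<in> borel_measurable M \<and> strict_mono (r :: nat \<Rightarrow> nat) \<and>
      (AE x in M. (\<lambda>n. f (r n) x) \<longlonglongrightarrow> g x) \<and>
      (\<forall>e::real>0. \<exists>N. \<forall>n\<ge>N. (\<integral>\<^sup>+x. ennreal (norm (f n x - g x) ^ p) \<partial>M) \<le> ennreal e)"
proof -
  let ?d = "\<lambda>m n. \<integral>\<^sup>+x. ennreal (norm (f m x - f n x) ^ p) \<partial>M"
  obtain r where r: "strict_mono r" and rd: "\<And>k m n. m \<ge> r k \<Longrightarrow> n \<ge> r k \<Longrightarrow> ?d m n < ennreal ((1/4)^k)"
  proof -
    have "\<exists>N. \<forall>m\<ge>N. \<forall>n\<ge>N. ?d m n < ennreal ((1/4)^k)" for k by (rule cau) simp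
    from fast_subsequence[of ?d "\<lambda>k. ennreal ((1/4)^k)", OF this] that show ?thesis by blast
  qed
  have AEc: "AE x in M. convergent (\<lambda>n. f (r n) x)"
  proof (rule AE_convergent_of_fast_cauchy[OF _ p])
    fix n
    have "r n \<le> r (Suc n)" using r by (simp add: strict_mono_less_eq)
    then show "(\<integral>\<^sup>+x. ennreal (norm (f (r (Suc n)) x - f (r n) x) ^ p) \<partial>M) \<le> ennreal ((1/4)^n)"
      using rd[of n "r (Suc n)" "r n"] by simp
  qed measurable
  define g where "g x = lim (\<lambda>n. f (r n) x)" for x
  have g[measurable]: "g \<in> borel_measurable M" unfolding g_def by measurable
  have lim: "AE x in M. (\<lambda>n. f (r n) x) \<longlonglongrightarrow> g x"
    using AEc by eventually_elim (simp add: g_def convergent_LIMSEQ_iff)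
  have "\<exists>N. \<forall>n\<ge>N. (\<integral>\<^sup>+x. ennreal (norm (f n x - g x) ^ p) \<partial>M) \<le> ennreal e" if "e > 0" for e :: real
  proof -
    from cau[OF that] obtain N where N: "\<And>m n. m \<ge> N \<Longrightarrow> n \<ge> N \<Longrightarrow> ?d m n < ennreal e" by blast
    have "(\<integral>\<^sup>+x. ennreal (norm (f n x - g x) ^ p) \<partial>M) \<le> ennreal e" if n: "n \<ge> N" for n
    proof -
      have "(\<integral>\<^sup>+x. ennreal (norm (f n x - g x) ^ p) \<partial>M)
          = (\<integral>\<^sup>+x. liminf (\<lambda>k. ennreal (norm (f n x - f (r k) x) ^ p)) \<partial>M)"
      proof (rule nn_integral_cong_AE)
        show "AE x in M. ennreal (norm (f n x - g x) ^ p)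
            = liminf (\<lambda>k. ennreal (norm (f n x - f (r k) x) ^ p))"
          using lim
        proof eventually_elim
          case (elim x)
          have "(\<lambda>k. ennreal (norm (f n x - f (r k) x) ^ p)) \<longlonglongrightarrow> ennreal (norm (f n x - g x) ^ p)"
            by (intro tendsto_intros elim)
          then show ?case by (metis lim_imp_Liminf sequentially_bot)
        qed
      qed
      also have "\<dots> \<le> liminf (\<lambda>k. ?d n (r k))"
        by (rule nn_integral_liminf) measurable
      also have "\<dots> \<le> ennreal e"
      proof (rule Liminf_le)
        have "?d n (r k) \<le> ennreal e" if "k \<ge> N" for k
          using N[OF n, of "r k"] seq_suble[OF r, of k] that by simp
        then show "\<forall>\<^sub>F k in sequentially. ?d n (r k) \<le> ennreal e"
          unfolding eventually_sequentially by blast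
      qed simp
      finally show ?thesis .
    qed
    then show ?thesis by blast
  qed
  then show ?thesis using g r lim by blast
qed

lemma L2_complete:
  fixes f :: "nat \<Rightarrow> 'x \<Rightarrow> 'b::euclidean_space"
  assumes f: "\<And>n. sqint M (f n)"
    and cau: "\<And>e. e > 0 \<Longrightarrow> \<exists>N. \<forall>m\<ge>N. \<forall>n\<ge>N. l2n M (\<lambda>x. f m x - f n x) < e"
  shows "\<exists>g. sqint M g \<and> (\<lambda>n. l2n M (\<lambda>x. f n x - g x)) \<longlonglongrightarrow> 0"
proof -
  have nn: "(\<integral>\<^sup>+x. ennreal (norm (f m x - f n x) ^ 2) \<partial>M)
      = ennreal ((l2n M (\<lambda>x. f m x - f n x))\<^sup>2)" for m n
    by (rule nn_integral_l2n[OF sqint_diff[OF f f]])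
  have "\<exists>g r. g \<in> borel_measurable M \<and> strict_mono (r :: nat \<Rightarrow> nat) \<and>
      (AE x in M. (\<lambda>n. f (r n) x) \<longlonglongrightarrow> g x) \<and>
      (\<forall>e::real>0. \<exists>N. \<forall>n\<ge>N. (\<integral>\<^sup>+x. ennreal (norm (f n x - g x) ^ 2) \<partial>M) \<le> ennreal e)"
  proof (rule Lp_complete)
    fix e :: real assume "e > 0"
    then obtain N where N: "\<And>m n. m \<ge> N \<Longrightarrow> n \<ge> N \<Longrightarrow> l2n M (\<lambda>x. f m x - f n x) < sqrt e"
      using cau[of "sqrt e"] by auto
    have "(l2n M (\<lambda>x. f m x - f n x))\<^sup>2 < e" if "m \<ge> N" "n \<ge> N" for m n
      using power_strict_mono[OF N[OF that], of 2] \<open>e > 0\<close> by simp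
    then show "\<exists>N. \<forall>m\<ge>N. \<forall>n\<ge>N. (\<integral>\<^sup>+x. ennreal (norm (f m x - f n x) ^ 2) \<partial>M) < ennreal e"
      unfolding nn using \<open>e > 0\<close> by (auto simp: ennreal_less_iff)
  qed (use f in \<open>auto dest: sqintD\<close>)
  then obtain g where [measurable]: "g \<in> borel_measurable M"
    and g: "\<And>e::real. e>0 \<Longrightarrow> \<exists>N. \<forall>n\<ge>N. (\<integral>\<^sup>+x. ennreal (norm (f n x - g x) ^ 2) \<partial>M) \<le> ennreal e"
    by blast
  have fm[measurable]: "f n \<in> borel_measurable M" for n using f by (rule sqintD)
  have sg: "sqint M g"
  proof -
    obtain N where "(\<integral>\<^sup>+x. ennreal (norm (f N x - g x) ^ 2) \<partial>M) \<le> ennreal 1" using g[of 1] by auto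
    then have "sqint M (\<lambda>x. f N x - g x)" unfolding sqint_iff_nn by (auto simp: le_less_trans)
    from sqint_diff[OF f[of N] this] show ?thesis by simp
  qed
  have "(\<lambda>n. l2n M (\<lambda>x. f n x - g x)) \<longlonglongrightarrow> 0"
  proof (rule LIMSEQ_I)
    fix e :: real assume "e > 0"
    then obtain N where N: "\<And>n. n \<ge> N \<Longrightarrow> (\<integral>\<^sup>+x. ennreal (norm (f n x - g x) ^ 2) \<partial>M)
        \<le> ennreal ((e/2)\<^sup>2)"
      using g[of "(e/2)\<^sup>2"] by auto
    have "l2n M (\<lambda>x. f n x - g x) \<le> e/2" if "n \<ge> N" for n
      using N[OF that] nn_integral_l2n[OF sqint_diff[OF f sg], of n] \<open>e > 0\<close>
      by (simp add: power2_le_iff_abs_le)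
    then have "\<forall>n\<ge>N. norm (l2n M (\<lambda>x. f n x - g x) - 0) < e" using \<open>e > 0\<close> by fastforce
    then show "\<exists>N. \<forall>n\<ge>N. norm (l2n M (\<lambda>x. f n x - g x) - 0) < e" by blast
  qed
  with sg show ?thesis by blast
qed

section \<open>Test functions\<close>

lemma C_k_SucI:
  assumes "\<And>x. (f has_derivative D x) (at x)" "\<And>i. i \<in> Basis \<Longrightarrow> C_k k (\<lambda>x. D x i)"
  shows "C_k (Suc k) f"
proof -
  have "frechet_derivative f (at x) = D x" for x
    using frechet_derivative_at[OF assms(1)] by simp
  then show ?thesis using assms by (auto simp: differentiable_def)
qed

lemma C_k_has_derivative:
  "C_k (Suc k) f \<Longrightarrow> (f has_derivative frechet_derivative f (at x)) (at x)"
  by (simp add: frechet_derivative_works[symmetric])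

lemma C_k_Suc_imp: "C_k (Suc k) f \<Longrightarrow> C_k k f"
proof (induction k arbitrary: f)
  case 0
  then show ?case
    by (auto intro!: differentiable_imp_continuous_on simp: differentiable_on_def
        intro: differentiable_at_withinI)
next
  case (Suc k)
  then show ?case by (subst C_k.simps) (auto simp: C_k.simps(2)[of "Suc k"] simp del: C_k.simps)
qed

lemma C_k_const: "C_k k (\<lambda>x. c)"
proof (induction k arbitrary: c)
  case (Suc k)
  show ?case by (rule C_k_SucI[where D="\<lambda>x h. 0"]) (auto simp: Suc)
qed auto

lemma C_k_add: "C_k k f \<Longrightarrow> C_k k g \<Longrightarrow> C_k k (\<lambda>x. f x + g x)"
proof (induction k arbitrary: f g)
  case 0
  then show ?case by (auto intro: continuous_intros)
next
  case (Suc k)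
  note d = C_k_has_derivative[OF Suc.prems(1)] C_k_has_derivative[OF Suc.prems(2)]
  show ?case
    by (rule C_k_SucI, rule has_derivative_add[OF d]) (use Suc in auto)
qed

lemma C_k_mult: "C_k k f \<Longrightarrow> C_k k g \<Longrightarrow> C_k k (\<lambda>x. f x * g x)"
proof (induction k arbitrary: f g)
  case 0
  then show ?case by (auto intro: continuous_intros)
next
  case (Suc k)
  note d = C_k_has_derivative[OF Suc.prems(1)] C_k_has_derivative[OF Suc.prems(2)]
  show ?case
  proof (rule C_k_SucI, rule has_derivative_mult[OF d])
    fix i :: 'a assume i: "i \<in> Basis"
    show "C_k k (\<lambda>x. f x * frechet_derivative g (at x) i + frechet_derivative f (at x) i * g x)"
      using Suc.prems i C_k_Suc_imp[OF Suc.prems(1)] C_k_Suc_imp[OF Suc.prems(2)]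
      by (intro C_k_add Suc.IH) auto
  qed
qed

lemma C_k_inner_diff: "C_k k (\<lambda>x. (x - a) \<bullet> b)"
proof (cases k)
  case 0
  then show ?thesis by (auto intro!: continuous_intros)
next
  case (Suc j)
  have "((\<lambda>x. (x - a) \<bullet> b) has_derivative (\<lambda>h. h \<bullet> b)) (at x)" for x
    by (auto intro!: derivative_eq_intros)
  then show ?thesis unfolding Suc by (rule C_k_SucI) (rule C_k_const)
qed

section \<open>Smooth bump functions\<close>

text \<open>The flat function \<open>exp (- 1/t)\<close> times a power of \<open>1/t\<close>,
  continued by 0. The exponent \<open>m\<close> makes the family closed under differentiation up to
  linear combinations, which an induction over \<open>C_k\<close> requires.\<close>

definition exp_inv :: "nat \<Rightarrow> real \<Rightarrow> real" where
  "exp_inv m t = (if t > 0 then exp (- inverse t) * inverse t ^ m else 0)"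

lemma exp_inv_tendsto_0: "(exp_inv m \<longlongrightarrow> 0) (at 0)"
proof -
  have "((\<lambda>t. inverse t ^ m / exp (inverse t)) \<longlongrightarrow> 0) (at_right (0::real))"
    by (rule filterlim_compose[OF tendsto_power_div_exp_0 filterlim_inverse_at_top_right])
  moreover have "\<forall>\<^sub>F t in at_right 0. inverse t ^ m / exp (inverse t) = exp_inv m t"
    unfolding eventually_at_right_field
    by (intro exI[of _ 1]) (auto simp: exp_inv_def exp_minus divide_inverse mult.commute)
  ultimately have R: "(exp_inv m \<longlongrightarrow> 0) (at_right 0)" by (rule Lim_transform_eventually)
  have "\<forall>\<^sub>F t in at_left 0. 0 = exp_inv m t"
    unfolding eventually_at_left_field by (intro exI[of _ "-1"]) (auto simp: exp_inv_def)
  then have "(exp_inv m \<longlongrightarrow> 0) (at_left 0)" by (rule Lim_transform_eventually[OF tendsto_const])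
  with R show ?thesis by (simp add: filterlim_split_at)
qed

text \<open>For positive \<open>t\<close> this is the product rule and for negative \<open>t\<close>
  the function is constant. At 0 the difference quotient is the member of the family with exponent
  \<open>m + 1\<close>, which tends to 0.\<close>

lemma exp_inv_has_derivative:
  "(exp_inv m has_real_derivative exp_inv (m + 2) t - real m * exp_inv (m + 1) t) (at t)"
proof -
  consider "t > 0" | "t < 0" | "t = 0" by linarith
  then show ?thesis
  proof cases
    case 1
    have "((\<lambda>t. exp (- inverse t)) has_real_derivative exp (- inverse t) * inverse t ^ 2) (at t)"
      using 1 by (auto intro!: derivative_eq_intros simp: power2_eq_square divide_inverse)
    moreover have "((\<lambda>t. inverse t ^ m) has_real_derivative - real m * inverse t ^ (m + 1)) (at t)"
    proof (cases m)
      case (Suc n)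
      have "(inverse has_real_derivative - (inverse t * inverse t)) (at t)"
        using DERIV_inverse[of t UNIV] 1 by (simp add: numeral_2_eq_2)
      from DERIV_power_Suc[OF this, of n] show ?thesis by (simp add: Suc algebra_simps)
    qed simp
    ultimately have "((\<lambda>t. exp (- inverse t) * inverse t ^ m) has_real_derivative
        exp (- inverse t) * inverse t ^ 2 * inverse t ^ m
        + - real m * inverse t ^ (m + 1) * exp (- inverse t)) (at t)"
      by (rule DERIV_mult)
    moreover have "exp (- inverse t) * inverse t ^ 2 * inverse t ^ m
        + - real m * inverse t ^ (m + 1) * exp (- inverse t)
        = exp_inv (m + 2) t - real m * exp_inv (m + 1) t"
      using 1 by (simp add: exp_inv_def power_add power2_eq_square)
    ultimately have "((\<lambda>t. exp (- inverse t) * inverse t ^ m) has_real_derivative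
        exp_inv (m + 2) t - real m * exp_inv (m + 1) t) (at t)" by simp
    moreover have "\<forall>\<^sub>F s in nhds t. exp_inv m s = exp (- inverse s) * inverse s ^ m"
      using eventually_nhds_in_open[of "{0<..}" t] 1
          by (auto elim!: eventually_mono simp: exp_inv_def)
    ultimately show ?thesis
      by (subst DERIV_cong_ev[OF refl _ refl, where g="\<lambda>s. exp (- inverse s) * inverse s ^ m"])
  next
    case 2
    have "\<forall>\<^sub>F s in nhds t. exp_inv m s = 0"
      using eventually_nhds_in_open[of "{..<0}" t] 2
          by (auto elim!: eventually_mono simp: exp_inv_def)
    then have "(exp_inv m has_real_derivative 0) (at t) \<longleftrightarrow> ((\<lambda>_. 0) has_real_derivative 0) (at t)"
      by (intro DERIV_cong_ev) auto
    then show ?thesis using 2 by (simp add: exp_inv_def)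
  next
    case 3
    have "((\<lambda>h. (exp_inv m (0 + h) - exp_inv m 0) / h) \<longlongrightarrow> 0) (at 0)"
    proof (rule Lim_transform_eventually[OF exp_inv_tendsto_0[of "Suc m"]])
      show "\<forall>\<^sub>F x in at 0. exp_inv (Suc m) x = (exp_inv m (0 + x) - exp_inv m 0) / x"
        by (auto simp: exp_inv_def divide_inverse eventually_at_filter)
    qed
    then show ?thesis using 3 by (simp add: DERIV_def exp_inv_def)
  qed
qed

lemma continuous_exp_inv: "continuous_on UNIV (exp_inv m)"
  by (meson DERIV_isCont exp_inv_has_derivative continuous_at_imp_continuous_on)

text \<open>The standard mollifier kernel with centre \<open>a\<close> and support radius
  \<open>e\<close>; it is not normalised, and \<open>bmass\<close> supplies the constant.\<close>

definition bump :: "'a::euclidean_space \<Rightarrow> real \<Rightarrow> 'a \<Rightarrow> real" where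
  "bump a e y = exp_inv 0 (1 - (norm (y - a))\<^sup>2 / e\<^sup>2)"

text \<open>The induction covers all \<open>m\<close> at once because one differentiation produces
  the orders \<open>m + 1\<close> and \<open>m + 2\<close>, multiplied by an affine
  function.\<close>

lemma C_k_exp_inv_radial:
  "C_k k (\<lambda>y::'a::euclidean_space. exp_inv m (1 - (norm (y - a))\<^sup>2 / e\<^sup>2))"
proof (induction k arbitrary: m)
  case 0
  show ?case
    by (simp, rule continuous_on_compose2[OF continuous_exp_inv])
      (auto simp: divide_inverse intro!: continuous_intros)
next
  case (Suc k)
  let ?q = "\<lambda>y::'a. 1 - (norm (y - a))\<^sup>2 / e\<^sup>2"
  let ?D = "\<lambda>y h. (exp_inv (m + 2) (?q y) + (- real m) * exp_inv (m + 1) (?q y))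
      * ((-2 / e\<^sup>2) * ((y - a) \<bullet> h))"
  have q: "(?q has_derivative (\<lambda>h. (-2 / e\<^sup>2) * ((y - a) \<bullet> h))) (at y)" for y
    unfolding power2_norm_eq_inner divide_inverse
    by (auto intro!: derivative_eq_intros simp: inner_commute algebra_simps)
  show ?case
  proof (rule C_k_SucI[where D="?D"])
    fix y
    have "(exp_inv m has_derivative (*) (exp_inv (m + 2) (?q y) - real m * exp_inv (m
        + 1) (?q y))) (at (?q y))"
      using exp_inv_has_derivative by (rule has_field_derivative_imp_has_derivative)
    from has_derivative_compose[OF q this]
    show "((\<lambda>y. exp_inv m (?q y)) has_derivative ?D y) (at y)" by simp
    fix i :: 'a
    show "C_k k (\<lambda>y. ?D y i)"
      by (intro C_k_mult C_k_add C_k_const C_k_inner_diff Suc)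
  qed
qed

lemma bump_nonneg [simp]: "0 \<le> bump a e y"
  by (simp add: bump_def exp_inv_def)

lemma bump_le_1: "bump a e y \<le> 1"
  by (simp add: bump_def exp_inv_def)

lemma bump_pos: "e > 0 \<Longrightarrow> norm (y - a) < e \<Longrightarrow> 0 < bump a e y"
  by (simp add: bump_def exp_inv_def field_simps power_strict_mono)

lemma bump_eq_0: "e > 0 \<Longrightarrow> e \<le> norm (y - a) \<Longrightarrow> bump a e y = 0"
  by (simp add: bump_def exp_inv_def field_simps power_mono not_less)

lemma test_functionI:
  fixes \<phi> :: "'a::euclidean_space \<Rightarrow> real"
  assumes "\<And>k. C_k k \<phi>" "\<And>x. norm x > R \<Longrightarrow> \<phi> x = 0"
  shows "test_function \<phi>"
proof -
  have "{x. \<phi> x \<noteq> 0} \<subseteq> cball 0 R" using assms(2) by (auto simp: not_less[symmetric])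
  then have "bounded {x. \<phi> x \<noteq> 0}" using bounded_cball bounded_subset by blast
  then show ?thesis using assms(1) by (simp add: test_function_def compact_closure)
qed

lemma test_function_support:
  fixes \<phi> :: "'a::euclidean_space \<Rightarrow> real"
  assumes "test_function \<phi>"
  obtains R where "R > 0" "\<And>x. norm x > R \<Longrightarrow> \<phi> x = 0"
proof -
  have "bounded (closure {x. \<phi> x \<noteq> 0})"
    using assms by (simp add: test_function_def compact_imp_bounded)
  then obtain R where R: "R > 0" "\<And>x. x \<in> closure {x. \<phi> x \<noteq> 0} \<Longrightarrow> norm x \<le> R"
    unfolding bounded_pos by blast
  show ?thesis
  proof (rule that[OF R(1)])
    fix x :: 'a assume "norm x > R"
    then have "x \<notin> closure {x. \<phi> x \<noteq> 0}" using R(2)[of x] by auto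
    then show "\<phi> x = 0" using closure_subset[of "{x. \<phi> x \<noteq> 0}"] by blast
  qed
qed

lemma test_function_bump:
  fixes a :: "'a::euclidean_space"
  assumes "e > 0" shows "test_function (bump a e)"
proof (rule test_functionI)
  show "C_k k (bump a e)" for k
    using C_k_exp_inv_radial[of k 0 a e] by (simp add: bump_def[abs_def])
  fix x :: 'a assume "norm x > norm a + e"
  then have "e \<le> norm (x - a)" using norm_triangle_ineq2[of x a] by linarith
  then show "bump a e x = 0" using assms by (simp add: bump_eq_0)
qed

lemma test_function_mult:
  assumes "test_function \<phi>" "test_function \<psi>"
  shows "test_function (\<lambda>x. \<phi> x * \<psi> x)"
proof -
  obtain R where "\<And>x. norm x > R \<Longrightarrow> \<phi> x = 0" using test_function_support[OF assms(1)] by blast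
  then show ?thesis using assms
    by (intro test_functionI[where R=R] C_k_mult) (auto simp: test_function_def)
qed

lemma test_function_partial:
  assumes \<phi>: "test_function \<phi>" and i: "i \<in> Basis"
  shows "test_function (\<lambda>x. frechet_derivative \<phi> (at x) i)"
proof -
  obtain R where R: "\<And>x. norm x > R \<Longrightarrow> \<phi> x = 0" using test_function_support[OF \<phi>] by blast
  show ?thesis
  proof (rule test_functionI[where R=R])
    show "C_k k (\<lambda>x. frechet_derivative \<phi> (at x) i)" for k
    proof -
      have "C_k (Suc k) \<phi>" using \<phi> by (simp only: test_function_def)
      with i show ?thesis by simp
    qed
    fix x :: 'a assume x: "norm x > R"
    have "open {x::'a. norm x > R}" by (intro open_Collect_less continuous_intros)
    then have "(\<phi> has_derivative (\<lambda>h. 0)) (at x)"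
      by (rule has_derivative_transform_within_open[OF has_derivative_const[of 0]]) (use x R in
          auto)
    then show "frechet_derivative \<phi> (at x) i = 0"
      by (metis frechet_derivative_at)
  qed
qed

section \<open>Classical gradients of test functions\<close>

definition tgrad :: "('a::euclidean_space \<Rightarrow> real) \<Rightarrow> 'a \<Rightarrow> 'a" where
  "tgrad \<phi> x = (\<Sum>i\<in>Basis. frechet_derivative \<phi> (at x) i *\<^sub>R i)"

lemma tgrad_inner_Basis: "i \<in> Basis \<Longrightarrow> tgrad \<phi> x \<bullet> i = frechet_derivative \<phi> (at x) i"
  by (simp add: tgrad_def)

lemma test_function_has_derivative:
  assumes "test_function \<phi>"
  shows "(\<phi> has_derivative (\<lambda>h. tgrad \<phi> x \<bullet> h)) (at x)"
proof -
  let ?D = "frechet_derivative \<phi> (at x)"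
  have "C_k (Suc 0) \<phi>" using assms by (simp only: test_function_def)
  then have D: "(\<phi> has_derivative ?D) (at x)" by (rule C_k_has_derivative)
  then interpret D: bounded_linear ?D by (rule has_derivative_bounded_linear)
  have "?D h = tgrad \<phi> x \<bullet> h" for h
  proof -
    have "?D h = ?D (\<Sum>i\<in>Basis. (h \<bullet> i) *\<^sub>R i)" by (simp add: euclidean_representation)
    also have "\<dots> = (\<Sum>i\<in>Basis. (h \<bullet> i) * ?D i)" by (simp add: D.sum D.scaleR)
    also have "\<dots> = tgrad \<phi> x \<bullet> h"
      by (simp add: tgrad_def inner_sum_left inner_commute[of h] mult.commute)
    finally show ?thesis .
  qed
  then have "?D = (\<lambda>h. tgrad \<phi> x \<bullet> h)" by (rule ext)
  then show ?thesis using D by simp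
qed

subsection \<open>Continuous functions with bounded support\<close>

text \<open>The common property of test functions and of their gradients from which boundedness and
  square integrability follow.\<close>

definition cbs :: "('a::euclidean_space \<Rightarrow> 'b::euclidean_space) \<Rightarrow> bool" where
  "cbs f \<longleftrightarrow> continuous_on UNIV f \<and> (\<exists>R. \<forall>x. norm x > R \<longrightarrow> f x = 0)"

lemma cbs_bounded:
  assumes "cbs f" obtains K where "K > 0" "\<And>x. norm (f x) \<le> K"
proof -
  obtain R where R: "\<And>x. norm x > R \<Longrightarrow> f x = 0" using assms by (auto simp: cbs_def)
  have "compact (f ` cball 0 R)"
    using assms by (intro compact_continuous_image) (auto simp: cbs_def intro: continuous_on_subset)
  then have "bounded (f ` cball 0 R)" by (rule compact_imp_bounded)
  then obtain K where K: "K > 0" "\<And>x. norm x \<le> R \<Longrightarrow> norm (f x) \<le> K"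
    unfolding bounded_pos by auto
  show ?thesis
  proof (rule that[OF K(1)])
    show "norm (f x) \<le> K" for x using K R[of x] by (cases "norm x \<le> R") auto
  qed
qed

lemma cbs_borel: "cbs f \<Longrightarrow> f \<in> borel_measurable borel"
  by (simp add: cbs_def borel_measurable_continuous_onI)

lemma sqint_indicator:
  fixes A :: "'a::euclidean_space set"
  assumes "A \<in> sets M" "emeasure M A < \<infinity>"
  shows "sqint M (\<lambda>x. indicator A x :: real)"
proof -
  have "(\<lambda>x. (indicator A x :: real)\<^sup>2) = indicator A"
    by (auto simp: indicator_def)
  then show ?thesis using assms by (simp add: sqint_real)
qed

lemma sqint_bounded_support:
  assumes "f \<in> borel_measurable M" "sets borel \<subseteq> sets M" "emeasure M (cball 0 R) < \<infinity>"
    "\<And>x. norm x > R \<Longrightarrow> f x = 0" "\<And>x. norm (f x) \<le> K"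
  shows "sqint M (f :: 'a::euclidean_space \<Rightarrow> 'b::euclidean_space)"
proof (rule sqint_bound[where c=K and f="\<lambda>x. indicator (cball 0 R) x :: real"])
  show "sqint M (\<lambda>x. indicator (cball (0::'a) R) x :: real)"
    by (rule sqint_indicator) (use assms in auto)
  show "AE x in M. norm (f x) \<le> K * norm (indicator (cball 0 R) x :: real)"
  proof (rule AE_I2)
    fix x show "norm (f x) \<le> K * norm (indicator (cball 0 R) x :: real)"
      using assms(4)[of x] assms(5)[of x] by (cases "norm x \<le> R") (auto simp: indicator_def)
  qed
qed (use assms in auto)

lemma lebesgue_borel_subset: "sets (borel :: 'a::euclidean_space measure) \<subseteq> sets lebesgue"
  by auto

lemma emeasure_lebesgue_cball: "emeasure lebesgue (cball (a::'a::euclidean_space) R) < \<infinity>"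
  using emeasure_lborel_cball_finite[of a R] by simp

lemma cbs_sqint: "cbs f \<Longrightarrow> sqint lebesgue f"
proof -
  assume f: "cbs f"
  then obtain R where R: "\<And>x. norm x > R \<Longrightarrow> f x = 0" by (auto simp: cbs_def)
  obtain K where "\<And>x. norm (f x) \<le> K" using cbs_bounded[OF f] by blast
  note K = this
  have "f \<in> borel_measurable lborel" using cbs_borel[OF f] by simp
  then have "f \<in> borel_measurable lebesgue" by (rule measurable_completion)
  then show ?thesis
    by (rule sqint_bounded_support[OF _ lebesgue_borel_subset emeasure_lebesgue_cball _ K])
      (use R in blast)
qed

lemma test_function_cbs:
  assumes "test_function \<phi>" shows "cbs \<phi>"
proof -
  have "C_k 0 \<phi>" using assms by (simp only: test_function_def)
  moreover obtain R where "\<And>x. norm x > R \<Longrightarrow> \<phi> x = 0" using test_function_support[OF assms] by blast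
  ultimately show ?thesis by (auto simp: cbs_def)
qed

lemma cbs_tgrad:
  assumes "test_function \<phi>" shows "cbs (tgrad \<phi>)"
proof -
  have p: "cbs (\<lambda>x. frechet_derivative \<phi> (at x) i)" if "i \<in> Basis" for i
    using test_function_cbs[OF test_function_partial[OF assms that]] .
  then obtain R where R: "\<And>i x. i \<in> Basis \<Longrightarrow> norm x > R i \<Longrightarrow> frechet_derivative \<phi> (at x) i = 0"
    unfolding cbs_def by metis
  have "tgrad \<phi> x = 0" if "norm x > Max (R ` Basis)" for x
    unfolding tgrad_def using that by (intro sum.neutral) (auto simp: R)
  moreover have "continuous_on UNIV (tgrad \<phi>)"
    using p by (auto simp: cbs_def tgrad_def[abs_def] intro!: continuous_intros)
  ultimately show ?thesis unfolding cbs_def by blast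
qed

lemma test_function_lipschitz:
  assumes \<phi>: "test_function \<phi>"
  obtains L where "L > 0" "\<And>x y. \<bar>\<phi> x - \<phi> y\<bar> \<le> L * norm (x - y)"
proof -
  obtain L where L: "L > 0" "\<And>x. norm (tgrad \<phi> x) \<le> L" using cbs_bounded[OF cbs_tgrad[OF \<phi>]]
      by blast
  have "norm (\<phi> x - \<phi> y) \<le> L * norm (x - y)" for x y
  proof (rule differentiable_bound[OF convex_UNIV])
    show "(\<phi> has_derivative (\<lambda>h. tgrad \<phi> x \<bullet> h)) (at x within UNIV)" for x
      using test_function_has_derivative[OF \<phi>] by simp
    show "onorm (\<lambda>h. tgrad \<phi> x \<bullet> h) \<le> L" for x
    proof (rule onorm_le)
      fix h
      have "norm (tgrad \<phi> x \<bullet> h) \<le> norm (tgrad \<phi> x) * norm h" by (simp add: Cauchy_Schwarz_ineq2)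
      also have "\<dots> \<le> L * norm h" by (intro mult_right_mono L) auto
      finally show "norm (tgrad \<phi> x \<bullet> h) \<le> L * norm h" .
    qed
  qed auto
  then show ?thesis using that L(1) by auto
qed

text \<open>Partial derivatives of a test function are test functions, so the Lipschitz bound
  applies to each component.\<close>

lemma tgrad_lipschitz:
  assumes \<phi>: "test_function \<phi>"
  obtains L where "L > 0" "\<And>x y. norm (tgrad \<phi> x - tgrad \<phi> y) \<le> L * norm (x - y)"
proof -
  have "\<exists>L>0. \<forall>x y. \<bar>frechet_derivative \<phi> (at x) i - frechet_derivative \<phi> (at y) i\<bar>
      \<le> L * norm (x - y)"
    if "i \<in> Basis" for i
    using test_function_lipschitz[OF test_function_partial[OF \<phi> that]] by metis
  then obtain L where L: "\<And>i. i \<in> Basis \<Longrightarrow> L i > 0"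
    "\<And>i x y. i \<in> Basis \<Longrightarrow> \<bar>frechet_derivative \<phi> (at x) i - frechet_derivative \<phi> (at y) i\<bar>
        \<le> L i * norm (x - y)"
    by metis
  have "norm (tgrad \<phi> x - tgrad \<phi> y) \<le> (\<Sum>i\<in>Basis. L i) * norm (x - y)" for x y
  proof -
    have "tgrad \<phi> x - tgrad \<phi> y = (\<Sum>i\<in>Basis. (frechet_derivative \<phi> (at x) i - frechet_derivative \<phi>
        (at y) i) *\<^sub>R i)"
      by (simp add: tgrad_def scaleR_diff_left sum_subtractf)
    also have "norm \<dots> \<le> (\<Sum>i\<in>Basis. L i * norm (x - y))"
      by (rule sum_norm_le) (use L(2) in simp)
    finally show ?thesis by (simp add: sum_distrib_right)
  qed
  moreover have "(\<Sum>i\<in>Basis. L i) > 0" by (rule sum_pos) (auto simp: L)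
  ultimately show ?thesis using that by blast
qed

section \<open>Mollification\<close>

lemma nn_integral_lborel_shift:
  fixes h :: "'a::euclidean_space"
  assumes [measurable]: "f \<in> borel_measurable borel"
  shows "(\<integral>\<^sup>+x. f (x + h) \<partial>lborel) = (\<integral>\<^sup>+x. f x \<partial>lborel)"
proof -
  have "(\<integral>\<^sup>+x. f x \<partial>lborel) = (\<integral>\<^sup>+x. f x \<partial>distr lborel borel ((+) h))"
    by (simp add: lborel_distr_plus)
  also have "\<dots> = (\<integral>\<^sup>+x. f (h + x) \<partial>lborel)"
    by (rule nn_integral_distr) auto
  finally show ?thesis by (simp add: add.commute)
qed

lemma norm_triangle3: "norm (a + b + c) \<le> norm a + norm b + norm (c :: 'b::real_normed_vector)"
  using norm_triangle_ineq[of "a + b" c] norm_triangle_ineq[of a b] by simp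

section \<open>Continuity of translations\<close>

text \<open>Continuity of translation in L1 at 0. It is phrased along sequences because dominated
  convergence is applied to sequences, and with the nonnegative integral so that no integrability
  has to be carried along.\<close>

definition shift_continuous :: "('a::euclidean_space \<Rightarrow> 'b::euclidean_space) \<Rightarrow> bool" where
  "shift_continuous f \<longleftrightarrow> (\<forall>h. h \<longlonglongrightarrow> 0 \<longrightarrow> (\<forall>e>0. \<forall>\<^sub>F n::nat in sequentially.
     (\<integral>\<^sup>+x. ennreal (norm (f (x + h n) - f x)) \<partial>lborel) \<le> ennreal e))"

text \<open>Three-term splitting: by translation invariance the first error equals the last one, so
  one approximation of \<open>f\<close> serves for both.\<close>

lemma shift_continuousI_approx:
  fixes f :: "'a::euclidean_space \<Rightarrow> 'b::euclidean_space"
  assumes [measurable]: "f \<in> borel_measurable borel"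
    and ap: "\<And>e. e > 0 \<Longrightarrow> \<exists>g::'a \<Rightarrow> 'b. g \<in> borel_measurable borel \<and> shift_continuous g \<and>
      (\<integral>\<^sup>+x. ennreal (norm (f x - g x)) \<partial>lborel) \<le> ennreal e"
  shows "shift_continuous f"
  unfolding shift_continuous_def
proof (intro allI impI)
  fix h :: "nat \<Rightarrow> 'a" and e :: real assume h: "h \<longlonglongrightarrow> 0" and e: "e > 0"
  from ap[of "e/3"] e obtain g :: "'a \<Rightarrow> 'b" where g[measurable]:
      "g \<in> borel_measurable borel" and sg: "shift_continuous g"
    and fg: "(\<integral>\<^sup>+x. ennreal (norm (f x - g x)) \<partial>lborel) \<le> ennreal (e/3)" by auto
  have "e/3 > 0" using e by simp
  then have "\<forall>\<^sub>F n in sequentially. (\<integral>\<^sup>+x. ennreal (norm (g (x + h n) - g x)) \<partial>lborel)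
      \<le> ennreal (e/3)"
    using sg h unfolding shift_continuous_def by blast
  then show "\<forall>\<^sub>F n in sequentially. (\<integral>\<^sup>+x. ennreal (norm (f (x + h n) - f x)) \<partial>lborel) \<le> ennreal e"
  proof eventually_elim
    case (elim n)
    have "(\<integral>\<^sup>+x. ennreal (norm (f (x + h n) - f x)) \<partial>lborel)
      \<le> (\<integral>\<^sup>+x. (ennreal (norm (f (x + h n) - g (x + h n))) + ennreal (norm (g (x + h n) - g x)))
            + ennreal (norm (f x - g x)) \<partial>lborel)"
    proof (rule nn_integral_mono)
      fix x
      have "norm (f (x + h n) - f x)
         \<le> norm (f (x + h n) - g (x + h n)) + norm (g (x + h n) - g x) + norm (f x - g x)"
        using norm_triangle3[of "f (x + h n) - g (x + h n)" "g (x + h n) - g x" "g x - f x"]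
        by (simp add: norm_minus_commute)
      then show "ennreal (norm (f (x + h n) - f x)) \<le> (ennreal (norm (f (x + h n) - g (x + h n)))
          + ennreal (norm (g (x + h n) - g x)))
            + ennreal (norm (f x - g x))"
        by (simp flip: ennreal_plus)
    qed
    also have "\<dots> = ((\<integral>\<^sup>+x. ennreal (norm (f (x + h n) - g (x + h n))) \<partial>lborel)
        + (\<integral>\<^sup>+x. ennreal (norm (g (x + h n) - g x)) \<partial>lborel))
            + (\<integral>\<^sup>+x. ennreal (norm (f x - g x)) \<partial>lborel)"
      by (simp add: nn_integral_add)
    also have "(\<integral>\<^sup>+x. ennreal (norm (f (x + h n) - g (x + h n))) \<partial>lborel)
        = (\<integral>\<^sup>+x. ennreal (norm (f x - g x)) \<partial>lborel)"
      by (rule nn_integral_lborel_shift) measurable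
    also have "((\<integral>\<^sup>+x. ennreal (norm (f x - g x)) \<partial>lborel)
        + (\<integral>\<^sup>+x. ennreal (norm (g (x + h n) - g x)) \<partial>lborel))
            + (\<integral>\<^sup>+x. ennreal (norm (f x - g x)) \<partial>lborel)
      \<le> (ennreal (e/3) + ennreal (e/3)) + ennreal (e/3)"
      by (intro add_mono fg elim)
    also have "\<dots> = ennreal e" using e by (simp flip: ennreal_plus)
    finally show ?case .
  qed
qed

text \<open>The indicator of an open set is lower semicontinuous, so dominated convergence controls the
  measure of the points leaving the set; by translation invariance the points entering it are those
  leaving it under the opposite translation.\<close>

lemma shift_continuous_open:
  fixes U :: "'a::euclidean_space set"
  assumes U: "open U" and fin: "emeasure lborel U < \<infinity>"
  shows "shift_continuous (\<lambda>x. indicator U x :: real)"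
  unfolding shift_continuous_def
proof (intro allI impI)
  fix h :: "nat \<Rightarrow> 'a" and e :: real assume h: "h \<longlonglongrightarrow> 0" and e: "e > 0"
  have [measurable]: "U \<in> sets borel" using U by simp
  have half: "\<forall>\<^sub>F n in sequentially.
      (\<integral>\<^sup>+x. ennreal (indicator U x * (1 - indicator U (x + h n))) \<partial>lborel) \<le> ennreal (e/2)"
    if h: "h \<longlonglongrightarrow> 0" for h :: "nat \<Rightarrow> 'a"
  proof -
    let ?s = "\<lambda>n x. indicator U x * (1 - indicator U (x + h n)) :: real"
    have iU: "integrable lborel (\<lambda>x. indicator U x :: real)"
      using fin by (simp add: integrable_indicator_iff)
    have "(\<lambda>n. LINT x|lborel. ?s n x) \<longlonglongrightarrow> (LINT x|(lborel::'a measure). 0)"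
    proof (rule integral_dominated_convergence[OF _ _ iU])
      show "AE x in lborel. (\<lambda>n. ?s n x) \<longlonglongrightarrow> 0"
      proof (rule AE_I2)
        fix x
        show "(\<lambda>n. ?s n x) \<longlonglongrightarrow> 0"
        proof (cases "x \<in> U")
          case True
          have "(\<lambda>n. x + h n) \<longlonglongrightarrow> x + 0" by (intro tendsto_intros h)
          then have "\<forall>\<^sub>F n in sequentially. x + h n \<in> U" using U True
              by (auto dest: topological_tendstoD)
          then have "\<forall>\<^sub>F n in sequentially. 0 = ?s n x" by eventually_elim simp
          then show ?thesis by (rule Lim_transform_eventually[OF tendsto_const])
        qed simp
      qed
      show "AE x in lborel. norm (?s n x) \<le> indicator U x" for n
        by (rule AE_I2) (auto simp: indicator_def)
    qed (measurable)
    then have "\<forall>\<^sub>F n in sequentially. (LINT x|lborel. ?s n x) < e/2"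
      using order_tendstoD(2)[of _ 0 sequentially "e/2"] e by simp
    then show ?thesis
    proof eventually_elim
      case (elim n)
      have "integrable lborel (?s n)"
        by (rule Bochner_Integration.integrable_bound[OF iU]) (measurable, auto simp: indicator_def)
      then have "(\<integral>\<^sup>+x. ennreal (?s n x) \<partial>lborel) = ennreal (LINT x|lborel. ?s n x)"
        by (intro nn_integral_eq_integral) (auto simp: indicator_def)
      then show ?case using elim by (simp add: ennreal_leI)
    qed
  qed
  have h': "(\<lambda>n. - h n) \<longlonglongrightarrow> 0" using tendsto_minus[OF h] by simp
  from half[OF h] half[OF h']
  show "\<forall>\<^sub>F n in sequentially. (\<integral>\<^sup>+x. ennreal (norm (indicator U (x
      + h n) - indicator U x :: real)) \<partial>lborel) \<le> ennreal e"
  proof eventually_elim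
    case (elim n)
    have "(\<integral>\<^sup>+x. ennreal (norm (indicator U (x + h n) - indicator U x :: real)) \<partial>lborel)
      = (\<integral>\<^sup>+x. ennreal (indicator U x * (1 - indicator U (x + h n)))
           + ennreal (indicator U (x + h n) * (1 - indicator U ((x + h n) + - h n))) \<partial>lborel)"
      by (intro nn_integral_cong) (auto simp: indicator_def)
    also have "\<dots> = (\<integral>\<^sup>+x. ennreal (indicator U x * (1 - indicator U (x + h n))) \<partial>lborel)
        + (\<integral>\<^sup>+x. ennreal (indicator U (x + h n) * (1 - indicator U ((x + h n) + - h n))) \<partial>lborel)"
      by (rule nn_integral_add) measurable
    also have "(\<integral>\<^sup>+x. ennreal (indicator U (x + h n) * (1 - indicator U ((x + h n)
        + - h n))) \<partial>lborel)
       = (\<integral>\<^sup>+x. ennreal (indicator U x * (1 - indicator U (x + - h n))) \<partial>lborel)"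
      by (rule nn_integral_lborel_shift[where f="\<lambda>x. ennreal (indicator U x * (1 - indicator U (x
          + - h n)))"]) measurable
    also have "(\<integral>\<^sup>+x. ennreal (indicator U x * (1 - indicator U (x + h n))) \<partial>lborel) + \<dots>
      \<le> ennreal (e/2) + ennreal (e/2)" by (intro add_mono elim)
    also have "\<dots> = ennreal e" using e by (simp flip: ennreal_plus)
    finally show ?case .
  qed
qed

text \<open>Outer regularity of Lebesgue measure replaces the Borel set by an open set up to small
  measure.\<close>

lemma shift_continuous_indicator:
  fixes A :: "'a::euclidean_space set"
  assumes A: "A \<in> sets borel" and fin: "emeasure lborel A < \<infinity>"
  shows "shift_continuous (\<lambda>x. indicator A x :: real)"
proof (rule shift_continuousI_approx)
  fix e :: real assume "e > 0"
  then obtain U where U: "open U" "A \<subseteq> U" "emeasure lborel (U - A) < e"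
    using outer_regular_lborel[OF A] by blast
  have [measurable]: "U \<in> sets borel" "A \<in> sets borel" using U A by simp_all
  have "emeasure lborel U = emeasure lborel A + emeasure lborel (U - A)"
    by (subst plus_emeasure) (use U(2) in \<open>auto simp: Un_absorb1\<close>)
  then have "emeasure lborel U < \<infinity>" using fin U(3) by (auto simp: less_top[symmetric])
  then have "shift_continuous (\<lambda>x. indicator U x :: real)" by (rule shift_continuous_open[OF U(1)])
  moreover have "(\<integral>\<^sup>+x. ennreal (norm (indicator A x - indicator U x :: real)) \<partial>lborel)
      = (\<integral>\<^sup>+x. indicator (U - A) x \<partial>lborel)"
    using U(2) by (intro nn_integral_cong) (auto simp: indicator_def)
  then have "(\<integral>\<^sup>+x. ennreal (norm (indicator A x - indicator U x :: real)) \<partial>lborel) \<le> ennreal e"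
    using U(3) by simp
  ultimately show "\<exists>g::'a \<Rightarrow> real. g \<in> borel_measurable borel \<and> shift_continuous g \<and>
      (\<integral>\<^sup>+x. ennreal (norm (indicator A x - g x)) \<partial>lborel) \<le> ennreal e"
    by (intro exI[of _ "\<lambda>x. indicator U x"]) simp
qed (use A in simp)

text \<open>Induction over integrable functions: multiples of indicators, sums, and limits of
  dominated sequences, the last by approximation in L1.\<close>

lemma shift_continuous_integrable:
  fixes f :: "'a::euclidean_space \<Rightarrow> 'b::euclidean_space"
  assumes "integrable lborel f"
  shows "shift_continuous f"
  using assms
proof (induction rule: integrable_induct)
  case (base A c)
  show ?case unfolding shift_continuous_def
  proof (intro allI impI)
    fix h :: "nat \<Rightarrow> 'a" and e :: real assume h: "h \<longlonglongrightarrow> 0" and e: "e > 0"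
    have A[measurable]: "A \<in> sets borel" using base by simp
    have "e / (norm c + 1) > 0" using e by (simp add: add_nonneg_pos)
    then have "\<forall>\<^sub>F n in sequentially. (\<integral>\<^sup>+x. ennreal (norm (indicator A (x
        + h n) - indicator A x :: real)) \<partial>lborel) \<le> ennreal (e / (norm c + 1))"
      using shift_continuous_indicator[OF A] base h unfolding shift_continuous_def by blast
    then show "\<forall>\<^sub>F n in sequentially. (\<integral>\<^sup>+x. ennreal (norm (indicator A (x
        + h n) *\<^sub>R c - indicator A x *\<^sub>R c)) \<partial>lborel) \<le> ennreal e"
    proof eventually_elim
      case (elim n)
      have "(\<integral>\<^sup>+x. ennreal (norm (indicator A (x + h n) *\<^sub>R c - indicator A x *\<^sub>R c)) \<partial>lborel)
        = (\<integral>\<^sup>+x. ennreal (norm c) * ennreal (norm (indicator A (x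
            + h n) - indicator A x :: real)) \<partial>lborel)"
        by (intro nn_integral_cong) (simp add: ennreal_mult'[symmetric] mult.commute flip:
            scaleR_diff_left)
      also have "\<dots> = ennreal (norm c) * (\<integral>\<^sup>+x. ennreal (norm (indicator A (x
          + h n) - indicator A x :: real)) \<partial>lborel)"
        by (rule nn_integral_cmult) measurable
      also have "\<dots> \<le> ennreal (norm c) * ennreal (e / (norm c + 1))"
          by (intro mult_left_mono elim) simp
      also have "\<dots> = ennreal (norm c * (e / (norm c + 1)))" using e
          by (intro ennreal_mult[symmetric]) auto
      also have "\<dots> \<le> ennreal e"
      proof (rule ennreal_leI)
        have "norm c * e \<le> e * (norm c + 1)" using e by (simp add: algebra_simps)
        then show "norm c * (e / (norm c + 1)) \<le> e" by (simp add: divide_le_eq add_nonneg_pos)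
      qed
      finally show ?case .
    qed
  qed
next
  case (add f g)
  have [measurable]: "f \<in> borel_measurable borel" "g \<in> borel_measurable borel" using add by auto
  show ?case unfolding shift_continuous_def
  proof (intro allI impI)
    fix h :: "nat \<Rightarrow> 'a" and e :: real assume h: "h \<longlonglongrightarrow> 0" and e: "e > 0"
    have e2: "e/2 > 0" using e by simp
    have "\<forall>\<^sub>F n in sequentially. (\<integral>\<^sup>+x. ennreal (norm (f (x + h n) - f x)) \<partial>lborel) \<le> ennreal (e/2)"
      "\<forall>\<^sub>F n in sequentially. (\<integral>\<^sup>+x. ennreal (norm (g (x + h n) - g x)) \<partial>lborel) \<le> ennreal (e/2)"
      using add h e2 unfolding shift_continuous_def by blast+
    then show "\<forall>\<^sub>F n in sequentially. (\<integral>\<^sup>+x. ennreal (norm (f (x + h n) + g (x + h n) - (f x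
        + g x))) \<partial>lborel) \<le> ennreal e"
    proof eventually_elim
      case (elim n)
      have "(\<integral>\<^sup>+x. ennreal (norm (f (x + h n) + g (x + h n) - (f x + g x))) \<partial>lborel)
        \<le> (\<integral>\<^sup>+x. ennreal (norm (f (x + h n) - f x)) + ennreal (norm (g (x + h n) - g x)) \<partial>lborel)"
        by (intro nn_integral_mono)
          (simp add: add_diff_add norm_triangle_ineq flip: ennreal_plus)
      also have "\<dots> = (\<integral>\<^sup>+x. ennreal (norm (f (x + h n) - f x)) \<partial>lborel) + (\<integral>\<^sup>+x. ennreal (norm (g (x
          + h n) - g x)) \<partial>lborel)"
        by (rule nn_integral_add) measurable
      also have "\<dots> \<le> ennreal (e/2) + ennreal (e/2)" by (intro add_mono elim)
      also have "\<dots> = ennreal e" using e by (simp flip: ennreal_plus)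
      finally show ?case .
    qed
  qed
next
  case (lim f s)
  have [measurable]: "f \<in> borel_measurable borel" "\<And>i. s i \<in> borel_measurable borel" using lim
      by auto
  show ?case
  proof (rule shift_continuousI_approx)
    fix e :: real assume e: "e > 0"
    have bd: "norm (norm (f x - s i x)) \<le> 3 * norm (f x)" for i x
    proof -
      have "norm (s i x) \<le> 2 * norm (f x)" using lim by simp
      then show ?thesis using norm_triangle_ineq4[of "f x" "s i x"] by simp
    qed
    have "(\<lambda>i. LINT x|lborel. norm (f x - s i x)) \<longlonglongrightarrow> (LINT x|(lborel::'a measure). 0)"
    proof (rule integral_dominated_convergence[where w="\<lambda>x. 3 * norm (f x)"])
      show "AE x in lborel. (\<lambda>i. norm (f x - s i x)) \<longlonglongrightarrow> 0"
      proof (rule AE_I2)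
        fix x :: 'a
        have "(\<lambda>i. norm (f x - s i x)) \<longlonglongrightarrow> norm (f x - f x)" by (intro tendsto_intros lim) simp
        then show "(\<lambda>i. norm (f x - s i x)) \<longlonglongrightarrow> 0" by simp
      qed
    qed (use lim bd in auto)
    then have "\<forall>\<^sub>F i in sequentially. (LINT x|lborel. norm (f x - s i x)) < e"
      using order_tendstoD(2)[of _ 0 sequentially e] e by simp
    then obtain i where i: "(LINT x|lborel. norm (f x - s i x)) < e"
      unfolding eventually_sequentially by blast
    have "integrable lborel (\<lambda>x. norm (f x - s i x))" using lim by auto
    then have "(\<integral>\<^sup>+x. ennreal (norm (f x - s i x)) \<partial>lborel)
        = ennreal (LINT x|lborel. norm (f x - s i x))"
      by (intro nn_integral_eq_integral) auto
    then have "(\<integral>\<^sup>+x. ennreal (norm (f x - s i x)) \<partial>lborel) \<le> ennreal e" using i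
        by (simp add: ennreal_leI)
    then show "\<exists>g. g \<in> borel_measurable borel \<and> shift_continuous g \<and>
      (\<integral>\<^sup>+x. ennreal (norm (f x - g x)) \<partial>lborel) \<le> ennreal e"
      using lim by (intro exI[of _ "s i"]) simp
  qed simp
qed

lemma norm_sq_triangle3:
  fixes a b c :: "'b::real_normed_vector"
  shows "(norm (a + b + c))\<^sup>2 \<le> 3 * (norm a)\<^sup>2 + 3 * (norm b)\<^sup>2 + 3 * (norm c)\<^sup>2"
proof -
  have "(norm (a + b + c))\<^sup>2 \<le> (norm a + norm b + norm c)\<^sup>2"
      by (intro power_mono norm_triangle3) auto
  also have "\<dots> \<le> 3 * (norm a)\<^sup>2 + 3 * (norm b)\<^sup>2 + 3 * (norm c)\<^sup>2"
  proof -
    have "0 \<le> (norm a - norm b)\<^sup>2 + (norm b - norm c)\<^sup>2 + (norm a - norm c)\<^sup>2" by simp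
    then show ?thesis by (simp add: power2_eq_square algebra_simps)
  qed
  finally show ?thesis .
qed

lemma ennreal_times_3: "0 \<le> t \<Longrightarrow> 3 * ennreal t = ennreal (3 * t)"
  by (simp add: ennreal_mult)

lemma ennreal_le_sum3:
  assumes "a \<le> 3 * b + 3 * c + 3 * d" "0 \<le> b" "0 \<le> c" "0 \<le> d"
  shows "ennreal a \<le> 3 * ennreal b + 3 * ennreal c + 3 * ennreal d"
proof -
  have "3 * ennreal b + 3 * ennreal c + 3 * ennreal d = ennreal (3 * b + 3 * c + 3 * d)"
    using assms by (simp only: ennreal_times_3 ennreal_plus mult_nonneg_nonneg add_nonneg_nonneg
        zero_le_numeral)
  then show ?thesis using assms by (simp only: ennreal_leI)
qed

text \<open>Truncation in domain and range reduces the claim to L1: for a bounded function the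
  squared difference is at most a multiple of the difference, and the truncation is integrable
  because its support is bounded. Arguing by contradiction produces the sequence of translations
  that \<open>shift_continuous\<close> speaks about.\<close>

lemma shift_continuous_L2:
  fixes f :: "'a::euclidean_space \<Rightarrow> 'b::euclidean_space"
  assumes f: "sqint lborel f" and e: "e > 0"
  shows "\<exists>d>0. \<forall>h. norm h \<le> d \<longrightarrow> (\<integral>\<^sup>+x. ennreal ((norm (f (x + h) - f x))\<^sup>2) \<partial>lborel) \<le> ennreal e"
proof (rule ccontr)
  assume "\<not> ?thesis"
  then have "\<exists>h. norm h \<le> 1 / real (Suc n) \<and> \<not> (\<integral>\<^sup>+x. ennreal ((norm (f (x + h) - f x))\<^sup>2) \<partial>lborel)
      \<le> ennreal e" for n
    by (metis of_nat_0_less_iff zero_less_Suc zero_less_divide_1_iff)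
  then obtain h where h: "\<And>n. norm (h n) \<le> 1 / real (Suc n)"
    and neg: "\<And>n. \<not> (\<integral>\<^sup>+x. ennreal ((norm (f (x + h n) - f x))\<^sup>2) \<partial>lborel) \<le> ennreal e" by metis
  have h0: "h \<longlonglongrightarrow> 0"
    by (rule Lim_null_comparison[OF _ LIMSEQ_Suc[OF lim_1_over_n]]) (use h in auto)
  have fm[measurable]: "f \<in> borel_measurable borel" using sqintD[OF f] by simp
  define T where "T k = {x. norm x \<le> real k \<and> norm (f x) \<le> real k}" for k
  have [measurable]: "T k \<in> sets borel" for k unfolding T_def by measurable
  define fk where "fk k x = indicator (T k) x *\<^sub>R f x" for k x
  have [measurable]: "fk k \<in> borel_measurable borel" for k unfolding fk_def by measurable
  have "(\<lambda>k. LINT x|lborel. (norm (f x - fk k x))\<^sup>2) \<longlonglongrightarrow> (LINT x|(lborel::'a measure). 0)"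
  proof (rule integral_dominated_convergence[where w="\<lambda>x. (norm (f x))\<^sup>2"])
    show "AE x in lborel. (\<lambda>k. (norm (f x - fk k x))\<^sup>2) \<longlonglongrightarrow> 0"
    proof (rule AE_I2)
      fix x
      obtain K where "max (norm x) (norm (f x)) \<le> real K" using real_arch_simple by blast
      then have "\<forall>\<^sub>F k in sequentially. 0 = (norm (f x - fk k x))\<^sup>2"
        unfolding eventually_sequentially
        by (intro exI[of _ K]) (auto simp: fk_def T_def indicator_def)
      then show "(\<lambda>k. (norm (f x - fk k x))\<^sup>2) \<longlonglongrightarrow> 0"
          by (rule Lim_transform_eventually[OF tendsto_const])
    qed
    show "AE x in lborel. norm ((norm (f x - fk k x))\<^sup>2) \<le> (norm (f x))\<^sup>2" for k
      by (rule AE_I2) (auto simp: fk_def indicator_def)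
  qed (use sqint_int[OF f] in auto)
  then have "\<forall>\<^sub>F k in sequentially. (LINT x|lborel. (norm (f x - fk k x))\<^sup>2) < e/12"
    using order_tendstoD(2)[of _ 0 sequentially "e/12"] e by simp
  \<comment> \<open>The final splitting has three terms with factor 3; the budgets
    \<open>e/12\<close>, \<open>e/6\<close> and \<open>e/12\<close>, multiplied by 3, add up to
    \<open>e\<close>.\<close>
  then obtain k where k: "(LINT x|lborel. (norm (f x - fk k x))\<^sup>2) < e/12"
    unfolding eventually_sequentially by blast
  have sk: "sqint lborel (fk k)"
    by (rule sqint_bound[OF f, where c=1]) (auto simp: fk_def indicator_def)
  have k': "(\<integral>\<^sup>+x. ennreal ((norm (f x - fk k x))\<^sup>2) \<partial>lborel) \<le> ennreal (e/12)"
    using k nn_integral_eq_integral[OF sqint_int[OF sqint_diff[OF f sk]]] by (simp add: ennreal_leI)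
  have "integrable lborel (\<lambda>x. indicator (cball (0::'a) (real k)) x *\<^sub>R real k)"
    using emeasure_lborel_cball_finite[of "0::'a" "real k"] by simp
  then have ik: "integrable lborel (fk k)"
    by (rule Bochner_Integration.integrable_bound) (auto simp: fk_def T_def indicator_def)
  \<comment> \<open>Twice the bound of the truncation dominates its differences; the summand 2 keeps
    \<open>K\<close> positive for \<open>k = 0\<close>.\<close>
  define K where "K = 2 * real k + 2"
  have K: "K > 0" by (simp add: K_def)
  have "e / (6 * K) > 0" using e K by simp
  then have "\<forall>\<^sub>F n in sequentially. (\<integral>\<^sup>+x. ennreal (norm (fk k (x + h n) - fk k x)) \<partial>lborel)
      \<le> ennreal (e / (6 * K))"
    using shift_continuous_integrable[OF ik] h0 unfolding shift_continuous_def by blast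
  then obtain n where n: "(\<integral>\<^sup>+x. ennreal (norm (fk k (x + h n) - fk k x)) \<partial>lborel)
      \<le> ennreal (e / (6 * K))"
    unfolding eventually_sequentially by blast
  have bk: "norm (fk k x) \<le> real k" for x by (auto simp: fk_def T_def indicator_def)
  have "(\<integral>\<^sup>+x. ennreal ((norm (fk k (x + h n) - fk k x))\<^sup>2) \<partial>lborel)
      \<le> (\<integral>\<^sup>+x. ennreal (K) * ennreal (norm (fk k (x + h n) - fk k x)) \<partial>lborel)"
  proof (rule nn_integral_mono)
    fix x
    have "norm (fk k (x + h n) - fk k x) \<le> K"
      using norm_triangle_ineq4[of "fk k (x + h n)" "fk k x"] bk[of "x + h n"] bk[of x]
          by (simp add: K_def)
    then have "(norm (fk k (x + h n) - fk k x))\<^sup>2 \<le> K * norm (fk k (x + h n) - fk k x)"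
      unfolding power2_eq_square by (intro mult_right_mono) auto
    then show "ennreal ((norm (fk k (x + h n) - fk k x))\<^sup>2) \<le> ennreal (K) * ennreal (norm (fk k (x
        + h n) - fk k x))"
      using K by (simp add: ennreal_leI flip: ennreal_mult)
  qed
  also have "\<dots> = ennreal (K) * (\<integral>\<^sup>+x. ennreal (norm (fk k (x + h n) - fk k x)) \<partial>lborel)"
    by (rule nn_integral_cmult) measurable
  also have "\<dots> \<le> ennreal (K) * ennreal (e / (6 * K))"
    by (intro mult_left_mono n) simp
  also have "\<dots> = ennreal (e/6)" using e K by (simp flip: ennreal_mult)
  finally have n': "(\<integral>\<^sup>+x. ennreal ((norm (fk k (x + h n) - fk k x))\<^sup>2) \<partial>lborel) \<le> ennreal (e/6)" .
  let ?a = "\<lambda>x. ennreal ((norm (f x - fk k x))\<^sup>2)"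
  have "(\<integral>\<^sup>+x. ennreal ((norm (f (x + h n) - f x))\<^sup>2) \<partial>lborel)
    \<le> (\<integral>\<^sup>+x. (3 * ?a (x + h n) + 3 * ennreal ((norm (fk k (x + h n) - fk k x))\<^sup>2))
        + 3 * ?a x \<partial>lborel)"
  proof (rule nn_integral_mono)
    fix x
    have "f (x + h n) - f x = (f (x + h n) - fk k (x + h n)) + (fk k (x + h n) - fk k x)
        + (fk k x - f x)" by simp
    then have "(norm (f (x + h n) - f x))\<^sup>2 \<le> 3 * (norm (f (x + h n) - fk k (x + h n)))\<^sup>2
       + 3 * (norm (fk k (x + h n) - fk k x))\<^sup>2 + 3 * (norm (fk k x - f x))\<^sup>2"
      by (metis norm_sq_triangle3)
    then show "ennreal ((norm (f (x + h n) - f x))\<^sup>2)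
      \<le> (3 * ?a (x + h n) + 3 * ennreal ((norm (fk k (x + h n) - fk k x))\<^sup>2)) + 3 * ?a x"
      unfolding norm_minus_commute[of "f x"] by (intro ennreal_le_sum3) auto
  qed
  also have "\<dots> = (3 * (\<integral>\<^sup>+x. ?a (x + h n) \<partial>lborel) + 3 * (\<integral>\<^sup>+x. ennreal ((norm (fk k (x
      + h n) - fk k x))\<^sup>2) \<partial>lborel))
       + 3 * (\<integral>\<^sup>+x. ?a x \<partial>lborel)"
    by (simp add: nn_integral_add nn_integral_cmult)
  also have "(\<integral>\<^sup>+x. ?a (x + h n) \<partial>lborel) = (\<integral>\<^sup>+x. ?a x \<partial>lborel)"
    by (rule nn_integral_lborel_shift) measurable
  also have "(3 * (\<integral>\<^sup>+x. ?a x \<partial>lborel) + 3 * (\<integral>\<^sup>+x. ennreal ((norm (fk k (x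
      + h n) - fk k x))\<^sup>2) \<partial>lborel))
       + 3 * (\<integral>\<^sup>+x. ?a x \<partial>lborel) \<le> (3 * ennreal (e/12) + 3 * ennreal (e/6)) + 3 * ennreal (e/12)"
    by (intro add_mono mult_left_mono k' n') auto
  also have "\<dots> = ennreal (3 * (e/12) + 3 * (e/6) + 3 * (e/12))"
    using e by (simp only: ennreal_times_3 ennreal_plus divide_nonneg_nonneg zero_le_numeral
        less_imp_le mult_nonneg_nonneg add_nonneg_nonneg)
  also have "\<dots> = ennreal e" by simp
  finally show False using neg by blast
qed

section \<open>Convolution with the bump kernel\<close>

lemma bump_shift: "bump a e y = bump 0 e (y - a)"
  by (simp add: bump_def)

lemma bump_measurable [measurable]: "bump a e \<in> borel_measurable borel"
  unfolding bump_def[abs_def]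
  by (intro measurable_compose[OF _ borel_measurable_continuous_onI[OF continuous_exp_inv]])
      measurable

lemma bump_measurable_lebesgue [measurable]: "bump a e \<in> borel_measurable lebesgue"
  using measurable_completion[of "bump a e" lborel borel] by simp

lemma sqint_bump: "e > 0 \<Longrightarrow> sqint lebesgue (bump a e)"
  by (intro cbs_sqint test_function_cbs test_function_bump)

lemma sqint_lborel_iff:
  "f \<in> borel_measurable borel \<Longrightarrow> sqint lborel f \<longleftrightarrow> sqint lebesgue f"
  unfolding sqint_iff_nn by (auto simp: nn_integral_completion intro: measurable_completion)

text \<open>Translation invariance and Fubini are applied to Borel functions over
  \<open>lborel\<close>, so functions measurable for the completion are first replaced, component by
  component.\<close>

lemma ex_borel_AE:
  fixes f :: "'a::euclidean_space \<Rightarrow> 'b::euclidean_space"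
  assumes f: "f \<in> borel_measurable lebesgue"
  shows "\<exists>g \<in> borel_measurable borel. AE x in lebesgue. f x = g x"
proof -
  have "\<exists>g \<in> borel_measurable lborel. AE x in lborel. f x \<bullet> i = g x" for i
    by (rule completion_ex_borel_measurable_real) (use f in measurable)
  then obtain g where g: "\<And>i. g i \<in> borel_measurable lborel" "\<And>i. AE x in lborel. f x \<bullet> i = g i x"
    by metis
  let ?g = "\<lambda>x. \<Sum>i\<in>Basis. g i x *\<^sub>R (i :: 'b)"
  have [measurable]: "g i \<in> borel_measurable borel" for i using g(1)[of i] by simp
  have "AE x in lborel. \<forall>i\<in>Basis. f x \<bullet> i = g i x"
    by (rule AE_finite_allI) (use g in auto)
  then have "AE x in lborel. f x = ?g x"
  proof eventually_elim
    case (elim x)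
    have "f x = (\<Sum>i\<in>Basis. (f x \<bullet> i) *\<^sub>R i)" by (simp add: euclidean_representation)
    also have "\<dots> = ?g x" using elim by (intro sum.cong) auto
    finally show ?case .
  qed
  then have "AE x in lebesgue. f x = ?g x" by (rule AE_completion)
  then show ?thesis by (intro bexI[where x="?g"]) measurable
qed

text \<open>The normalising constant of the kernel. The dimension enters through the domain type
  alone, hence the type argument.\<close>

definition bmass :: "'a::euclidean_space itself \<Rightarrow> real \<Rightarrow> real" where
  "bmass _ e = (LINT y|(lborel :: 'a measure). bump 0 e y)"

definition moll :: "real \<Rightarrow> ('a::euclidean_space \<Rightarrow> 'b::euclidean_space) \<Rightarrow> 'a \<Rightarrow> 'b" where
  "moll e u x = (1 / bmass TYPE('a) e) *\<^sub>R (LINT y|lebesgue. bump x e y *\<^sub>R u y)"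

lemma integrable_bump: "e > 0 \<Longrightarrow> integrable lborel (bump (a::'a::euclidean_space) e)"
proof -
  assume e: "e > 0"
  have "integrable lborel (\<lambda>x. indicator (cball (a::'a) e) x :: real)"
    using emeasure_lborel_cball_finite[of a e] by (simp add: integrable_indicator_iff)
  then show ?thesis
  proof (rule Bochner_Integration.integrable_bound)
    show "AE x in lborel. norm (bump a e x) \<le> norm (indicator (cball a e) x :: real)"
      using bump_le_1[of a e] bump_eq_0[OF e, of _ a]
      by (intro AE_I2) (auto simp: indicator_def dist_norm norm_minus_commute)
  qed simp
qed

lemma integral_bump: "(LINT y|lborel. bump (x::'a::euclidean_space) e y) = bmass TYPE('a) e"
proof -
  have "bmass TYPE('a) e = (LINT y|distr lborel borel ((+) (- x)). bump (0::'a) e y)"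
    by (simp add: bmass_def lborel_distr_plus)
  also have "\<dots> = (LINT y|lborel. bump 0 e (- x + y))" by (rule integral_distr) auto
  finally show ?thesis by (simp add: bump_shift[of x])
qed

lemma nn_integral_bump:
  "e > 0 \<Longrightarrow> (\<integral>\<^sup>+y. ennreal (bump (x::'a::euclidean_space) e y) \<partial>lborel) = ennreal (bmass TYPE('a) e)"
  using nn_integral_eq_integral[OF integrable_bump, of e x] by (simp add: integral_bump)

lemma bmass_pos:
  assumes "e > 0" shows "bmass TYPE('a::euclidean_space) e > 0"
proof (rule ccontr)
  have nn: "0 \<le> bmass TYPE('a) e" by (simp add: bmass_def)
  assume "\<not> ?thesis"
  with nn have "bmass TYPE('a) e = 0" by linarith
  then have "(LINT y|lborel. bump (0::'a) e y) = 0" by (simp add: bmass_def)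
  then have "AE y in lborel. bump (0::'a) e y = 0"
    using integral_nonneg_eq_0_iff_AE[OF integrable_bump[OF assms, of "0::'a"]] by simp
  then have "AE y in lborel. y \<notin> ball (0::'a) e"
  proof eventually_elim
    case (elim y)
    then show ?case using bump_pos[OF assms, of y 0] by auto
  qed
  then have "emeasure lborel (ball (0::'a) e) = 0"
    by (subst (asm) AE_iff_measurable[where N="ball (0::'a) e"]) auto
  then show False
    using emeasure_ball[of e "0::'a"] assms unit_ball_vol_pos[of "real (DIM('a))"] by simp
qed

lemma integrable_scaleR_sqint:
  assumes "sqint M f" "sqint M u"
  shows "integrable M (\<lambda>y. f y *\<^sub>R (u y :: 'b::euclidean_space))"
  using sqint_norm_mult[OF assms] sqintD[OF assms(1)] sqintD[OF assms(2)]
  by (intro Bochner_Integration.integrable_bound[OF sqint_norm_mult[OF assms]]) auto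

lemma norm_integral_scaleR_le:
  assumes f: "sqint M f" and u: "sqint M u"
  shows "norm (LINT y|M. f y *\<^sub>R (u y :: 'b::euclidean_space)) \<le> l2n M f * l2n M u"
proof -
  have "norm (LINT y|M. f y *\<^sub>R u y) \<le> (LINT y|M. norm (f y *\<^sub>R u y))"
    by (rule integral_norm_bound)
  also have "\<dots> = (LINT y|M. norm (f y) * norm (u y))" by simp
  also have "\<dots> \<le> l2n M f * l2n M u" by (rule l2_cauchy_schwarz[OF f u])
  finally show ?thesis .
qed

lemma sqint_indicator_cball: "sqint lebesgue (\<lambda>y. indicator (cball (a::'a::euclidean_space) r) y ::
    real)"
  using emeasure_lebesgue_cball[of a r] by (intro sqint_indicator) auto

lemma l2n_indicator_cball:
  "l2n lebesgue (\<lambda>y. indicator (cball (a::'a::euclidean_space) r) y :: real)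
   = l2n lebesgue (\<lambda>y. indicator (cball (0::'a) r) y :: real)"
proof -
  have sq: "(\<lambda>y. (norm (indicator (cball c r) y :: real))\<^sup>2) = indicator (cball c r)" for c :: 'a
    by (auto simp: indicator_def)
  have "l2n lebesgue (\<lambda>y. indicator (cball c r) y :: real)
      = sqrt (measure lebesgue (cball c r))" for c :: 'a
    unfolding l2n_def sq by simp
  moreover have "measure lebesgue (cball a r) = measure lebesgue (cball (0::'a) r)"
  proof -
    have "cball a r = (+) a ` cball 0 r" by (simp add: cball_translation)
    then show ?thesis by (metis measure_translation)
  qed
  ultimately show ?thesis by simp
qed

text \<open>One constant serves all functions and all points. Together with
  \<open>moll_lipschitz\<close> this makes the mollifications of a bounded sequence uniformly
  bounded and equicontinuous.\<close>

lemma moll_bounded: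
  assumes e: "e > 0"
  shows "\<exists>K\<ge>0. \<forall>u x. sqint lebesgue u \<longrightarrow>
    norm (moll e u x :: 'b::euclidean_space) \<le> K * l2n lebesgue (u :: 'a::euclidean_space \<Rightarrow> 'b)"
proof (intro exI conjI allI impI)
  let ?K = "(1 / bmass TYPE('a) e) * l2n lebesgue (\<lambda>y. indicator (cball (0::'a) e) y :: real)"
  show "0 \<le> ?K" using bmass_pos[OF e, where 'a='a] by simp
  fix u :: "'a \<Rightarrow> 'b" and x assume u: "sqint lebesgue u"
  have "norm (LINT y|lebesgue. bump x e y *\<^sub>R u y) \<le> l2n lebesgue (bump x e) * l2n lebesgue u"
    by (rule norm_integral_scaleR_le[OF sqint_bump[OF e] u])
  also have "\<dots> \<le> l2n lebesgue (\<lambda>y. indicator (cball x e) y :: real) * l2n lebesgue u"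
    using bump_le_1[of x e] bump_eq_0[OF e, of _ x]
    by (intro mult_right_mono l2n_mono sqint_indicator_cball AE_I2)
      (auto simp: indicator_def dist_norm norm_minus_commute)
  finally have "norm (LINT y|lebesgue. bump x e y *\<^sub>R u y)
      \<le> l2n lebesgue (\<lambda>y. indicator (cball (0::'a) e) y :: real) * l2n lebesgue u"
    by (simp only: l2n_indicator_cball[of x])
  then show "norm (moll e u x) \<le> ?K * l2n lebesgue u"
    using bmass_pos[OF e, where 'a='a] by (simp add: moll_def divide_right_mono)
qed

text \<open>The difference of two kernels is bounded by a multiple of the distance of their centres
  and lives on two balls of radius \<open>e\<close>, whose indicators have the same L2 norm for all
  centres; Cauchy-Schwarz does the rest.\<close>

lemma moll_lipschitz:
  assumes e: "e > 0"
  shows "\<exists>K\<ge>0. \<forall>u x x'. sqint lebesgue u \<longrightarrow>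
    norm (moll e u x - moll e u x' :: 'b::euclidean_space)
      \<le> K * norm (x - x') * l2n lebesgue (u :: 'a::euclidean_space \<Rightarrow> 'b)"
proof -
  obtain L where L: "L > 0" "\<And>x y. \<bar>bump (0::'a) e x - bump 0 e y\<bar> \<le> L * norm (x - y)"
    using test_function_lipschitz[OF test_function_bump[OF e, of "0::'a"]] by blast
  let ?I = "l2n lebesgue (\<lambda>y. indicator (cball (0::'a) e) y :: real)"
  let ?K = "(1 / bmass TYPE('a) e) * (L * (2 * ?I))"
  have bm: "bmass TYPE('a) e > 0" by (rule bmass_pos[OF e])
  have "norm (moll e u x - moll e u x') \<le> ?K * norm (x - x') * l2n lebesgue u"
    if u: "sqint lebesgue u" for u :: "'a \<Rightarrow> 'b" and x x'
  proof -
    let ?i = "\<lambda>x y. indicator (cball x e) y :: real"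
    let ?d = "\<lambda>y. bump x e y - bump x' e y"
    have sd: "sqint lebesgue ?d" by (intro sqint_diff sqint_bump e)
    have si: "sqint lebesgue (\<lambda>y. ?i x y + ?i x' y)" by (intro sqint_add sqint_indicator_cball)
    have "(LINT y|lebesgue. bump x e y *\<^sub>R u y) - (LINT y|lebesgue. bump x' e y *\<^sub>R u y)
        = (LINT y|lebesgue. ?d y *\<^sub>R u y)"
      using integrable_scaleR_sqint[OF sqint_bump[OF e] u]
      by (simp add: scaleR_diff_left)
    moreover have "norm (LINT y|lebesgue. ?d y *\<^sub>R u y) \<le> l2n lebesgue ?d * l2n lebesgue u"
      by (rule norm_integral_scaleR_le[OF sd u])
    moreover have "l2n lebesgue ?d \<le> l2n lebesgue (\<lambda>y. (L * norm (x - x')) *\<^sub>R (?i x y + ?i x' y))"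
    proof (intro l2n_mono sqint_scaleR si AE_I2)
      fix y
      show "norm (?d y) \<le> norm ((L * norm (x - x')) *\<^sub>R (?i x y + ?i x' y))"
      proof (cases "y \<in> cball x e \<or> y \<in> cball x' e")
        case True
        have "\<bar>?d y\<bar> \<le> L * norm ((y - x) - (y - x'))"
          unfolding bump_shift[of x] bump_shift[of x'] by (rule L(2))
        also have "\<dots> = L * norm (x - x') * 1" by (simp add: norm_minus_commute)
        also have "\<dots> \<le> L * norm (x - x') * (?i x y + ?i x' y)"
          using True L(1) by (intro mult_left_mono) (auto simp: indicator_def)
        finally show ?thesis using L(1) by (simp add: abs_mult)
      next
        case False
        then have "bump x e y = 0" "bump x' e y = 0"
          by (auto intro!: bump_eq_0 e simp: dist_norm norm_minus_commute)
        then show ?thesis by simp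
      qed
    qed (use sqintD[OF sd] in simp)
    moreover have "\<dots> \<le> (L * norm (x - x')) * (2 * ?I)"
      using l2n_triangle[OF sqint_indicator_cball sqint_indicator_cball, of x e x' e] L(1)
      unfolding l2n_scaleR l2n_indicator_cball[of x] l2n_indicator_cball[of x']
      by (simp add: abs_mult mult_left_mono)
    ultimately have "norm ((LINT y|lebesgue. bump x e y *\<^sub>R u y) - (LINT y|lebesgue. bump x' e y *\<^sub>R
        u y))
       \<le> (L * norm (x - x')) * (2 * ?I) * l2n lebesgue u"
      by (smt (verit) l2n_nonneg mult_right_mono)
    moreover have "moll e u x - moll e u x' = (1 / bmass TYPE('a) e) *\<^sub>R
       ((LINT y|lebesgue. bump x e y *\<^sub>R u y) - (LINT y|lebesgue. bump x' e y *\<^sub>R u y))"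
      by (simp add: moll_def scaleR_diff_right)
    ultimately have "norm (moll e u x - moll e u x')
       \<le> (1 / bmass TYPE('a) e) * ((L * norm (x - x')) * (2 * ?I) * l2n lebesgue u)"
      using bm by (simp add: mult_left_mono divide_right_mono)
    then show ?thesis by (simp add: ac_simps)
  qed
  moreover have "?K \<ge> 0" using bm L(1) by simp
  ultimately show ?thesis by blast
qed

lemma continuous_moll:
  assumes "e > 0" "sqint lebesgue u"
  shows "continuous_on UNIV (moll e u)"
proof -
  obtain K where "K \<ge> 0" and "\<And>x x'. norm (moll e u x - moll e u x')
      \<le> K * norm (x - x') * l2n lebesgue u"
    using moll_lipschitz[OF assms(1)] assms(2) by blast
  then have "(K * l2n lebesgue u)-lipschitz_on UNIV (moll e u)"
    by (intro lipschitz_onI) (auto simp: dist_norm mult_ac)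
  then show ?thesis by (rule lipschitz_on_continuous_on)
qed

lemma moll_cong_AE:
  assumes "AE x in lebesgue. u x = v x" "u \<in> borel_measurable lebesgue"
      "v \<in> borel_measurable lebesgue"
  shows "moll e u = moll e v"
  unfolding moll_def[abs_def] fun_eq_iff
  using assms by (intro allI arg_cong[where f="\<lambda>t. _ *\<^sub>R t"] integral_cong_AE) (auto elim!:
      eventually_mono)

section \<open>Derivative and L2 error of a mollification\<close>

text \<open>The remainder is uniform in the base point. This permits differentiation under the
  integral by Cauchy-Schwarz, with an explicit rate.\<close>

lemma test_function_taylor:
  fixes \<phi> :: "'a::euclidean_space \<Rightarrow> real"
  assumes \<phi>: "test_function \<phi>"
  shows "\<exists>L>0. \<forall>z h. \<bar>\<phi> (z + h) - \<phi> z - tgrad \<phi> z \<bullet> h\<bar> \<le> L * (norm h)\<^sup>2"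
proof -
  obtain L where L: "L > 0" "\<And>x y. norm (tgrad \<phi> x - tgrad \<phi> y) \<le> L * norm (x - y)"
    using tgrad_lipschitz[OF \<phi>] by blast
  have "\<bar>\<phi> (z + h) - \<phi> z - tgrad \<phi> z \<bullet> h\<bar> \<le> L * (norm h)\<^sup>2" for z h
  proof -
    have "norm (\<phi> (z + h) - \<phi> z - tgrad \<phi> z \<bullet> (z + h - z)) \<le> norm (z + h - z) * (L * norm h)"
    proof (rule differentiable_bound_linearization[where S="cball z (norm h)" and f'="\<lambda>x h. tgrad \<phi>
        x \<bullet> h"])
      show "t \<in> {0..1} \<Longrightarrow> z + t *\<^sub>R (z + h - z) \<in> cball z (norm h)" for t
        by (auto simp: dist_norm mult_left_le_one_le)
      show "(\<phi> has_derivative (\<bullet>) (tgrad \<phi> x)) (at x within cball z (norm h))" for x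
        using test_function_has_derivative[OF \<phi>] has_derivative_at_withinI by blast
      fix x assume x: "x \<in> cball z (norm h)"
      show "onorm ((\<bullet>) (tgrad \<phi> x) - (\<bullet>) (tgrad \<phi> z)) \<le> L * norm h"
      proof (rule onorm_le)
        fix k
        have "norm (((\<bullet>) (tgrad \<phi> x) - (\<bullet>) (tgrad \<phi> z)) k) = \<bar>(tgrad \<phi> x - tgrad \<phi> z) \<bullet> k\<bar>"
          by (simp add: inner_diff_left)
        also have "\<dots> \<le> norm (tgrad \<phi> x - tgrad \<phi> z) * norm k" by (rule Cauchy_Schwarz_ineq2)
        also have "\<dots> \<le> (L * norm (x - z)) * norm k" by (intro mult_right_mono L(2)) auto
        also have "\<dots> \<le> (L * norm h) * norm k"
          using x L(1) by (intro mult_right_mono mult_left_mono) (auto simp: dist_norm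
              norm_minus_commute)
        finally show "norm (((\<bullet>) (tgrad \<phi> x) - (\<bullet>) (tgrad \<phi> z)) k) \<le> L * norm h * norm k" .
      qed
    qed auto
    then show ?thesis by (simp add: power2_eq_square mult_ac)
  qed
  with L(1) show ?thesis by blast
qed

lemma tgrad_bump_shift:
  assumes e: "e > 0"
  shows "tgrad (bump (x::'a::euclidean_space) e) y = tgrad (bump 0 e) (y - x)"
proof -
  have "(bump 0 e has_derivative (\<lambda>h. tgrad (bump 0 e) (y - x) \<bullet> h)) (at (y - x))"
    by (rule test_function_has_derivative[OF test_function_bump[OF e]])
  moreover have "((\<lambda>y. y - x) has_derivative (\<lambda>h. h)) (at y)" by (auto intro!: derivative_eq_intros)
  ultimately have "((\<lambda>y. bump 0 e (y - x)) has_derivative (\<lambda>h. tgrad (bump 0 e) (y - x) \<bullet> h)) (at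
      y)"
    by (rule has_derivative_compose[rotated])
  then have "(bump x e has_derivative (\<lambda>h. tgrad (bump 0 e) (y - x) \<bullet> h)) (at y)"
    by (simp add: bump_shift[of x, abs_def])
  from has_derivative_unique[OF this test_function_has_derivative[OF test_function_bump[OF e]]]
  have "tgrad (bump 0 e) (y - x) \<bullet> h = tgrad (bump x e) y \<bullet> h" for h by meson
  then show ?thesis by (metis vector_eq_rdot)
qed

text \<open>The derivative with respect to the centre of the kernel is minus the derivative in its
  variable, and the weak gradient identity with the kernel as test function moves it onto
  \<open>u\<close> with another change of sign.\<close>

lemma moll_has_derivative:
  fixes u :: "'a::euclidean_space \<Rightarrow> real"
  assumes e: "e > 0" and u: "sqint lebesgue u" and g: "sqint lebesgue g" and ug: "weak_gradient u g"
  shows "(moll e u has_derivative (\<lambda>h. moll e g x \<bullet> h)) (at x)"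
proof -
  let ?\<rho> = "bump (0::'a) e"
  let ?m = "bmass TYPE('a) e"
  have m: "?m > 0" by (rule bmass_pos[OF e])
  obtain L where L: "L > 0" "\<And>z h. \<bar>?\<rho> (z + h) - ?\<rho> z - tgrad ?\<rho> z \<bullet> h\<bar> \<le> L * (norm h)\<^sup>2"
    using test_function_taylor[OF test_function_bump[OF e, of "0::'a"]] by blast
  \<comment> \<open>Increments are restricted to norm below 1, so both kernels and the gradient of
    the one at \<open>x\<close> vanish outside this ball.\<close>
  let ?i = "\<lambda>y. indicator (cball x (e + 1)) y :: real"
  define K where "K = (1 / ?m) * (L * l2n lebesgue ?i * l2n lebesgue u)"
  have st: "sqint lebesgue (\<lambda>y. tgrad (bump x e) y \<bullet> h)" for h
    by (intro sqint_inner_const cbs_sqint cbs_tgrad test_function_bump e)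
  have grad: "(LINT y|lebesgue. u y * (tgrad (bump x e) y \<bullet> h))
      = - ((LINT y|lebesgue. bump x e y *\<^sub>R g y) \<bullet> h)" for h
  proof -
    have b: "(LINT y|lebesgue. u y * (tgrad (bump x e) y \<bullet> i))
        = - (LINT y|lebesgue. bump x e y *\<^sub>R g y) \<bullet> i"
      if i: "i \<in> Basis" for i
    proof -
      have "(LINT y|lebesgue. u y * (tgrad (bump x e) y \<bullet> i))
          = - (LINT y|lebesgue. (g y \<bullet> i) * bump x e y)"
        using ug test_function_bump[OF e, of x] i by (simp add: weak_gradient_def tgrad_inner_Basis)
      also have "(LINT y|lebesgue. (g y \<bullet> i) * bump x e y)
          = (LINT y|lebesgue. (bump x e y *\<^sub>R g y) \<bullet> i)"
        by (simp add: mult.commute)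
      also have "\<dots> = (LINT y|lebesgue. bump x e y *\<^sub>R g y) \<bullet> i"
        by (rule integral_inner_left) (use integrable_scaleR_sqint[OF sqint_bump[OF e] g] in simp)
      finally show ?thesis by simp
    qed
    have "(LINT y|lebesgue. u y * (tgrad (bump x e) y \<bullet> h))
        = (LINT y|lebesgue. (\<Sum>i\<in>Basis. (h \<bullet> i) * (u y * (tgrad (bump x e) y \<bullet> i))))"
      by (subst euclidean_inner) (simp add: sum_distrib_left mult_ac)
    also have "\<dots> = (\<Sum>i\<in>Basis. (h \<bullet> i) * (LINT y|lebesgue. u y * (tgrad (bump x e) y \<bullet> i)))"
      using sqint_mult[OF u st] by (subst Bochner_Integration.integral_sum) auto
    also have "\<dots> = (\<Sum>i\<in>Basis. (h \<bullet> i) * - ((LINT y|lebesgue. bump x e y *\<^sub>R g y) \<bullet> i))"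
      using b by (intro sum.cong) auto
    also have "\<dots> = - ((LINT y|lebesgue. bump x e y *\<^sub>R g y) \<bullet> h)"
      by (subst (2) euclidean_inner) (simp add: sum_negf mult.commute)
    finally show ?thesis .
  qed
  have main: "norm (moll e u y - moll e u x - moll e g x \<bullet> (y - x)) \<le> K * (norm (y - x))\<^sup>2"
    if "dist y x < 1" for y
  proof -
    define h where "h = y - x"
    have h: "norm h < 1" "y = x + h" using that by (auto simp: h_def dist_norm)
    \<comment> \<open>The Taylor remainder of the kernel as a function of its centre; the linear
      term has a plus sign because that derivative is minus \<open>tgrad\<close>.\<close>
    let ?r = "\<lambda>z. bump y e z - bump x e z + tgrad (bump x e) z \<bullet> h"
    have sr: "sqint lebesgue ?r" by (intro sqint_add sqint_diff sqint_bump e st)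
    have "l2n lebesgue ?r \<le> l2n lebesgue (\<lambda>z. (L * (norm h)\<^sup>2) *\<^sub>R ?i z)"
    proof (rule l2n_mono[OF sqint_scaleR[OF sqint_indicator_cball] sqintD[OF sr] AE_I2])
      fix z
      show "norm (?r z) \<le> norm ((L * (norm h)\<^sup>2) *\<^sub>R ?i z)"
      proof (cases "z \<in> cball x (e + 1)")
        case True
        have "?r z = ?\<rho> ((z - x) + - h) - ?\<rho> (z - x) - tgrad ?\<rho> (z - x) \<bullet> (- h)"
          by (simp add: h(2) bump_shift[of "h
              + x"] bump_shift[of x] tgrad_bump_shift[OF e, of x] algebra_simps)
        then have "\<bar>?r z\<bar> \<le> L * (norm (- h))\<^sup>2" using L(2) by presburger
        then show ?thesis using True L(1) by simp
      next
        case False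
        then have zx: "norm (z - x) > e + 1" by (auto simp: dist_norm norm_minus_commute)
        have "norm (z - x) \<le> norm (z - y) + norm h" using norm_triangle_ineq[of "z - y" h] h by simp
        then have 1: "bump y e z = 0" "bump x e z = 0"
          using zx h e by (auto intro!: bump_eq_0)
        have "open {z. norm (z - x) > e}" by (intro open_Collect_less continuous_intros)
        then have "((bump x e) has_derivative (\<lambda>h. 0)) (at z)"
          by (rule has_derivative_transform_within_open[OF has_derivative_const[of 0]])
            (use zx e in \<open>auto simp: bump_eq_0\<close>)
        from has_derivative_unique[OF this test_function_has_derivative[OF test_function_bump[OF
            e]]]
        have "tgrad (bump x e) z \<bullet> h = 0" by metis
        then show ?thesis using 1 by simp
      qed
    qed
    then have lr: "l2n lebesgue ?r \<le> L * (norm h)\<^sup>2 * l2n lebesgue ?i"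
      unfolding l2n_scaleR using L(1) by simp
    have "(LINT z|lebesgue. ?r z *\<^sub>R u z) = (LINT z|lebesgue. bump y e z *\<^sub>R u z - bump x e z *\<^sub>R u
        z + u z * (tgrad (bump x e) z \<bullet> h))"
      by (intro Bochner_Integration.integral_cong) (auto simp: algebra_simps)
    also have "\<dots> = (LINT z|lebesgue. bump y e z *\<^sub>R u z) - (LINT z|lebesgue. bump x e z *\<^sub>R u z)
        + (LINT z|lebesgue. u z * (tgrad (bump x e) z \<bullet> h))"
      using integrable_scaleR_sqint[OF sqint_bump[OF e] u] sqint_mult[OF u st]
      by (subst Bochner_Integration.integral_add) auto
    finally have "(LINT z|lebesgue. ?r z *\<^sub>R u z) = (LINT z|lebesgue. bump y e z *\<^sub>R u z)
        - (LINT z|lebesgue. bump x e z *\<^sub>R u z) - (LINT z|lebesgue. bump x e z *\<^sub>R g z) \<bullet> h"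
      unfolding grad by simp
    then have "moll e u y - moll e u x - moll e g x \<bullet> h
        = (1 / ?m) *\<^sub>R (LINT z|lebesgue. ?r z *\<^sub>R u z)"
      unfolding moll_def by (simp only: scaleR_diff_right inner_scaleR_left real_scaleR_def
          right_diff_distrib)
    then have "norm (moll e u y - moll e u x - moll e g x \<bullet> h)
        \<le> (1 / ?m) * (l2n lebesgue ?r * l2n lebesgue u)"
      using norm_integral_scaleR_le[OF sr u] m by (simp add: divide_right_mono)
    also have "\<dots> \<le> (1 / ?m) * ((L * (norm h)\<^sup>2 * l2n lebesgue ?i) * l2n lebesgue u)"
      using lr m by (intro mult_left_mono mult_right_mono) auto
    finally show ?thesis by (simp add: K_def h_def mult_ac)
  qed
  show ?thesis
  proof (rule has_derivativeI_sandwich[where e=1 and H="\<lambda>y. K * norm (y - x)"])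
    show "bounded_linear ((\<bullet>) (moll e g x))" by (rule bounded_linear_inner_right)
    fix y assume "y \<noteq> x" "dist y x < 1"
    then show "norm (moll e u y - moll e u x - moll e g x \<bullet> (y - x)) / norm (y - x)
        \<le> K * norm (y - x)"
      using main[of y] by (simp add: divide_le_eq power2_eq_square mult_ac)
  next
    have "((\<lambda>y. K * norm (y - x)) \<longlongrightarrow> K * norm (x - x)) (at x)" by (intro tendsto_intros)
    then show "((\<lambda>y. K * norm (y - x)) \<longlongrightarrow> 0) (at x)" by simp
  qed simp
qed

text \<open>Jensen's inequality for the probability density \<open>bump / bmass\<close>, obtained
  from Cauchy-Schwarz by giving each factor a square root of the kernel.\<close>

lemma moll_minus_sq_le:
  fixes u :: "'a::euclidean_space \<Rightarrow> 'b::euclidean_space"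
  assumes e: "e > 0" and u: "sqint lborel u"
  shows "ennreal ((norm (moll e u x - u x))\<^sup>2) \<le> ennreal (1 / bmass TYPE('a) e) *
     (\<integral>\<^sup>+y. ennreal (bump x e y) * ennreal ((norm (u y - u x))\<^sup>2) \<partial>lborel)"
proof -
  let ?m = "bmass TYPE('a) e"
  have m: "?m > 0" by (rule bmass_pos[OF e])
  have [measurable]: "u \<in> borel_measurable borel" using sqintD[OF u] by simp
  have ul: "sqint lebesgue u" using u sqint_lborel_iff[of u] by simp
  define f where "f y = sqrt (bump x e y)" for y
  define g where "g y = sqrt (bump x e y) * norm (u y - u x)" for y
  have [measurable]: "f \<in> borel_measurable borel" "g \<in> borel_measurable borel"
    unfolding f_def g_def by measurable
  have sf: "sqint lborel f" using integrable_bump[OF e, of x] by (simp add: sqint_real f_def)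
  have s1: "sqint lborel (\<lambda>y. norm (u y) + norm (u x) *\<^sub>R f y)"
    by (intro sqint_add sqint_norm u sqint_scaleR sf)
  have sg: "sqint lborel g"
  proof (rule sqint_bound[OF s1, where c=1])
    show "AE y in lborel. norm (g y) \<le> 1 * norm (norm (u y) + norm (u x) *\<^sub>R f y)"
    proof (rule AE_I2)
      fix y
      have f01: "0 \<le> f y" "f y \<le> 1" using bump_le_1[of x e y] by (auto simp: f_def)
      have "f y * norm (u y - u x) \<le> f y * (norm (u y) + norm (u x))"
        by (intro mult_left_mono norm_triangle_ineq4 f01)
      also have "\<dots> \<le> norm (u y) + norm (u x) * f y"
        using mult_right_mono[OF f01(2), of "norm (u y)"] by (simp add: algebra_simps)
      finally show "norm (g y) \<le> 1 * norm (norm (u y) + norm (u x) *\<^sub>R f y)"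
        using f01 by (simp add: g_def f_def abs_mult)
    qed
  qed simp
  have fg: "norm (f y) * norm (g y) = bump x e y * norm (u y - u x)" for y
    by (simp add: f_def g_def abs_mult flip: mult.assoc)
  have i1: "integrable lborel (\<lambda>y. bump x e y *\<^sub>R u y)"
    using integrable_scaleR_sqint[OF sqint_bump[OF e] ul, of x]
    by (subst (asm) integrable_completion) auto
  have i2: "integrable lborel (\<lambda>y. bump x e y *\<^sub>R u x)"
    using integrable_bump[OF e, of x] by simp
  have "moll e u x - u x = (1 / ?m) *\<^sub>R (LINT y|lborel. bump x e y *\<^sub>R (u y - u x))"
  proof -
    have "(LINT y|lebesgue. bump x e y *\<^sub>R u y) = (LINT y|lborel. bump x e y *\<^sub>R u y)"
      by (rule integral_completion) simp
    moreover have "(LINT y|lborel. bump x e y *\<^sub>R u x) = ?m *\<^sub>R u x"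
      using integral_bump[of x e] integrable_bump[OF e, of x] by simp
    moreover have "(LINT y|lborel. bump x e y *\<^sub>R (u y - u x))
        = (LINT y|lborel. bump x e y *\<^sub>R u y) - (LINT y|lborel. bump x e y *\<^sub>R u x)"
      using i1 i2 by (simp only: scaleR_diff_right Bochner_Integration.integral_diff)
    ultimately show ?thesis using m by (simp add: moll_def scaleR_diff_right)
  qed
  then have "norm (moll e u x - u x) = (1 / ?m) * norm (LINT y|lborel. bump x e y *\<^sub>R (u y - u x))"
    using m by simp
  also have "\<dots> \<le> (1 / ?m) * (LINT y|lborel. norm (f y) * norm (g y))"
  proof (rule mult_left_mono)
    have "norm (LINT y|lborel. bump x e y *\<^sub>R (u y - u x))
        \<le> (LINT y|lborel. norm (bump x e y *\<^sub>R (u y - u x)))"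
      by (rule integral_norm_bound)
    then show "norm (LINT y|lborel. bump x e y *\<^sub>R (u y - u x))
        \<le> (LINT y|lborel. norm (f y) * norm (g y))"
      unfolding fg by simp
  qed (use m in simp)
  also have "\<dots> \<le> (1 / ?m) * (l2n lborel f * l2n lborel g)"
    by (intro mult_left_mono l2_cauchy_schwarz sf sg) (use m in simp)
  finally have "(norm (moll e u x - u x))\<^sup>2 \<le> ((1 / ?m) * (l2n lborel f * l2n lborel g))\<^sup>2"
    by (intro power_mono) auto
  also have "\<dots> = (1 / ?m) * (l2n lborel g)\<^sup>2"
  proof -
    have "(l2n lborel f)\<^sup>2 = ?m" by (simp add: l2n_sq f_def integral_bump)
    moreover have "((1 / ?m) * (l2n lborel f * l2n lborel g))\<^sup>2
        = ((l2n lborel f)\<^sup>2 / (?m * ?m)) * (l2n lborel g)\<^sup>2"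
      by (simp add: power_mult_distrib power_divide power2_eq_square[of ?m])
    ultimately show ?thesis using m by simp
  qed
  finally have "ennreal ((norm (moll e u x - u x))\<^sup>2)
      \<le> ennreal (1 / ?m) * ennreal ((l2n lborel g)\<^sup>2)"
    using m by (simp add: ennreal_leI flip: ennreal_mult)
  also have "ennreal ((l2n lborel g)\<^sup>2) = (\<integral>\<^sup>+y. ennreal ((norm (g y))\<^sup>2) \<partial>lborel)"
    using nn_integral_l2n[OF sg] by simp
  also have "\<dots> = (\<integral>\<^sup>+y. ennreal (bump x e y) * ennreal ((norm (u y - u x))\<^sup>2) \<partial>lborel)"
    by (intro nn_integral_cong) (simp add: g_def power_mult_distrib ennreal_mult)
  finally show ?thesis .
qed

text \<open>After substituting \<open>y = x + h\<close> and exchanging the integrals, the squared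
  error is at most a weighted mean of squared translation differences with
  \<open>norm h \<le> e\<close>.\<close>

lemma moll_L2_le:
  fixes u :: "'a::euclidean_space \<Rightarrow> 'b::euclidean_space"
  assumes e: "e > 0" and u: "sqint lborel u"
    and S: "\<And>h. norm h \<le> e \<Longrightarrow> (\<integral>\<^sup>+x. ennreal ((norm (u (x + h) - u x))\<^sup>2) \<partial>lborel) \<le> S"
  shows "(\<integral>\<^sup>+x. ennreal ((norm (moll e u x - u x))\<^sup>2) \<partial>lborel) \<le> S"
proof -
  let ?m = "bmass TYPE('a) e"
  have m: "?m > 0" by (rule bmass_pos[OF e])
  have [measurable]: "u \<in> borel_measurable borel" using sqintD[OF u] by simp
  let ?F = "\<lambda>x h. ennreal (bump 0 e h) * ennreal ((norm (u (x + h) - u x))\<^sup>2)"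
  have eq: "(\<integral>\<^sup>+y. ennreal (bump x e y) * ennreal ((norm (u y - u x))\<^sup>2) \<partial>lborel)
      = (\<integral>\<^sup>+h. ?F x h \<partial>lborel)" for x
  proof -
    have "(\<integral>\<^sup>+y. ennreal (bump x e y) * ennreal ((norm (u y - u x))\<^sup>2) \<partial>lborel)
       = (\<integral>\<^sup>+h. ennreal (bump x e (h + x)) * ennreal ((norm (u (h + x) - u x))\<^sup>2) \<partial>lborel)"
      by (rule nn_integral_lborel_shift[symmetric]) measurable
    then show ?thesis by (simp add: bump_shift[of x] add.commute)
  qed
  have "(\<integral>\<^sup>+x. ennreal ((norm (moll e u x - u x))\<^sup>2) \<partial>lborel)
      \<le> (\<integral>\<^sup>+x. ennreal (1 / ?m) * (\<integral>\<^sup>+h. ?F x h \<partial>lborel) \<partial>lborel)"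
    using moll_minus_sq_le[OF e u] unfolding eq by (rule nn_integral_mono)
  also have "\<dots> = ennreal (1 / ?m) * (\<integral>\<^sup>+x. (\<integral>\<^sup>+h. ?F x h \<partial>lborel) \<partial>lborel)"
    by (rule nn_integral_cmult) measurable
  also have "(\<integral>\<^sup>+x. (\<integral>\<^sup>+h. ?F x h \<partial>lborel) \<partial>lborel) = (\<integral>\<^sup>+h. (\<integral>\<^sup>+x. ?F x h \<partial>lborel) \<partial>lborel)"
    by (rule lborel_pair.Fubini'[where f="\<lambda>x h. ?F x h", symmetric]) measurable
  also have "ennreal (1 / ?m) * \<dots> \<le> ennreal (1 / ?m) * (\<integral>\<^sup>+h. ennreal (bump (0::'a) e h) * S
      \<partial>lborel)"
  proof (intro mult_left_mono nn_integral_mono)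
    fix h :: 'a
    have "(\<integral>\<^sup>+x. ?F x h \<partial>lborel) = ennreal (bump 0 e h) * (\<integral>\<^sup>+x. ennreal ((norm (u (x
        + h) - u x))\<^sup>2) \<partial>lborel)"
      by (rule nn_integral_cmult) measurable
    also have "\<dots> \<le> ennreal (bump 0 e h) * S"
    proof (cases "norm h \<le> e")
      case True
      then show ?thesis by (intro mult_left_mono S) auto
    next
      case False
      then show ?thesis using bump_eq_0[OF e, of h 0] by simp
    qed
    finally show "(\<integral>\<^sup>+x. ?F x h \<partial>lborel) \<le> ennreal (bump 0 e h) * S" .
  qed simp
  also have "(\<integral>\<^sup>+h. ennreal (bump (0::'a) e h) * S \<partial>lborel) = ennreal ?m * S"
    by (subst nn_integral_multc) (auto simp: nn_integral_bump[OF e])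
  also have "ennreal (1 / ?m) * (ennreal ?m * S) = S"
  proof -
    have "ennreal (1 / ?m) * ennreal ?m = 1" using m by (simp flip: ennreal_mult)
    then show ?thesis by (simp flip: mult.assoc)
  qed
  finally show ?thesis .
qed

lemma sqint_l2n_leI:
  assumes "f \<in> borel_measurable M" "(\<integral>\<^sup>+x. ennreal ((norm (f x))\<^sup>2) \<partial>M) \<le> ennreal (c\<^sup>2)" "0 \<le> c"
  shows "sqint M f \<and> l2n M f \<le> c"
proof
  show s: "sqint M f" using assms by (auto simp: sqint_iff_nn le_less_trans)
  have "(l2n M f)\<^sup>2 \<le> c\<^sup>2" using assms nn_integral_l2n[OF s] by simp
  then show "l2n M f \<le> c" using assms(3) by (rule power2_le_imp_le)
qed

lemma l2n_lborel_lebesgue: "f \<in> borel_measurable borel \<Longrightarrow> l2n lborel f = l2n lebesgue f"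
  unfolding l2n_def by (subst integral_completion) auto

lemma sqint_shift:
  fixes u :: "'a::euclidean_space \<Rightarrow> 'b::euclidean_space"
  assumes u: "sqint lborel u"
  shows "sqint lborel (\<lambda>x. u (x + h))" "l2n lborel (\<lambda>x. u (x + h)) = l2n lborel u"
proof -
  have [measurable]: "u \<in> borel_measurable borel" using sqintD[OF u] by simp
  have eq: "(\<integral>\<^sup>+x. ennreal ((norm (u (x + h)))\<^sup>2) \<partial>lborel)
      = (\<integral>\<^sup>+x. ennreal ((norm (u x))\<^sup>2) \<partial>lborel)"
    by (rule nn_integral_lborel_shift) measurable
  show s: "sqint lborel (\<lambda>x. u (x + h))"
    using u unfolding sqint_iff_nn eq by simp
  have "(l2n lborel (\<lambda>x. u (x + h)))\<^sup>2 = (l2n lborel u)\<^sup>2"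
    using eq unfolding nn_integral_l2n[OF u] nn_integral_l2n[OF s] by simp
  then show "l2n lborel (\<lambda>x. u (x + h)) = l2n lborel u" by (simp add: power2_eq_iff_nonneg)
qed

lemma borel_imp_lebesgue:
  assumes "f \<in> borel_measurable borel" shows "f \<in> borel_measurable lebesgue"
proof -
  have "f \<in> borel_measurable lborel" using assms by simp
  then show ?thesis by (rule measurable_completion)
qed

lemma sqint_ex_borel:
  fixes u :: "'a::euclidean_space \<Rightarrow> 'b::euclidean_space"
  assumes u: "sqint lebesgue u"
  obtains v where "v \<in> borel_measurable borel" "sqint lborel v" "sqint lebesgue v"
    "AE x in lebesgue. u x = v x" "\<And>e. moll e u = moll e v"
proof -
  obtain v where v: "v \<in> borel_measurable borel" "AE x in lebesgue. u x = v x"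
    using ex_borel_AE[OF sqintD[OF u]] by blast
  have vl: "v \<in> borel_measurable lebesgue" by (rule borel_imp_lebesgue[OF v(1)])
  have sv: "sqint lebesgue v"
    by (rule sqint_cong_AE[OF _ vl u]) (use v(2) in \<open>auto elim!: eventually_mono\<close>)
  show ?thesis
  proof (rule that[OF v(1) _ sv v(2)])
    show "sqint lborel v" using sv sqint_lborel_iff[OF v(1)] by simp
    show "moll e u = moll e v" for e by (rule moll_cong_AE[OF v(2) sqintD[OF u] vl])
  qed
qed

lemma moll_close:
  fixes u :: "'a::euclidean_space \<Rightarrow> 'b::euclidean_space"
  assumes e: "e > 0" and u: "sqint lborel u" and c: "c \<ge> 0"
    and S: "\<And>h. norm h \<le> e \<Longrightarrow> (\<integral>\<^sup>+x. ennreal ((norm (u (x + h) - u x))\<^sup>2) \<partial>lborel) \<le> ennreal (c\<^sup>2)"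
  shows "sqint lebesgue (moll e u)" "l2n lebesgue (\<lambda>x. moll e u x - u x) \<le> c"
proof -
  have [measurable]: "u \<in> borel_measurable borel" using sqintD[OF u] by simp
  have ul: "sqint lebesgue u" using u sqint_lborel_iff[of u] by simp
  have [measurable]: "moll e u \<in> borel_measurable borel"
    by (rule borel_measurable_continuous_onI[OF continuous_moll[OF e ul]])
  have *: "sqint lborel (\<lambda>x. moll e u x - u x) \<and> l2n lborel (\<lambda>x. moll e u x - u x) \<le> c"
    by (rule sqint_l2n_leI[OF _ moll_L2_le[OF e u S] c]) measurable
  then show "l2n lebesgue (\<lambda>x. moll e u x - u x) \<le> c" by (simp add: l2n_lborel_lebesgue)
  have "sqint lborel (\<lambda>x. (moll e u x - u x) + u x)" using * u by (intro sqint_add) auto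
  then show "sqint lebesgue (moll e u)" by (simp add: sqint_lborel_iff)
qed

text \<open>Membership is all that is wanted, so \<open>moll_close\<close> is fed with the crude
  bound of the translation differences by twice the norm.\<close>

lemma sqint_moll:
  fixes u :: "'a::euclidean_space \<Rightarrow> 'b::euclidean_space"
  assumes e: "e > 0" and u: "sqint lebesgue u"
  shows "sqint lebesgue (moll e u)"
proof -
  obtain v where v: "sqint lborel v" "\<And>e. moll e u = moll e v" using sqint_ex_borel[OF u] by metis
  have "(\<integral>\<^sup>+x. ennreal ((norm (v (x + h) - v x))\<^sup>2) \<partial>lborel) \<le> ennreal ((2 * l2n lborel v)\<^sup>2)" for h
  proof -
    have "l2n lborel (\<lambda>x. v (x + h) + - 1 *\<^sub>R v x) \<le> 2 * l2n lborel v"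
      using l2n_triangle[OF sqint_shift(1)[OF v(1), of h] sqint_scaleR[OF v(1), of
          "-1"]] l2n_scaleR[of lborel "-1" v]
      by (simp add: sqint_shift(2)[OF v(1)])
    then have "(l2n lborel (\<lambda>x. v (x + h) - v x))\<^sup>2 \<le> (2 * l2n lborel v)\<^sup>2"
      by (intro power_mono) auto
    then show ?thesis
      unfolding nn_integral_l2n[OF sqint_diff[OF sqint_shift(1)[OF v(1), of h] v(1)]]
      by (rule ennreal_leI)
  qed
  from moll_close(1)[OF e v(1) _ this] show ?thesis by (simp add: v(2))
qed

lemma moll_tendsto:
  fixes u :: "'a::euclidean_space \<Rightarrow> 'b::euclidean_space"
  assumes u: "sqint lebesgue u"
  shows "(\<lambda>n. l2n lebesgue (\<lambda>x. moll (1 / real (Suc n)) u x - u x)) \<longlonglongrightarrow> 0"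
proof (rule LIMSEQ_I)
  fix r :: real assume r: "r > 0"
  obtain v where vb: "v \<in> borel_measurable borel" and v: "sqint lborel v" and uv:
      "AE x in lebesgue. u x = v x"
    and mv: "\<And>e. moll e u = moll e v" and vl: "sqint lebesgue v"
    using sqint_ex_borel[OF u] by metis
  have "(r/2)\<^sup>2 > 0" using r by simp
  from shift_continuous_L2[OF v this] obtain d where d: "d > 0"
    and S: "\<And>h. norm h \<le> d \<Longrightarrow> (\<integral>\<^sup>+x. ennreal ((norm (v (x + h) - v x))\<^sup>2) \<partial>lborel)
        \<le> ennreal ((r/2)\<^sup>2)"
    by blast
  have "\<forall>\<^sub>F n in sequentially. 1 / real (Suc n) < d"
    using order_tendstoD(2)[OF LIMSEQ_Suc[OF lim_1_over_n] d] .
  then obtain N where N: "\<And>n. n \<ge> N \<Longrightarrow> 1 / real (Suc n) < d" unfolding eventually_sequentially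
      by blast
  have "l2n lebesgue (\<lambda>x. moll (1 / real (Suc n)) u x - u x) < r" if "n \<ge> N" for n
  proof -
    let ?e = "1 / real (Suc n)"
    have e: "?e > 0" by simp
    have "l2n lebesgue (\<lambda>x. moll ?e v x - v x) \<le> r/2"
      using moll_close(2)[OF e v, of "r/2"] S N[OF that] r by simp
    moreover have "l2n lebesgue (\<lambda>x. moll ?e u x - u x) = l2n lebesgue (\<lambda>x. moll ?e v x - v x)"
    proof (rule l2n_cong_AE)
      show "AE x in lebesgue. moll ?e u x - u x = moll ?e v x - v x"
        using uv by eventually_elim (simp add: mv)
      show "(\<lambda>x. moll ?e u x - u x) \<in> borel_measurable lebesgue"
        by (rule sqintD[OF sqint_diff[OF sqint_moll[OF e u] u]])
      show "(\<lambda>x. moll ?e v x - v x) \<in> borel_measurable lebesgue"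
        by (rule sqintD[OF sqint_diff[OF sqint_moll[OF e vl] vl]])
    qed
    ultimately show ?thesis using r by linarith
  qed
  then show "\<exists>N. \<forall>n\<ge>N. norm (l2n lebesgue (\<lambda>x. moll (1 / real (Suc n)) u x - u x) - 0) < r" by auto
qed

text \<open>The approximants live on the whole space and are square integrable but not compactly
  supported; \<open>weak_gradient_C1\<close> and the translation estimates are therefore stated for
  such functions.\<close>

lemma smooth_approx:
  fixes u :: "'a::euclidean_space \<Rightarrow> real"
  assumes u: "sqint lebesgue u" and g: "sqint lebesgue g" and ug: "weak_gradient u g"
  obtains U G where
    "\<And>n::nat. \<And>x. (U n has_derivative (\<lambda>h. G n x \<bullet> h)) (at x)" "\<And>n. continuous_on UNIV (G n)"
    "\<And>n. continuous_on UNIV (U n)"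
    "\<And>n. sqint lebesgue (U n)" "\<And>n. sqint lebesgue (G n)"
    "(\<lambda>n. l2n lebesgue (\<lambda>x. U n x - u x)) \<longlonglongrightarrow> 0" "(\<lambda>n. l2n lebesgue (\<lambda>x. G n x - g x)) \<longlonglongrightarrow> 0"
proof (rule that[of "\<lambda>n. moll (1 / real (Suc n)) u" "\<lambda>n. moll (1 / real (Suc n)) g"])
  fix n
  have e: "1 / real (Suc n) > 0" by simp
  show "\<And>x. (moll (1 / real (Suc n)) u has_derivative (\<bullet>) (moll (1 / real (Suc n)) g x)) (at x)"
    by (rule moll_has_derivative[OF e u g ug])
  show "continuous_on UNIV (moll (1 / real (Suc n)) g)" by (rule continuous_moll[OF e g])
  show "continuous_on UNIV (moll (1 / real (Suc n)) u)" by (rule continuous_moll[OF e u])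
  show "sqint lebesgue (moll (1 / real (Suc n)) u)" by (rule sqint_moll[OF e u])
  show "sqint lebesgue (moll (1 / real (Suc n)) g)" by (rule sqint_moll[OF e g])
qed (rule moll_tendsto[OF u], rule moll_tendsto[OF g])

subsection \<open>Translations of Sobolev functions\<close>

text \<open>The fundamental theorem of calculus along the segment from \<open>x\<close> to
  \<open>x + h\<close>, then Cauchy-Schwarz on the unit interval.\<close>

lemma C1_increment_sq_le:
  fixes U :: "'a::euclidean_space \<Rightarrow> real"
  assumes U: "\<And>x. (U has_derivative (\<lambda>h. G x \<bullet> h)) (at x)" and G: "continuous_on UNIV G"
  shows "ennreal ((U (x + h) - U x)\<^sup>2)
    \<le> (\<integral>\<^sup>+t. ennreal (indicator {0..1} t * ((norm h)\<^sup>2 * (norm (G (x + t *\<^sub>R h)))\<^sup>2)) \<partial>lborel)"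
proof -
  define f where "f t = G (x + t *\<^sub>R h) \<bullet> h" for t :: real
  have fc: "continuous_on {0..1} f"
    unfolding f_def by (intro continuous_intros continuous_on_compose2[OF G]) auto
  have [measurable]: "G \<in> borel_measurable borel" by (rule borel_measurable_continuous_onI[OF G])
  have [measurable]: "f \<in> borel_measurable borel" unfolding f_def by measurable
  let ?i = "\<lambda>t::real. indicator {0..1} t :: real"
  have i: "sqint lborel ?i" by (rule sqint_indicator) auto
  have ii: "(?i t * y)\<^sup>2 = ?i t * y\<^sup>2" for t y by (auto simp: indicator_def)
  have "continuous_on {0..1} (\<lambda>t. (f t)\<^sup>2)" by (intro continuous_intros fc)
  from borel_integrable_atLeastAtMost'[OF this]
  have g: "sqint lborel (\<lambda>t. ?i t * f t)"
    by (simp add: sqint_real ii set_integrable_def)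
  have "(LINT t|lborel. ?i t *\<^sub>R f t) = U (x + 1 *\<^sub>R h) - U (x + 0 *\<^sub>R h)"
  proof (rule integral_FTC_Icc)
    fix t :: real
    have "((\<lambda>t. x + t *\<^sub>R h) has_derivative (\<lambda>s. s *\<^sub>R h)) (at t within {0..1})"
      by (auto intro!: derivative_eq_intros)
    from has_derivative_compose[OF this U]
    show "((\<lambda>t. U (x + t *\<^sub>R h)) has_vector_derivative f t) (at t within {0..1})"
      by (simp add: has_vector_derivative_def f_def)
  qed (use fc in simp_all)
  then have "U (x + h) - U x = (LINT t|lborel. ?i t *\<^sub>R f t)" by simp
  \<comment> \<open>Inserting the indicator twice gives Cauchy-Schwarz a first factor of norm
    1.\<close>
  also have "\<dots> = (LINT t|lborel. ?i t * (?i t * f t))"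
    by (intro Bochner_Integration.integral_cong) (auto simp: indicator_def)
  finally have "\<bar>U (x + h) - U x\<bar> \<le> l2n lborel ?i * l2n lborel (\<lambda>t. ?i t * f t)"
    using l2_cauchy_schwarz_inner[OF i g] by simp
  also have "l2n lborel ?i = 1" unfolding l2n_def using ii[of _ 1] by simp
  finally have "\<bar>U (x + h) - U x\<bar>\<^sup>2 \<le> (l2n lborel (\<lambda>t. ?i t * f t))\<^sup>2" by (intro power_mono) auto
  then have "ennreal ((U (x + h) - U x)\<^sup>2) \<le> ennreal ((l2n lborel (\<lambda>t. ?i t * f t))\<^sup>2)"
    by (simp add: ennreal_leI)
  also have "\<dots> = (\<integral>\<^sup>+t. ennreal ((norm (?i t * f t))\<^sup>2) \<partial>lborel)" using nn_integral_l2n[OF g]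
      by simp
  also have "\<dots> \<le> (\<integral>\<^sup>+t. ennreal (?i t * ((norm h)\<^sup>2 * (norm (G (x + t *\<^sub>R h)))\<^sup>2)) \<partial>lborel)"
  proof (intro nn_integral_mono ennreal_leI)
    fix t
    have "\<bar>f t\<bar> \<le> norm h * norm (G (x + t *\<^sub>R h))"
      unfolding f_def by (metis Cauchy_Schwarz_ineq2 mult.commute)
    then have "\<bar>f t\<bar>\<^sup>2 \<le> (norm h * norm (G (x + t *\<^sub>R h)))\<^sup>2" by (intro power_mono) auto
    then show "(norm (?i t * f t))\<^sup>2 \<le> ?i t * ((norm h)\<^sup>2 * (norm (G (x + t *\<^sub>R h)))\<^sup>2)"
      by (simp add: indicator_def power_mult_distrib)
  qed
  finally show ?thesis .
qed

text \<open>Once the integral in \<open>x\<close> is the inner one, translation invariance removes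
  the shift by \<open>t *\<^sub>R h\<close>, so each \<open>t\<close> contributes the same
  amount.\<close>

lemma C1_shift_le:
  fixes U :: "'a::euclidean_space \<Rightarrow> real"
  assumes U: "\<And>x. (U has_derivative (\<lambda>h. G x \<bullet> h)) (at x)" and G: "continuous_on UNIV G"
    and Uc: "continuous_on UNIV U" and sU: "sqint lborel U" and sG: "sqint lborel G"
  shows "l2n lborel (\<lambda>x. U (x + h) - U x) \<le> norm h * l2n lborel G"
proof -
  have [measurable]: "G \<in> borel_measurable borel" by (rule borel_measurable_continuous_onI[OF G])
  have [measurable]: "U \<in> borel_measurable borel" by (rule borel_measurable_continuous_onI[OF Uc])
  let ?F = "\<lambda>x t. ennreal (indicator {0..1} t * ((norm h)\<^sup>2 * (norm (G (x + t *\<^sub>R h)))\<^sup>2))"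
  have "(\<integral>\<^sup>+x. ennreal ((U (x + h) - U x)\<^sup>2) \<partial>lborel)
      \<le> (\<integral>\<^sup>+x. (\<integral>\<^sup>+(t::real). ?F x t \<partial>lborel) \<partial>lborel)"
    by (intro nn_integral_mono C1_increment_sq_le U G)
  also have "\<dots> = (\<integral>\<^sup>+(t::real). (\<integral>\<^sup>+x. ?F x t \<partial>lborel) \<partial>lborel)"
    by (rule lborel_pair.Fubini'[where f="\<lambda>x t. ?F x t", symmetric]) measurable
  also have "\<dots> = (\<integral>\<^sup>+(t::real). ennreal ((norm h * l2n lborel G)\<^sup>2) * indicator {0..1} t \<partial>lborel)"
  proof (rule nn_integral_cong)
    fix t :: real
    have "(\<integral>\<^sup>+x. ?F x t \<partial>lborel) = (\<integral>\<^sup>+x. ennreal (indicator {0..1} t * (norm h)\<^sup>2) * ennreal ((norm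
        (G (x + t *\<^sub>R h)))\<^sup>2) \<partial>lborel)"
      by (intro nn_integral_cong) (simp add: mult.assoc flip: ennreal_mult)
    also have "\<dots> = ennreal (indicator {0..1} t * (norm h)\<^sup>2) * (\<integral>\<^sup>+x. ennreal ((norm (G (x
        + t *\<^sub>R h)))\<^sup>2) \<partial>lborel)"
      by (rule nn_integral_cmult) measurable
    also have "(\<integral>\<^sup>+x. ennreal ((norm (G (x + t *\<^sub>R h)))\<^sup>2) \<partial>lborel)
        = (\<integral>\<^sup>+x. ennreal ((norm (G x))\<^sup>2) \<partial>lborel)"
      by (rule nn_integral_lborel_shift) measurable
    also have "\<dots> = ennreal ((l2n lborel G)\<^sup>2)" by (rule nn_integral_l2n[OF sG])
    finally show "(\<integral>\<^sup>+x. ?F x t \<partial>lborel) = ennreal ((norm h * l2n lborel G)\<^sup>2) * indicator {0..1} t"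
      by (auto simp: indicator_def power_mult_distrib ennreal_mult)
  qed
  also have "\<dots> = ennreal ((norm h * l2n lborel G)\<^sup>2)"
    by (subst nn_integral_cmult_indicator) auto
  finally have "(\<integral>\<^sup>+x. ennreal ((norm (U (x + h) - U x))\<^sup>2) \<partial>lborel)
      \<le> ennreal ((norm h * l2n lborel G)\<^sup>2)" by simp
  from sqint_l2n_leI[OF _ this] show ?thesis by simp
qed

lemma H1_shift_le:
  fixes u :: "'a::euclidean_space \<Rightarrow> real"
  assumes ub: "sqint lborel u" and g: "sqint lebesgue g" and ug: "weak_gradient u g"
  shows "l2n lborel (\<lambda>x. u (x + h) - u x) \<le> norm h * l2n lebesgue g"
proof -
  have [measurable]: "u \<in> borel_measurable borel" using sqintD[OF ub] by simp
  have u: "sqint lebesgue u" using ub by (simp add: sqint_lborel_iff)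
  obtain U G where U: "\<And>n::nat. \<And>x. (U n has_derivative (\<lambda>h. G n x \<bullet> h)) (at x)" and Gc:
      "\<And>n. continuous_on UNIV (G n)"
    and Uc: "\<And>n. continuous_on UNIV (U n)"
    and sU: "\<And>n. sqint lebesgue (U n)" and sG: "\<And>n. sqint lebesgue (G n)"
    and lU: "(\<lambda>n. l2n lebesgue (\<lambda>x. U n x - u x)) \<longlonglongrightarrow> 0" and lG:
        "(\<lambda>n. l2n lebesgue (\<lambda>x. G n x - g x)) \<longlonglongrightarrow> 0"
    using smooth_approx[OF u g ug] by blast
  have [measurable]: "G n \<in> borel_measurable borel" for n
      by (rule borel_measurable_continuous_onI[OF Gc])
  have [measurable]: "U n \<in> borel_measurable borel" for n
      by (rule borel_measurable_continuous_onI[OF Uc])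
  have bU: "sqint lborel (U n)" and bG: "sqint lborel (G n)" for n using sU sG
      by (simp_all add: sqint_lborel_iff)
  let ?d = "\<lambda>n. l2n lebesgue (\<lambda>x. U n x - u x)" and ?e = "\<lambda>n. l2n lebesgue (\<lambda>x. G n x - g x)"
  have "l2n lborel (\<lambda>x. u (x + h) - u x) \<le> norm h * (l2n lebesgue g + ?e n) + 2 * ?d n" for n
  proof -
    note s = sqint_shift(1)[OF ub, of h] sqint_shift(1)[OF bU, of n h]
    have "l2n lborel (\<lambda>x. u (x + h) - u x) \<le> l2n lborel (\<lambda>x. u (x + h) - U n (x + h))
        + l2n lborel (\<lambda>x. U n (x + h) - u x)"
      by (rule l2n_triangle_diff[OF s ub])
    also have "l2n lborel (\<lambda>x. U n (x + h) - u x) \<le> l2n lborel (\<lambda>x. U n (x + h) - U n x)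
        + l2n lborel (\<lambda>x. U n x - u x)"
      by (rule l2n_triangle_diff[OF s(2) bU ub])
    also have "l2n lborel (\<lambda>x. u (x + h) - U n (x + h)) = l2n lborel (\<lambda>x. u x - U n x)"
      by (rule sqint_shift(2)[OF sqint_diff[OF ub bU]])
    also have "\<dots> = ?d n" by (simp add: l2n_minus_commute[of _ u] l2n_lborel_lebesgue)
    also have "l2n lborel (\<lambda>x. U n x - u x) = ?d n" by (simp add: l2n_lborel_lebesgue)
    finally have 1: "l2n lborel (\<lambda>x. u (x + h) - u x) \<le> l2n lborel (\<lambda>x. U n (x + h) - U n x)
        + 2 * ?d n" by simp
    have "l2n lborel (\<lambda>x. U n (x + h) - U n x) \<le> norm h * l2n lebesgue (G n)"
      using C1_shift_le[OF U Gc Uc bU bG] by (simp add: l2n_lborel_lebesgue)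
    also have "l2n lebesgue (G n) \<le> l2n lebesgue g + ?e n"
      using l2n_triangle[OF g sqint_diff[OF sG g]] by simp
    finally show ?thesis using 1 by (simp add: mult_left_mono)
  qed
  moreover have "(\<lambda>n. norm h * (l2n lebesgue g + ?e n) + 2 * ?d n) \<longlonglongrightarrow> norm h * (l2n lebesgue g + 0)
      + 2 * 0"
    by (intro tendsto_intros lU lG)
  ultimately show ?thesis by (intro LIMSEQ_le_const[of _ "norm h * l2n lebesgue g"]) auto
qed

text \<open>The rate is linear in \<open>e\<close> and depends on \<open>u\<close> only through the
  norm of its gradient; this uniformity over bounded sets is what compactness rests on.\<close>

lemma H1_moll_close:
  fixes u :: "'a::euclidean_space \<Rightarrow> real"
  assumes e: "e > 0" and u: "sqint lebesgue u" and g: "sqint lebesgue g" and ug: "weak_gradient u g"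
  shows "l2n lebesgue (\<lambda>x. moll e u x - u x) \<le> e * l2n lebesgue g"
proof -
  obtain v where vb: "v \<in> borel_measurable borel" and v: "sqint lborel v" and uv:
      "AE x in lebesgue. u x = v x"
    and mv: "\<And>e. moll e u = moll e v" and vl: "sqint lebesgue v"
    using sqint_ex_borel[OF u] by metis
  have vg: "weak_gradient v g" unfolding weak_gradient_def
  proof (intro allI impI ballI)
    fix \<phi> :: "'a \<Rightarrow> real" and i :: 'a assume \<phi>: "test_function \<phi>" and i: "i \<in> Basis"
    have s: "sqint lebesgue (\<lambda>x. frechet_derivative \<phi> (at x) i)"
      by (rule cbs_sqint[OF test_function_cbs[OF test_function_partial[OF \<phi> i]]])
    have "(LINT x|lebesgue. v x * frechet_derivative \<phi> (at x) i)
        = (LINT x|lebesgue. u x * frechet_derivative \<phi> (at x) i)"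
      using uv sqint_mult[OF u s] sqint_mult[OF vl s] by (intro integral_cong_AE) auto
    then show "(LINT x|lebesgue. v x * frechet_derivative \<phi> (at x) i)
        = - (LINT x|lebesgue. (g x \<bullet> i) * \<phi> x)"
      using ug \<phi> i by (simp add: weak_gradient_def)
  qed
  have "(\<integral>\<^sup>+x. ennreal ((norm (v (x + h) - v x))\<^sup>2) \<partial>lborel) \<le> ennreal ((e * l2n lebesgue g)\<^sup>2)" if
      "norm h \<le> e" for h
  proof -
    have "l2n lborel (\<lambda>x. v (x + h) - v x) \<le> norm h * l2n lebesgue g"
        by (rule H1_shift_le[OF v g vg])
    also have "\<dots> \<le> e * l2n lebesgue g" using that by (simp add: mult_right_mono)
    finally have "(l2n lborel (\<lambda>x. v (x + h) - v x))\<^sup>2 \<le> (e * l2n lebesgue g)\<^sup>2"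
        by (intro power_mono) auto
    then show ?thesis
      unfolding nn_integral_l2n[OF sqint_diff[OF sqint_shift(1)[OF v] v]] by (rule ennreal_leI)
  qed
  from moll_close(2)[OF e v _ this] e have *:
      "l2n lebesgue (\<lambda>x. moll e v x - v x) \<le> e * l2n lebesgue g" by simp
  have "l2n lebesgue (\<lambda>x. moll e u x - u x) = l2n lebesgue (\<lambda>x. moll e v x - v x)"
  proof (rule l2n_cong_AE)
    show "AE x in lebesgue. moll e u x - u x = moll e v x - v x"
      using uv by eventually_elim (simp add: mv)
    show "(\<lambda>x. moll e u x - u x) \<in> borel_measurable lebesgue"
      by (rule sqintD[OF sqint_diff[OF sqint_moll[OF e u] u]])
    show "(\<lambda>x. moll e v x - v x) \<in> borel_measurable lebesgue"
      by (rule sqintD[OF sqint_diff[OF sqint_moll[OF e vl] vl]])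
  qed
  with * show ?thesis by simp
qed

section \<open>Weak gradients\<close>

lemma weak_gradient_eqD:
  "weak_gradient u g \<Longrightarrow> test_function \<phi> \<Longrightarrow> i \<in> Basis \<Longrightarrow>
    (LINT x|lebesgue. u x * frechet_derivative \<phi> (at x) i) = - (LINT x|lebesgue. (g x \<bullet> i) * \<phi> x)"
  by (simp add: weak_gradient_def)

lemma sqint_test: "test_function \<phi> \<Longrightarrow> sqint lebesgue \<phi>"
  by (intro cbs_sqint test_function_cbs)

lemma sqint_test_partial:
  "test_function \<phi> \<Longrightarrow> i \<in> Basis \<Longrightarrow> sqint lebesgue (\<lambda>x. frechet_derivative \<phi> (at x) i)"
  by (intro sqint_test test_function_partial)

text \<open>Each \<open>bump\<close> is a test function, so all mollifications of
  \<open>g - g'\<close> vanish identically, while they converge to it in L2.\<close>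

lemma weak_gradient_unique:
  fixes g g' :: "'a::euclidean_space \<Rightarrow> 'a"
  assumes g: "sqint lebesgue g" and g': "sqint lebesgue g'"
    and "weak_gradient u g" "weak_gradient u g'"
  shows "AE x in lebesgue. g x = g' x"
proof -
  let ?d = "\<lambda>x. g x - g' x"
  have d: "sqint lebesgue ?d" by (rule sqint_diff[OF g g'])
  have "moll e ?d x = 0" if e: "e > 0" for e x
  proof -
    have "(LINT y|lebesgue. bump x e y *\<^sub>R ?d y) \<bullet> i = 0" if i: "i \<in> Basis" for i
    proof -
      note s = sqint_bump[OF e, of x]
      have "(LINT y|lebesgue. bump x e y *\<^sub>R ?d y) \<bullet> i
          = (LINT y|lebesgue. (bump x e y *\<^sub>R ?d y) \<bullet> i)"
        by (rule integral_inner_left[symmetric]) (use integrable_scaleR_sqint[OF s d] in simp)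
      also have "\<dots> = (LINT y|lebesgue. (g y \<bullet> i) * bump x e y - (g' y \<bullet> i) * bump x e y)"
        by (intro Bochner_Integration.integral_cong) (auto simp: algebra_simps)
      also have "\<dots> = (LINT y|lebesgue. (g y \<bullet> i) * bump x e y) - (LINT y|lebesgue. (g' y \<bullet> i) * bump
          x e y)"
        by (intro Bochner_Integration.integral_diff sqint_mult sqint_inner_const g g' s)
      also have "\<dots> = 0"
        using weak_gradient_eqD[OF assms(3) test_function_bump[OF e, of x] i]
          weak_gradient_eqD[OF assms(4) test_function_bump[OF e, of x] i] by simp
      finally show ?thesis .
    qed
    then have "(LINT y|lebesgue. bump x e y *\<^sub>R ?d y) = 0"
        by (intro euclidean_eqI[where 'a='a]) simp
    then show ?thesis by (simp add: moll_def)
  qed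
  then have "(\<lambda>n::nat. l2n lebesgue (\<lambda>x. 0 - ?d x)) \<longlonglongrightarrow> 0"
    using moll_tendsto[OF d] by simp
  then have "l2n lebesgue (\<lambda>x. 0 - ?d x) = 0" using LIMSEQ_const_iff by blast
  then have "AE x in lebesgue. 0 - ?d x = 0" by (intro l2n_eq_0_AE sqint_diff sqint_zero d)
  then show ?thesis by eventually_elim simp
qed

lemma weak_gradient_cong_AE:
  assumes "weak_gradient u g" "sqint lebesgue u" "sqint lebesgue v" "sqint lebesgue g"
      "sqint lebesgue k"
    "AE x in lebesgue. u x = v x" "AE x in lebesgue. g x = k x"
  shows "weak_gradient v k"
  unfolding weak_gradient_def
proof (intro allI impI ballI)
  fix \<phi> :: "'a \<Rightarrow> real" and i :: 'a assume \<phi>: "test_function \<phi>" and i: "i \<in> Basis"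
  note s = sqint_test_partial[OF \<phi> i] and t = sqint_test[OF \<phi>]
  have "(LINT x|lebesgue. v x * frechet_derivative \<phi> (at x) i)
      = (LINT x|lebesgue. u x * frechet_derivative \<phi> (at x) i)"
    using assms(6) sqint_mult[OF assms(2) s] sqint_mult[OF assms(3) s]
        by (intro integral_cong_AE) auto
  moreover have "(LINT x|lebesgue. (g x \<bullet> i) * \<phi> x) = (LINT x|lebesgue. (k x \<bullet> i) * \<phi> x)"
    using assms(7) sqint_mult[OF sqint_inner_const[OF assms(4)] t] sqint_mult[OF
        sqint_inner_const[OF assms(5)] t]
    by (intro integral_cong_AE) auto
  ultimately show "(LINT x|lebesgue. v x * frechet_derivative \<phi> (at x) i)
      = - (LINT x|lebesgue. (k x \<bullet> i) * \<phi> x)"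
    using weak_gradient_eqD[OF assms(1) \<phi> i] by simp
qed

lemma weak_gradient_lincomb:
  assumes "weak_gradient u g" "weak_gradient v k"
    and u: "sqint lebesgue u" and v: "sqint lebesgue v" and g: "sqint lebesgue g" and k:
        "sqint lebesgue k"
  shows "weak_gradient (\<lambda>x. u x + c * v x) (\<lambda>x. g x + c *\<^sub>R k x)"
  unfolding weak_gradient_def
proof (intro allI impI ballI)
  fix \<phi> :: "'a \<Rightarrow> real" and i :: 'a assume \<phi>: "test_function \<phi>" and i: "i \<in> Basis"
  note s = sqint_test_partial[OF \<phi> i] and t = sqint_test[OF \<phi>]
  have "(LINT x|lebesgue. (u x + c * v x) * frechet_derivative \<phi> (at x) i)
     = (LINT x|lebesgue. u x * frechet_derivative \<phi> (at x) i
         + c * (v x * frechet_derivative \<phi> (at x) i))"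
    by (intro Bochner_Integration.integral_cong) (auto simp: algebra_simps)
  also have "\<dots> = (LINT x|lebesgue. u x * frechet_derivative \<phi> (at x) i)
      + c * (LINT x|lebesgue. v x * frechet_derivative \<phi> (at x) i)"
    using sqint_mult[OF u s] sqint_mult[OF v s] by simp
  also have "\<dots> = - ((LINT x|lebesgue. (g x \<bullet> i) * \<phi> x) + c * (LINT x|lebesgue. (k x \<bullet> i) * \<phi> x))"
    using weak_gradient_eqD[OF assms(1) \<phi> i] weak_gradient_eqD[OF assms(2) \<phi> i] by simp
  also have "(LINT x|lebesgue. (g x \<bullet> i) * \<phi> x) + c * (LINT x|lebesgue. (k x \<bullet> i) * \<phi> x)
     = (LINT x|lebesgue. (g x \<bullet> i) * \<phi> x + c * ((k x \<bullet> i) * \<phi> x))"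
    using sqint_mult[OF sqint_inner_const[OF g] t] sqint_mult[OF sqint_inner_const[OF k] t] by simp
  also have "\<dots> = (LINT x|lebesgue. ((g x + c *\<^sub>R k x) \<bullet> i) * \<phi> x)"
    by (intro Bochner_Integration.integral_cong) (auto simp: algebra_simps)
  finally show "(LINT x|lebesgue. (u x + c * v x) * frechet_derivative \<phi> (at x) i)
      = - (LINT x|lebesgue. ((g x + c *\<^sub>R k x) \<bullet> i) * \<phi> x)" .
qed

lemma weak_gradient_limit:
  assumes "\<And>n. weak_gradient (U n) (G n)" and U: "\<And>n. sqint lebesgue (U n)" and G:
      "\<And>n. sqint lebesgue (G n)"
    and u: "sqint lebesgue u" and g: "sqint lebesgue g"
    and lU: "(\<lambda>n. l2n lebesgue (\<lambda>x. U n x - u x)) \<longlonglongrightarrow> 0" and lG: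
        "(\<lambda>n. l2n lebesgue (\<lambda>x. G n x - g x)) \<longlonglongrightarrow> 0"
  shows "weak_gradient u g"
  unfolding weak_gradient_def
proof (intro allI impI ballI)
  fix \<phi> :: "'a \<Rightarrow> real" and i :: 'a assume \<phi>: "test_function \<phi>" and i: "i \<in> Basis"
  have 1: "(\<lambda>n. LINT x|lebesgue. U n x * frechet_derivative \<phi> (at x) i)
      \<longlonglongrightarrow> (LINT x|lebesgue. u x * frechet_derivative \<phi> (at x) i)"
    using integral_inner_tendsto[OF U u sqint_test_partial[OF \<phi> i] lU] by simp
  have s: "sqint lebesgue (\<lambda>x. \<phi> x *\<^sub>R i)"
    by (rule sqint_bound[OF sqint_test[OF \<phi>], where c=1]) (use i sqintD[OF sqint_test[OF \<phi>]] in
        auto)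
  have 2: "(\<lambda>n. LINT x|lebesgue. (G n x \<bullet> i) * \<phi> x) \<longlonglongrightarrow> (LINT x|lebesgue. (g x \<bullet> i) * \<phi> x)"
    using integral_inner_tendsto[OF G g s lG] by (simp add: mult.commute)
  have "(\<lambda>n. LINT x|lebesgue. U n x * frechet_derivative \<phi> (at x) i)
      \<longlonglongrightarrow> - (LINT x|lebesgue. (g x \<bullet> i) * \<phi> x)"
    using tendsto_minus[OF 2] weak_gradient_eqD[OF assms(1) \<phi> i] by simp
  from LIMSEQ_unique[OF 1 this]
  show "(LINT x|lebesgue. u x * frechet_derivative \<phi> (at x) i)
      = - (LINT x|lebesgue. (g x \<bullet> i) * \<phi> x)" .
qed

section \<open>Integration by parts for C1 functions\<close>

lemma integral_lborel_shift:
  fixes f :: "'a::euclidean_space \<Rightarrow> real"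
  assumes [measurable]: "f \<in> borel_measurable borel"
  shows "(LINT x|lborel. f (x + h)) = (LINT x|lborel. f x)"
proof -
  have "(LINT x|lborel. f x) = (LINT x|distr lborel borel ((+) h). f x)"
    by (simp add: lborel_distr_plus)
  also have "\<dots> = (LINT x|lborel. f (h + x))"
    by (rule integral_distr) auto
  finally show ?thesis by (simp add: add.commute)
qed

text \<open>The difference quotients have integral 0 by translation invariance, and they converge
  boundedly with a common bounded support. No coordinates or iterated integrals enter.\<close>

lemma integral_partial_derivative_eq_0:
  fixes p :: "'a::euclidean_space \<Rightarrow> real"
  assumes p: "\<And>x. (p has_derivative (\<lambda>h. P x \<bullet> h)) (at x)" and cp: "cbs p" and cP: "cbs P"
  shows "(LINT x|lebesgue. P x \<bullet> b) = 0"
proof -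
  obtain K where K: "K > 0" "\<And>x. norm (P x) \<le> K" using cbs_bounded[OF cP] by blast
  obtain R where R: "\<And>x. norm x > R \<Longrightarrow> p x = 0" using cp by (auto simp: cbs_def)
  have [measurable]: "P \<in> borel_measurable borel" "p \<in> borel_measurable borel" using cbs_borel cP cp
      by auto
  have lip: "norm (p (x + h) - p x) \<le> K * norm h" for x h
  proof -
    have "norm (p (x + h) - p x) \<le> K * norm (x + h - x)"
    proof (rule differentiable_bound[OF convex_UNIV])
      show "(p has_derivative (\<lambda>h. P x \<bullet> h)) (at x within UNIV)" for x using p by simp
      show "onorm (\<lambda>h. P x \<bullet> h) \<le> K" for x
      proof (rule onorm_le)
        fix h
        have "norm (P x \<bullet> h) \<le> norm (P x) * norm h" by (simp add: Cauchy_Schwarz_ineq2)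
        also have "\<dots> \<le> K * norm h" by (intro mult_right_mono K) auto
        finally show "norm (P x \<bullet> h) \<le> K * norm h" .
      qed
    qed auto
    then show ?thesis by simp
  qed
  define t where "t n = 1 / real (Suc n)" for n
  have t0: "t n > 0" "t n \<le> 1" for n by (auto simp: t_def)
  have tl: "t \<longlonglongrightarrow> 0" unfolding t_def by (rule LIMSEQ_Suc[OF lim_1_over_n])
  let ?s = "\<lambda>n x. (p (x + t n *\<^sub>R b) - p x) / t n"
  have "(\<lambda>n. LINT x|lborel. ?s n x) \<longlonglongrightarrow> (LINT x|lborel. P x \<bullet> b)"
  \<comment> \<open>As \<open>t n \<le> 1\<close>, a point outside this larger ball and its
    translate both lie outside the support of \<open>p\<close>.\<close>
  proof (rule integral_dominated_convergence[where w="\<lambda>x. K * norm b * indicator (cball 0 (R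
      + norm b)) x"])
    show "integrable lborel (\<lambda>x::'a. K * norm b * indicator (cball 0 (R + norm b)) x)"
      using emeasure_lborel_cball_finite[of "0::'a" "R + norm b"]
          by (simp add: integrable_indicator_iff)
    show "AE x in lborel. (\<lambda>n. ?s n x) \<longlonglongrightarrow> P x \<bullet> b"
    proof (rule AE_I2)
      fix x
      have "((\<lambda>r. x + r *\<^sub>R b) has_derivative (\<lambda>r. r *\<^sub>R b)) (at 0)"
          by (auto intro!: derivative_eq_intros)
      then have "((\<lambda>r. p (x + r *\<^sub>R b)) has_derivative (\<lambda>r. P (x + 0 *\<^sub>R b) \<bullet> (r *\<^sub>R b))) (at 0)"
        by (rule has_derivative_compose[OF _ p])
      then have "((\<lambda>r. p (x + r *\<^sub>R b)) has_real_derivative (P x \<bullet> b)) (at 0)"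
        by (simp add: has_field_derivative_def mult_commute_abs)
      then have "((\<lambda>r. (p (x + r *\<^sub>R b) - p x) / r) \<longlongrightarrow> P x \<bullet> b) (at 0)"
        by (simp add: DERIV_def)
      moreover have "filterlim t (at 0) sequentially"
        using tl t0(1) by (auto simp: filterlim_at intro!: always_eventually
            less_imp_neq[symmetric])
      ultimately show "(\<lambda>n. ?s n x) \<longlonglongrightarrow> P x \<bullet> b" by (rule filterlim_compose)
    qed
    show "AE x in lborel. norm (?s n x) \<le> K * norm b * indicator (cball 0 (R + norm b)) x" for n
    proof (rule AE_I2)
      fix x
      show "norm (?s n x) \<le> K * norm b * indicator (cball 0 (R + norm b)) x"
      proof (cases "norm x \<le> R + norm b")
        case True
        have "norm (p (x + t n *\<^sub>R b) - p x) \<le> K * norm b * t n"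
          using lip[of x "t n *\<^sub>R b"] t0[of n] by (simp add: mult_ac)
        then show ?thesis using True t0[of n] by (simp add: divide_le_eq)
      next
        case False
        have "norm (t n *\<^sub>R b) \<le> norm b" using t0[of n] by (simp add: mult_left_le_one_le)
        moreover have "norm x \<le> norm (x + t n *\<^sub>R b) + norm (t n *\<^sub>R b)"
          using norm_triangle_ineq4[of "x + t n *\<^sub>R b" "t n *\<^sub>R b"] by simp
        ultimately have "norm (x + t n *\<^sub>R b) > R" using False by linarith
        moreover have "norm x > R" using False norm_ge_zero[of b] by linarith
        ultimately show ?thesis using R False by simp
      qed
    qed
  qed measurable
  moreover have "(LINT x|lborel. ?s n x) = 0" for n
  proof -
    have "sqint lebesgue p" by (rule cbs_sqint[OF cp])
    have ip: "integrable lborel p"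
    proof -
      obtain B where B: "\<And>x. norm (p x) \<le> B" using cbs_bounded[OF cp] by blast
      have "integrable lborel (\<lambda>x::'a. B * indicator (cball 0 R) x)"
        using emeasure_lborel_cball_finite[of "0::'a" R] by (simp add: integrable_indicator_iff)
      then show ?thesis
      proof (rule Bochner_Integration.integrable_bound)
        show "AE x in lborel. norm (p x) \<le> norm (B * indicator (cball 0 R) x :: real)"
        proof (rule AE_I2)
          fix x show "norm (p x) \<le> norm (B * indicator (cball 0 R) x :: real)"
            using B[of x] R[of x] by (cases "norm x \<le> R") (auto simp: indicator_def)
        qed
      qed simp
    qed
    have ip': "integrable lborel (\<lambda>x. p (x + t n *\<^sub>R b))"
    proof -
      have "integrable (distr lborel borel ((+) (t n *\<^sub>R b))) p" using ip
          by (simp add: lborel_distr_plus)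
      then show ?thesis by (subst (asm) integrable_distr_eq) (auto simp: add.commute)
    qed
    have "(LINT x|lborel. ?s n x) = ((LINT x|lborel. p (x
        + t n *\<^sub>R b)) - (LINT x|lborel. p x)) / t n"
      using ip ip' by simp
    also have "(LINT x|lborel. p (x + t n *\<^sub>R b)) = (LINT x|lborel. p x)"
      by (rule integral_lborel_shift) simp
    finally show ?thesis by simp
  qed
  ultimately have "(\<lambda>n::nat. 0) \<longlonglongrightarrow> (LINT x|lborel. P x \<bullet> b)" by (simp only:)
  then have "(LINT x|lborel. P x \<bullet> b) = 0" by (simp only: LIMSEQ_const_iff)
  then show ?thesis by (subst integral_completion) auto
qed

text \<open>This is \<open>integral_partial_derivative_eq_0\<close> for the product of
  \<open>v\<close> and the test function, which has bounded support although \<open>v\<close> has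
  not.\<close>

lemma weak_gradient_C1:
  fixes v :: "'a::euclidean_space \<Rightarrow> real"
  assumes v: "\<And>x. (v has_derivative (\<lambda>h. G x \<bullet> h)) (at x)" and cv: "continuous_on UNIV v" and cG:
      "continuous_on UNIV G"
    and sv: "sqint lebesgue v" and sG: "sqint lebesgue G"
  shows "weak_gradient v G"
  unfolding weak_gradient_def
proof (intro allI impI ballI)
  fix \<phi> :: "'a \<Rightarrow> real" and i :: 'a assume \<phi>: "test_function \<phi>" and i: "i \<in> Basis"
  let ?P = "\<lambda>x. v x *\<^sub>R tgrad \<phi> x + \<phi> x *\<^sub>R G x"
  note t = test_function_cbs[OF \<phi>] cbs_tgrad[OF \<phi>]
  obtain R1 R2 where R: "\<And>x. norm x > R1 \<Longrightarrow> \<phi> x = 0" "\<And>x. norm x > R2 \<Longrightarrow> tgrad \<phi> x = 0"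
    using t unfolding cbs_def by blast
  have "(LINT x|lebesgue. ?P x \<bullet> i) = 0"
  proof (rule integral_partial_derivative_eq_0)
    fix x
    have "((\<lambda>x. v x * \<phi> x) has_derivative (\<lambda>h. v x * (tgrad \<phi> x \<bullet> h) + (G x \<bullet> h) * \<phi> x)) (at x)"
      by (rule has_derivative_mult[OF v test_function_has_derivative[OF \<phi>]])
    then show "((\<lambda>x. v x * \<phi> x) has_derivative (\<lambda>h. ?P x \<bullet> h)) (at x)"
      by (simp add: inner_add_left mult.commute)
  next
    show "cbs (\<lambda>x. v x * \<phi> x)" unfolding cbs_def
      using t R(1) cv by (intro conjI exI[of _ R1] continuous_intros) (auto simp: cbs_def)
    show "cbs ?P" unfolding cbs_def
      using t R cv cG by (intro conjI exI[of _ "max R1 R2"] continuous_intros) (auto simp: cbs_def)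
  qed
  moreover have "(LINT x|lebesgue. ?P x \<bullet> i) = (LINT x|lebesgue. v x * frechet_derivative \<phi> (at x) i
      + (G x \<bullet> i) * \<phi> x)"
    by (intro Bochner_Integration.integral_cong) (auto simp: inner_add_left tgrad_inner_Basis[OF i])
  moreover have "\<dots> = (LINT x|lebesgue. v x * frechet_derivative \<phi> (at x) i)
      + (LINT x|lebesgue. (G x \<bullet> i) * \<phi> x)"
    by (intro Bochner_Integration.integral_add sqint_mult sv sqint_test_partial \<phi> i
        sqint_inner_const sG sqint_test)
  ultimately show "(LINT x|lebesgue. v x * frechet_derivative \<phi> (at x) i)
      = - (LINT x|lebesgue. (G x \<bullet> i) * \<phi> x)"
    by simp
qed

section \<open>Chain rule, truncation and product rule\<close>

text \<open>For the smooth approximations this is the classical chain rule. The Lipschitz bound on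
  \<open>F'\<close> makes the passage to the limit quantitative, so no almost everywhere convergent
  subsequence has to be chosen.\<close>

lemma weak_gradient_chain:
  fixes u :: "'a::euclidean_space \<Rightarrow> real"
  assumes u: "sqint lebesgue u" and g: "sqint lebesgue g" and ug: "weak_gradient u g"
    and F: "\<And>t. (F has_real_derivative F' t) (at t)" and F0: "F 0 = 0"
    and K: "\<And>t. \<bar>F' t\<bar> \<le> K" and \<Lambda>: "\<And>s t. \<bar>F' s - F' t\<bar> \<le> \<Lambda> * \<bar>s - t\<bar>"
  shows "weak_gradient (\<lambda>x. F (u x)) (\<lambda>x. F' (u x) *\<^sub>R g x)"
  unfolding weak_gradient_def
proof (intro allI impI ballI)
  fix \<phi> :: "'a \<Rightarrow> real" and i :: 'a assume \<phi>: "test_function \<phi>" and i: "i \<in> Basis"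
  obtain U G where U: "\<And>n::nat. \<And>x. (U n has_derivative (\<lambda>h. G n x \<bullet> h)) (at x)" and Gc:
      "\<And>n. continuous_on UNIV (G n)"
    and Uc: "\<And>n. continuous_on UNIV (U n)"
    and sU: "\<And>n. sqint lebesgue (U n)" and sG: "\<And>n. sqint lebesgue (G n)"
    and lU: "(\<lambda>n. l2n lebesgue (\<lambda>x. U n x - u x)) \<longlonglongrightarrow> 0" and lG:
        "(\<lambda>n. l2n lebesgue (\<lambda>x. G n x - g x)) \<longlonglongrightarrow> 0"
    using smooth_approx[OF u g ug] by blast
  have K0: "0 \<le> K" using K[of 0] by linarith
  have \<Lambda>0: "0 \<le> \<Lambda>" using order_trans[OF abs_ge_zero \<Lambda>[of 1 0]] by simp
  have Flip: "\<bar>F s - F t\<bar> \<le> K * \<bar>s - t\<bar>" for s t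
    using field_differentiable_bound[of UNIV F F' K s t] F K by simp
  have Fc: "continuous_on UNIV F" using F DERIV_isCont continuous_at_imp_continuous_on by blast
  have F'c: "continuous_on UNIV F'"
    by (rule lipschitz_on_continuous_on[OF lipschitz_onI[of UNIV F' \<Lambda>]]) (use \<Lambda> \<Lambda>0 in \<open>auto simp:
        dist_real_def\<close>)
  have [measurable]: "F \<in> borel_measurable borel" "F' \<in> borel_measurable borel"
    using Fc F'c by (auto intro: borel_measurable_continuous_onI)
  have sF: "sqint lebesgue (\<lambda>x. F (w x))" if "sqint lebesgue w" for w :: "'a \<Rightarrow> real"
    by (rule sqint_bound[OF that, where c=K]) (use Flip[of _ 0] F0 sqintD[OF that] in auto)
  have sF': "sqint lebesgue (\<lambda>x. F' (w x) *\<^sub>R k x)" if "sqint lebesgue w"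
      "sqint lebesgue k" for w and k :: "'a \<Rightarrow> 'a"
    by (rule sqint_bound[OF that(2), where c=K])
      (use K sqintD[OF that(1)] sqintD[OF that(2)] in \<open>auto intro!: mult_right_mono\<close>)
  obtain M where M: "M > 0" "\<And>x. norm (\<phi> x) \<le> M" using cbs_bounded[OF test_function_cbs[OF \<phi>]]
      by blast
  note s = sqint_test_partial[OF \<phi> i] and t = sqint_test[OF \<phi>]
  have wg: "weak_gradient (\<lambda>x. F (U n x)) (\<lambda>x. F' (U n x) *\<^sub>R G n x)" for n
  proof (rule weak_gradient_C1)
    fix x
    have "((\<lambda>x. F (U n x)) has_derivative (\<lambda>h. F' (U n x) * (G n x \<bullet> h))) (at x)"
      using has_derivative_compose[OF U F[unfolded has_field_derivative_def]] by blast
    then show "((\<lambda>x. F (U n x)) has_derivative (\<lambda>h. F' (U n x) *\<^sub>R G n x \<bullet> h)) (at x)" by simp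
  next
    show "continuous_on UNIV (\<lambda>x. F (U n x))" by (rule continuous_on_compose2[OF Fc Uc]) auto
    show "continuous_on UNIV (\<lambda>x. F' (U n x) *\<^sub>R G n x)"
      by (intro continuous_on_scaleR Gc continuous_on_compose2[OF F'c Uc]) auto
  qed (intro sF sF' sU sG)+
  have 1: "(\<lambda>n. LINT x|lebesgue. F (U n x) * frechet_derivative \<phi> (at x) i)
      \<longlonglongrightarrow> (LINT x|lebesgue. F (u x) * frechet_derivative \<phi> (at x) i)"
  proof -
    have "(\<lambda>n. l2n lebesgue (\<lambda>x. F (U n x) - F (u x))) \<longlonglongrightarrow> 0"
    proof (rule tendsto_sandwich[where f="\<lambda>_. 0"])
      have "l2n lebesgue (\<lambda>x. F (U n x) - F (u x)) \<le> l2n lebesgue (\<lambda>x. K *\<^sub>R (U n x - u x))" for n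
        by (rule l2n_mono[OF sqint_scaleR[OF sqint_diff[OF sU u]] sqintD[OF sqint_diff[OF sF[OF sU]
            sF[OF u]]] AE_I2])
          (use Flip K0 in \<open>auto simp: abs_mult\<close>)
      then show "\<forall>\<^sub>F n in sequentially. l2n lebesgue (\<lambda>x. F (U n x) - F (u x))
          \<le> K * l2n lebesgue (\<lambda>x. U n x - u x)"
        using K0 by (simp only: l2n_scaleR) simp
      show "(\<lambda>n. K * l2n lebesgue (\<lambda>x. U n x - u x)) \<longlonglongrightarrow> 0" using tendsto_mult_right_zero[OF lU] .
    qed auto
    from integral_inner_tendsto[OF sF[OF sU] sF[OF u] s this] show ?thesis by simp
  qed
  let ?I = "\<lambda>w k. LINT x|lebesgue. (F' (w x) *\<^sub>R k x \<bullet> i) * \<phi> x"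
  have 2: "(\<lambda>n. ?I (U n) (G n)) \<longlonglongrightarrow> ?I u g"
  proof (rule Lim_null[THEN iffD2], rule tendsto_rabs_zero_cancel, rule tendsto_sandwich[where
      f="\<lambda>_. 0"])
    let ?r = "\<lambda>n. K * (l2n lebesgue (\<lambda>x. G n x - g x) * l2n lebesgue \<phi>)
       + (\<Lambda> * M) * (l2n lebesgue (\<lambda>x. U n x - u x) * l2n lebesgue g)"
    have "?r \<longlonglongrightarrow> K * (0 * l2n lebesgue \<phi>) + (\<Lambda> * M) * (0 * l2n lebesgue g)"
      by (intro tendsto_intros lU lG)
    then show "?r \<longlonglongrightarrow> 0" by simp
    have "\<bar>?I (U n) (G n) - ?I u g\<bar> \<le> ?r n" for n
    proof -
      note i1 = sqint_mult[OF sqint_inner_const[OF sF'[OF sU sG]] t]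
      note i2 = sqint_mult[OF sqint_inner_const[OF sF'[OF u g]] t]
      note j1 = sqint_norm_mult[OF sqint_diff[OF sG g] t]
      note j2 = sqint_norm_mult[OF sqint_diff[OF sU u] g]
      have "?I (U n) (G n) - ?I u g
         = (LINT x|lebesgue. (F' (U n x) *\<^sub>R G n x \<bullet> i) * \<phi> x - (F' (u x) *\<^sub>R g x \<bullet> i) * \<phi> x)"
        by (rule Bochner_Integration.integral_diff[symmetric, OF i1 i2])
      also have "\<bar>\<dots>\<bar> \<le> (LINT x|lebesgue. \<bar>(F' (U n x) *\<^sub>R G n x \<bullet> i) * \<phi> x - (F' (u x) *\<^sub>R g x \<bullet> i)
          * \<phi> x\<bar>)"
        by (rule integral_abs_bound)
      also have "\<dots> \<le> (LINT x|lebesgue. K * (norm (G n x - g x) * norm (\<phi> x))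
          + (\<Lambda> * M) * (norm (U n x - u x) * norm (g x)))"
      proof (rule integral_mono)
        show "integrable lebesgue (\<lambda>x. \<bar>(F' (U n x) *\<^sub>R G n x \<bullet> i) * \<phi> x - (F' (u x) *\<^sub>R g x \<bullet> i) *
            \<phi> x\<bar>)"
          by (intro integrable_abs Bochner_Integration.integrable_diff i1 i2)
        show "integrable lebesgue (\<lambda>x. K * (norm (G n x - g x) * norm (\<phi> x))
          + (\<Lambda> * M) * (norm (U n x - u x) * norm (g x)))"
          by (intro Bochner_Integration.integrable_add integrable_mult_right j1 j2)
        fix x
        \<comment> \<open>The error splits into one part where the gradients differ and one where
          the arguments of \<open>F'\<close> differ; in the second the test function is bounded by
          \<open>M\<close>, which leaves a product of two L2 functions.\<close>
        have eq: "(F' (U n x) *\<^sub>R G n x \<bullet> i) * \<phi> x - (F' (u x) *\<^sub>R g x \<bullet> i) * \<phi> x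
          = F' (U n x) * (((G n x - g x) \<bullet> i) * \<phi> x) + (F' (U n x) - F' (u x)) * ((g x \<bullet> i) * \<phi> x)"
          by (simp add: algebra_simps)
        have ni: "\<bar>v \<bullet> i\<bar> \<le> norm v" for v using Cauchy_Schwarz_ineq2[of v i] i by simp
        have "\<bar>F' (U n x) * (((G n x - g x) \<bullet> i) * \<phi> x)\<bar> \<le> K * (norm (G n x - g x) * norm (\<phi> x))"
          unfolding abs_mult real_norm_def by (intro mult_mono K ni) (use K0 in auto)
        moreover have "\<bar>(F' (U n x) - F' (u x)) * ((g x \<bullet> i) * \<phi> x)\<bar>
            \<le> (\<Lambda> * \<bar>U n x - u x\<bar>) * (norm (g x) * M)"
          unfolding abs_mult by (intro mult_mono \<Lambda> ni) (use \<Lambda>0 M in auto)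
        ultimately show "\<bar>(F' (U n x) *\<^sub>R G n x \<bullet> i) * \<phi> x - (F' (u x) *\<^sub>R g x \<bullet> i) * \<phi> x\<bar>
          \<le> K * (norm (G n x - g x) * norm (\<phi> x)) + (\<Lambda> * M) * (norm (U n x - u x) * norm (g x))"
          unfolding eq by (simp add: mult_ac)
      qed
      also have "\<dots> = K * (LINT x|lebesgue. norm (G n x - g x) * norm (\<phi> x))
          + (\<Lambda> * M) * (LINT x|lebesgue. norm (U n x - u x) * norm (g x))"
        using j1 j2 by simp
      also have "\<dots> \<le> ?r n"
        using l2_cauchy_schwarz[OF sqint_diff[OF sG g] t] l2_cauchy_schwarz[OF sqint_diff[OF sU u]
            g] K0 \<Lambda>0 M(1)
        by (intro add_mono mult_left_mono) auto
      finally show ?thesis .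
    qed
    then show "\<forall>\<^sub>F n in sequentially. \<bar>?I (U n) (G n) - ?I u g\<bar> \<le> ?r n" by simp
  qed auto
  have "(\<lambda>n. LINT x|lebesgue. F (U n x) * frechet_derivative \<phi> (at x) i) \<longlonglongrightarrow> - ?I u g"
    using tendsto_minus[OF 2] weak_gradient_eqD[OF wg \<phi> i] by simp
  from LIMSEQ_unique[OF 1 this]
  show "(LINT x|lebesgue. F (u x) * frechet_derivative \<phi> (at x) i) = - ?I u g" .
qed

text \<open>Squaring removes the kink of the positive part; the regularisation in
  \<open>weak_gradient_excess\<close> is built on this.\<close>

lemma max_sq_has_derivative:
  "((\<lambda>t. (max (t - c) 0)\<^sup>2) has_real_derivative 2 * max (t - c) 0) (at (t::real))"
proof -
  consider "t > c" | "t < c" | "t = c" by linarith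
  then show ?thesis
  proof cases
    case 1
    have "((\<lambda>t. (t - c)\<^sup>2) has_real_derivative 2 * (t - c)) (at t)"
      by (auto intro!: derivative_eq_intros)
    then have "((\<lambda>t. (max (t - c) 0)\<^sup>2) has_real_derivative 2 * (t - c)) (at t)"
      by (rule has_field_derivative_transform_within_open[where S="{c<..}"]) (use 1 in auto)
    then show ?thesis using 1 by simp
  next
    case 2
    have "((\<lambda>t. 0) has_real_derivative 0) (at t)" by simp
    then have "((\<lambda>t. (max (t - c) 0)\<^sup>2) has_real_derivative 0) (at t)"
      by (rule has_field_derivative_transform_within_open[where S="{..<c}"]) (use 2 in auto)
    then show ?thesis using 2 by simp
  next
    case 3
    have "((\<lambda>h. ((max (t + h - c) 0)\<^sup>2 - (max (t - c) 0)\<^sup>2) / h) \<longlongrightarrow> 0) (at 0)"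
    proof (rule Lim_null_comparison)
      show "\<forall>\<^sub>F h in at 0. norm (((max (t + h - c) 0)\<^sup>2 - (max (t - c) 0)\<^sup>2) / h) \<le> \<bar>h\<bar>"
        by (rule always_eventually) (auto simp: 3 max_def power2_eq_square)
      show "((\<lambda>h::real. \<bar>h\<bar>) \<longlongrightarrow> 0) (at 0)" using tendsto_rabs_zero[OF tendsto_ident_at] .
    qed
    then show ?thesis using 3 by (simp add: DERIV_def)
  qed
qed

lemma sqrt_sq_add_lipschitz:
  fixes a b d :: real
  assumes "d > 0"
  shows "\<bar>sqrt (a\<^sup>2 + d\<^sup>2) - sqrt (b\<^sup>2 + d\<^sup>2)\<bar> \<le> \<bar>a - b\<bar>"
proof -
  let ?A = "sqrt (a\<^sup>2 + d\<^sup>2)" and ?B = "sqrt (b\<^sup>2 + d\<^sup>2)"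
  have A: "\<bar>a\<bar> \<le> ?A" "\<bar>b\<bar> \<le> ?B" by (auto intro!: real_le_rsqrt)
  have p: "?A > 0" "?B > 0" using assms by (auto intro!: add_nonneg_pos)
  have "\<bar>?A - ?B\<bar> * (?A + ?B) = \<bar>(?A - ?B) * (?A + ?B)\<bar>" using p by (simp add: abs_mult)
  also have "(?A - ?B) * (?A + ?B) = (a - b) * (a + b)"
    by (simp add: algebra_simps flip: power2_eq_square)
  also have "\<bar>(a - b) * (a + b)\<bar> \<le> \<bar>a - b\<bar> * (?A + ?B)"
    unfolding abs_mult using A by (intro mult_left_mono order_trans[OF abs_triangle_ineq] add_mono)
        auto
  finally show ?thesis using p by simp
qed

text \<open>The positive part \<open>S\<close> of \<open>t - c\<close> is replaced by
  \<open>sqrt (S^2 + d^2) - d\<close>, whose derivative is bounded by 1 and Lipschitz with constant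
  \<open>2/d\<close>, so that the chain rule applies. As \<open>d\<close> tends to 0, the derivative
  tends to the indicator of \<open>t > c\<close>; at \<open>t = c\<close> it is 0 for every
  \<open>d\<close>, which explains the strict inequality. Since \<open>c \<ge> 0\<close>, the
  regularised function vanishes at 0.\<close>

lemma weak_gradient_excess:
  fixes u :: "'a::euclidean_space \<Rightarrow> real"
  assumes u: "sqint lebesgue u" and g: "sqint lebesgue g" and ug: "weak_gradient u g" and c: "c \<ge> 0"
  shows "weak_gradient (\<lambda>x. max (u x - c) 0) (\<lambda>x. indicator {x. u x > c} x *\<^sub>R g x)"
  unfolding weak_gradient_def
proof (intro allI impI ballI)
  fix \<phi> :: "'a \<Rightarrow> real" and i :: 'a assume \<phi>: "test_function \<phi>" and i: "i \<in> Basis"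
  have [measurable]: "u \<in> borel_measurable lebesgue" "g \<in> borel_measurable lebesgue"
    using u g by (auto dest: sqintD)
  note s = sqint_test_partial[OF \<phi> i] and t = sqint_test[OF \<phi>]
  have [measurable]: "\<phi> \<in> borel_measurable lebesgue"
      "(\<lambda>x. frechet_derivative \<phi> (at x) i) \<in> borel_measurable lebesgue"
    using s t by (auto dest: sqintD)
  define d where "d n = 1 / real (Suc n)" for n
  have d0: "d n > 0" for n by (simp add: d_def)
  have dl: "d \<longlonglongrightarrow> 0" unfolding d_def by (rule LIMSEQ_Suc[OF lim_1_over_n])
  define S where "S t = max (t - c) 0" for t
  define F where "F n t = sqrt ((S t)\<^sup>2 + (d n)\<^sup>2) - d n" for n t
  define F' where "F' n t = S t / sqrt ((S t)\<^sup>2 + (d n)\<^sup>2)" for n t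
  have Q: "sqrt ((S t)\<^sup>2 + (d n)\<^sup>2) > 0" "S t \<le> sqrt ((S t)\<^sup>2 + (d n)\<^sup>2)"
      "d n \<le> sqrt ((S t)\<^sup>2 + (d n)\<^sup>2)" for t n
    using d0[of n] by (auto intro!: add_nonneg_pos real_le_rsqrt)
  have S0: "0 \<le> S t" for t by (simp add: S_def)
  have F01: "0 \<le> F' n t" "F' n t \<le> 1" for n t
    using Q(1)[of t n] Q(2)[of t n] S0[of t] by (simp_all add: F'_def)
  have wg: "weak_gradient (\<lambda>x. F n (u x)) (\<lambda>x. F' n (u x) *\<^sub>R g x)" for n
  proof (rule weak_gradient_chain[OF u g ug, where K=1 and \<Lambda>="2 / d n"])
    fix t
    have "((\<lambda>t. (S t)\<^sup>2 + (d n)\<^sup>2) has_real_derivative 2 * S t) (at t)"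
      using DERIV_add[OF max_sq_has_derivative[of c t] DERIV_const[of "(d n)\<^sup>2"]]
          by (simp add: S_def)
    moreover have "(S t)\<^sup>2 + (d n)\<^sup>2 > 0" using d0[of n] by (simp add: add_nonneg_pos)
    ultimately have "((\<lambda>t. sqrt ((S t)\<^sup>2 + (d n)\<^sup>2)) has_real_derivative (inverse (sqrt ((S t)\<^sup>2
        + (d n)\<^sup>2)) / 2) * (2 * S t)) (at t)"
      by (intro DERIV_chain2[OF DERIV_real_sqrt])
    then have "((\<lambda>t. sqrt ((S t)\<^sup>2 + (d n)\<^sup>2) - d n) has_real_derivative (inverse (sqrt ((S t)\<^sup>2
        + (d n)\<^sup>2)) / 2) * (2 * S t) - 0) (at t)"
      by (intro DERIV_diff DERIV_const)
    moreover have "F n = (\<lambda>t. sqrt ((S t)\<^sup>2 + (d n)\<^sup>2) - d n)" by (rule ext) (simp add: F_def)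
    moreover have "F' n t = (inverse (sqrt ((S t)\<^sup>2 + (d n)\<^sup>2)) / 2) * (2 * S t) - 0"
    proof -
      have "s / q = (inverse q / 2) * (2 * s) - 0" for s q :: real by (simp add: inverse_eq_divide)
      then show ?thesis unfolding F'_def .
    qed
    ultimately show "(F n has_real_derivative F' n t) (at t)" by (simp only:)
  next
    show "F n 0 = 0" using c d0[of n] by (simp add: F_def S_def)
    show "\<bar>F' n t\<bar> \<le> 1" for t using F01[of n t] by simp
    fix a b
    let ?A = "sqrt ((S a)\<^sup>2 + (d n)\<^sup>2)" and ?B = "sqrt ((S b)\<^sup>2 + (d n)\<^sup>2)"
    \<comment> \<open>Numerators and denominators are compared separately; each part contributes
      \<open>1 / d n\<close> to the Lipschitz constant.\<close>
    have eq: "F' n a - F' n b = (S a - S b) / ?A + F' n b * ((?B - ?A) / ?A)"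
    proof -
      have "s / A - r / B = (s - r) / A + (r / B) * ((B - A) / A)" if "A > 0"
          "B > 0" for s r A B :: real
        using that by (simp add: field_simps)
      from this[OF Q(1) Q(1)] show ?thesis unfolding F'_def .
    qed
    have Sab: "\<bar>S a - S b\<bar> \<le> \<bar>a - b\<bar>" by (auto simp: S_def max_def)
    have BA: "\<bar>?B - ?A\<bar> \<le> \<bar>a - b\<bar>"
      using sqrt_sq_add_lipschitz[OF d0[of n], of "S b" "S a"] Sab by linarith
    have div: "\<bar>y / ?A\<bar> \<le> \<bar>a - b\<bar> / d n" if "\<bar>y\<bar> \<le> \<bar>a - b\<bar>" for y
      using Q(1)[of a n] Q(3)[of n a] that d0[of n] by (simp add: abs_divide frac_le)
    have "\<bar>F' n b * ((?B - ?A) / ?A)\<bar> \<le> 1 * (\<bar>a - b\<bar> / d n)"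
      unfolding abs_mult using F01[of n b] by (intro mult_mono div BA) auto
    with div[OF Sab] have "\<bar>F' n a - F' n b\<bar> \<le> \<bar>a - b\<bar> / d n + \<bar>a - b\<bar> / d n"
      unfolding eq by (intro order_trans[OF abs_triangle_ineq add_mono]) simp_all
    then show "\<bar>F' n a - F' n b\<bar> \<le> 2 / d n * \<bar>a - b\<bar>" by simp
  qed
  have ql: "(\<lambda>n. sqrt ((S t)\<^sup>2 + (d n)\<^sup>2)) \<longlonglongrightarrow> S t" for t
  proof -
    have "(\<lambda>n. sqrt ((S t)\<^sup>2 + (d n)\<^sup>2)) \<longlonglongrightarrow> sqrt ((S t)\<^sup>2 + 0\<^sup>2)" by (intro tendsto_intros dl)
    then show ?thesis using S0[of t] by simp
  qed
  have [measurable]: "S \<in> borel_measurable borel" unfolding S_def by measurable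
  have [measurable]: "F n \<in> borel_measurable borel" "F' n \<in> borel_measurable borel" for n
    unfolding F_def F'_def by measurable
  have 1: "(\<lambda>n. LINT x|lebesgue. F n (u x) * frechet_derivative \<phi> (at x) i)
      \<longlonglongrightarrow> (LINT x|lebesgue. S (u x) * frechet_derivative \<phi> (at x) i)"
  proof (rule integral_dominated_convergence[OF _ _ sqint_norm_mult[OF u s]])
    show "AE x in lebesgue. (\<lambda>n. F n (u x) * frechet_derivative \<phi> (at x) i)
        \<longlonglongrightarrow> S (u x) * frechet_derivative \<phi> (at x) i"
    proof (rule AE_I2)
      fix x
      have "(\<lambda>n. F n (u x)) \<longlonglongrightarrow> S (u x) - 0" unfolding F_def by (intro tendsto_diff ql dl)
      then show "(\<lambda>n. F n (u x) * frechet_derivative \<phi> (at x) i)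
          \<longlonglongrightarrow> S (u x) * frechet_derivative \<phi> (at x) i"
        by (intro tendsto_mult tendsto_const) simp
    qed
    have "\<bar>F n r\<bar> \<le> \<bar>r\<bar>" for n r
    proof -
      have "F n r \<ge> 0" using Q(3)[of n r] by (simp add: F_def)
      moreover have "sqrt ((S r)\<^sup>2 + (d n)\<^sup>2) \<le> S r + d n"
        using S0[of r] d0[of n] by (intro real_le_lsqrt) (auto simp: power2_sum)
      moreover have "S r \<le> \<bar>r\<bar>" using c by (auto simp: S_def)
      ultimately show ?thesis by (simp add: F_def)
    qed
    then show "AE x in lebesgue. norm (F n (u x) * frechet_derivative \<phi> (at x) i)
        \<le> norm (u x) * norm (frechet_derivative \<phi> (at x) i)" for n
      by (intro AE_I2) (auto simp: abs_mult intro: mult_right_mono)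
  qed measurable
  have 2: "(\<lambda>n. LINT x|lebesgue. (F' n (u x) *\<^sub>R g x \<bullet> i) * \<phi> x)
      \<longlonglongrightarrow> (LINT x|lebesgue. (indicator {x. u x > c} x *\<^sub>R g x \<bullet> i) * \<phi> x)"
  proof (rule integral_dominated_convergence[OF _ _ sqint_norm_mult[OF g t]])
    show "AE x in lebesgue. (\<lambda>n. (F' n (u x) *\<^sub>R g x \<bullet> i) * \<phi> x)
        \<longlonglongrightarrow> (indicator {x. u x > c} x *\<^sub>R g x \<bullet> i) * \<phi> x"
    proof (rule AE_I2)
      fix x
      have "(\<lambda>n. F' n (u x)) \<longlonglongrightarrow> (indicator {x. u x > c} x :: real)"
      proof (cases "u x > c")
        case True
        then have "S (u x) > 0" by (simp add: S_def)
        then have "(\<lambda>n. F' n (u x)) \<longlonglongrightarrow> S (u x) / S (u x)" unfolding F'_def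
            by (intro tendsto_intros ql) auto
        then show ?thesis using \<open>S (u x) > 0\<close> True by simp
      next
        case False
        then show ?thesis by (simp add: F'_def S_def)
      qed
      then show "(\<lambda>n. (F' n (u x) *\<^sub>R g x \<bullet> i) * \<phi> x)
          \<longlonglongrightarrow> (indicator {x. u x > c} x *\<^sub>R g x \<bullet> i) * \<phi> x"
        by (intro tendsto_mult tendsto_inner tendsto_scaleR tendsto_const)
    qed
    show "AE x in lebesgue. norm ((F' n (u x) *\<^sub>R g x \<bullet> i) * \<phi> x) \<le> norm (g x) * norm (\<phi> x)" for n
    proof (rule AE_I2)
      fix x
      have "\<bar>F' n (u x)\<bar> * \<bar>g x \<bullet> i\<bar> \<le> 1 * norm (g x)"
        using F01[of n "u x"] Cauchy_Schwarz_ineq2[of "g x" i] i by (intro mult_mono) auto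
      then show "norm ((F' n (u x) *\<^sub>R g x \<bullet> i) * \<phi> x) \<le> norm (g x) * norm (\<phi> x)"
        by (simp add: abs_mult mult_right_mono)
    qed
  qed measurable
  have "(\<lambda>n. LINT x|lebesgue. F n (u x) * frechet_derivative \<phi> (at x) i)
     \<longlonglongrightarrow> - (LINT x|lebesgue. (indicator {x. u x > c} x *\<^sub>R g x \<bullet> i) * \<phi> x)"
    using tendsto_minus[OF 2] weak_gradient_eqD[OF wg \<phi> i] by simp
  from LIMSEQ_unique[OF 1 this]
  show "(LINT x|lebesgue. max (u x - c) 0 * frechet_derivative \<phi> (at x) i)
     = - (LINT x|lebesgue. (indicator {x. u x > c} x *\<^sub>R g x \<bullet> i) * \<phi> x)" by (simp add: S_def)
qed

lemma sqint_mult_cbs: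
  fixes u :: "'a::euclidean_space \<Rightarrow> real"
  assumes \<eta>: "cbs \<eta>" and u: "sqint lebesgue u"
  shows "sqint lebesgue (\<lambda>x. u x *\<^sub>R \<eta> x :: 'b::euclidean_space)"
proof -
  obtain M where M: "M > 0" "\<And>x. norm (\<eta> x) \<le> M" using cbs_bounded[OF \<eta>] by blast
  have "norm (u x *\<^sub>R \<eta> x) \<le> M * norm (u x)" for x
    using mult_left_mono[OF M(2)[of x], of "\<bar>u x\<bar>"] by (simp add: mult.commute)
  then show ?thesis
    using sqintD[OF u] sqintD[OF cbs_sqint[OF \<eta>]] by (intro sqint_bound[OF u, where c=M]) auto
qed

lemma sqint_cbs_mult:
  fixes \<eta> :: "'a::euclidean_space \<Rightarrow> real"
  assumes \<eta>: "cbs \<eta>" and u: "sqint lebesgue u"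
  shows "sqint lebesgue (\<lambda>x. \<eta> x *\<^sub>R u x :: 'b::euclidean_space)"
proof -
  obtain M where M: "M > 0" "\<And>x. norm (\<eta> x) \<le> M" using cbs_bounded[OF \<eta>] by blast
  have "norm (\<eta> x *\<^sub>R u x) \<le> M * norm (u x)" for x
    using mult_right_mono[OF M(2)[of x], of "norm (u x)"] by simp
  then show ?thesis
    using sqintD[OF u] sqintD[OF cbs_sqint[OF \<eta>]] by (intro sqint_bound[OF u, where c=M]) auto
qed

text \<open>The product of \<open>\<eta>\<close> and a test function is again a test function, and
  the weak identity for it contains the product rule.\<close>

lemma weak_gradient_test_mult:
  fixes u :: "'a::euclidean_space \<Rightarrow> real"
  assumes u: "sqint lebesgue u" and g: "sqint lebesgue g" and ug: "weak_gradient u g" and \<eta>: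
      "test_function \<eta>"
  shows "weak_gradient (\<lambda>x. \<eta> x * u x) (\<lambda>x. \<eta> x *\<^sub>R g x + u x *\<^sub>R tgrad \<eta> x)"
  unfolding weak_gradient_def
proof (intro allI impI ballI)
  fix \<phi> :: "'a \<Rightarrow> real" and i :: 'a assume \<phi>: "test_function \<phi>" and i: "i \<in> Basis"
  let ?d = "\<lambda>\<phi> x. frechet_derivative \<phi> (at x) i"
  note t\<eta> = test_function_cbs[OF \<eta>] and tg\<eta> = cbs_tgrad[OF \<eta>]
  have "((\<lambda>x. \<eta> x * \<phi> x) has_derivative (\<lambda>h. \<eta> x * (tgrad \<phi> x \<bullet> h)
      + (tgrad \<eta> x \<bullet> h) * \<phi> x)) (at x)" for x
    by (intro has_derivative_mult test_function_has_derivative \<eta> \<phi>)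
  from frechet_derivative_at[OF this]
  have eq: "?d (\<lambda>x. \<eta> x * \<phi> x) x = \<eta> x * ?d \<phi> x + ?d \<eta> x * \<phi> x" for x
    by (metis tgrad_inner_Basis[OF i])
  have s1: "sqint lebesgue (\<lambda>x. \<eta> x * u x)" using sqint_cbs_mult[OF t\<eta> u] by simp
  have s2: "sqint lebesgue (\<lambda>x. u x *\<^sub>R tgrad \<eta> x)" by (rule sqint_mult_cbs[OF tg\<eta> u])
  have s3: "sqint lebesgue (\<lambda>x. \<eta> x *\<^sub>R g x)" by (rule sqint_cbs_mult[OF t\<eta> g])
  note t = sqint_test[OF \<phi>]
  have m: "(\<lambda>x. (u x *\<^sub>R tgrad \<eta> x \<bullet> i) * \<phi> x) = (\<lambda>x. u x * (?d \<eta> x * \<phi> x))"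
    by (simp add: tgrad_inner_Basis[OF i] mult_ac)
  have "(LINT x|lebesgue. u x * ?d (\<lambda>x. \<eta> x * \<phi> x) x)
     = (LINT x|lebesgue. (\<eta> x * u x) * ?d \<phi> x + (u x *\<^sub>R tgrad \<eta> x \<bullet> i) * \<phi> x)"
    by (intro Bochner_Integration.integral_cong) (auto simp: eq tgrad_inner_Basis[OF i]
        algebra_simps)
  also have "\<dots> = (LINT x|lebesgue. (\<eta> x * u x) * ?d \<phi> x)
      + (LINT x|lebesgue. (u x *\<^sub>R tgrad \<eta> x \<bullet> i) * \<phi> x)"
    by (intro Bochner_Integration.integral_add sqint_mult s1 sqint_test_partial \<phi> i
        sqint_inner_const s2 t)
  finally have "(LINT x|lebesgue. (\<eta> x * u x) * ?d \<phi> x)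
     = - ((LINT x|lebesgue. (g x \<bullet> i) * (\<eta> x * \<phi> x))
         + (LINT x|lebesgue. (u x *\<^sub>R tgrad \<eta> x \<bullet> i) * \<phi> x))"
    using weak_gradient_eqD[OF ug test_function_mult[OF \<eta> \<phi>] i] by simp
  also have "(LINT x|lebesgue. (g x \<bullet> i) * (\<eta> x * \<phi> x))
      = (LINT x|lebesgue. (\<eta> x *\<^sub>R g x \<bullet> i) * \<phi> x)"
    by (intro Bochner_Integration.integral_cong) (auto simp: mult_ac)
  also have "\<dots> + (LINT x|lebesgue. (u x *\<^sub>R tgrad \<eta> x \<bullet> i) * \<phi> x)
     = (LINT x|lebesgue. (\<eta> x *\<^sub>R g x \<bullet> i) * \<phi> x + (u x *\<^sub>R tgrad \<eta> x \<bullet> i) * \<phi> x)"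
    by (intro Bochner_Integration.integral_add[symmetric] sqint_mult sqint_inner_const s2 s3 t)
  also have "\<dots> = (LINT x|lebesgue. ((\<eta> x *\<^sub>R g x + u x *\<^sub>R tgrad \<eta> x) \<bullet> i) * \<phi> x)"
    by (intro Bochner_Integration.integral_cong) (auto simp: algebra_simps)
  finally show "(LINT x|lebesgue. (\<eta> x * u x) * ?d \<phi> x)
     = - (LINT x|lebesgue. ((\<eta> x *\<^sub>R g x + u x *\<^sub>R tgrad \<eta> x) \<bullet> i) * \<phi> x)" .
qed

section \<open>The Sobolev space\<close>

lemma H1I:
  assumes "sqint lebesgue u" "sqint lebesgue g" "weak_gradient u g"
  shows "u \<in> H1"
  using assms by (auto simp: H1_def L2_iff)

lemma H1D:
  assumes "u \<in> H1"
  shows "sqint lebesgue u" "sqint lebesgue (grad u)" "weak_gradient u (grad u)"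
proof -
  have "\<exists>g. g \<in> L2 \<and> weak_gradient u g" using assms by (auto simp: H1_def)
  from someI_ex[OF this] show "sqint lebesgue (grad u)" "weak_gradient u (grad u)"
    by (auto simp: grad_def L2_iff)
  show "sqint lebesgue u" using assms by (simp add: H1_def L2_iff)
qed

text \<open>\<open>grad\<close> is an arbitrary choice; this identifies it with any weak gradient
  found by construction.\<close>

lemma grad_AE:
  assumes "sqint lebesgue u" "sqint lebesgue g" "weak_gradient u g"
  shows "AE x in lebesgue. grad u x = g x"
  using weak_gradient_unique H1D(2,3)[OF H1I[OF assms]] assms(2,3) by blast

definition H1_form :: "('a::euclidean_space \<Rightarrow> real) \<Rightarrow> ('a \<Rightarrow> real) \<Rightarrow> real" where
  "H1_form u v = (LINT x|lebesgue. grad u x \<bullet> grad v x + u x * v x)"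

lemma H1_form_integrable:
  assumes "u \<in> H1" "v \<in> H1"
  shows "integrable lebesgue (\<lambda>x. grad u x \<bullet> grad v x + u x * v x)"
  using assms by (intro Bochner_Integration.integrable_add sqint_inner sqint_mult H1D)

lemma H1_lincomb:
  assumes u: "u \<in> H1" and v: "v \<in> H1"
  shows "(\<lambda>x. u x + c * v x) \<in> H1" "AE x in lebesgue. grad (\<lambda>x. u x + c * v x) x = grad u x
      + c *\<^sub>R grad v x"
proof -
  have su: "sqint lebesgue (\<lambda>x. u x + c * v x)"
    using sqint_add[OF H1D(1)[OF u] sqint_scaleR[OF H1D(1)[OF v], of c]] by simp
  have sg: "sqint lebesgue (\<lambda>x. grad u x + c *\<^sub>R grad v x)"
    by (intro sqint_add sqint_scaleR H1D u v)
  have w: "weak_gradient (\<lambda>x. u x + c * v x) (\<lambda>x. grad u x + c *\<^sub>R grad v x)"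
    by (intro weak_gradient_lincomb H1D u v)
  show "(\<lambda>x. u x + c * v x) \<in> H1" by (rule H1I[OF su sg w])
  show "AE x in lebesgue. grad (\<lambda>x. u x + c * v x) x = grad u x + c *\<^sub>R grad v x"
    by (rule grad_AE[OF su sg w])
qed

lemma H1_diff_grad:
  assumes u: "u \<in> H1" and v: "v \<in> H1"
  shows "AE x in lebesgue. grad (\<lambda>x. u x - v x) x = grad u x - grad v x"
  using H1_lincomb(2)[OF u v, of "-1"] by simp

lemma H1_zero: "(\<lambda>x. 0) \<in> H1"
  by (rule H1I[of _ "\<lambda>x. 0"]) (auto simp: weak_gradient_def)

text \<open>Linearity of the form does not hold pointwise under the integral: \<open>grad\<close> is
  chosen separately for every function and is linear only almost everywhere.\<close>

interpretation h1: prehilbert "H1 :: ('a::euclidean_space \<Rightarrow> real) set" H1_form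
proof
  fix u v w :: "'a \<Rightarrow> real" and c :: real
  show "(\<lambda>x. 0::real) \<in> H1" by (rule H1_zero)
  assume u: "u \<in> H1"
  show "0 \<le> H1_form u u" unfolding H1_form_def by (rule Bochner_Integration.integral_nonneg) simp
  assume v: "v \<in> H1"
  show "(\<lambda>x. u x + c * v x) \<in> H1" by (rule H1_lincomb[OF u v])
  show "H1_form u v = H1_form v u" unfolding H1_form_def by (simp add: inner_commute mult.commute)
  assume w: "w \<in> H1"
  let ?z = "\<lambda>x. u x + c * v x"
  have "H1_form ?z w = (LINT x|lebesgue. (grad u x \<bullet> grad w x + u x * w x)
      + c * (grad v x \<bullet> grad w x + v x * w x))"
    unfolding H1_form_def
  proof (rule integral_cong_AE)
    show "(\<lambda>x. grad ?z x \<bullet> grad w x + ?z x * w x) \<in> borel_measurable lebesgue"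
      using H1_form_integrable[OF H1_lincomb(1)[OF u v] w] by (rule borel_measurable_integrable)
    show "(\<lambda>x. (grad u x \<bullet> grad w x + u x * w x) + c * (grad v x \<bullet> grad w x
        + v x * w x)) \<in> borel_measurable lebesgue"
      using H1_form_integrable[OF u w] H1_form_integrable[OF v w] by measurable
    show "AE x in lebesgue. grad ?z x \<bullet> grad w x + ?z x * w x
       = (grad u x \<bullet> grad w x + u x * w x) + c * (grad v x \<bullet> grad w x + v x * w x)"
      using H1_lincomb(2)[OF u v, of c] by eventually_elim (simp add: algebra_simps)
  qed
  also have "\<dots> = H1_form u w + c * H1_form v w"
    using H1_form_integrable[OF u w] H1_form_integrable[OF v w] by (simp add: H1_form_def)
  finally show "H1_form ?z w = H1_form u w + c * H1_form v w" .
qed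

lemma H1_form_l2n:
  assumes u: "u \<in> H1"
  shows "H1_form u u = (l2n lebesgue (grad u))\<^sup>2 + (l2n lebesgue u)\<^sup>2"
proof -
  have "H1_form u u = (LINT x|lebesgue. (norm (grad u x))\<^sup>2 + (norm (u x))\<^sup>2)"
    unfolding H1_form_def by (simp add: dot_square_norm flip: power2_eq_square)
  also have "\<dots> = (l2n lebesgue (grad u))\<^sup>2 + (l2n lebesgue u)\<^sup>2"
    unfolding l2n_sq by (intro Bochner_Integration.integral_add sqint_int H1D u)
  finally show ?thesis .
qed

lemma H1_energy_eq: "u \<in> H1 \<Longrightarrow> H1_energy u = ennreal ((h1.nrm u)\<^sup>2)"
proof -
  assume u: "u \<in> H1"
  have "H1_energy u = (\<integral>\<^sup>+x. ennreal (grad u x \<bullet> grad u x + u x * u x) \<partial>lebesgue)"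
    unfolding H1_energy_def by (simp only: dot_square_norm power2_eq_square[of "u _"])
  also have "\<dots> = ennreal (H1_form u u)"
    unfolding H1_form_def by (rule nn_integral_eq_integral[OF H1_form_integrable[OF u u]]) auto
  finally show ?thesis using u by (simp add: h1.nrm_sq)
qed

lemma l2n_le_h1: "u \<in> H1 \<Longrightarrow> l2n lebesgue u \<le> h1.nrm u"
  by (rule power2_le_imp_le) (auto simp: h1.nrm_sq H1_form_l2n)

lemma l2n_grad_le_h1: "u \<in> H1 \<Longrightarrow> l2n lebesgue (grad u) \<le> h1.nrm u"
  by (rule power2_le_imp_le) (auto simp: h1.nrm_sq H1_form_l2n)

lemma h1_nrm_le: "u \<in> H1 \<Longrightarrow> h1.nrm u \<le> l2n lebesgue (grad u) + l2n lebesgue u"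
  by (rule power2_le_imp_le) (auto simp: h1.nrm_sq H1_form_l2n power2_sum)

lemma H1_cong_AE:
  assumes u: "u \<in> H1" and v: "v \<in> borel_measurable lebesgue" and uv: "AE x in lebesgue. u x = v x"
  shows "v \<in> H1" "AE x in lebesgue. grad v x = grad u x" "h1.nrm (\<lambda>x. u x - v x) = 0"
proof -
  have sv: "sqint lebesgue v" by (rule sqint_cong_AE[OF _ v H1D(1)[OF u]]) (use uv in \<open>auto elim!:
      eventually_mono\<close>)
  have w: "weak_gradient v (grad u)"
    by (rule weak_gradient_cong_AE[OF H1D(3)[OF u] H1D(1)[OF u] sv H1D(2)[OF u] H1D(2)[OF u] uv])
        simp
  show vH: "v \<in> H1" by (rule H1I[OF sv H1D(2)[OF u] w])
  show gv: "AE x in lebesgue. grad v x = grad u x" by (rule grad_AE[OF sv H1D(2)[OF u] w])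
  have d: "(\<lambda>x. u x - v x) \<in> H1" by (rule h1.diff_mem[OF u vH])
  have "l2n lebesgue (\<lambda>x. u x - v x) = l2n lebesgue (\<lambda>x::'a. 0::real)"
    by (rule l2n_cong_AE) (use uv H1D(1)[OF d] sqintD in \<open>auto elim!: eventually_mono\<close>)
  moreover have "l2n lebesgue (grad (\<lambda>x. u x - v x)) = l2n lebesgue (\<lambda>x::'a. 0::'a)"
  proof (rule l2n_cong_AE)
    show "AE x in lebesgue. grad (\<lambda>x. u x - v x) x = 0"
      using H1_diff_grad[OF u vH] gv by eventually_elim simp
  qed (use H1D(2)[OF d] sqintD in auto)
  ultimately have "h1.nrm (\<lambda>x. u x - v x) \<le> 0" using h1_nrm_le[OF d] by (simp add: l2n_def)
  then show "h1.nrm (\<lambda>x. u x - v x) = 0" using h1.nrm_nonneg[OF d] by linarith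
qed

text \<open>The functions and their gradients converge separately in L2, and weak gradients are
  closed under this convergence.\<close>

lemma H1_complete:
  assumes "h1.cauchy s"
  shows "\<exists>u\<in>H1. (\<lambda>n. h1.nrm (\<lambda>x. s n x - u x)) \<longlonglongrightarrow> 0"
proof -
  have s: "s n \<in> H1" for n using assms by (simp add: h1.cauchy_def)
  note d = h1.diff_mem[OF s s]
  have cau: "\<exists>N. \<forall>m\<ge>N. \<forall>n\<ge>N. h1.nrm (\<lambda>x. s m x - s n x) < e" if "e > 0" for e
    using assms that by (simp add: h1.cauchy_def)
  have g1: "l2n lebesgue (\<lambda>x. grad (s m) x - grad (s n) x) \<le> h1.nrm (\<lambda>x. s m x - s n x)" for m n
  proof -
    have "l2n lebesgue (\<lambda>x. grad (s m) x - grad (s n) x) = l2n lebesgue (grad (\<lambda>x. s m x - s n x))"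
      by (rule l2n_cong_AE)
        (use H1_diff_grad[OF s s, of m n] sqintD[OF sqint_diff[OF H1D(2)[OF s] H1D(2)[OF s]]]
            sqintD[OF H1D(2)[OF d]]
         in \<open>auto elim!: eventually_mono\<close>)
    then show ?thesis using l2n_grad_le_h1[OF d] by simp
  qed
  have "\<exists>u. sqint lebesgue u \<and> (\<lambda>n. l2n lebesgue (\<lambda>x. s n x - u x)) \<longlonglongrightarrow> 0"
    by (rule L2_complete[OF H1D(1)[OF s]]) (use cau l2n_le_h1[OF d] le_less_trans in meson)
  then obtain u where u: "sqint lebesgue u" and lu: "(\<lambda>n. l2n lebesgue (\<lambda>x. s n x - u x)) \<longlonglongrightarrow> 0"
      by blast
  have "\<exists>u. sqint lebesgue u \<and> (\<lambda>n. l2n lebesgue (\<lambda>x. grad (s n) x - u x)) \<longlonglongrightarrow> 0"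
    by (rule L2_complete[OF H1D(2)[OF s]]) (use cau g1 le_less_trans in meson)
  then obtain g where g: "sqint lebesgue g" and lg:
      "(\<lambda>n. l2n lebesgue (\<lambda>x. grad (s n) x - g x)) \<longlonglongrightarrow> 0" by blast
  have w: "weak_gradient u g" by (rule weak_gradient_limit[OF H1D(3)[OF s] H1D(1)[OF s] H1D(2)[OF s]
      u g lu lg])
  have uH: "u \<in> H1" by (rule H1I[OF u g w])
  have "(\<lambda>n. h1.nrm (\<lambda>x. s n x - u x)) \<longlonglongrightarrow> 0"
  proof (rule tendsto_sandwich[where f="\<lambda>_. 0"])
    have "h1.nrm (\<lambda>x. s n x - u x) \<le> l2n lebesgue (\<lambda>x. grad (s n) x - g x)
        + l2n lebesgue (\<lambda>x. s n x - u x)" for n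
    proof -
      have d: "(\<lambda>x. s n x - u x) \<in> H1" by (rule h1.diff_mem[OF s uH])
      have "AE x in lebesgue. grad (\<lambda>x. s n x - u x) x = grad (s n) x - g x"
        using H1_diff_grad[OF s uH, of n] grad_AE[OF u g w] by eventually_elim simp
      then have "l2n lebesgue (grad (\<lambda>x. s n x - u x)) = l2n lebesgue (\<lambda>x. grad (s n) x - g x)"
        by (rule l2n_cong_AE) (use sqintD[OF sqint_diff[OF H1D(2)[OF s] g]] sqintD[OF H1D(2)[OF d]]
            in auto)
      then show ?thesis using h1_nrm_le[OF d] by simp
    qed
    then show "\<forall>\<^sub>F n in sequentially. h1.nrm (\<lambda>x. s n x - u x)
        \<le> l2n lebesgue (\<lambda>x. grad (s n) x - g x) + l2n lebesgue (\<lambda>x. s n x - u x)"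
      by simp
    show "(\<lambda>n. l2n lebesgue (\<lambda>x. grad (s n) x - g x) + l2n lebesgue (\<lambda>x. s n x - u x)) \<longlonglongrightarrow> 0"
      using tendsto_add[OF lg lu] by simp
    show "\<forall>\<^sub>F n in sequentially. 0 \<le> h1.nrm (\<lambda>x. s n x - u x)" using h1.diff_mem[OF s uH] by simp
  qed auto
  with uH show ?thesis by blast
qed

subsection \<open>Lattice operations and multiplication\<close>

lemma H1_excess:
  assumes u: "u \<in> H1" and c: "c \<ge> 0"
  shows "(\<lambda>x. max (u x - c) 0) \<in> H1"
    "AE x in lebesgue. grad (\<lambda>x. max (u x - c) 0) x = indicator {x. u x > c} x *\<^sub>R grad u x"
proof -
  have [measurable]: "u \<in> borel_measurable lebesgue" "grad u \<in> borel_measurable lebesgue"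
    using H1D[OF u] by (auto dest: sqintD)
  have su: "sqint lebesgue (\<lambda>x. max (u x - c) 0)"
    by (rule sqint_bound[OF H1D(1)[OF u], where c=1]) (use c in auto)
  have sg: "sqint lebesgue (\<lambda>x. indicator {x. u x > c} x *\<^sub>R grad u x)"
    by (rule sqint_bound[OF H1D(2)[OF u], where c=1]) (auto simp: indicator_def)
  note w = weak_gradient_excess[OF H1D[OF u] c]
  show "(\<lambda>x. max (u x - c) 0) \<in> H1" by (rule H1I[OF su sg w])
  show "AE x in lebesgue. grad (\<lambda>x. max (u x - c) 0) x = indicator {x. u x > c} x *\<^sub>R grad u x"
    by (rule grad_AE[OF su sg w])
qed

lemma H1_uminus: "u \<in> H1 \<Longrightarrow> (\<lambda>x. - u x) \<in> H1"
  using h1.scale_mem[of u "-1"] by simp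

text \<open>Where the truncation is positive it has the gradient of \<open>u\<close>, and
  \<open>u\<close> exceeds it by exactly \<open>c\<close>; elsewhere both integrands vanish.\<close>

lemma H1_form_excess:
  assumes u: "u \<in> H1" and c: "c \<ge> 0"
  shows "H1_form u (\<lambda>x. max (u x - c) 0) =
    H1_form (\<lambda>x. max (u x - c) 0) (\<lambda>x. max (u x - c) 0) + c * (LINT x|lebesgue. max (u x - c) 0)"
proof -
  let ?e = "\<lambda>x. max (u x - c) 0"
  have e: "?e \<in> H1" by (rule H1_excess[OF u c])
  \<comment> \<open>Where \<open>u > c\<close>, the product \<open>c * (u - c)\<close> is at most
    \<open>u * u\<close>, so integrability comes from L2 although the domain has infinite
    measure.\<close>
  have int: "integrable lebesgue (\<lambda>x. c * ?e x)"
  proof -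
    have "integrable lebesgue (\<lambda>x. \<bar>u x\<bar> * \<bar>u x\<bar>)"
        using sqint_norm_mult[OF H1D(1)[OF u] H1D(1)[OF u]] by simp
    then have "integrable lebesgue (\<lambda>x. \<bar>u x\<bar> * \<bar>u x\<bar>)" .
    then show ?thesis
    proof (rule Bochner_Integration.integrable_bound)
      show "(\<lambda>x. c * ?e x) \<in> borel_measurable lebesgue" using sqintD[OF H1D(1)[OF e]] by measurable
      show "AE x in lebesgue. norm (c * ?e x) \<le> norm (\<bar>u x\<bar> * \<bar>u x\<bar>)"
      proof (rule AE_I2)
        fix x
        show "norm (c * ?e x) \<le> norm (\<bar>u x\<bar> * \<bar>u x\<bar>)"
        proof (cases "u x > c")
          case True
          then have "c * (u x - c) \<le> u x * u x" using c by (intro mult_mono) auto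
          then show ?thesis using True c by (simp add: abs_mult)
        qed simp
      qed
    qed
  qed
  have "H1_form u ?e = (LINT x|lebesgue. (grad ?e x \<bullet> grad ?e x + ?e x * ?e x) + c * ?e x)"
    unfolding H1_form_def
  proof (rule integral_cong_AE)
    show "(\<lambda>x. grad u x \<bullet> grad ?e x + u x * ?e x) \<in> borel_measurable lebesgue"
      by (rule borel_measurable_integrable[OF H1_form_integrable[OF u e]])
    show "(\<lambda>x. (grad ?e x \<bullet> grad ?e x + ?e x * ?e x) + c * ?e x) \<in> borel_measurable lebesgue"
      using borel_measurable_integrable[OF H1_form_integrable[OF e e]]
          borel_measurable_integrable[OF int]
      by (rule borel_measurable_add)
    show "AE x in lebesgue. grad u x \<bullet> grad ?e x + u x * ?e x = (grad ?e x \<bullet> grad ?e x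
        + ?e x * ?e x) + c * ?e x"
      using H1_excess(2)[OF u c]
    proof eventually_elim
      case (elim x)
      show ?case unfolding elim by (auto simp: indicator_def max_def algebra_simps)
    qed
  qed
  also have "\<dots> = H1_form ?e ?e + (LINT x|lebesgue. c * ?e x)"
    unfolding H1_form_def by (rule Bochner_Integration.integral_add[OF H1_form_integrable[OF e e]
        int])
  finally show ?thesis by simp
qed

lemma H1_abs:
  assumes u: "u \<in> H1"
  shows "(\<lambda>x. \<bar>u x\<bar>) \<in> H1" "h1.nrm (\<lambda>x. \<bar>u x\<bar>) \<le> h1.nrm u"
    "AE x in lebesgue. norm (grad (\<lambda>x. \<bar>u x\<bar>) x) \<le> norm (grad u x)"
proof -
  let ?p = "\<lambda>x. max (u x - 0) 0" and ?n = "\<lambda>x. max (- u x - 0) 0"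
  note u' = H1_uminus[OF u]
  have p: "?p \<in> H1" "?n \<in> H1" using H1_excess(1)[OF u, of 0] H1_excess(1)[OF u', of 0] by auto
  have eq: "(\<lambda>x. \<bar>u x\<bar>) = (\<lambda>x. ?p x + 1 * ?n x)" by (auto simp: max_def abs_if)
  show a: "(\<lambda>x. \<bar>u x\<bar>) \<in> H1" unfolding eq by (rule H1_lincomb[OF p])
  have gm: "AE x in lebesgue. grad (\<lambda>x. - u x) x = - grad u x"
    using H1_lincomb(2)[OF H1_zero u, of "-1"] grad_AE[of "\<lambda>x. 0" "\<lambda>x. 0"]
    by (auto simp: weak_gradient_def elim!: eventually_elim2)
  show g: "AE x in lebesgue. norm (grad (\<lambda>x. \<bar>u x\<bar>) x) \<le> norm (grad u x)"
    using H1_lincomb(2)[OF p, of 1] H1_excess(2)[OF u, of 0, simplified] H1_excess(2)[OF u', of 0,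
        simplified] gm
    unfolding eq
    by eventually_elim (auto simp: indicator_def)
  have "l2n lebesgue (grad (\<lambda>x. \<bar>u x\<bar>)) \<le> l2n lebesgue (grad u)"
    by (rule l2n_mono[OF H1D(2)[OF u] sqintD[OF H1D(2)[OF a]] g])
  moreover have "l2n lebesgue (\<lambda>x. \<bar>u x\<bar>) = l2n lebesgue u" by (simp add: l2n_def)
  ultimately have "H1_form (\<lambda>x. \<bar>u x\<bar>) (\<lambda>x. \<bar>u x\<bar>) \<le> H1_form u u"
    unfolding H1_form_l2n[OF u] H1_form_l2n[OF a] by (simp add: power_mono)
  then show "h1.nrm (\<lambda>x. \<bar>u x\<bar>) \<le> h1.nrm u" by (simp add: h1.nrm_def)
qed

lemma H1_test_mult:
  assumes u: "u \<in> H1" and \<eta>: "test_function \<eta>"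
  shows "(\<lambda>x. \<eta> x * u x) \<in> H1"
    "AE x in lebesgue. grad (\<lambda>x. \<eta> x * u x) x = \<eta> x *\<^sub>R grad u x + u x *\<^sub>R tgrad \<eta> x"
proof -
  note t\<eta> = test_function_cbs[OF \<eta>] and tg\<eta> = cbs_tgrad[OF \<eta>]
  have s1: "sqint lebesgue (\<lambda>x. \<eta> x * u x)" using sqint_cbs_mult[OF t\<eta> H1D(1)[OF u]] by simp
  have s2: "sqint lebesgue (\<lambda>x. \<eta> x *\<^sub>R grad u x + u x *\<^sub>R tgrad \<eta> x)"
    by (intro sqint_add sqint_mult_cbs[OF tg\<eta>] sqint_cbs_mult[OF t\<eta>] H1D u)
  note w = weak_gradient_test_mult[OF H1D[OF u] \<eta>]
  show "(\<lambda>x. \<eta> x * u x) \<in> H1" by (rule H1I[OF s1 s2 w])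
  show "AE x in lebesgue. grad (\<lambda>x. \<eta> x * u x) x = \<eta> x *\<^sub>R grad u x + u x *\<^sub>R tgrad \<eta> x"
    by (rule grad_AE[OF s1 s2 w])
qed

section \<open>Capacity\<close>

lemma cap_le:
  assumes "u \<in> H1" "open U" "E \<subseteq> U" "AE x in lebesgue. x \<in> U \<longrightarrow> 1 \<le> u x"
  shows "cap E \<le> ennreal ((h1.nrm u)\<^sup>2)"
  unfolding cap_def H1_energy_eq[OF assms(1), symmetric]
  by (rule INF_lower) (use assms in blast)

text \<open>Passing to the absolute value makes the competitor nonnegative without raising its norm,
  so that competitors can be added.\<close>

lemma cap_lessD:
  assumes "cap E < ennreal (e\<^sup>2)" "e > 0"
  obtains u U where "u \<in> H1" "h1.nrm u < e" "\<And>x. 0 \<le> u x" "open U" "E \<subseteq> U"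
    "AE x in lebesgue. x \<in> U \<longrightarrow> 1 \<le> u x"
proof -
  obtain u U where u: "u \<in> H1" "open U" "E \<subseteq> U" "AE x in lebesgue. x \<in> U \<longrightarrow> 1 \<le> u x"
      "H1_energy u < ennreal (e\<^sup>2)"
    using assms(1) unfolding cap_def INF_less_iff by blast
  have "(h1.nrm u)\<^sup>2 < e\<^sup>2" using u(5) unfolding H1_energy_eq[OF u(1)]
      by (simp add: ennreal_less_iff)
  then have "h1.nrm u < e" using assms(2) power2_less_imp_less[of "h1.nrm u" e] by simp
  show ?thesis
  proof (rule that[of "\<lambda>x. \<bar>u x\<bar>" U])
    show "(\<lambda>x. \<bar>u x\<bar>) \<in> H1" by (rule H1_abs[OF u(1)])
    show "h1.nrm (\<lambda>x. \<bar>u x\<bar>) < e" using H1_abs(2)[OF u(1)] \<open>h1.nrm u < e\<close> by simp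
    show "AE x in lebesgue. x \<in> U \<longrightarrow> 1 \<le> \<bar>u x\<bar>" using u(4) by eventually_elim auto
  qed (use u in auto)
qed

lemma cap_mono: "E \<subseteq> F \<Longrightarrow> cap E \<le> cap F"
  unfolding cap_def by (rule INF_superset_mono) auto

lemma cap_empty [simp]: "cap {} = 0"
  using cap_le[OF H1_zero, of "{}" "{}"] by (simp add: h1.nrm_zero)

text \<open>A competitor for a set is also a competitor for the open neighbourhood that comes with
  it.\<close>

lemma cap_open_superset:
  assumes "cap E < ennreal (e\<^sup>2)" "e > 0"
  obtains U where "open U" "E \<subseteq> U" "cap U < ennreal (e\<^sup>2)"
proof -
  obtain u U where u: "u \<in> H1" "h1.nrm u < e" "open U" "E \<subseteq> U" "AE x in lebesgue. x \<in> U \<longrightarrow> 1 \<le> u x"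
    using cap_lessD[OF assms] by metis
  have "cap U \<le> ennreal ((h1.nrm u)\<^sup>2)" by (rule cap_le[OF u(1,3) order_refl u(5)])
  also have "\<dots> < ennreal (e\<^sup>2)" using u(1,2) assms(2)
      by (intro ennreal_lessI) (auto intro: power_strict_mono)
  finally show ?thesis using that u(3,4) by blast
qed

text \<open>Only the subadditivity of the square root of the capacity, which is the triangle inequality
  for the \<open>H1\<close> norm.\<close>

lemma cap_UN_le:
  fixes E :: "nat \<Rightarrow> 'a::euclidean_space set"
  assumes E: "\<And>n. cap (E n) < ennreal ((e n)\<^sup>2)" and e: "\<And>n. e n > 0" and "summable e"
  shows "cap (\<Union>n. E n) \<le> ennreal ((\<Sum>n. e n)\<^sup>2)"
proof -
  have "\<exists>u U. u \<in> H1 \<and> h1.nrm u < e n \<and> (\<forall>x. 0 \<le> u x) \<and> open U \<and> E n \<subseteq> U \<and> (AE x in lebesgue. x \<in> U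
      \<longrightarrow> 1 \<le> u x)" for n
    using cap_lessD[OF E[of n] e] by metis
  then have "\<forall>n. \<exists>u U. u \<in> H1 \<and> h1.nrm u < e n \<and> (\<forall>x. 0 \<le> u x) \<and> open U \<and> E n \<subseteq> U
      \<and> (AE x in lebesgue. x \<in> U \<longrightarrow> 1 \<le> u x)"
    by (rule allI)
  from choice[OF this] obtain u where "\<forall>n. \<exists>U. u n \<in> H1 \<and> h1.nrm (u n) < e n \<and>
      (\<forall>x. 0 \<le> u n x) \<and> open U \<and> E n \<subseteq> U \<and> (AE x in lebesgue. x \<in> U \<longrightarrow> 1 \<le> u n x)" by blast
  from choice[OF this] obtain U where "\<forall>n. u n \<in> H1 \<and> h1.nrm (u n) < e n \<and>
      (\<forall>x. 0 \<le> u n x) \<and> open (U n) \<and> E n \<subseteq> U n \<and> (AE x in lebesgue. x \<in> U n \<longrightarrow> 1 \<le> u n x)" by blast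
  then have u: "\<And>n. u n \<in> H1" "\<And>n. h1.nrm (u n) < e n" "\<And>n x. 0 \<le> u n x"
    and U: "\<And>n. open (U n)" "\<And>n. E n \<subseteq> U n" "\<And>n. AE x in lebesgue. x \<in> U n \<longrightarrow> 1 \<le> u n x"
    by blast+
  \<comment> \<open>The partial sums increase and form a Cauchy sequence; their limit
    \<open>w\<close> will be the competitor for the union.\<close>
  define s where "s n x = (\<Sum>k<n. u k x)" for n x
  have s: "s n \<in> H1" for n unfolding s_def[abs_def] by (rule h1.sum_mem) (use u in auto)
  have "h1.cauchy s"
  proof (rule h1.cauchyI_summable[OF s _ \<open>summable e\<close>])
    show "h1.nrm (\<lambda>x. s (Suc n) x - s n x) \<le> e n" for n using u(2)[of n] by (simp add: s_def)
  qed
  from H1_complete[OF this] obtain w where w: "w \<in> H1" and lim: "(\<lambda>n. h1.nrm (\<lambda>x. s n x - w x)) \<longlonglongrightarrow> 0"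
      by blast
  have sn: "h1.nrm (s n) \<le> (\<Sum>n. e n)" for n
  proof -
    have "h1.nrm (s n) \<le> (\<Sum>k<n. h1.nrm (u k))" unfolding s_def[abs_def]
        by (rule h1.nrm_sum) (use u in auto)
    also have "\<dots> \<le> (\<Sum>k<n. e k)" by (intro sum_mono) (use u(2) less_imp_le in blast)
    also have "\<dots> \<le> (\<Sum>n. e n)" by (rule sum_le_suminf[OF \<open>summable e\<close>]) (use e less_imp_le in auto)
    finally show ?thesis .
  qed
  have wn: "h1.nrm w \<le> (\<Sum>n. e n)"
  proof (rule LIMSEQ_le_const)
    show "(\<lambda>n. (\<Sum>n. e n) + h1.nrm (\<lambda>x. s n x - w x)) \<longlonglongrightarrow> (\<Sum>n. e n)"
      using tendsto_add[OF tendsto_const lim] by simp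
    show "\<exists>N. \<forall>n\<ge>N. h1.nrm w \<le> (\<Sum>n. e n) + h1.nrm (\<lambda>x. s n x - w x)"
    proof (intro exI allI impI)
      fix n
      show "h1.nrm w \<le> (\<Sum>n. e n) + h1.nrm (\<lambda>x. s n x - w x)"
        using h1.nrm_le_add[OF w s, of n] sn[of n] h1.nrm_minus_commute[OF w s, of n] by linarith
    qed
  qed
  have "AE x in lebesgue. s n x \<le> w x" for n
  proof -
    \<comment> \<open>The amount by which \<open>s n\<close> exceeds \<open>w\<close> is dominated
      by the distance of \<open>w\<close> to every later partial sum, so its L2 norm is 0.\<close>
    let ?d = "\<lambda>x. max (s n x - w x - 0) 0"
    have d: "?d \<in> H1" using H1_excess(1)[OF h1.diff_mem[OF s w], of 0] by simp
    have "l2n lebesgue ?d \<le> 0"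
    proof (rule LIMSEQ_le_const[OF lim])
      have "l2n lebesgue ?d \<le> h1.nrm (\<lambda>x. s m x - w x)" if "m \<ge> n" for m
      proof -
        have "s n x \<le> s m x" for x unfolding s_def using u(3) that by (intro sum_mono2) auto
        then have "norm (?d x) \<le> norm (s m x - w x)" for x
          by (smt (verit, best) real_norm_def)
        then have "l2n lebesgue ?d \<le> l2n lebesgue (\<lambda>x. s m x - w x)"
          by (intro l2n_mono H1D(1) h1.diff_mem s w sqintD[OF H1D(1)[OF d]] AE_I2)
        then show ?thesis using l2n_le_h1[OF h1.diff_mem[OF s w], of m] by simp
      qed
      then show "\<exists>N. \<forall>m\<ge>N. l2n lebesgue ?d \<le> h1.nrm (\<lambda>x. s m x - w x)" by blast
    qed
    then have "l2n lebesgue ?d = 0" using l2n_nonneg[of lebesgue ?d] by linarith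
    from l2n_eq_0_AE[OF H1D(1)[OF d] this] show ?thesis
        by eventually_elim (auto simp: max_def split: if_splits)
  qed
  then have "AE x in lebesgue. \<forall>n. s n x \<le> w x" by (simp add: AE_all_countable)
  moreover have "AE x in lebesgue. \<forall>n. x \<in> U n \<longrightarrow> 1 \<le> u n x" using U(3)
      by (simp add: AE_all_countable)
  ultimately have "AE x in lebesgue. x \<in> (\<Union>n. U n) \<longrightarrow> 1 \<le> w x"
  proof eventually_elim
    case (elim x)
    show ?case
    proof
      assume "x \<in> (\<Union>n. U n)"
      then obtain n where "x \<in> U n" by blast
      then have "1 \<le> u n x" using elim by blast
      also have "u n x \<le> s (Suc n) x" unfolding s_def using member_le_sum[of n "{..<Suc n}"
          "\<lambda>k. u k x"] u(3) by simp
      also have "\<dots> \<le> w x" using elim by blast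
      finally show "1 \<le> w x" .
    qed
  qed
  then have "cap (\<Union>n. E n) \<le> ennreal ((h1.nrm w)\<^sup>2)" using U by (intro cap_le[OF w, of
      "\<Union>n. U n"]) auto
  also have "\<dots> \<le> ennreal ((\<Sum>n. e n)\<^sup>2)" using wn w by (intro ennreal_leI power_mono) auto
  finally show ?thesis .
qed

section \<open>Sets of capacity zero\<close>

lemma cap_0I:
  assumes "\<And>e. e > 0 \<Longrightarrow> cap E \<le> ennreal (e\<^sup>2)" shows "cap E = 0"
proof -
  have "cap E \<le> 0"
  proof (rule ennreal_le_epsilon)
    fix e :: real assume "e > 0"
    then show "cap E \<le> 0 + ennreal e" using assms[of "sqrt e"] by simp
  qed
  then show ?thesis by simp
qed

lemma cap_UN_0:
  fixes E :: "nat \<Rightarrow> 'a::euclidean_space set"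
  assumes "\<And>n. cap (E n) = 0"
  shows "cap (\<Union>n. E n) = 0"
proof (rule cap_0I)
  fix e :: real assume e: "e > 0"
  \<comment> \<open>These weights, multiplied by \<open>e\<close>, distribute the budget
    \<open>e\<close> over the sets.\<close>
  have *: "(\<lambda>n. (1/2)^Suc n) sums (1::real)" by (rule power_half_series)
  have "cap (\<Union>n. E n) \<le> ennreal ((\<Sum>n. e * (1/2)^Suc n)\<^sup>2)"
  proof (rule cap_UN_le)
    show "cap (E n) < ennreal ((e * (1/2)^Suc n)\<^sup>2)" for n using assms e by simp
    show "summable (\<lambda>n. e * (1/2)^Suc n)" using * by (intro summable_mult) (rule sums_summable)
  qed (use e in simp)
  also have "(\<Sum>n. e * (1/2)^Suc n) = e" using sums_unique[OF sums_mult[OF *, of e]] by simp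
  finally show "cap (\<Union>n. E n) \<le> ennreal (e\<^sup>2)" .
qed

lemma cap_Un_le:
  assumes "cap A < ennreal (a\<^sup>2)" "a > 0" "cap B < ennreal (b\<^sup>2)" "b > 0"
  shows "cap (A \<union> B) < ennreal ((a + b)\<^sup>2)"
proof -
  obtain u U where u: "u \<in> H1" "h1.nrm u < a" "\<And>x. 0 \<le> u x" "open U" "A \<subseteq> U"
      "AE x in lebesgue. x \<in> U \<longrightarrow> 1 \<le> u x"
    using cap_lessD[OF assms(1,2)] by metis
  obtain v V where v: "v \<in> H1" "h1.nrm v < b" "\<And>x. 0 \<le> v x" "open V" "B \<subseteq> V"
      "AE x in lebesgue. x \<in> V \<longrightarrow> 1 \<le> v x"
    using cap_lessD[OF assms(3,4)] by metis
  have "AE x in lebesgue. x \<in> U \<union> V \<longrightarrow> 1 \<le> u x + v x"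
    using u(6) v(6)
  proof eventually_elim
    case (elim x) then show ?case using u(3)[of x] v(3)[of x] by auto
  qed
  then have "cap (A \<union> B) \<le> ennreal ((h1.nrm (\<lambda>x. u x + v x))\<^sup>2)"
    using u(4,5) v(4,5) by (intro cap_le[OF h1.add_mem[OF u(1) v(1)], of "U \<union> V"]) auto
  also have "\<dots> < ennreal ((a + b)\<^sup>2)"
  proof (rule ennreal_lessI)
    have "h1.nrm (\<lambda>x. u x + v x) < a + b" using h1.nrm_triangle[OF u(1) v(1)] u(2) v(2) by linarith
    then show "(h1.nrm (\<lambda>x. u x + v x))\<^sup>2 < (a + b)\<^sup>2"
      by (intro power_strict_mono h1.nrm_nonneg h1.add_mem u v) auto
  qed (use assms in simp)
  finally show ?thesis .
qed

lemma cap_Un_0: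
  assumes "cap A = 0" "cap B = 0" shows "cap (A \<union> B) = 0"
proof (rule cap_0I)
  fix e :: real assume e: "e > 0"
  then have "cap (A \<union> B) < ennreal ((e/2 + e/2)\<^sup>2)" using assms by (intro cap_Un_le) auto
  then show "cap (A \<union> B) \<le> ennreal (e\<^sup>2)" by simp
qed

lemma cap_0_open:
  assumes "cap E = 0" "e > 0"
  obtains U where "open U" "E \<subseteq> U" "cap U < ennreal (e\<^sup>2)"
  using cap_open_superset[of E e] assms by auto

text \<open>Chebyshev: a neighbourhood whose competitor has norm below \<open>1/(n+1)\<close> has
  Lebesgue measure at most the square of that number. The set itself may fail to be measurable; the
  intersection of the neighbourhoods is a null set containing it.\<close>

lemma cap_0_AE:
  fixes E :: "'a::euclidean_space set"
  assumes "cap E = 0" shows "AE x in lebesgue. x \<notin> E"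
proof -
  have "\<exists>U. open U \<and> E \<subseteq> U \<and> emeasure lebesgue U \<le> ennreal ((1 / real (Suc n))\<^sup>2)" for n
  proof -
    have "cap E < ennreal ((1 / real (Suc n))\<^sup>2)" using assms by simp
    then obtain u U where u: "u \<in> H1" "h1.nrm u < 1 / real (Suc n)" "open U" "E \<subseteq> U"
        "AE x in lebesgue. x \<in> U \<longrightarrow> 1 \<le> u x"
      by (rule cap_lessD) auto
    have "emeasure lebesgue U = (\<integral>\<^sup>+x. indicator U x \<partial>lebesgue)" using u(3) by simp
    also have "\<dots> \<le> (\<integral>\<^sup>+x. ennreal ((norm (u x))\<^sup>2) \<partial>lebesgue)"
    proof (rule nn_integral_mono_AE)
      show "AE x in lebesgue. indicator U x \<le> ennreal ((norm (u x))\<^sup>2)"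
        using u(5)
      proof eventually_elim
        case (elim x)
        show ?case
        proof (cases "x \<in> U")
          case True
          then have "1 \<le> (norm (u x))\<^sup>2" using elim by simp
          then show ?thesis using True ennreal_leI[of 1] by (auto simp: indicator_def)
        qed simp
      qed
    qed
    also have "\<dots> = ennreal ((l2n lebesgue u)\<^sup>2)" by (rule nn_integral_l2n[OF H1D(1)[OF u(1)]])
    also have "\<dots> \<le> ennreal ((1 / real (Suc n))\<^sup>2)"
      using l2n_le_h1[OF u(1)] u(2) by (intro ennreal_leI power_mono) auto
    finally show ?thesis using u(3,4) by blast
  qed
  then obtain U where U: "\<And>n. open (U n)" "\<And>n. E \<subseteq> U n"
      "\<And>n. emeasure lebesgue (U n) \<le> ennreal ((1 / real (Suc n))\<^sup>2)"
    by metis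
  let ?N = "\<Inter>n. U n"
  have N: "?N \<in> sets lebesgue" using U(1) by auto
  have "emeasure lebesgue ?N \<le> 0"
  proof (rule LIMSEQ_le_const)
    have "(\<lambda>n. ennreal ((1 / real (Suc n))\<^sup>2)) \<longlonglongrightarrow> ennreal (0\<^sup>2)"
      by (intro tendsto_intros LIMSEQ_Suc[OF lim_1_over_n])
    then show "(\<lambda>n. ennreal ((1 / real (Suc n))\<^sup>2)) \<longlonglongrightarrow> 0" by simp
    have "emeasure lebesgue ?N \<le> ennreal ((1 / real (Suc n))\<^sup>2)" for n
    proof -
      have "emeasure lebesgue ?N \<le> emeasure lebesgue (U n)" using U(1) by (intro emeasure_mono) auto
      also have "\<dots> \<le> ennreal ((1 / real (Suc n))\<^sup>2)" by (rule U(3))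
      finally show ?thesis .
    qed
    then show "\<exists>N. \<forall>n\<ge>N. emeasure lebesgue ?N \<le> ennreal ((1 / real (Suc n))\<^sup>2)" by blast
  qed
  then have "?N \<in> null_sets lebesgue" using N by (simp add: null_sets_def)
  then have "AE x in lebesgue. x \<notin> ?N" by (rule AE_not_in)
  then show ?thesis using U(2) by (auto elim!: eventually_mono)
qed

lemma qe_AE: "quasi_everywhere P \<Longrightarrow> AE x in lebesgue. P x"
  unfolding quasi_everywhere_def using cap_0_AE by fastforce

lemma qe_mono: "quasi_everywhere P \<Longrightarrow> (\<And>x. P x \<Longrightarrow> Q x) \<Longrightarrow> quasi_everywhere Q"
  unfolding quasi_everywhere_def using cap_mono[of "{x. \<not> Q x}" "{x. \<not> P x}"]
      by (auto simp: le_zero_eq)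

lemma qe_conj:
  assumes "quasi_everywhere P" "quasi_everywhere Q"
  shows "quasi_everywhere (\<lambda>x. P x \<and> Q x)"
proof -
  have "{x. \<not> (P x \<and> Q x)} = {x. \<not> P x} \<union> {x. \<not> Q x}" by blast
  then show ?thesis using assms by (simp add: quasi_everywhere_def cap_Un_0)
qed

text \<open>Sets of capacity zero are closed under countable unions, so quantifiers over real radii
  have to be reduced to countable ones before this applies.\<close>

lemma qe_all:
  assumes "\<And>n::nat. quasi_everywhere (P n)"
  shows "quasi_everywhere (\<lambda>x. \<forall>n. P n x)"
proof -
  have "{x. \<not> (\<forall>n. P n x)} = (\<Union>n. {x. \<not> P n x})" by blast
  then show ?thesis using assms by (simp add: quasi_everywhere_def cap_UN_0)
qed

lemma qe_True: "(\<And>x. P x) \<Longrightarrow> quasi_everywhere P"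
  by (simp add: quasi_everywhere_def)

section \<open>Quasi-continuous functions\<close>

lemma quasi_continuousD:
  assumes "quasi_continuous u" "e > 0"
  obtains A where "open A" "cap A < ennreal (e\<^sup>2)" "continuous_on (- A) u"
proof -
  have "ennreal (e\<^sup>2) > 0" using assms(2) by simp
  then show ?thesis using assms(1) that unfolding quasi_continuous_def by blast
qed

text \<open>The definition quantifies over extended real bounds; finite ones are squares, and for
  the infinite bound any set of finite capacity will do.\<close>

lemma quasi_continuousI:
  assumes "\<And>e::real. e > 0 \<Longrightarrow> \<exists>A. open A \<and> cap A < ennreal (e\<^sup>2) \<and> continuous_on (- A) u"
  shows "quasi_continuous u"
  unfolding quasi_continuous_def
proof (intro allI impI)
  fix e :: ennreal assume e: "e > 0"
  show "\<exists>A. open A \<and> cap A < e \<and> continuous_on (- A) u"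
  proof (cases e)
    case (real r)
    with e have "sqrt r > 0" by simp
    from assms[OF this] real show ?thesis by simp
  next
    case top
    from assms[of 1] obtain A where "open A" "cap A < ennreal (1\<^sup>2)" "continuous_on (- A) u" by auto
    then show ?thesis using top by (intro exI[of _ A]) (auto simp: less_top[symmetric] dest:
        less_imp_neq)
  qed
qed

lemma quasi_continuous_continuous: "continuous_on UNIV u \<Longrightarrow> quasi_continuous u"
  by (rule quasi_continuousI) (auto intro!: exI[of _ "{}"])

lemma quasi_continuous_compose2:
  assumes u: "quasi_continuous u" and v: "quasi_continuous v" and F:
      "continuous_on UNIV (\<lambda>(a, b). F a b)"
  shows "quasi_continuous (\<lambda>x. F (u x) (v x))"
proof (rule quasi_continuousI)
  fix e :: real assume e: "e > 0"
  then have e2: "e/2 > 0" by simp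
  obtain A where A: "open A" "cap A < ennreal ((e/2)\<^sup>2)" "continuous_on (- A) u"
      using quasi_continuousD[OF u e2] .
  obtain B where B: "open B" "cap B < ennreal ((e/2)\<^sup>2)" "continuous_on (- B) v"
      using quasi_continuousD[OF v e2] .
  have "cap (A \<union> B) < ennreal ((e/2 + e/2)\<^sup>2)" by (rule cap_Un_le[OF A(2) e2 B(2) e2])
  moreover have "continuous_on (- (A \<union> B)) (\<lambda>x. (u x, v x))"
    by (intro continuous_on_Pair continuous_on_subset[OF A(3)] continuous_on_subset[OF B(3)]) auto
  from continuous_on_compose2[OF F this] have "continuous_on (- (A \<union> B)) (\<lambda>x. F (u x) (v x))"
      by simp
  ultimately show "\<exists>A. open A \<and> cap A < ennreal (e\<^sup>2) \<and> continuous_on (- A) (\<lambda>x. F (u x) (v x))"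
    using A(1) B(1) by (intro exI[of _ "A \<union> B"]) auto
qed

lemma quasi_continuous_lincomb:
  "quasi_continuous u \<Longrightarrow> quasi_continuous v \<Longrightarrow> quasi_continuous (\<lambda>x. u x + c * v x)"
  by (rule quasi_continuous_compose2[where F="\<lambda>a b. a + c * b"])
    (auto simp: split_beta intro!: continuous_intros)

lemma quasi_continuous_diff:
  "quasi_continuous u \<Longrightarrow> quasi_continuous v \<Longrightarrow> quasi_continuous (\<lambda>x. u x - v x)"
  by (rule quasi_continuous_compose2[where F="\<lambda>a b. a - b"])
    (auto simp: split_beta intro!: continuous_intros)

lemma quasi_continuous_mult:
  "quasi_continuous u \<Longrightarrow> quasi_continuous v \<Longrightarrow> quasi_continuous (\<lambda>x. u x * v x)"
  by (rule quasi_continuous_compose2[where F="\<lambda>a b. a * b"])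
    (auto simp: split_beta intro!: continuous_intros)

lemma quasi_continuous_excess: "quasi_continuous u \<Longrightarrow> quasi_continuous (\<lambda>x. max (u x - c) 0)"
  by (rule quasi_continuous_compose2[where F="\<lambda>a b. max (a - c) 0" and v=u])
    (auto simp: split_beta intro!: continuous_intros)

lemma quasi_continuous_abs: "quasi_continuous u \<Longrightarrow> quasi_continuous (\<lambda>x. \<bar>u x\<bar>)"
  by (rule quasi_continuous_compose2[where F="\<lambda>a b. \<bar>a\<bar>" and v=u])
    (auto simp: split_beta intro!: continuous_intros)

text \<open>Where \<open>v\<close> fails to be continuous, an almost optimal competitor for the capacity of the
  exceptional set is added to \<open>\<bar>v\<bar> / t\<close>; the sum is at least \<open>1\<close> on an open set.\<close>

lemma qc_level_set:
  assumes v: "v \<in> H1" and qc: "quasi_continuous v" and t: "t > 0" and e: "e > 0"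
  obtains V where "open V" "{x. t < \<bar>v x\<bar>} \<subseteq> V" "cap V \<le> ennreal ((h1.nrm v / t + e)\<^sup>2)"
proof -
  obtain A where A: "open A" "cap A < ennreal (e\<^sup>2)" "continuous_on (- A) v"
      using quasi_continuousD[OF qc e] .
  obtain w W where w: "w \<in> H1" "h1.nrm w < e" "\<And>x. 0 \<le> w x" "open W" "A \<subseteq> W"
      "AE x in lebesgue. x \<in> W \<longrightarrow> 1 \<le> w x"
    using cap_lessD[OF A(2) e] by metis
  \<comment> \<open>This set is closed because \<open>v\<close> is continuous on the closed set
    \<open>- A\<close>; its complement consists of \<open>A\<close> and the level set.\<close>
  let ?C = "{x \<in> - A. \<bar>v x\<bar> \<le> t}"
  have "closed ?C"
    using A(1,3) by (intro continuous_on_closed_Collect_le continuous_intros) auto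
  then have "open (- ?C)" by (rule open_Compl)
  let ?z = "\<lambda>x. \<bar>v x\<bar> + t * w x"
  let ?y = "\<lambda>x. (1/t) * ?z x"
  have z: "?z \<in> H1" by (rule h1.lincomb_mem[OF H1_abs(1)[OF v] w(1)])
  have y: "?y \<in> H1" by (rule h1.scale_mem[OF z])
  have "AE x in lebesgue. x \<in> - ?C \<longrightarrow> 1 \<le> ?y x"
    using w(6)
  proof eventually_elim
    case (elim x)
    show ?case
    proof
      assume "x \<in> - ?C"
      then consider "x \<in> A" | "\<bar>v x\<bar> > t" by fastforce
      then have "t \<le> ?z x"
      proof cases
        case 1
        then have "1 \<le> w x" using elim w(5) by blast
        then have "t * 1 \<le> t * w x" using t by (intro mult_left_mono) auto
        then show ?thesis by simp
      next
        case 2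
        have "0 \<le> t * w x" using t w(3) by simp
        with 2 show ?thesis by linarith
      qed
      then show "1 \<le> ?y x" using t by simp
    qed
  qed
  then have "cap (- ?C) \<le> ennreal ((h1.nrm ?y)\<^sup>2)"
    by (intro cap_le[OF y \<open>open (- ?C)\<close>]) auto
  moreover have "h1.nrm ?y \<le> h1.nrm v / t + e"
  proof -
    have "h1.nrm ?z \<le> h1.nrm (\<lambda>x. \<bar>v x\<bar>) + h1.nrm (\<lambda>x. t * w x)"
      by (rule h1.nrm_triangle[OF H1_abs(1)[OF v] h1.scale_mem[OF w(1)]])
    moreover have "h1.nrm (\<lambda>x. t * w x) \<le> t * e" using h1.nrm_scale[OF w(1), of t] t w(2) by simp
    ultimately have "h1.nrm ?z \<le> h1.nrm v + t * e" using H1_abs(2)[OF v] by linarith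
    then have "(1/t) * h1.nrm ?z \<le> (1/t) * (h1.nrm v + t * e)" using t
        by (intro mult_left_mono) auto
    moreover have "(1/t) * (h1.nrm v + t * e) = h1.nrm v / t + e" using t by (simp add: field_simps)
    ultimately show ?thesis using h1.nrm_scale[OF z, of "1/t"] t by simp
  qed
  then have "ennreal ((h1.nrm ?y)\<^sup>2) \<le> ennreal ((h1.nrm v / t + e)\<^sup>2)"
    using h1.nrm_nonneg[OF y] by (intro ennreal_leI power_mono)
  ultimately have "cap (- ?C) \<le> ennreal ((h1.nrm v / t + e)\<^sup>2)" by (rule order_trans)
  then show ?thesis by (rule that[OF \<open>open (- ?C)\<close>, rotated]) (auto simp: not_le)
qed

text \<open>For vanishing norm the bound of \<open>qc_level_set\<close> no longer depends on the
  level, so every level set has capacity zero. This turns almost everywhere equality of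
  quasi-continuous functions of \<open>H1\<close> into quasi-everywhere equality.\<close>

lemma qc_null:
  assumes v: "v \<in> H1" and qc: "quasi_continuous v" and 0: "h1.nrm v = 0"
  shows "quasi_everywhere (\<lambda>x. v x = 0)"
proof -
  have "cap {x. 1 / real (Suc n) < \<bar>v x\<bar>} = 0" for n
  proof (rule cap_0I)
    fix e :: real assume e: "e > 0"
    obtain V where V: "open V" "{x. 1 / real (Suc n) < \<bar>v x\<bar>} \<subseteq> V"
        "cap V \<le> ennreal ((h1.nrm v / (1 / real (Suc n)) + e)\<^sup>2)"
      by (rule qc_level_set[OF v qc _ e, of "1 / real (Suc n)"]) auto
    then show "cap {x. 1 / real (Suc n) < \<bar>v x\<bar>} \<le> ennreal (e\<^sup>2)"
      using order_trans[OF cap_mono[OF V(2)] V(3)] by (simp add: 0)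
  qed
  then have "cap (\<Union>n. {x. 1 / real (Suc n) < \<bar>v x\<bar>}) = 0" by (rule cap_UN_0)
  moreover have "{x. \<not> v x = 0} \<subseteq> (\<Union>n. {x. 1 / real (Suc n) < \<bar>v x\<bar>})"
  proof
    fix x assume "x \<in> {x. \<not> v x = 0}"
    then have "0 < \<bar>v x\<bar>" by simp
    from reals_Archimedean[OF this] show "x \<in> (\<Union>n. {x. 1 / real (Suc n) < \<bar>v x\<bar>})"
      by (auto simp: inverse_eq_divide)
  qed
  ultimately show ?thesis
    unfolding quasi_everywhere_def using cap_mono[of "{x. \<not> v x = 0}"
        "\<Union>n. {x. 1 / real (Suc n) < \<bar>v x\<bar>}"] by simp
qed

section \<open>Quasi-continuous limits\<close>

text \<open>By Fatou's lemma the squared distance of the two limits has an integral of at most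
  0.\<close>

lemma AE_lim_L2_unique:
  assumes f: "\<And>n. sqint M (f n)" and g: "sqint M g" and U[measurable]: "U \<in> borel_measurable M"
    and lim: "AE x in M. (\<lambda>n. f n x) \<longlonglongrightarrow> U x" and l2: "(\<lambda>n. l2n M (\<lambda>x. f n x - g x)) \<longlonglongrightarrow> 0"
  shows "AE x in M. U x = g x"
proof -
  have [measurable]: "f n \<in> borel_measurable M" "g \<in> borel_measurable M" for n using f g
      by (auto dest: sqintD)
  have "(\<integral>\<^sup>+x. ennreal ((norm (U x - g x))\<^sup>2) \<partial>M)
      = (\<integral>\<^sup>+x. liminf (\<lambda>n. ennreal ((norm (f n x - g x))\<^sup>2)) \<partial>M)"
  proof (rule nn_integral_cong_AE)
    show "AE x in M. ennreal ((norm (U x - g x))\<^sup>2) = liminf (\<lambda>n. ennreal ((norm (f n x - g x))\<^sup>2))"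
      using lim
    proof eventually_elim
      case (elim x)
      have "(\<lambda>n. ennreal ((norm (f n x - g x))\<^sup>2)) \<longlonglongrightarrow> ennreal ((norm (U x - g x))\<^sup>2)"
        by (intro tendsto_intros elim)
      then show ?case by (metis lim_imp_Liminf sequentially_bot)
    qed
  qed
  also have "\<dots> \<le> liminf (\<lambda>n. \<integral>\<^sup>+x. ennreal ((norm (f n x - g x))\<^sup>2) \<partial>M)"
    by (rule nn_integral_liminf) measurable
  also have "\<dots> = liminf (\<lambda>n. ennreal ((l2n M (\<lambda>x. f n x - g x))\<^sup>2))"
    by (simp add: nn_integral_l2n[OF sqint_diff[OF f g]])
  also have "\<dots> = 0"
  proof -
    have "(\<lambda>n. ennreal ((l2n M (\<lambda>x. f n x - g x))\<^sup>2)) \<longlonglongrightarrow> ennreal (0\<^sup>2)" by (intro tendsto_intros l2)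
    then show ?thesis using lim_imp_Liminf[OF sequentially_bot] by fastforce
  qed
  finally have "(\<integral>\<^sup>+x. ennreal ((norm (U x - g x))\<^sup>2) \<partial>M) = 0" by simp
  then have "AE x in M. ennreal ((norm (U x - g x))\<^sup>2) = 0"
      by (subst (asm) nn_integral_0_iff_AE) auto
  then show ?thesis by eventually_elim (simp add: ennreal_eq_0_iff)
qed

text \<open>The Weierstrass test for the increments from index \<open>m\<close> on; the series
  telescopes to differences with \<open>t m\<close>, which is continuous itself.\<close>

lemma qc_uniform_limit:
  fixes t :: "nat \<Rightarrow> 'a::euclidean_space \<Rightarrow> real"
  assumes c: "\<And>k. continuous_on S (t k)"
    and b: "\<And>k x. k \<ge> m \<Longrightarrow> x \<in> S \<Longrightarrow> \<bar>t (Suc k) x - t k x\<bar> \<le> (1/2)^k"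
  shows "\<exists>U. continuous_on S U \<and> (\<forall>x\<in>S. (\<lambda>k. t k x) \<longlonglongrightarrow> U x)"
proof -
  have b': "norm (t (Suc (m + n)) x - t (m + n) x) \<le> (1/2)^n" if "x \<in> S" for n x
  proof -
    have "norm (t (Suc (m + n)) x - t (m + n) x) \<le> (1/2)^(m+n)" using b[of "m+n" x] that by simp
    also have "\<dots> \<le> (1/2)^n" by (rule power_decreasing) auto
    finally show ?thesis .
  qed
  have tele: "(\<Sum>i<n. t (Suc (m + i)) x - t (m + i) x) = t (m + n) x - t m x" for n x
    using sum_lessThan_telescope[of "\<lambda>i. t (m + i) x" n] by simp
  define g where "g x = (\<Sum>i. t (Suc (m + i)) x - t (m + i) x)" for x
  have "uniform_limit S (\<lambda>n x. \<Sum>i<n. t (Suc (m + i)) x - t (m + i) x) g sequentially"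
    unfolding g_def by (rule Weierstrass_m_test[OF b' complete_algebra_summable_geometric]) auto
  then have ul: "uniform_limit S (\<lambda>n x. t (m + n) x - t m x) g sequentially" unfolding tele .
  have "continuous_on S g"
    by (rule uniform_limit_theorem[OF always_eventually ul]) (auto intro!: continuous_on_diff c)
  then have "continuous_on S (\<lambda>x. g x + t m x)" by (intro continuous_intros c)
  moreover have "(\<lambda>k. t k x) \<longlonglongrightarrow> g x + t m x" if "x \<in> S" for x
  proof -
    have "(\<lambda>n. (t (m + n) x - t m x) + t m x) \<longlonglongrightarrow> g x + t m x"
      by (intro tendsto_add tendsto_uniform_limitI[OF ul that] tendsto_const)
    then have "(\<lambda>n. t (n + m) x) \<longlonglongrightarrow> g x + t m x" by (simp add: add.commute)
    then show ?thesis by (rule LIMSEQ_offset)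
  qed
  ultimately show ?thesis by blast
qed

text \<open>Along a subsequence with increments of norm below \<open>(1/4)^k\<close>, the set where
  an increment exceeds \<open>(1/2)^k\<close> has capacity of order \<open>(1/4)^k\<close> by
  \<open>qc_level_set\<close>. Let \<open>W m\<close> be the union of these sets for
  \<open>k \<ge> m\<close> and of exceptional sets for the continuity of all members. Outside
  \<open>W m\<close> the convergence is uniform and the limit continuous, and the capacity of
  \<open>W m\<close> tends to 0.\<close>

lemma qc_complete:
  assumes cau: "h1.cauchy s" and qc: "\<And>n. quasi_continuous (s n)"
  obtains u and r :: "nat \<Rightarrow> nat" where "u \<in> H1" "quasi_continuous u"
      "(\<lambda>n. h1.nrm (\<lambda>x. s n x - u x)) \<longlonglongrightarrow> 0"
    "strict_mono r" "quasi_everywhere (\<lambda>x. (\<lambda>n. s (r n) x) \<longlonglongrightarrow> u x)"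
proof -
  have s: "s n \<in> H1" for n using cau by (simp add: h1.cauchy_def)
  have "\<exists>N. \<forall>m\<ge>N. \<forall>n\<ge>N. h1.nrm (\<lambda>x. s m x - s n x) < (1/4)^k" for k :: nat
    using cau by (simp add: h1.cauchy_def)
  from fast_subsequence[of "\<lambda>m n. h1.nrm (\<lambda>x. s m x - s n x)" "\<lambda>k. (1/4)^k", OF this]
  obtain r where r: "strict_mono r" and rd: "\<forall>k. \<forall>m\<ge>r k. \<forall>n\<ge>r k. h1.nrm (\<lambda>x. s m x - s n x)
      < (1/4)^k" by blast
  define t where "t k = s (r k)" for k
  have t: "t k \<in> H1" "quasi_continuous (t k)" for k using s qc by (auto simp: t_def)
  have td: "h1.nrm (\<lambda>x. t (Suc k) x - t k x) \<le> (1/4)^k" for k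
    using rd r by (auto simp: t_def strict_mono_less_eq intro!: less_imp_le)
  \<comment> \<open>The norm of the increment divided by the level and the slack in
    \<open>qc_level_set\<close> are both at most \<open>(1/2)^k\<close>; the factor 3 instead of 2
    gives the strict inequality assumed in \<open>cap_UN_le\<close>.\<close>
  have "\<exists>V. open V \<and> {x. (1/2)^k < \<bar>t (Suc k) x - t k x\<bar>} \<subseteq> V \<and> cap V
      < ennreal ((3 * (1/2)^k)\<^sup>2)" for k
  proof -
    have p: "(1/2)^k > (0::real)" by simp
    obtain V where V: "open V" "{x. (1/2)^k < \<bar>t (Suc k) x - t k x\<bar>} \<subseteq> V"
      "cap V \<le> ennreal ((h1.nrm (\<lambda>x. t (Suc k) x - t k x) / (1/2)^k + (1/2)^k)\<^sup>2)"
      by (rule qc_level_set[OF h1.diff_mem[OF t(1) t(1)] quasi_continuous_diff[OF t(2) t(2)] p p])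
    have "h1.nrm (\<lambda>x. t (Suc k) x - t k x) / (1/2)^k \<le> (1/4)^k / (1/2)^k"
      by (intro divide_right_mono td) simp
    also have "(1/4::real)^k / (1/2)^k = (1/2)^k" by (simp flip: power_divide)
    finally have "h1.nrm (\<lambda>x. t (Suc k) x - t k x) / (1/2)^k + (1/2)^k \<le> 2 * (1/2)^k" by simp
    moreover have "0 \<le> h1.nrm (\<lambda>x. t (Suc k) x - t k x) / (1/2)^k"
      by (intro divide_nonneg_pos h1.nrm_nonneg h1.diff_mem t) simp
    ultimately have "(h1.nrm (\<lambda>x. t (Suc k) x - t k x) / (1/2)^k + (1/2)^k)\<^sup>2 \<le> (2 * (1/2)^k)\<^sup>2"
      by (intro power_mono) auto
    also have "\<dots> < (3 * (1/2)^k)\<^sup>2" by (intro power_strict_mono) auto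
    finally have "ennreal ((h1.nrm (\<lambda>x. t (Suc k) x - t k x) / (1/2)^k + (1/2)^k)\<^sup>2)
        < ennreal ((3 * (1/2)^k)\<^sup>2)"
      by (intro ennreal_lessI) auto
    then show ?thesis using V le_less_trans by blast
  qed
  then have "\<forall>k. \<exists>V. open V \<and> {x. (1/2)^k < \<bar>t (Suc k) x - t k x\<bar>} \<subseteq> V \<and> cap V
      < ennreal ((3 * (1/2)^k)\<^sup>2)" by blast
  from choice[OF this] obtain V where V: "\<And>k. open (V k)"
      "\<And>k. {x. (1/2)^k < \<bar>t (Suc k) x - t k x\<bar>} \<subseteq> V k"
    "\<And>k. cap (V k) < ennreal ((3 * (1/2)^k)\<^sup>2)" by blast
  \<comment> \<open>Each member gets its own exceptional set for every \<open>m\<close>, since the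
    sets of all members enter \<open>W m\<close> and their total must shrink with
    \<open>m\<close>.\<close>
  have "\<forall>p::nat\<times>nat. \<exists>A. open A \<and> cap A < ennreal (((1/2)^(fst p + snd p))\<^sup>2)
      \<and> continuous_on (- A) (t (snd p))"
  proof
    fix p :: "nat \<times> nat"
    have "(1/2)^(fst p + snd p) > (0::real)" by simp
    from quasi_continuousD[OF t(2) this]
    show "\<exists>A. open A \<and> cap A < ennreal (((1/2)^(fst p + snd p))\<^sup>2)
        \<and> continuous_on (- A) (t (snd p))"
      by blast
  qed
  from choice[OF this] obtain A' where A': "\<forall>p. open (A' p) \<and> cap (A' p) < ennreal (((1/2)^(fst p
      + snd p))\<^sup>2) \<and> continuous_on (- A' p) (t (snd p))" ..
  define A where "A m k = A' (m, k)" for m k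
  have A: "open (A m k)" "cap (A m k) < ennreal (((1/2)^(m + k))\<^sup>2)"
      "continuous_on (- A m k) (t k)" for m k
    using A'[rule_format, of "(m, k)"] by (auto simp: A_def)
  define W where "W m = (\<Union>k. V (m + k) \<union> A m k)" for m
  have Wo: "open (W m)" for m unfolding W_def using V(1) A(1) by blast
  have Wcap: "cap (W m) \<le> ennreal ((8 * (1/2)^m)\<^sup>2)" for m
  proof -
    \<comment> \<open>The factors 3 and 1 of the two kinds of sets add up to 4, and the geometric
      series doubles it.\<close>
    have sm: "(\<lambda>k. 4 * (1/2)^(m + k)) sums (8 * (1/2)^m :: real)"
      using sums_mult[OF geometric_sums[of "1/2::real"], of "4 * (1/2)^m"]
          by (simp add: power_add mult_ac)
    have "cap (W m) \<le> ennreal ((\<Sum>k. 4 * (1/2)^(m + k))\<^sup>2)" unfolding W_def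
    proof (rule cap_UN_le)
      fix k
      have "cap (V (m + k) \<union> A m k) < ennreal ((3 * (1/2)^(m+k) + (1/2)^(m+k))\<^sup>2)"
        by (rule cap_Un_le[OF V(3) _ A(2)]) auto
      then show "cap (V (m + k) \<union> A m k) < ennreal ((4 * (1/2)^(m + k))\<^sup>2)" by simp
    qed (use sums_summable[OF sm] in auto)
    then show ?thesis using sums_unique[OF sm] by simp
  qed
  have "\<exists>U. continuous_on (- W m) U \<and> (\<forall>x\<in>- W m. (\<lambda>k. t k x) \<longlonglongrightarrow> U x)" for m
  proof (rule qc_uniform_limit)
    show "continuous_on (- W m) (t k)" for k
      by (rule continuous_on_subset[OF A(3)[of m k]]) (auto simp: W_def)
    fix k x assume k: "m \<le> k" and x: "x \<in> - W m"
    have "x \<notin> V (m + (k - m))" using x unfolding W_def by blast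
    then have "x \<notin> V k" using k by simp
    then show "\<bar>t (Suc k) x - t k x\<bar> \<le> (1/2)^k" using V(2)[of k] by (auto simp: not_less[symmetric])
  qed
  then obtain U' where U': "\<And>m. continuous_on (- W m) (U' m)" "\<And>m x. x \<notin> W m \<Longrightarrow> (\<lambda>k. t k x) \<longlonglongrightarrow> U' m x"
    by (metis ComplI)
  \<comment> \<open>A pointwise limit that does not depend on \<open>m\<close>. The points of
    divergence, where \<open>lim\<close> returns an arbitrary value, lie in every
    \<open>W m\<close>.\<close>
  define U where "U x = lim (\<lambda>k. t k x)" for x
  have Ulim: "(\<lambda>k. t k x) \<longlonglongrightarrow> U x" if "x \<notin> W m" for x m
    using U'(2)[OF that] by (simp add: U_def limI)
  have Uc: "continuous_on (- W m) U" for m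
  proof (rule continuous_on_eq[OF U'(1)[of m]])
    show "U' m x = U x" if "x \<in> - W m" for x
      using U'(2)[of x m] that limI unfolding U_def by fastforce
  qed
  have pow: "\<exists>m. 8 * (1/2)^m < e" if "e > 0" for e :: real
  proof -
    obtain m where "(1/2)^m < e/8" using real_arch_pow_inv[of "e/8" "1/2"] \<open>e > 0\<close> by auto
    then show ?thesis by (intro exI[of _ m]) simp
  qed
  have qcU: "quasi_continuous U"
  proof (rule quasi_continuousI)
    fix e :: real assume e: "e > 0"
    obtain m where m: "8 * (1/2)^m < e" using pow[OF e] by blast
    have "cap (W m) < ennreal (e\<^sup>2)"
    proof (rule le_less_trans[OF Wcap[of m]])
      show "ennreal ((8 * (1/2)^m)\<^sup>2) < ennreal (e\<^sup>2)"
        using m e by (intro ennreal_lessI power_strict_mono) auto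
    qed
    then show "\<exists>A. open A \<and> cap A < ennreal (e\<^sup>2) \<and> continuous_on (- A) U" using Wo Uc by blast
  qed
  have qe: "quasi_everywhere (\<lambda>x. (\<lambda>k. t k x) \<longlonglongrightarrow> U x)"
    unfolding quasi_everywhere_def
  proof (rule cap_0I)
    fix e :: real assume e: "e > 0"
    obtain m where m: "8 * (1/2)^m < e" using pow[OF e] by blast
    have "cap {x. \<not> (\<lambda>k. t k x) \<longlonglongrightarrow> U x} \<le> cap (W m)" using Ulim by (intro cap_mono) blast
    also have "\<dots> \<le> ennreal ((8 * (1/2)^m)\<^sup>2)" by (rule Wcap)
    also have "\<dots> \<le> ennreal (e\<^sup>2)" using m by (intro ennreal_leI power_mono) auto
    finally show "cap {x. \<not> (\<lambda>k. t k x) \<longlonglongrightarrow> U x} \<le> ennreal (e\<^sup>2)" .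
  qed
  obtain u0 where u0: "u0 \<in> H1" and l0: "(\<lambda>n. h1.nrm (\<lambda>x. s n x - u0 x)) \<longlonglongrightarrow> 0"
      using H1_complete[OF cau] by blast
  have [measurable]: "t k \<in> borel_measurable lebesgue" for k by (rule sqintD[OF H1D(1)[OF t(1)]])
  have Um: "U \<in> borel_measurable lebesgue" unfolding U_def by measurable
  have "(\<lambda>k. h1.nrm (\<lambda>x. t k x - u0 x)) \<longlonglongrightarrow> 0"
    using LIMSEQ_subseq_LIMSEQ[OF l0 r] by (simp add: t_def o_def)
  then have "(\<lambda>k. l2n lebesgue (\<lambda>x. t k x - u0 x)) \<longlonglongrightarrow> 0"
    by (rule Lim_null_comparison[rotated]) (use l2n_le_h1[OF h1.diff_mem[OF t(1) u0]] in auto)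
  \<comment> \<open>The limit \<open>u0\<close> in \<open>H1\<close> has no reason to be
    quasi-continuous; \<open>U\<close> is its quasi-continuous representative.\<close>
  from AE_lim_L2_unique[OF H1D(1)[OF t(1)] H1D(1)[OF u0] Um qe_AE[OF qe] this]
  have AE: "AE x in lebesgue. u0 x = U x" by eventually_elim simp
  note UH = H1_cong_AE[OF u0 Um AE]
  have "(\<lambda>n. h1.nrm (\<lambda>x. s n x - U x)) \<longlonglongrightarrow> 0"
  proof (rule tendsto_sandwich[where f="\<lambda>_. 0"])
    show "\<forall>\<^sub>F n in sequentially. h1.nrm (\<lambda>x. s n x - U x) \<le> h1.nrm (\<lambda>x. s n x - u0 x)"
      using h1.nrm_triangle_diff[OF s u0 UH(1)] UH(3) by simp
  qed (use l0 h1.diff_mem[OF s UH(1)] in auto)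
  with UH(1) qcU r qe show ?thesis by (intro that[of U r]) (auto simp: t_def)
qed

section \<open>Measures that do not charge sets of capacity zero\<close>

text \<open>A countable intersection of open neighbourhoods of small capacity serves as the Borel
  set.\<close>

lemma cap_0_borel:
  assumes "cap E = 0"
  obtains N where "N \<in> sets borel" "E \<subseteq> N" "cap N = 0"
proof -
  have "\<forall>n::nat. \<exists>U. open U \<and> E \<subseteq> U \<and> cap U < ennreal ((1 / real (Suc n))\<^sup>2)"
  proof
    fix n
    obtain U where "open U" "E \<subseteq> U" "cap U < ennreal ((1 / real (Suc n))\<^sup>2)"
      by (rule cap_0_open[OF assms, of "1 / real (Suc n)"]) auto
    then show "\<exists>U. open U \<and> E \<subseteq> U \<and> cap U < ennreal ((1 / real (Suc n))\<^sup>2)" by blast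
  qed
  from choice[OF this] obtain U where U: "\<And>n. open (U n)" "\<And>n. E \<subseteq> U n"
      "\<And>n. cap (U n) < ennreal ((1 / real (Suc n))\<^sup>2)" by blast
  show ?thesis
  proof (rule that[of "\<Inter>n. U n"])
    show "(\<Inter>n. U n) \<in> sets borel" using U(1) by (intro sets.countable_INT) auto
    show "E \<subseteq> (\<Inter>n. U n)" using U(2) by blast
    show "cap (\<Inter>n. U n) = 0"
    proof (rule cap_0I)
      fix e :: real assume "e > 0"
      then obtain n where n: "1 / real (Suc n) < e" using reals_Archimedean
          by (auto simp: inverse_eq_divide)
      have "cap (\<Inter>n. U n) \<le> cap (U n)" by (intro cap_mono) blast
      also have "\<dots> \<le> ennreal ((1 / real (Suc n))\<^sup>2)" using U(3) less_imp_le by blast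
      also have "\<dots> \<le> ennreal (e\<^sup>2)" using n by (intro ennreal_leI power_mono) auto
      finally show "cap (\<Inter>n. U n) \<le> ennreal (e\<^sup>2)" .
    qed
  qed
qed

text \<open>The complements of the exceptional sets are countably many closed sets on which
  \<open>u\<close> is continuous, and what they leave uncovered has capacity zero.\<close>

lemma qc_ex_borel:
  assumes u: "quasi_continuous u"
  obtains v N where "v \<in> borel_measurable borel" "N \<in> sets borel" "cap N = 0"
      "\<And>x. x \<notin> N \<Longrightarrow> u x = v x"
proof -
  have "\<forall>n::nat. \<exists>A. open A \<and> cap A < ennreal ((1 / real (Suc n))\<^sup>2) \<and> continuous_on (- A) u"
  proof
    fix n
    obtain A where "open A" "cap A < ennreal ((1 / real (Suc n))\<^sup>2)" "continuous_on (- A) u"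
      by (rule quasi_continuousD[OF u, of "1 / real (Suc n)"]) auto
    then show "\<exists>A. open A \<and> cap A < ennreal ((1 / real (Suc n))\<^sup>2) \<and> continuous_on (- A) u" by blast
  qed
  from choice[OF this] obtain A where A: "\<And>n. open (A n)"
      "\<And>n. cap (A n) < ennreal ((1 / real (Suc n))\<^sup>2)"
    "\<And>n. continuous_on (- A n) u" by blast
  let ?N = "\<Inter>n. A n"
  have N: "?N \<in> sets borel" using A(1) by (intro sets.countable_INT) auto
  have cN: "cap ?N = 0"
  proof (rule cap_0I)
    fix e :: real assume "e > 0"
    then obtain n where n: "1 / real (Suc n) < e" using reals_Archimedean
        by (auto simp: inverse_eq_divide)
    have "cap ?N \<le> cap (A n)" by (intro cap_mono) blast
    also have "\<dots> \<le> ennreal ((1 / real (Suc n))\<^sup>2)" using A(2) less_imp_le by blast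
    also have "\<dots> \<le> ennreal (e\<^sup>2)" using n by (intro ennreal_leI power_mono) auto
    finally show "cap ?N \<le> ennreal (e\<^sup>2)" .
  qed
  let ?v = "\<lambda>x. if x \<in> ?N then 0 else u x"
  have "?v \<in> borel_measurable borel"
  proof (rule measurable_piecewise_restrict[where C="insert ?N (range (\<lambda>n. - A n))"])
    fix \<Omega> assume "\<Omega> \<in> insert ?N (range (\<lambda>n. - A n))"
    then consider "\<Omega> = ?N" | n where "\<Omega> = - A n" by blast
    then show "?v \<in> borel_measurable (restrict_space borel \<Omega>)"
    proof cases
      case 1
      have "?v \<in> borel_measurable (restrict_space borel \<Omega>) \<longleftrightarrow> (\<lambda>x. 0::real) \<in> borel_measurable
          (restrict_space borel \<Omega>)"
        by (rule measurable_cong) (simp add: 1 space_restrict_space)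
      then show ?thesis by simp
    next
      case 2
      have "?v \<in> borel_measurable (restrict_space borel \<Omega>) \<longleftrightarrow> u \<in> borel_measurable (restrict_space
          borel \<Omega>)"
        by (rule measurable_cong) (auto simp: 2 space_restrict_space)
      then show ?thesis using borel_measurable_continuous_on_restrict[OF A(3)[of n]] 2 by simp
    qed
  qed (use N A(1) in auto)
  then show ?thesis by (rule that[OF _ N cN]) (simp only: if_not_P if_False)
qed

lemma cap_0_disjoint_UN:
  fixes A :: "nat \<Rightarrow> 'a::euclidean_space set"
  shows "cap ((\<Union>i. A i) \<inter> S) = 0 \<longleftrightarrow> (\<forall>i. cap (A i \<inter> S) = 0)"
proof
  assume "cap ((\<Union>i. A i) \<inter> S) = 0"
  moreover have "cap (A i \<inter> S) \<le> cap ((\<Union>i. A i) \<inter> S)" for i by (intro cap_mono) blast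
  ultimately show "\<forall>i. cap (A i \<inter> S) = 0" by simp
next
  assume "\<forall>i. cap (A i \<inter> S) = 0"
  then have "cap (\<Union>i. A i \<inter> S) = 0" by (intro cap_UN_0) auto
  then show "cap ((\<Union>i. A i) \<inter> S) = 0" by (simp add: Int_UN_distrib2 flip: UN_extend_simps)
qed

section \<open>The measures \<open>infty_on\<close> and Dirichlet restrictions\<close>

lemma sets_infty_on [simp]: "sets (infty_on S) = sets borel"
  using sets.sigma_sets_eq[of borel] by (simp add: infty_on_def sets_measure_of_conv)

text \<open>\<open>measure_of\<close> takes the prescribed values once countable additivity is
  verified: both sides are infinite as soon as one member of the family meets \<open>S\<close> in
  positive capacity.\<close>

lemma emeasure_infty_on:
  fixes S :: "'a::euclidean_space set"
  assumes "B \<in> sets borel"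
  shows "emeasure (infty_on S) B = (if cap (B \<inter> S) = 0 then 0 else \<infinity>)"
proof -
  let ?\<mu> = "\<lambda>B. if cap (B \<inter> S) = 0 then 0 else \<infinity> :: ennreal"
  have "sigma_algebra (UNIV :: 'a set) (sets borel)" using sets.sigma_algebra_axioms[of borel]
      by simp
  moreover have "positive (sets borel) ?\<mu>" by (simp add: positive_def)
  moreover have "countably_additive (sets borel) ?\<mu>" unfolding countably_additive_def
  proof (intro allI impI)
    fix A :: "nat \<Rightarrow> 'a set"
    show "(\<Sum>i. ?\<mu> (A i)) = ?\<mu> (\<Union>i. A i)"
    proof (cases "\<forall>i. cap (A i \<inter> S) = 0")
      case True
      then show ?thesis by (simp add: cap_0_disjoint_UN)
    next
      case False
      then obtain i where i: "cap (A i \<inter> S) \<noteq> 0" by blast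
      have "?\<mu> (A i) \<le> (\<Sum>i. ?\<mu> (A i))" using sum_le_suminf[of "\<lambda>i. ?\<mu> (A i)" "{i}"] by simp
      then have "(\<Sum>i. ?\<mu> (A i)) = \<infinity>" using i by (simp add: top_unique)
      then show ?thesis using False by (simp add: cap_0_disjoint_UN)
    qed
  qed
  ultimately show ?thesis unfolding infty_on_def
    using emeasure_measure_of_sigma[of UNIV "sets borel" ?\<mu> B] assms by simp
qed

lemma sets_dirichlet_restriction [simp]: "sets (dirichlet_restriction \<mu> \<Omega>) = sets borel"
  using sets.sigma_sets_eq[of borel] by (simp add: dirichlet_restriction_def sets_measure_of_conv)

lemma emeasure_dirichlet_restriction:
  fixes \<mu> :: "'a::euclidean_space measure"
  assumes \<mu>: "sets \<mu> = sets borel" and B: "B \<in> sets borel"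
  shows "emeasure (dirichlet_restriction \<mu> \<Omega>) B = emeasure \<mu> B + (if cap (B - \<Omega>) = 0 then 0 else \<infinity>)"
proof -
  let ?\<nu> = "\<lambda>B. emeasure \<mu> B + emeasure (infty_on (- \<Omega>)) B"
  have "sigma_algebra (UNIV :: 'a set) (sets borel)" using sets.sigma_algebra_axioms[of borel]
      by simp
  moreover have "positive (sets borel) ?\<nu>" by (simp add: positive_def)
  moreover have "countably_additive (sets borel) ?\<nu>" unfolding countably_additive_def
  proof (intro allI impI)
    fix A :: "nat \<Rightarrow> 'a set" assume A: "range A \<subseteq> sets borel" and d: "disjoint_family A"
    have "(\<Sum>i. emeasure \<mu> (A i)) = emeasure \<mu> (\<Union>i. A i)"
        by (rule suminf_emeasure) (use A d \<mu> in auto)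
    moreover have "(\<Sum>i. emeasure (infty_on (- \<Omega>)) (A i)) = emeasure (infty_on (- \<Omega>)) (\<Union>i. A i)"
      by (rule suminf_emeasure) (use A d in auto)
    ultimately show "(\<Sum>i. ?\<nu> (A i)) = ?\<nu> (\<Union>i. A i)" by (simp add: suminf_add[symmetric])
  qed
  ultimately have "emeasure (dirichlet_restriction \<mu> \<Omega>) B = ?\<nu> B"
      unfolding dirichlet_restriction_def
    using emeasure_measure_of_sigma[of UNIV "sets borel" ?\<nu> B] B by simp
  then show ?thesis using emeasure_infty_on[OF B] by (simp add: Diff_eq)
qed

section \<open>Quasi-everywhere statements and a fixed measure\<close>

text \<open>Both properties pass to Dirichlet restrictions, by \<open>capacitary_dirichlet\<close>,
  so that \<open>\<mu>\<close> and its restrictions can be treated as instances of one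
  locale.\<close>

locale capacitary_measure =
  fixes \<mu> :: "'a::euclidean_space measure"
  assumes sets_mu: "sets \<mu> = sets borel"
    and null_mu: "B \<in> sets borel \<Longrightarrow> cap B = 0 \<Longrightarrow> emeasure \<mu> B = 0"
begin

text \<open>The exceptional set may fail to be Borel; it is enclosed in a Borel set of capacity
  zero.\<close>

lemma AE_mu: "quasi_everywhere P \<Longrightarrow> AE x in \<mu>. P x"
proof -
  assume "quasi_everywhere P"
  then have "cap {x. \<not> P x} = 0" by (simp add: quasi_everywhere_def)
  then obtain N where N: "N \<in> sets borel" "{x. \<not> P x} \<subseteq> N" "cap N = 0" by (rule cap_0_borel)
  then have "N \<in> null_sets \<mu>" using null_mu sets_mu by (simp add: null_sets_def)
  then show ?thesis by (rule AE_I'[of N]) (use N in auto)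
qed

lemma AE_completion_mu: "quasi_everywhere P \<Longrightarrow> AE x in completion \<mu>. P x"
  by (intro AE_completion AE_mu)

lemma space_mu: "space \<mu> = UNIV"
  using sets_eq_imp_space_eq[OF sets_mu] by simp

lemma borel_measurable_mu: "borel_measurable \<mu> = borel_measurable borel"
  by (rule measurable_cong_sets[OF sets_mu refl])

text \<open>A Borel function agrees with \<open>u\<close> off a \<open>\<mu>\<close>-null set, and
  changes on such a set preserve measurability for the completion.\<close>

lemma qc_measurable:
  assumes u: "quasi_continuous u" shows "u \<in> borel_measurable (completion \<mu>)"
proof -
  obtain v N where v: "v \<in> borel_measurable borel" "N \<in> sets borel" "cap N = 0"
      "\<And>x. x \<notin> N \<Longrightarrow> u x = v x"
    using qc_ex_borel[OF u] by metis
  have N: "N \<in> null_sets \<mu>" using v null_mu sets_mu by (simp add: null_sets_def)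
  have vm: "v \<in> borel_measurable (completion \<mu>)" using v(1) borel_measurable_mu
      by (auto intro: measurable_completion)
  have "AE x in completion \<mu>. x \<notin> N" by (rule AE_completion[OF AE_not_in[OF N]])
  then have ae: "AE x in completion \<mu>. x \<in> v -` S \<longleftrightarrow> x \<in> u -` S" for S
    by eventually_elim (simp add: v(4))
  show ?thesis
  proof (rule measurableI)
    fix S :: "real set" assume S: "S \<in> sets borel"
    have "u -` S \<in> sets (completion \<mu>)"
    proof (rule completion.in_sets_AE[OF ae])
      show "v -` S \<in> sets (completion \<mu>)" using measurable_sets[OF vm S] by (simp add: space_mu)
    qed (simp add: space_mu)
    then show "u -` S \<inter> space (completion \<mu>) \<in> sets (completion \<mu>)" by (simp add: space_mu)
  qed simp
qed

lemma H1_mu_iff: "u \<in> H1_mu \<mu> \<longleftrightarrow> u \<in> H1 \<and> quasi_continuous u \<and> sqint (completion \<mu>) u"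
  using qc_measurable[of u]
  by (auto simp: H1_mu_def H1_mu_norm_sq_def sqint_iff_nn H1_energy_eq)

lemma capacitary_dirichlet: "capacitary_measure (dirichlet_restriction \<mu> \<Omega>)"
proof
  fix B :: "'a set" assume B: "B \<in> sets borel" "cap B = 0"
  have "cap (B - \<Omega>) \<le> cap B" by (intro cap_mono) blast
  then show "emeasure (dirichlet_restriction \<mu> \<Omega>) B = 0"
    using B null_mu by (simp add: emeasure_dirichlet_restriction[OF sets_mu])
qed simp

text \<open>The two measures coincide on all Borel subsets of the set where \<open>f\<close> is
  nonzero, so \<open>f\<close> may be integrated over the common restriction to that set.\<close>

lemma nn_integral_dirichlet_restriction:
  fixes f :: "'a \<Rightarrow> ennreal"
  assumes f: "f \<in> borel_measurable borel" and 0: "cap ({x. f x \<noteq> 0} - \<Omega>) = 0"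
  shows "(\<integral>\<^sup>+x. f x \<partial>dirichlet_restriction \<mu> \<Omega>) = (\<integral>\<^sup>+x. f x \<partial>\<mu>)"
proof -
  let ?M = "dirichlet_restriction \<mu> \<Omega>" and ?E = "{x. f x \<noteq> 0}"
  have E: "?E \<in> sets borel" using f by measurable
  have r: "restrict_space ?M ?E = restrict_space \<mu> ?E"
  proof (rule measure_eqI)
    show s: "sets (restrict_space ?M ?E) = sets (restrict_space \<mu> ?E)"
      by (rule sets_restrict_space_cong) (simp add: sets_mu)
    fix A assume "A \<in> sets (restrict_space ?M ?E)"
    then have A: "A \<in> sets borel" "A \<subseteq> ?E" using E by (auto simp: sets_restrict_space)
    have "cap (A - \<Omega>) \<le> cap (?E - \<Omega>)" using A(2) by (intro cap_mono) blast
    then have "cap (A - \<Omega>) = 0" using 0 by simp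
    then show "emeasure (restrict_space ?M ?E) A = emeasure (restrict_space \<mu> ?E) A"
      using A E by (simp add: emeasure_restrict_space sets_mu space_mu
          emeasure_dirichlet_restriction[OF sets_mu] sets_eq_imp_space_eq[of ?M borel])
  qed
  have "(\<integral>\<^sup>+x. f x \<partial>?M) = (\<integral>\<^sup>+x. f x * indicator ?E x \<partial>?M)"
    by (intro nn_integral_cong) (auto simp: indicator_def)
  also have "\<dots> = (\<integral>\<^sup>+x. f x \<partial>restrict_space ?M ?E)"
    using E by (subst nn_integral_restrict_space) (auto simp: sets_eq_imp_space_eq[of ?M borel])
  also have "\<dots> = (\<integral>\<^sup>+x. f x * indicator ?E x \<partial>\<mu>)"
    unfolding r using E by (subst nn_integral_restrict_space) (auto simp: sets_mu space_mu)
  also have "\<dots> = (\<integral>\<^sup>+x. f x \<partial>\<mu>)"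
    by (intro nn_integral_cong) (auto simp: indicator_def)
  finally show ?thesis .
qed

text \<open>If \<open>u\<close> were nonzero on a part of the complement of \<open>\<Omega>\<close>
  of positive capacity, one of the sets where the square of its Borel representative is at least
  \<open>1/(n+1)\<close> would already have infinite measure. For \<open>u\<close> vanishing there,
  the added measure does not contribute to the norm.\<close>

lemma H1_mu_dirichlet_restriction:
  "u \<in> H1_mu (dirichlet_restriction \<mu> \<Omega>) \<longleftrightarrow> u \<in> H1_mu \<mu> \<and> quasi_everywhere (\<lambda>x. x \<notin> \<Omega> \<longrightarrow> u x = 0)"
proof (cases "u \<in> H1 \<and> quasi_continuous u")
  case False
  then show ?thesis by (auto simp: H1_mu_def)
next
  case True
  let ?M = "dirichlet_restriction \<mu> \<Omega>"
  interpret M: capacitary_measure ?M by (rule capacitary_dirichlet)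
  obtain v N where v: "v \<in> borel_measurable borel" "N \<in> sets borel" "cap N = 0"
      "\<And>x. x \<notin> N \<Longrightarrow> u x = v x"
    using qc_ex_borel True by metis
  have qe: "quasi_everywhere (\<lambda>x. u x = v x)"
    using v(3) cap_mono[of "{x. u x \<noteq> v x}" N] v(4) by (fastforce simp: quasi_everywhere_def)
  let ?f = "\<lambda>x. ennreal ((v x)\<^sup>2)"
  have f: "?f \<in> borel_measurable borel" using v(1) by measurable
  have I: "(\<integral>\<^sup>+x. ennreal ((norm (u x))\<^sup>2) \<partial>completion \<mu>) = (\<integral>\<^sup>+x. ?f x \<partial>\<mu>)"
    unfolding nn_integral_completion by (rule nn_integral_cong_AE) (use AE_mu[OF qe] in \<open>auto elim!:
        eventually_mono\<close>)
  have IM: "(\<integral>\<^sup>+x. ennreal ((norm (u x))\<^sup>2) \<partial>completion ?M) = (\<integral>\<^sup>+x. ?f x \<partial>?M)"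
    unfolding nn_integral_completion by (rule nn_integral_cong_AE) (use M.AE_mu[OF qe] in \<open>auto
        elim!: eventually_mono\<close>)
  have z: "quasi_everywhere (\<lambda>x. x \<notin> \<Omega> \<longrightarrow> u x = 0) \<longleftrightarrow> cap ({x. ?f x \<noteq> 0} - \<Omega>) = 0"
  proof -
    have "quasi_everywhere (\<lambda>x. x \<notin> \<Omega> \<longrightarrow> u x = 0) \<longleftrightarrow> quasi_everywhere (\<lambda>x. x \<notin> \<Omega> \<longrightarrow> v x = 0)"
      using qe_conj[OF qe] by (auto elim!: qe_mono[OF qe_conj[OF qe]])
    also have "\<dots> \<longleftrightarrow> cap ({x. ?f x \<noteq> 0} - \<Omega>) = 0"
      unfolding quasi_everywhere_def by (intro arg_cong[where f="\<lambda>S. cap S = 0"]) auto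
    finally show ?thesis .
  qed
  have fin: "cap ({x. ?f x \<noteq> 0} - \<Omega>) = 0" if "(\<integral>\<^sup>+x. ?f x \<partial>?M) < \<infinity>"
  proof -
    have "cap ({x. 1 / real (Suc n) \<le> (v x)\<^sup>2} \<inter> - \<Omega>) = 0" for n
    proof -
      let ?B = "{x. 1 / real (Suc n) \<le> (v x)\<^sup>2}"
      have B: "?B \<in> sets borel" using v(1) by measurable
      have "ennreal (1 / real (Suc n)) * emeasure ?M ?B
          = (\<integral>\<^sup>+x. ennreal (1 / real (Suc n)) * indicator ?B x \<partial>?M)"
        using B by (subst nn_integral_cmult_indicator) auto
      also have "\<dots> \<le> (\<integral>\<^sup>+x. ?f x \<partial>?M)"
        by (intro nn_integral_mono) (auto simp: indicator_def intro!: ennreal_leI)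
      finally have "ennreal (1 / real (Suc n)) * emeasure ?M ?B < \<infinity>" using that
          by (rule le_less_trans)
      then have "emeasure ?M ?B < \<infinity>" by (auto simp: ennreal_mult_less_top ennreal_eq_0_iff)
      then show ?thesis
        using emeasure_dirichlet_restriction[OF sets_mu B, of \<Omega>]
            by (auto simp: Diff_eq split: if_splits)
    qed
    then have "cap ((\<Union>n. {x. 1 / real (Suc n) \<le> (v x)\<^sup>2}) \<inter> - \<Omega>) = 0"
        by (simp add: cap_0_disjoint_UN)
    moreover have "{x. ?f x \<noteq> 0} - \<Omega> \<subseteq> (\<Union>n. {x. 1 / real (Suc n) \<le> (v x)\<^sup>2}) \<inter> - \<Omega>"
    proof
      fix x assume x: "x \<in> {x. ?f x \<noteq> 0} - \<Omega>"
      then have "(v x)\<^sup>2 > 0" by auto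
      from reals_Archimedean[OF this] obtain n where "1 / real (Suc n) < (v x)\<^sup>2"
          by (auto simp: inverse_eq_divide)
      then have "1 / real (Suc n) \<le> (v x)\<^sup>2" by (rule less_imp_le)
      then show "x \<in> (\<Union>n. {x. 1 / real (Suc n) \<le> (v x)\<^sup>2}) \<inter> - \<Omega>" using x by blast
    qed
    ultimately show ?thesis
      using cap_mono[of "{x. ?f x \<noteq> 0} - \<Omega>" "(\<Union>n. {x. 1 / real (Suc n) \<le> (v x)\<^sup>2}) \<inter> - \<Omega>"] by simp
  qed
  show ?thesis
    unfolding H1_mu_iff M.H1_mu_iff sqint_iff_nn I IM z
    using True qc_measurable[of u] M.qc_measurable[of u] fin nn_integral_dirichlet_restriction[OF f,
        of \<Omega>] by auto
qed

end

text \<open>\<open>w_mu\<close> is chosen and determined only up to sets of capacity zero, so its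
  measurability must come from a function that equals it almost everywhere.\<close>

lemma borel_measurable_completion_AE:
  fixes u v :: "'x \<Rightarrow> 'b::topological_space"
  assumes v: "v \<in> borel_measurable (completion M)" and ae: "AE x in completion M. v x = u x"
  shows "u \<in> borel_measurable (completion M)"
proof (rule measurableI)
  fix S :: "'b set" assume S: "S \<in> sets borel"
  show "u -` S \<inter> space (completion M) \<in> sets (completion M)"
  proof (rule completion.in_sets_AE)
    show "AE x in completion M. x \<in> v -` S \<inter> space (completion M) \<longleftrightarrow> x \<in> u -` S \<inter> space (completion
        M)"
      using ae by eventually_elim simp
    show "v -` S \<inter> space (completion M) \<in> sets (completion M)" by (rule measurable_sets[OF v S])
  qed simp
qed simp

section \<open>The space $H^1_\mu$ and its Dirichlet restrictions\<close>

definition H1_mu_form :: "'a::euclidean_space measure \<Rightarrow> ('a \<Rightarrow> real) \<Rightarrow> ('a \<Rightarrow> real) \<Rightarrow> real" where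
  "H1_mu_form \<mu> u v = H1_form u v + (LINT x|completion \<mu>. u x * v x)"

text \<open>This is \<open>H1_mu (dirichlet_restriction \<mu> \<Omega>)\<close>, by \<open>H1_mu_dirichlet_restriction\<close>.\<close>

definition H1_mu0 :: "'a::euclidean_space measure \<Rightarrow> 'a set \<Rightarrow> ('a \<Rightarrow> real) set" where
  "H1_mu0 \<mu> \<Omega> = {u \<in> H1_mu \<mu>. quasi_everywhere (\<lambda>x. x \<notin> \<Omega> \<longrightarrow> u x = 0)}"

lemma H1_mu0_UNIV [simp]: "H1_mu0 \<mu> UNIV = H1_mu \<mu>"
  by (auto simp: H1_mu0_def intro: qe_True)

context capacitary_measure
begin

lemma H1_mu0_D:
  assumes "u \<in> H1_mu0 \<mu> \<Omega>"
  shows "u \<in> H1" "quasi_continuous u" "sqint (completion \<mu>) u"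
      "quasi_everywhere (\<lambda>x. x \<notin> \<Omega> \<longrightarrow> u x = 0)"
  using assms by (auto simp: H1_mu0_def H1_mu_iff)

lemma H1_mu0_I:
  assumes "u \<in> H1" "quasi_continuous u" "sqint (completion \<mu>) u"
      "quasi_everywhere (\<lambda>x. x \<notin> \<Omega> \<longrightarrow> u x = 0)"
  shows "u \<in> H1_mu0 \<mu> \<Omega>"
  using assms by (auto simp: H1_mu0_def H1_mu_iff)

lemma H1_mu0_mono:
  assumes "\<Omega> \<subseteq> \<Omega>'" "u \<in> H1_mu0 \<mu> \<Omega>" shows "u \<in> H1_mu0 \<mu> \<Omega>'"
  using assms(2) unfolding H1_mu0_def by (auto intro: qe_mono subsetD[OF assms(1)])

text \<open>Membership of truncations, absolute values and cutoffs is reduced to pointwise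
  domination, by which integrability with respect to \<open>\<mu>\<close> is inherited.\<close>

lemma H1_mu0_dominated:
  assumes u: "u \<in> H1_mu0 \<mu> \<Omega>" and v: "v \<in> H1" "quasi_continuous v"
    and dom: "quasi_everywhere (\<lambda>x. \<bar>v x\<bar> \<le> K * \<bar>u x\<bar>)"
    and 0: "quasi_everywhere (\<lambda>x. x \<notin> \<Omega>' \<longrightarrow> v x = 0)"
  shows "v \<in> H1_mu0 \<mu> \<Omega>'"
proof (rule H1_mu0_I[OF v _ 0])
  show "sqint (completion \<mu>) v"
    by (rule sqint_bound[OF H1_mu0_D(3)[OF u] qc_measurable[OF v(2)], where c=K])
      (use AE_completion_mu[OF dom] in simp)
qed

text \<open>The form, and with it \<open>hm.nrm\<close>, does not involve \<open>\<Omega>\<close>,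
  so norms can be compared across domains; the carrier and the notion of a Cauchy sequence do depend
  on it.\<close>

sublocale hm: prehilbert "H1_mu0 \<mu> \<Omega>" "H1_mu_form \<mu>" for \<Omega>
proof
  fix u v w :: "'a \<Rightarrow> real" and c :: real
  show "(\<lambda>x. 0) \<in> H1_mu0 \<mu> \<Omega>"
    by (intro H1_mu0_I H1_zero quasi_continuous_continuous qe_True sqint_zero) auto
  assume u: "u \<in> H1_mu0 \<mu> \<Omega>"
  note u' = H1_mu0_D[OF u]
  show "0 \<le> H1_mu_form \<mu> u u" unfolding H1_mu_form_def
    using h1.B_nonneg[OF u'(1)] by (intro add_nonneg_nonneg Bochner_Integration.integral_nonneg)
        auto
  assume v: "v \<in> H1_mu0 \<mu> \<Omega>"
  note v' = H1_mu0_D[OF v]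
  show "(\<lambda>x. u x + c * v x) \<in> H1_mu0 \<mu> \<Omega>"
  proof (rule H1_mu0_I)
    show "(\<lambda>x. u x + c * v x) \<in> H1" by (rule H1_lincomb[OF u'(1) v'(1)])
    show "quasi_continuous (\<lambda>x. u x + c * v x)" by (rule quasi_continuous_lincomb[OF u'(2) v'(2)])
    show "sqint (completion \<mu>) (\<lambda>x. u x + c * v x)"
      using sqint_add[OF u'(3) sqint_scaleR[OF v'(3), of c]] by simp
    show "quasi_everywhere (\<lambda>x. x \<notin> \<Omega> \<longrightarrow> u x + c * v x = 0)"
      by (rule qe_mono[OF qe_conj[OF u'(4) v'(4)]]) simp
  qed
  show "H1_mu_form \<mu> u v = H1_mu_form \<mu> v u"
    unfolding H1_mu_form_def using h1.B_sym[OF u'(1) v'(1)] by (simp add: mult.commute)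
  assume w: "w \<in> H1_mu0 \<mu> \<Omega>"
  note w' = H1_mu0_D[OF w]
  have "(LINT x|completion \<mu>. (u x + c * v x) * w x)
      = (LINT x|completion \<mu>. u x * w x + c * (v x * w x))"
    by (intro Bochner_Integration.integral_cong) (auto simp: algebra_simps)
  also have "\<dots> = (LINT x|completion \<mu>. u x * w x) + c * (LINT x|completion \<mu>. v x * w x)"
    using sqint_mult[OF u'(3) w'(3)] sqint_mult[OF v'(3) w'(3)] by simp
  finally show "H1_mu_form \<mu> (\<lambda>x. u x + c * v x) w = H1_mu_form \<mu> u w + c * H1_mu_form \<mu> v w"
    unfolding H1_mu_form_def using h1.B_lincomb[OF u'(1) v'(1) w'(1), of c]
        by (simp add: algebra_simps)
qed

lemma hm_nrm_sq:
  assumes u: "u \<in> H1_mu0 \<mu> \<Omega>"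
  shows "(hm.nrm u)\<^sup>2 = (h1.nrm u)\<^sup>2 + (l2n (completion \<mu>) u)\<^sup>2"
proof -
  have "(LINT x|completion \<mu>. u x * u x) = (l2n (completion \<mu>) u)\<^sup>2"
    by (simp add: l2n_sq flip: power2_eq_square)
  then show ?thesis
    using hm.nrm_sq[OF u] h1.nrm_sq[OF H1_mu0_D(1)[OF u]] by (simp add: H1_mu_form_def)
qed

lemma h1_nrm_le_hm: "u \<in> H1_mu0 \<mu> \<Omega> \<Longrightarrow> h1.nrm u \<le> hm.nrm u"
  by (rule power2_le_imp_le) (auto simp: hm_nrm_sq)

lemma l2n_le_hm: "u \<in> H1_mu0 \<mu> \<Omega> \<Longrightarrow> l2n lebesgue u \<le> hm.nrm u"
  using l2n_le_h1[OF H1_mu0_D(1)] h1_nrm_le_hm order_trans by blast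

lemma l2n_grad_le_hm: "u \<in> H1_mu0 \<mu> \<Omega> \<Longrightarrow> l2n lebesgue (grad u) \<le> hm.nrm u"
  using l2n_grad_le_h1[OF H1_mu0_D(1)] h1_nrm_le_hm order_trans by blast

lemma l2n_mu_le_hm: "u \<in> H1_mu0 \<mu> \<Omega> \<Longrightarrow> l2n (completion \<mu>) u \<le> hm.nrm u"
  by (rule power2_le_imp_le) (auto simp: hm_nrm_sq)

lemma hm_nrm_le:
  assumes u: "u \<in> H1_mu0 \<mu> \<Omega>"
  shows "hm.nrm u \<le> h1.nrm u + l2n (completion \<mu>) u"
proof (rule power2_le_imp_le)
  have "0 \<le> h1.nrm u" by (rule h1.nrm_nonneg[OF H1_mu0_D(1)[OF u]])
  then show "(hm.nrm u)\<^sup>2 \<le> (h1.nrm u + l2n (completion \<mu>) u)\<^sup>2"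
      "0 \<le> h1.nrm u + l2n (completion \<mu>) u"
    by (auto simp: hm_nrm_sq[OF u] power2_sum)
qed

lemma H1_mu_norm_eq: "u \<in> H1_mu \<mu> \<Longrightarrow> H1_mu_norm \<mu> u = hm.nrm u"
proof -
  assume "u \<in> H1_mu \<mu>"
  then have u: "u \<in> H1_mu0 \<mu> UNIV" by simp
  note u' = H1_mu0_D[OF u]
  have "H1_mu_norm_sq \<mu> u = ennreal ((h1.nrm u)\<^sup>2) + ennreal ((l2n (completion \<mu>) u)\<^sup>2)"
    unfolding H1_mu_norm_sq_def H1_energy_eq[OF u'(1)] using nn_integral_l2n[OF u'(3)] by simp
  also have "\<dots> = ennreal ((hm.nrm u)\<^sup>2)" by (simp add: hm_nrm_sq[OF u])
  finally show ?thesis unfolding H1_mu_norm_def using hm.nrm_nonneg[OF u] by simp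
qed

text \<open>Limits exist separately in \<open>H1\<close>, with a quasi-continuous representative,
  and in L2 of \<open>\<mu>\<close>. Along one subsequence the convergence holds quasi-everywhere,
  hence \<open>\<mu>\<close>-almost everywhere, so the two limits agree; the same subsequence
  carries over the vanishing outside \<open>\<Omega>\<close>.\<close>

lemma H1_mu0_complete:
  assumes cau: "hm.cauchy \<Omega> s"
  shows "\<exists>u\<in>H1_mu0 \<mu> \<Omega>. (\<lambda>n. hm.nrm (\<lambda>x. s n x - u x)) \<longlonglongrightarrow> 0"
proof -
  have s: "s n \<in> H1_mu0 \<mu> \<Omega>" for n using cau by (simp add: hm.cauchy_def)
  note s' = H1_mu0_D[OF s]
  have c: "\<exists>N. \<forall>m\<ge>N. \<forall>n\<ge>N. hm.nrm (\<lambda>x. s m x - s n x) < e" if "e > 0" for e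
    using cau that by (simp add: hm.cauchy_def)
  have "h1.cauchy s" unfolding h1.cauchy_def
    using s'(1) c h1_nrm_le_hm[OF hm.diff_mem[OF s s]] by (meson le_less_trans)
  then obtain u and r :: "nat \<Rightarrow> nat" where u: "u \<in> H1" "quasi_continuous u" and lim:
      "(\<lambda>n. h1.nrm (\<lambda>x. s n x - u x)) \<longlonglongrightarrow> 0"
    and r: "strict_mono r" and qe: "quasi_everywhere (\<lambda>x. (\<lambda>n. s (r n) x) \<longlonglongrightarrow> u x)"
    by (rule qc_complete[OF _ s'(2)])
  have "\<exists>w. sqint (completion \<mu>) w \<and> (\<lambda>n. l2n (completion \<mu>) (\<lambda>x. s n x - w x)) \<longlonglongrightarrow> 0"
    by (rule L2_complete[OF s'(3)]) (use c l2n_mu_le_hm[OF hm.diff_mem[OF s s]] in \<open>meson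
        le_less_trans\<close>)
  then obtain w where w: "sqint (completion \<mu>) w" and wl:
      "(\<lambda>n. l2n (completion \<mu>) (\<lambda>x. s n x - w x)) \<longlonglongrightarrow> 0" by blast
  have um: "u \<in> borel_measurable (completion \<mu>)" by (rule qc_measurable[OF u(2)])
  have "(\<lambda>n. l2n (completion \<mu>) (\<lambda>x. s (r n) x - w x)) \<longlonglongrightarrow> 0"
    using LIMSEQ_subseq_LIMSEQ[OF wl r] by (simp add: o_def)
  from AE_lim_L2_unique[OF s'(3) w um AE_completion_mu[OF qe] this]
  have uw: "AE x in completion \<mu>. u x = w x" .
  have su: "sqint (completion \<mu>) u" by (rule sqint_cong_AE[OF uw um w])
  have "quasi_everywhere (\<lambda>x. \<forall>n. x \<notin> \<Omega> \<longrightarrow> s n x = 0)" by (rule qe_all[OF s'(4)])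
  from qe_conj[OF this qe] have "quasi_everywhere (\<lambda>x. x \<notin> \<Omega> \<longrightarrow> u x = 0)"
  proof (rule qe_mono)
    fix x assume *: "(\<forall>n. x \<notin> \<Omega> \<longrightarrow> s n x = 0) \<and> (\<lambda>n. s (r n) x) \<longlonglongrightarrow> u x"
    show "x \<notin> \<Omega> \<longrightarrow> u x = 0"
    proof
      assume "x \<notin> \<Omega>"
      then have "\<And>n. s n x = 0" using * by blast
      with conjunct2[OF *] have "(\<lambda>n. 0) \<longlonglongrightarrow> u x" by simp
      then show "u x = 0" by (simp add: LIMSEQ_const_iff)
    qed
  qed
  with u su have uV: "u \<in> H1_mu0 \<mu> \<Omega>" by (intro H1_mu0_I)
  have "(\<lambda>n. hm.nrm (\<lambda>x. s n x - u x)) \<longlonglongrightarrow> 0"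
  proof (rule tendsto_sandwich[where f="\<lambda>_. 0"])
    have eq: "l2n (completion \<mu>) (\<lambda>x. s n x - u x) = l2n (completion \<mu>) (\<lambda>x. s n x - w x)" for n
      by (rule l2n_cong_AE)
        (use uw sqintD[OF sqint_diff[OF s'(3) su]] sqintD[OF sqint_diff[OF s'(3) w]] in \<open>auto elim!:
            eventually_mono\<close>)
    show "\<forall>\<^sub>F n in sequentially. hm.nrm (\<lambda>x. s n x - u x)
        \<le> h1.nrm (\<lambda>x. s n x - u x) + l2n (completion \<mu>) (\<lambda>x. s n x - w x)"
      using hm_nrm_le[OF hm.diff_mem[OF s uV]] unfolding eq by simp
    show "(\<lambda>n. h1.nrm (\<lambda>x. s n x - u x) + l2n (completion \<mu>) (\<lambda>x. s n x - w x)) \<longlonglongrightarrow> 0"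
      using tendsto_add[OF lim wl] by simp
    show "\<forall>\<^sub>F n in sequentially. 0 \<le> hm.nrm (\<lambda>x. s n x - u x)"
      by (intro always_eventually allI hm.nrm_nonneg[OF hm.diff_mem[OF s uV]])
  qed auto
  with uV show ?thesis by blast
qed

lemma H1_mu0_abs:
  assumes u: "u \<in> H1_mu0 \<mu> \<Omega>"
  shows "(\<lambda>x. \<bar>u x\<bar>) \<in> H1_mu0 \<mu> \<Omega>" "hm.nrm (\<lambda>x. \<bar>u x\<bar>) \<le> hm.nrm u"
proof -
  note u' = H1_mu0_D[OF u]
  show a: "(\<lambda>x. \<bar>u x\<bar>) \<in> H1_mu0 \<mu> \<Omega>"
    by (rule H1_mu0_dominated[OF u H1_abs(1)[OF u'(1)] quasi_continuous_abs[OF u'(2)], where K=1])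
      (auto intro: qe_True qe_mono[OF u'(4)])
  have "h1.nrm (\<lambda>x. \<bar>u x\<bar>) \<le> h1.nrm u" by (rule H1_abs(2)[OF u'(1)])
  then have "(h1.nrm (\<lambda>x. \<bar>u x\<bar>))\<^sup>2 \<le> (h1.nrm u)\<^sup>2"
    using h1.nrm_nonneg[OF H1_mu0_D(1)[OF a]] by (rule power_mono)
  moreover have "l2n (completion \<mu>) (\<lambda>x. \<bar>u x\<bar>) = l2n (completion \<mu>) u" by (simp add: l2n_def)
  ultimately have "(hm.nrm (\<lambda>x. \<bar>u x\<bar>))\<^sup>2 \<le> (hm.nrm u)\<^sup>2"
    by (simp add: hm_nrm_sq[OF u] hm_nrm_sq[OF a])
  then show "hm.nrm (\<lambda>x. \<bar>u x\<bar>) \<le> hm.nrm u" using hm.nrm_nonneg[OF u] by (rule power2_le_imp_le)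
qed

text \<open>Testing with the part of \<open>z\<close> above \<open>c\<close> yields the energy of
  that part, plus the term on the right of the hypothesis, plus an integral with respect to
  \<open>\<mu>\<close>. The latter is nonnegative because \<open>c \<ge> 0\<close> makes
  \<open>z\<close> positive wherever the truncation is; hence the energy vanishes.\<close>

lemma maximum_principle:
  assumes z: "z \<in> H1_mu0 \<mu> \<Omega>" and c: "c \<ge> 0"
    and le: "H1_mu_form \<mu> z (\<lambda>x. max (z x - c) 0) \<le> c * (LINT x|lebesgue. max (z x - c) 0)"
  shows "quasi_everywhere (\<lambda>x. z x \<le> c)"
proof -
  let ?e = "\<lambda>x. max (z x - c) 0"
  note z' = H1_mu0_D[OF z]
  have e: "?e \<in> H1" by (rule H1_excess(1)[OF z'(1) c])
  have qe: "quasi_continuous ?e" by (rule quasi_continuous_excess[OF z'(2)])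
  have "0 \<le> (LINT x|completion \<mu>. z x * ?e x)"
    using c by (intro Bochner_Integration.integral_nonneg) (auto simp: max_def)
  then have "H1_form ?e ?e \<le> 0"
    using le H1_form_excess[OF z'(1) c] by (simp add: H1_mu_form_def)
  then have "h1.nrm ?e = 0" using h1.B_nonneg[OF e] by (simp add: h1.nrm_def)
  from qc_null[OF e qe this] show ?thesis by (rule qe_mono) (auto simp: max_def split: if_splits)
qed

lemma H1_mu0_excess:
  assumes u: "u \<in> H1_mu0 \<mu> \<Omega>" and c: "c \<ge> 0"
  shows "(\<lambda>x. max (u x - c) 0) \<in> H1_mu0 \<mu> \<Omega>"
proof -
  note u' = H1_mu0_D[OF u]
  show ?thesis
  proof (rule H1_mu0_dominated[OF u H1_excess(1)[OF u'(1) c] quasi_continuous_excess[OF u'(2)],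
      where K=1])
    show "quasi_everywhere (\<lambda>x. \<bar>max (u x - c) 0\<bar> \<le> 1 * \<bar>u x\<bar>)" using c by (intro qe_True) auto
    show "quasi_everywhere (\<lambda>x. x \<notin> \<Omega> \<longrightarrow> max (u x - c) 0 = 0)"
        by (rule qe_mono[OF u'(4)]) (use c in auto)
  qed
qed

section \<open>The resolvent\<close>

text \<open>The indicator of a ball is in L2, so Cauchy-Schwarz makes the integral a bounded
  functional; this is what \<open>riesz\<close> asks for in the construction of the
  resolvent.\<close>

lemma H1_mu0_ball_integrable:
  assumes u: "u \<in> H1_mu0 \<mu> (ball 0 R)"
  shows "integrable lebesgue u"
    "\<bar>LINT x|lebesgue. u x\<bar> \<le> l2n lebesgue (\<lambda>x. indicator (cball (0::'a) R) x :: real) * hm.nrm u"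
proof -
  let ?i = "\<lambda>x. indicator (cball (0::'a) R) x :: real"
  note u' = H1_mu0_D[OF u]
  have AE: "AE x in lebesgue. ?i x * u x = u x"
    using qe_AE[OF u'(4)] by eventually_elim (auto simp: indicator_def)
  have int: "integrable lebesgue (\<lambda>x. ?i x * u x)"
      by (rule sqint_mult[OF sqint_indicator_cball H1D(1)[OF u'(1)]])
  show i: "integrable lebesgue u"
    using integrable_cong_AE[THEN iffD1, OF _ _ AE int] borel_measurable_integrable[OF int]
        sqintD[OF H1D(1)[OF u'(1)]] by blast
  have "(LINT x|lebesgue. u x) = (LINT x|lebesgue. ?i x \<bullet> u x)"
    by (rule integral_cong_AE)
      (use AE borel_measurable_integrable[OF int] sqintD[OF H1D(1)[OF u'(1)]] in \<open>auto elim!: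
          eventually_mono\<close>)
  then have "\<bar>LINT x|lebesgue. u x\<bar> \<le> l2n lebesgue ?i * l2n lebesgue u"
    using l2_cauchy_schwarz_inner[OF sqint_indicator_cball H1D(1)[OF u'(1)], of 0 R] by simp
  also have "\<dots> \<le> l2n lebesgue ?i * hm.nrm u" by (intro mult_left_mono l2n_le_hm[OF u]) simp
  finally show "\<bar>LINT x|lebesgue. u x\<bar> \<le> l2n lebesgue ?i * hm.nrm u" .
qed

lemma resolvent_one_exists:
  "\<exists>u\<in>H1_mu0 \<mu> (ball 0 R). \<forall>\<phi>\<in>H1_mu0 \<mu> (ball 0 R). H1_mu_form \<mu> u \<phi> = (LINT x|lebesgue. \<phi> x)"
  by (rule hm.riesz[OF H1_mu0_complete _ H1_mu0_ball_integrable(2)])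
    (simp_all add: H1_mu0_ball_integrable(1))

lemma resolvent_one:
  shows "resolvent_one \<mu> (ball 0 R) \<in> H1_mu0 \<mu> (ball 0 R)"
    "\<And>\<phi>. \<phi> \<in> H1_mu0 \<mu> (ball 0 R) \<Longrightarrow> H1_mu_form \<mu> (resolvent_one \<mu> (ball 0 R)) \<phi>
        = (LINT x|lebesgue. \<phi> x)"
proof -
  \<comment> \<open>\<open>resolvent_one\<close> is defined with test functions from the space of
    the restricted measure, but with the integral over \<open>\<mu>\<close>; identifying the spaces
    reconciles the two.\<close>
  have eq: "H1_mu (dirichlet_restriction \<mu> (ball 0 R)) = H1_mu0 \<mu> (ball 0 R)"
    using H1_mu_dirichlet_restriction[of _ "ball 0 R"] by (auto simp: H1_mu0_def)
  have "\<exists>u. u \<in> H1_mu0 \<mu> (ball 0 R) \<and> (\<forall>\<phi>\<in>H1_mu0 \<mu> (ball 0 R). H1_mu_form \<mu> u \<phi>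
      = (LINT x|lebesgue. \<phi> x))"
    using resolvent_one_exists by blast
  from someI_ex[OF this]
  have "resolvent_one \<mu> (ball 0 R) \<in> H1_mu0 \<mu> (ball 0 R) \<and>
    (\<forall>\<phi>\<in>H1_mu0 \<mu> (ball 0 R). H1_mu_form \<mu> (resolvent_one \<mu> (ball 0 R)) \<phi> = (LINT x|lebesgue. \<phi> x))"
    unfolding resolvent_one_def eq H1_mu_form_def H1_form_def .
  then show "resolvent_one \<mu> (ball 0 R) \<in> H1_mu0 \<mu> (ball 0 R)"
    "\<And>\<phi>. \<phi> \<in> H1_mu0 \<mu> (ball 0 R) \<Longrightarrow> H1_mu_form \<mu> (resolvent_one \<mu> (ball 0 R)) \<phi>
        = (LINT x|lebesgue. \<phi> x)"
    by auto
qed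

text \<open>The negative of the resolvent solves the equation with right-hand side -1, so the
  maximum principle applies to it with \<open>c = 0\<close>.\<close>

lemma resolvent_one_nonneg: "quasi_everywhere (\<lambda>x. 0 \<le> resolvent_one \<mu> (ball 0 R) x)"
proof -
  let ?u = "resolvent_one \<mu> (ball 0 R)"
  have m: "(\<lambda>x. - ?u x) \<in> H1_mu0 \<mu> (ball 0 R)" using hm.scale_mem[OF resolvent_one(1), of "-1" R]
      by simp
  let ?e = "\<lambda>x. max (- ?u x - 0) 0"
  have e: "?e \<in> H1_mu0 \<mu> (ball 0 R)" by (rule H1_mu0_excess[OF m order_refl])
  have "H1_mu_form \<mu> (\<lambda>x. - ?u x) ?e = - H1_mu_form \<mu> ?u ?e"
    using hm.B_scale[OF resolvent_one(1) e, of "-1"] by simp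
  also have "\<dots> = - (LINT x|lebesgue. ?e x)" using resolvent_one(2)[OF e] by simp
  also have "\<dots> \<le> 0" by (simp add: Bochner_Integration.integral_nonneg)
  finally have "quasi_everywhere (\<lambda>x. - ?u x \<le> 0)" by (intro maximum_principle[OF m]) auto
  then show ?thesis by (rule qe_mono) simp
qed

text \<open>For \<open>c = 1\<close> the equation itself is the hypothesis of the maximum principle,
  with equality.\<close>

lemma resolvent_one_le_1: "quasi_everywhere (\<lambda>x. resolvent_one \<mu> (ball 0 R) x \<le> 1)"
  by (rule maximum_principle[OF resolvent_one(1)])
    (use resolvent_one(2)[OF H1_mu0_excess[OF resolvent_one(1), of 1 R]] in auto)

text \<open>The positive part of the difference is an admissible test function for both equations:
  outside the smaller ball the first resolvent is 0 and the second is nonnegative.\<close>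

lemma resolvent_one_mono:
  assumes RS: "R \<le> S"
  shows "quasi_everywhere (\<lambda>x. resolvent_one \<mu> (ball 0 R) x \<le> resolvent_one \<mu> (ball 0 S) x)"
proof -
  let ?u = "resolvent_one \<mu> (ball 0 R)" and ?v = "resolvent_one \<mu> (ball 0 S)"
  let ?z = "\<lambda>x. ?u x - ?v x"
  let ?e = "\<lambda>x. max (?z x - 0) 0"
  have "ball 0 R \<subseteq> ball (0::'a) S" using RS by auto
  from H1_mu0_mono[OF this] have sub: "w \<in> H1_mu0 \<mu> (ball 0 R) \<Longrightarrow> w \<in> H1_mu0 \<mu> (ball 0 S)" for w .
  have uS: "?u \<in> H1_mu0 \<mu> (ball 0 S)" by (rule sub[OF resolvent_one(1)])
  have z: "?z \<in> H1_mu0 \<mu> (ball 0 S)" by (rule hm.diff_mem[OF uS resolvent_one(1)])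
  have eS: "?e \<in> H1_mu0 \<mu> (ball 0 S)" by (rule H1_mu0_excess[OF z order_refl])
  have e: "?e \<in> H1_mu0 \<mu> (ball 0 R)"
  proof (rule H1_mu0_dominated[OF eS H1_mu0_D(1,2)[OF eS], where K=1])
    show "quasi_everywhere (\<lambda>x. x \<notin> ball 0 R \<longrightarrow> ?e x = 0)"
      by (rule qe_mono[OF qe_conj[OF H1_mu0_D(4)[OF resolvent_one(1)] resolvent_one_nonneg[of S]]])
          auto
  qed (auto intro: qe_True)
  have "H1_mu_form \<mu> ?z ?e = H1_mu_form \<mu> ?u ?e - H1_mu_form \<mu> ?v ?e"
    by (rule hm.B_diff[OF uS resolvent_one(1) eS])
  also have "\<dots> = 0" using resolvent_one(2)[OF e] resolvent_one(2)[OF eS] by simp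
  finally have "quasi_everywhere (\<lambda>x. ?z x \<le> 0)" by (intro maximum_principle[OF z]) auto
  then show ?thesis by (rule qe_mono) simp
qed

text \<open>The positive integers give one limit \<open>w\<close>. An arbitrary sequence of radii is
  compared with them in both directions, which takes only countably many quasi-everywhere
  inequalities, and is thereby squeezed to the same limit; this makes the choice in
  \<open>w_mu\<close> meaningful.\<close>

lemma w_mu_limit:
  fixes R :: "nat \<Rightarrow> real"
  assumes "\<And>n. 0 < R n" "filterlim R at_top sequentially"
  shows "quasi_everywhere (\<lambda>x. (\<lambda>n. resolvent_one \<mu> (ball 0 (R n)) x) \<longlonglongrightarrow> w_mu \<mu> x)"
proof -
  define U where "U r = resolvent_one \<mu> (ball (0::'a) r)" for r
  define w where "w x = lim (\<lambda>m. U (real (Suc m)) x)" for x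
  have "\<forall>R::nat \<Rightarrow> real. (\<forall>n. 0 < R n) \<and> filterlim R at_top sequentially \<longrightarrow>
     quasi_everywhere (\<lambda>x. (\<lambda>n. U (R n) x) \<longlonglongrightarrow> w x)"
  proof (intro allI impI)
    fix R :: "nat \<Rightarrow> real" assume "(\<forall>n. 0 < R n) \<and> filterlim R at_top sequentially"
    then have R: "filterlim R at_top sequentially" by simp
    \<comment> \<open>The comparison of the radii is put inside, so that the statement holds for all
      \<open>r\<close> and \<open>s\<close> and \<open>qe_all\<close> can quantify over countable
      families of pairs.\<close>
    have mono: "quasi_everywhere (\<lambda>x. r \<le> s \<longrightarrow> U r x \<le> U s x)" for r s
      by (cases "r \<le> s") (auto simp: U_def intro: qe_True resolvent_one_mono)
    have 1: "quasi_everywhere (\<lambda>x. \<forall>m. \<forall>n. real (Suc m) \<le> real (Suc n) \<longrightarrow> U (real (Suc m)) x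
        \<le> U (real (Suc n)) x)"
      by (intro qe_all mono)
    have 2: "quasi_everywhere (\<lambda>x. \<forall>m. \<forall>n. real (Suc m) \<le> R n \<longrightarrow> U (real (Suc m)) x \<le> U (R n) x)"
      by (intro qe_all mono)
    have 3: "quasi_everywhere (\<lambda>x. \<forall>m. \<forall>n. R n \<le> real (Suc m) \<longrightarrow> U (R n) x \<le> U (real (Suc m)) x)"
      by (intro qe_all mono)
    have 4: "quasi_everywhere (\<lambda>x. \<forall>m. U (real (Suc m)) x \<le> 1)"
      unfolding U_def by (intro qe_all resolvent_one_le_1)
    show "quasi_everywhere (\<lambda>x. (\<lambda>n. U (R n) x) \<longlonglongrightarrow> w x)"
    proof (rule qe_mono[OF qe_conj[OF qe_conj[OF 1 2] qe_conj[OF 3 4]]])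
      fix x
      assume *: "((\<forall>m n. real (Suc m) \<le> real (Suc n) \<longrightarrow> U (real (Suc m)) x \<le> U (real (Suc n)) x) \<and>
          (\<forall>m n. real (Suc m) \<le> R n \<longrightarrow> U (real (Suc m)) x \<le> U (R n) x)) \<and>
         (\<forall>m n. R n \<le> real (Suc m) \<longrightarrow> U (R n) x \<le> U (real (Suc m)) x) \<and> (\<forall>m. U (real (Suc m)) x \<le> 1)"
      define a where "a m = U (real (Suc m)) x" for m
      have inc: "incseq a" using * by (auto simp: incseq_def a_def)
      have "\<And>m. a m \<le> 1" using * by (simp add: a_def)
      then obtain L where L: "a \<longlonglongrightarrow> L" "\<And>m. a m \<le> L" using incseq_convergent[OF inc] by blast
      have w: "w x = L" using L(1) by (simp add: w_def a_def[abs_def] limI)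
      show "(\<lambda>n. U (R n) x) \<longlonglongrightarrow> w x" unfolding w
      proof (rule LIMSEQ_I)
        fix e :: real assume e: "e > 0"
        have "\<forall>\<^sub>F m in sequentially. L - e < a m" using order_tendstoD(1)[OF L(1)] e by simp
        then obtain m where m: "L - e < a m" unfolding eventually_sequentially by blast
        have "\<forall>\<^sub>F n in sequentially. real (Suc m) \<le> R n" using R unfolding filterlim_at_top by blast
        then obtain N where N: "\<And>n. n \<ge> N \<Longrightarrow> real (Suc m) \<le> R n" unfolding eventually_sequentially
            by blast
        have "norm (U (R n) x - L) < e" if "n \<ge> N" for n
        proof -
          obtain k where "R n \<le> real k" using real_arch_simple by blast
          then have "R n \<le> real (Suc k)" by simp
          then have "U (R n) x \<le> a k" using * unfolding a_def by blast
          moreover have "a m \<le> U (R n) x" using * N[OF that] unfolding a_def by blast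
          ultimately show ?thesis using L(2)[of k] m by simp
        qed
        then show "\<exists>N. \<forall>n\<ge>N. norm (U (R n) x - L) < e" by blast
      qed
    qed
  qed
  then have "\<exists>w. \<forall>R::nat \<Rightarrow> real. (\<forall>n. 0 < R n) \<and> filterlim R at_top sequentially \<longrightarrow>
     quasi_everywhere (\<lambda>x. (\<lambda>n. resolvent_one \<mu> (ball 0 (R n)) x) \<longlonglongrightarrow> w x)"
    unfolding U_def by blast
  from someI_ex[OF this] assms show ?thesis unfolding w_mu_def by blast
qed

end

section \<open>Cutoff functions\<close>

text \<open>Since \<open>bump 0 e 0 = exp (- 1)\<close>, the value at the origin is \<open>1\<close>.\<close>

definition cutoff :: "real \<Rightarrow> 'a::euclidean_space \<Rightarrow> real" where
  "cutoff e y = exp 1 * bump 0 e y"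

lemma test_function_cutoff:
  assumes "e > 0" shows "test_function (cutoff e :: 'a::euclidean_space \<Rightarrow> real)"
proof (rule test_functionI[where R=e])
  have "C_k k (bump (0::'a) e)" for k using test_function_bump[OF assms, of "0::'a"]
      by (simp add: test_function_def)
  then show "C_k k (cutoff e :: 'a \<Rightarrow> real)" for k
    unfolding cutoff_def[abs_def] by (intro C_k_mult C_k_const)
  show "cutoff e x = 0" if "norm x > e" for x :: 'a
    using bump_eq_0[OF assms, of x 0] that by (simp add: cutoff_def)
qed

lemma cutoff_nonneg [simp]: "0 \<le> cutoff e y"
  by (simp add: cutoff_def)

lemma cutoff_le_1: "cutoff e y \<le> 1"
proof -
  let ?t = "1 - (norm (y - 0))\<^sup>2 / e\<^sup>2"
  have "bump 0 e y \<le> exp (- 1)"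
  proof (cases "?t > 0")
    case True
    then have "1 \<le> inverse ?t" by (intro one_le_inverse) auto
    then show ?thesis using True by (simp add: bump_def exp_inv_def)
  qed (simp add: bump_def exp_inv_def)
  then have "exp 1 * bump 0 e y \<le> exp 1 * exp (- 1)" by (intro mult_left_mono) auto
  then show ?thesis by (simp add: cutoff_def flip: exp_add)
qed

lemma abs_1_minus_cutoff: "\<bar>1 - cutoff e y\<bar> \<le> 1"
  using cutoff_le_1[of e y] cutoff_nonneg[of e y] by linarith

lemma cutoff_contract: "\<bar>1 - cutoff e x\<bar> * norm y \<le> norm y"
  using mult_right_mono[OF abs_1_minus_cutoff norm_ge_zero, of e x y] by simp

lemma cutoff_eq_0: "e > 0 \<Longrightarrow> e \<le> norm y \<Longrightarrow> cutoff e y = 0"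
  using bump_eq_0[of e y 0] by (simp add: cutoff_def)

lemma cutoff_tendsto: "(\<lambda>n. cutoff (real (Suc n)) y) \<longlonglongrightarrow> 1"
proof -
  have "(\<lambda>n. 1 - (norm y)\<^sup>2 * (1 / real (Suc n))\<^sup>2) \<longlonglongrightarrow> 1 - (norm y)\<^sup>2 * 0\<^sup>2"
    by (intro tendsto_intros LIMSEQ_Suc[OF lim_1_over_n])
  then have *: "(\<lambda>n. 1 - (norm (y - 0))\<^sup>2 / (real (Suc n))\<^sup>2) \<longlonglongrightarrow> 1" by (simp add: power_divide)
  have "isCont (exp_inv 0) 1" using continuous_exp_inv[of 0]
      by (simp add: continuous_on_eq_continuous_at)
  from isCont_tendsto_compose[OF this *]
  have "(\<lambda>n. exp 1 * bump 0 (real (Suc n)) y) \<longlonglongrightarrow> exp 1 * exp_inv 0 1"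
    unfolding bump_def by (intro tendsto_mult tendsto_const)
  then show ?thesis by (simp add: cutoff_def exp_inv_def flip: exp_add)
qed

lemma cutoff_scale: "e > 0 \<Longrightarrow> cutoff e y = cutoff 1 ((1/e) *\<^sub>R y)"
  by (simp add: cutoff_def bump_def power_divide)

text \<open>All cutoffs are dilations of one function, so the gradient bound scales like
  \<open>1/e\<close>.\<close>

lemma tgrad_cutoff_bound:
  obtains K where "K \<ge> 0" "\<And>e y. e > 0 \<Longrightarrow> norm (tgrad (cutoff e) (y::'a::euclidean_space)) \<le> K / e"
proof -
  obtain K where K: "K > 0" "\<And>y::'a. norm (tgrad (cutoff 1) y) \<le> K"
    using cbs_bounded[OF cbs_tgrad[OF test_function_cutoff[OF zero_less_one]]] by blast
  have "norm (tgrad (cutoff e) y) \<le> K / e" if e: "e > 0" for e and y :: 'a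
  proof -
    let ?g = "tgrad (cutoff 1) ((1/e) *\<^sub>R y)"
    have "(cutoff 1 has_derivative (\<lambda>h. ?g \<bullet> h)) (at ((1/e) *\<^sub>R y))"
      by (rule test_function_has_derivative[OF test_function_cutoff]) simp
    moreover have "((\<lambda>y. (1/e) *\<^sub>R y) has_derivative (\<lambda>h. (1/e) *\<^sub>R h)) (at y)"
      by (auto intro!: derivative_eq_intros)
    ultimately have "((\<lambda>y. cutoff 1 ((1/e) *\<^sub>R y)) has_derivative (\<lambda>h. ?g \<bullet> ((1/e) *\<^sub>R h))) (at y)"
      by (rule has_derivative_compose[rotated])
    moreover have "(\<lambda>y::'a. cutoff 1 ((1/e) *\<^sub>R y)) = cutoff e"
        by (rule ext) (rule cutoff_scale[OF e, symmetric])
    ultimately have "(cutoff e has_derivative (\<lambda>h. ?g \<bullet> ((1/e) *\<^sub>R h))) (at y)" by (simp only:)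
    from has_derivative_unique[OF this test_function_has_derivative[OF test_function_cutoff[OF e]]]
    have "((1/e) *\<^sub>R ?g) \<bullet> h = tgrad (cutoff e) y \<bullet> h" for h
      by (simp add: fun_eq_iff)
    then have "tgrad (cutoff e) y = (1/e) *\<^sub>R ?g" by (metis vector_eq_rdot)
    then show ?thesis using K(2)[of "(1/e) *\<^sub>R y"] e by (simp add: divide_right_mono)
  qed
  then show ?thesis using that[of K] K(1) by simp
qed

lemma continuous_cutoff: "e > 0 \<Longrightarrow> continuous_on UNIV (cutoff e :: 'a::euclidean_space \<Rightarrow> real)"
  by (simp only: test_function_cbs[OF test_function_cutoff, unfolded cbs_def, THEN conjunct1])

text \<open>The measure is left general, with continuous functions measurable, because both
  \<open>lebesgue\<close> and \<open>completion \<mu>\<close> occur; the factors are at most 1 and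
  tend to 0 pointwise.\<close>

lemma l2n_cutoff_tendsto:
  fixes f :: "'a::euclidean_space \<Rightarrow> 'b::euclidean_space"
  assumes f: "sqint M f" and M: "\<And>g :: 'a \<Rightarrow> real. continuous_on UNIV g \<Longrightarrow> g \<in> borel_measurable M"
  shows "(\<lambda>n. l2n M (\<lambda>x. (1 - cutoff (real (Suc n)) x) *\<^sub>R f x)) \<longlonglongrightarrow> 0"
proof -
  have [measurable]: "cutoff (real (Suc n)) \<in> borel_measurable M" for n
    by (rule M[OF continuous_cutoff]) simp
  have [measurable]: "f \<in> borel_measurable M" by (rule sqintD[OF f])
  have "(\<lambda>n. LINT x|M. (norm ((1 - cutoff (real (Suc n)) x) *\<^sub>R f x))\<^sup>2) \<longlonglongrightarrow> (LINT x|M. 0)"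
  proof (rule integral_dominated_convergence[OF _ _ sqint_int[OF f]])
    show "AE x in M. (\<lambda>n. (norm ((1 - cutoff (real (Suc n)) x) *\<^sub>R f x))\<^sup>2) \<longlonglongrightarrow> 0"
    proof (rule AE_I2)
      fix x
      have "(\<lambda>n. (norm ((1 - cutoff (real (Suc n)) x) *\<^sub>R f x))\<^sup>2) \<longlonglongrightarrow> (norm ((1 - 1) *\<^sub>R f x))\<^sup>2"
        by (intro tendsto_intros cutoff_tendsto)
      then show "(\<lambda>n. (norm ((1 - cutoff (real (Suc n)) x) *\<^sub>R f x))\<^sup>2) \<longlonglongrightarrow> 0" by simp
    qed
    show "AE x in M. norm ((norm ((1 - cutoff (real (Suc n)) x) *\<^sub>R f x))\<^sup>2) \<le> (norm (f x))\<^sup>2" for n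
    proof (rule AE_I2)
      fix x
      have "\<bar>1 - cutoff (real (Suc n)) x\<bar> * norm (f x) \<le> 1 * norm (f x)"
        using cutoff_le_1[of "real (Suc n)" x] by (intro mult_right_mono) (auto simp: abs_if)
      then have "(norm ((1 - cutoff (real (Suc n)) x) *\<^sub>R f x))\<^sup>2 \<le> (norm (f x))\<^sup>2"
        by (intro power_mono) auto
      then show "norm ((norm ((1 - cutoff (real (Suc n)) x) *\<^sub>R f x))\<^sup>2) \<le> (norm (f x))\<^sup>2" by simp
    qed
  qed measurable
  then have "(\<lambda>n. sqrt (LINT x|M. (norm ((1 - cutoff (real (Suc n)) x) *\<^sub>R f x))\<^sup>2)) \<longlonglongrightarrow> sqrt 0"
    by (intro tendsto_real_sqrt) simp
  then show ?thesis by (simp add: l2n_def)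
qed

lemma sqint_1_minus_cutoff:
  fixes f :: "'a::euclidean_space \<Rightarrow> 'b::euclidean_space"
  assumes f: "sqint M f" and M: "\<And>g :: 'a \<Rightarrow> real. continuous_on UNIV g
      \<Longrightarrow> g \<in> borel_measurable M" and e: "e > 0"
  shows "sqint M (\<lambda>x. (1 - cutoff e x) *\<^sub>R f x)"
proof (rule sqint_bound[OF f, where c=1])
  show "AE x in M. norm ((1 - cutoff e x) *\<^sub>R f x) \<le> 1 * norm (f x)"
    by (intro AE_I2) (simp add: cutoff_contract)
  show "(\<lambda>x. (1 - cutoff e x) *\<^sub>R f x) \<in> borel_measurable M"
    using M[OF continuous_cutoff[OF e]] sqintD[OF f] by measurable
qed

lemma continuous_lebesgue_measurable:
  "continuous_on UNIV g \<Longrightarrow> g \<in> borel_measurable lebesgue" for g :: "'a::euclidean_space \<Rightarrow> real"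
  by (intro borel_imp_lebesgue borel_measurable_continuous_onI)

context capacitary_measure
begin

lemma continuous_mu_measurable:
  "continuous_on UNIV g \<Longrightarrow> g \<in> borel_measurable (completion \<mu>)" for g :: "'a \<Rightarrow> real"
  by (intro qc_measurable quasi_continuous_continuous)

lemma cutoff_mult:
  assumes u: "u \<in> H1_mu0 \<mu> \<Omega>" and e: "e > 0"
  shows "(\<lambda>x. cutoff e x * u x) \<in> H1_mu0 \<mu> (ball 0 e)"
proof (rule H1_mu0_dominated[OF u, where K=1])
  note u' = H1_mu0_D[OF u]
  show "(\<lambda>x. cutoff e x * u x) \<in> H1" by (rule H1_test_mult(1)[OF u'(1) test_function_cutoff[OF e]])
  show "quasi_continuous (\<lambda>x. cutoff e x * u x)"
    by (intro quasi_continuous_mult u' quasi_continuous_continuous continuous_cutoff e)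
  show "quasi_everywhere (\<lambda>x. \<bar>cutoff e x * u x\<bar> \<le> 1 * \<bar>u x\<bar>)"
    by (rule qe_True) (auto simp: abs_mult cutoff_le_1 intro!: mult_left_le_one_le)
  show "quasi_everywhere (\<lambda>x. x \<notin> ball 0 e \<longrightarrow> cutoff e x * u x = 0)"
    by (rule qe_True) (auto simp: cutoff_eq_0[OF e])
qed

lemma l2n_tgrad_cutoff:
  fixes u :: "'b::euclidean_space \<Rightarrow> real"
  assumes u: "sqint lebesgue u" and K: "K \<ge> 0" "\<And>y. norm (tgrad (cutoff e) (y::'b)) \<le> K" and e:
      "e > 0"
  shows "sqint lebesgue (\<lambda>x. u x *\<^sub>R tgrad (cutoff e) x)"
    "l2n lebesgue (\<lambda>x. u x *\<^sub>R tgrad (cutoff e) x) \<le> K * l2n lebesgue u"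
proof -
  show s: "sqint lebesgue (\<lambda>x. u x *\<^sub>R tgrad (cutoff e) x)"
    by (rule sqint_mult_cbs[OF cbs_tgrad[OF test_function_cutoff[OF e]] u])
  have "norm (u x *\<^sub>R tgrad (cutoff e) x) \<le> norm (K *\<^sub>R u x)" for x
    using mult_left_mono[OF K(2)[of x], of "\<bar>u x\<bar>"] K(1) by (simp add: abs_mult mult.commute)
  then have "l2n lebesgue (\<lambda>x. u x *\<^sub>R tgrad (cutoff e) x) \<le> l2n lebesgue (\<lambda>x. K *\<^sub>R u x)"
    by (rule l2n_mono[OF sqint_scaleR[OF u] sqintD[OF s] AE_I2])
  then show "l2n lebesgue (\<lambda>x. u x *\<^sub>R tgrad (cutoff e) x) \<le> K * l2n lebesgue u"
    using K(1) by (simp only: l2n_scaleR abs_of_nonneg)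
qed

text \<open>The bound is uniform in the radius: for \<open>e \<ge> 1\<close> the derivative falling
  on the cutoff is at most \<open>K / e \<le> K\<close>.\<close>

lemma cutoff_nrm:
  "\<exists>C\<ge>0. \<forall>\<Omega>. \<forall>u\<in>H1_mu0 \<mu> \<Omega>. \<forall>e\<ge>1. hm.nrm (\<lambda>x. cutoff e x * u x) \<le> C * hm.nrm u"
proof -
  obtain K where K: "K \<ge> 0" "\<And>e y. e > 0 \<Longrightarrow> norm (tgrad (cutoff e) (y::'a)) \<le> K / e"
    using tgrad_cutoff_bound by metis
  \<comment> \<open>The gradient, the function and the \<open>\<mu>\<close>-part contribute
    \<open>1 + K\<close>, \<open>1\<close> and \<open>1\<close>.\<close>
  have "hm.nrm (\<lambda>x. cutoff e x * u x) \<le> (3 + K) * hm.nrm u" if u: "u \<in> H1_mu0 \<mu> \<Omega>" and e: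
      "e \<ge> 1" for u \<Omega> e
  proof -
    note u' = H1_mu0_D[OF u]
    have e0: "e > 0" using e by simp
    let ?v = "\<lambda>x. cutoff e x * u x"
    have v: "?v \<in> H1_mu0 \<mu> (ball 0 e)" by (rule cutoff_mult[OF u e0])
    note v' = H1_mu0_D[OF v]
    have Ke: "norm (tgrad (cutoff e) y) \<le> K" for y :: 'a
      using K(2)[OF e0, of y] K(1) e order_trans[OF _ divide_left_mono[of 1 e K]] by fastforce
    note t = l2n_tgrad_cutoff[OF H1D(1)[OF u'(1)] K(1) Ke e0]
    have c: "norm (cutoff e x *\<^sub>R y) \<le> norm y" for x y :: 'a
      using cutoff_le_1[of e x] by (simp add: mult_left_le_one_le)
    have c': "norm (cutoff e x * y) \<le> norm y" for x :: 'a and y :: real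
      using cutoff_le_1[of e x] by (simp add: abs_mult mult_left_le_one_le)
    have s: "sqint lebesgue (\<lambda>x. cutoff e x *\<^sub>R grad u x)"
      by (rule sqint_cbs_mult[OF test_function_cbs[OF test_function_cutoff[OF e0]] H1D(2)[OF
          u'(1)]])
    have "l2n lebesgue (grad ?v) = l2n lebesgue (\<lambda>x. cutoff e x *\<^sub>R grad u x
        + u x *\<^sub>R tgrad (cutoff e) x)"
      by (rule l2n_cong_AE[OF H1_test_mult(2)[OF u'(1) test_function_cutoff[OF e0]] sqintD[OF
          H1D(2)[OF v'(1)]]
            sqintD[OF sqint_add[OF s t(1)]]])
    also have "\<dots> \<le> l2n lebesgue (\<lambda>x. cutoff e x *\<^sub>R grad u x)
        + l2n lebesgue (\<lambda>x. u x *\<^sub>R tgrad (cutoff e) x)"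
      by (rule l2n_triangle[OF s t(1)])
    also have "\<dots> \<le> l2n lebesgue (grad u) + K * l2n lebesgue u"
      by (rule add_mono[OF l2n_mono[OF H1D(2)[OF u'(1)] sqintD[OF s] AE_I2[OF c]] t(2)])
    finally have 1: "l2n lebesgue (grad ?v) \<le> l2n lebesgue (grad u) + K * l2n lebesgue u" .
    have 2: "l2n lebesgue ?v \<le> l2n lebesgue u"
      by (rule l2n_mono[OF H1D(1)[OF u'(1)] sqintD[OF H1D(1)[OF v'(1)]] AE_I2[OF c']])
    have 3: "l2n (completion \<mu>) ?v \<le> l2n (completion \<mu>) u"
      by (rule l2n_mono[OF u'(3) sqintD[OF v'(3)] AE_I2[OF c']])
    have "K * l2n lebesgue u \<le> K * hm.nrm u" by (intro mult_left_mono l2n_le_hm[OF u] K)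
    then show ?thesis
      using hm_nrm_le[OF v] h1_nrm_le[OF v'(1)] 1 2 3 l2n_le_hm[OF u] l2n_grad_le_hm[OF u]
          l2n_mu_le_hm[OF u]
      by (simp add: algebra_simps)
  qed
  then show ?thesis using K(1) by (intro exI[of _ "3 + K"]) auto
qed

section \<open>Integrability of the torsion function and the embedding into $L^1$\<close>

lemma w_mu_Suc:
  "quasi_everywhere (\<lambda>x. (\<lambda>n. resolvent_one \<mu> (ball 0 (real (Suc n))) x) \<longlonglongrightarrow> w_mu \<mu> x
     \<and> incseq (\<lambda>n. resolvent_one \<mu> (ball 0 (real (Suc n))) x) \<and> 0
         \<le> resolvent_one \<mu> (ball 0 (real (Suc 0))) x)"
proof -
  let ?u = "\<lambda>n. resolvent_one \<mu> (ball 0 (real (Suc n)))"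
  have 1: "quasi_everywhere (\<lambda>x. (\<lambda>n. ?u n x) \<longlonglongrightarrow> w_mu \<mu> x)"
    by (rule w_mu_limit[OF _ filterlim_compose[OF filterlim_real_sequentially filterlim_Suc]]) simp
  have 2: "quasi_everywhere (\<lambda>x. \<forall>n. ?u n x \<le> ?u (Suc n) x)"
    by (intro qe_all resolvent_one_mono) simp
  show ?thesis
    by (rule qe_mono[OF qe_conj[OF 1 qe_conj[OF 2 resolvent_one_nonneg[of "real (Suc 0)"]]]])
      (auto intro: incseq_SucI)
qed

lemma w_mu_AE:
  "AE x in lebesgue. (\<lambda>n. resolvent_one \<mu> (ball 0 (real (Suc n))) x) \<longlonglongrightarrow> w_mu \<mu> x
     \<and> (\<forall>n. 0 \<le> resolvent_one \<mu> (ball 0 (real (Suc n))) x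
         \<and> resolvent_one \<mu> (ball 0 (real (Suc n))) x \<le> w_mu \<mu> x)"
  using qe_AE[OF w_mu_Suc]
proof eventually_elim
  case (elim x)
  let ?a = "\<lambda>n. resolvent_one \<mu> (ball 0 (real (Suc n))) x"
  have "0 \<le> ?a n" for n using elim incseqD[of ?a 0 n] by fastforce
  moreover have "?a n \<le> w_mu \<mu> x" for n using elim by (intro incseq_le) auto
  ultimately show ?case using elim by blast
qed

lemma resolvent_one_nrm_sq:
  "(hm.nrm (resolvent_one \<mu> (ball 0 R)))\<^sup>2 = (LINT x|lebesgue. resolvent_one \<mu> (ball 0 R) x)"
  using hm.nrm_sq[OF resolvent_one(1)] resolvent_one(2)[OF resolvent_one(1)] by simp

lemma ball_L1_bound:
  assumes w: "integrable lebesgue (w_mu \<mu>)" and \<phi>: "\<phi> \<in> H1_mu0 \<mu> (ball 0 (real (Suc n)))"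
  shows "(LINT x|lebesgue. \<bar>\<phi> x\<bar>) \<le> sqrt (LINT x|lebesgue. w_mu \<mu> x) * hm.nrm \<phi>"
proof -
  let ?u = "resolvent_one \<mu> (ball 0 (real (Suc n)))"
  note a = H1_mu0_abs[OF \<phi>]
  have "(LINT x|lebesgue. ?u x) \<le> (LINT x|lebesgue. w_mu \<mu> x)"
    by (rule integral_mono_AE[OF H1_mu0_ball_integrable(1)[OF resolvent_one(1)] w])
      (use w_mu_AE in eventually_elim, blast)
  then have "hm.nrm ?u \<le> sqrt (LINT x|lebesgue. w_mu \<mu> x)"
    by (intro real_le_rsqrt) (simp only: resolvent_one_nrm_sq)
  then have "hm.nrm ?u * hm.nrm (\<lambda>x. \<bar>\<phi> x\<bar>) \<le> sqrt (LINT x|lebesgue. w_mu \<mu> x) * hm.nrm \<phi>"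
    using order_trans[OF hm.nrm_nonneg[OF resolvent_one(1)]]
    by (intro mult_mono a(2) hm.nrm_nonneg[OF a(1)]) blast+
  moreover have "(LINT x|lebesgue. \<bar>\<phi> x\<bar>) \<le> hm.nrm ?u * hm.nrm (\<lambda>x. \<bar>\<phi> x\<bar>)"
    using hm.cauchy_schwarz[OF resolvent_one(1) a(1)] resolvent_one(2)[OF a(1)] by simp
  ultimately show ?thesis by linarith
qed

lemma embedded_if_torsion_integrable:
  assumes w: "integrable lebesgue (w_mu \<mu>)"
  shows "continuously_embedded_L1 \<mu>"
proof -
  obtain C where C: "C \<ge> 0" "\<And>\<Omega> u e. u \<in> H1_mu0 \<mu> \<Omega> \<Longrightarrow> e \<ge> 1 \<Longrightarrow> hm.nrm (\<lambda>x. cutoff e x * u x)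
      \<le> C * hm.nrm u"
    using cutoff_nrm by blast
  let ?s = "sqrt (LINT x|lebesgue. w_mu \<mu> x)"
  \<comment> \<open>The absolute value makes the constant visibly nonnegative.\<close>
  have main: "integrable lebesgue u \<and> (LINT x|lebesgue. \<bar>u x\<bar>) \<le> (\<bar>?s\<bar> * C) * hm.nrm u" if
      "u \<in> H1_mu \<mu>" for u
  proof -
    from that have u: "u \<in> H1_mu0 \<mu> UNIV" by simp
    note u' = H1_mu0_D[OF u]
    have [measurable]: "u \<in> borel_measurable lebesgue" by (rule sqintD[OF H1D(1)[OF u'(1)]])
    let ?B = "(\<bar>?s\<bar> * C) * hm.nrm u"
    have B0: "0 \<le> ?B" using C(1) hm.nrm_nonneg[OF u] by simp
    let ?v = "\<lambda>n x. cutoff (real (Suc n)) x * u x"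
    have v: "?v n \<in> H1_mu0 \<mu> (ball 0 (real (Suc n)))" for n by (rule cutoff_mult[OF u]) simp
    have [measurable]: "?v n \<in> borel_measurable lebesgue" for n
        by (rule sqintD[OF H1D(1)[OF H1_mu0_D(1)[OF v]]])
    have vi: "(\<integral>\<^sup>+x. ennreal \<bar>?v n x\<bar> \<partial>lebesgue) \<le> ennreal ?B" for n
    proof -
      have "(\<integral>\<^sup>+x. ennreal \<bar>?v n x\<bar> \<partial>lebesgue) = ennreal (LINT x|lebesgue. \<bar>?v n x\<bar>)"
        by (rule nn_integral_eq_integral[OF integrable_abs[OF H1_mu0_ball_integrable(1)[OF v]]])
            simp
      moreover have "(LINT x|lebesgue. \<bar>?v n x\<bar>) \<le> ?B"
      proof -
        have "(LINT x|lebesgue. \<bar>?v n x\<bar>) \<le> ?s * hm.nrm (?v n)" by (rule ball_L1_bound[OF w v])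
        also have "\<dots> \<le> \<bar>?s\<bar> * (C * hm.nrm u)"
          by (intro mult_mono C(2)[OF u] hm.nrm_nonneg[OF v]) auto
        finally show ?thesis by (simp add: mult.assoc)
      qed
      ultimately show ?thesis by (simp add: ennreal_leI)
    qed
    have "(\<integral>\<^sup>+x. ennreal \<bar>u x\<bar> \<partial>lebesgue) = (\<integral>\<^sup>+x. liminf (\<lambda>n. ennreal \<bar>?v n x\<bar>) \<partial>lebesgue)"
    proof (rule nn_integral_cong)
      fix x
      have "(\<lambda>n. ennreal \<bar>?v n x\<bar>) \<longlonglongrightarrow> ennreal \<bar>1 * u x\<bar>" by (intro tendsto_intros cutoff_tendsto)
      from lim_imp_Liminf[OF sequentially_bot this] show
          "ennreal \<bar>u x\<bar> = liminf (\<lambda>n. ennreal \<bar>?v n x\<bar>)" by simp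
    qed
    \<comment> \<open>Fatou's lemma for the cutoffs of \<open>u\<close> yields integrability and the
      bound at once.\<close>
    also have "\<dots> \<le> liminf (\<lambda>n. \<integral>\<^sup>+x. ennreal \<bar>?v n x\<bar> \<partial>lebesgue)"
      by (rule nn_integral_liminf) measurable
    also have "\<dots> \<le> ennreal ?B" by (rule Liminf_le) (use vi in auto)
    finally have n: "(\<integral>\<^sup>+x. ennreal \<bar>u x\<bar> \<partial>lebesgue) \<le> ennreal ?B" .
    then have i: "integrable lebesgue u" by (intro integrableI_bounded) (auto simp: le_less_trans)
    have "ennreal (LINT x|lebesgue. \<bar>u x\<bar>) \<le> ennreal ?B"
      using n nn_integral_eq_integral[OF integrable_abs[OF i]] by simp
    then show ?thesis using i B0 by simp
  qed
  show ?thesis unfolding continuously_embedded_L1_def L1_def L1_norm_def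
    using main by (auto simp: H1_mu_norm_eq intro!: exI[of _ "\<bar>?s\<bar> * C"])
qed

lemma torsion_integrable_if_embedded:
  assumes "continuously_embedded_L1 \<mu>"
  shows "integrable lebesgue (w_mu \<mu>)"
proof -
  obtain C where C: "\<And>u. u \<in> H1_mu \<mu> \<Longrightarrow> (LINT x|lebesgue. \<bar>u x\<bar>) \<le> C * H1_mu_norm \<mu> u"
    using assms by (auto simp: continuously_embedded_L1_def L1_norm_def)
  let ?u = "\<lambda>n. resolvent_one \<mu> (ball 0 (real (Suc n)))"
  have u: "?u n \<in> H1_mu0 \<mu> (ball 0 (real (Suc n)))" for n by (rule resolvent_one(1))
  have um: "?u n \<in> H1_mu \<mu>" for n using H1_mu0_mono[OF subset_UNIV u] by simp
  have [measurable]: "?u n \<in> borel_measurable lebesgue" for n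
      by (rule sqintD[OF H1D(1)[OF H1_mu0_D(1)[OF u]]])
  have ui: "(\<integral>\<^sup>+x. ennreal \<bar>?u n x\<bar> \<partial>lebesgue) \<le> ennreal (C\<^sup>2)" for n
  proof -
    let ?N = "hm.nrm (?u n)"
    have N0: "0 \<le> ?N" by (rule hm.nrm_nonneg[OF u])
    have i: "integrable lebesgue (?u n)" by (rule H1_mu0_ball_integrable(1)[OF u])
    have "?N\<^sup>2 \<le> (LINT x|lebesgue. \<bar>?u n x\<bar>)"
      unfolding resolvent_one_nrm_sq by (intro integral_mono i integrable_abs) auto
    also have le: "\<dots> \<le> C * ?N" using C[OF um] H1_mu_norm_eq[OF um] by simp
    finally have *: "?N * ?N \<le> C * ?N" by (simp add: power2_eq_square)
    \<comment> \<open>\<open>C\<close> is an arbitrary real number. For \<open>?N = 0\<close> the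
      claim is trivial; otherwise dividing by \<open>?N\<close> gives
      \<open>?N \<le> C\<close>.\<close>
    have "C * ?N \<le> C\<^sup>2"
    proof (cases "?N = 0")
      case False
      then have "?N \<le> C" using * N0 by simp
      then show ?thesis using N0 by (simp add: power2_eq_square mult_left_mono)
    qed simp
    then have "(LINT x|lebesgue. \<bar>?u n x\<bar>) \<le> C\<^sup>2" using le by linarith
    then show ?thesis
      using nn_integral_eq_integral[OF integrable_abs[OF i]] by (simp add: ennreal_leI)
  qed
  have lim: "AE x in lebesgue. (\<lambda>n. ?u n x) \<longlonglongrightarrow> w_mu \<mu> x" using w_mu_AE by eventually_elim simp
  have wm[measurable]: "w_mu \<mu> \<in> borel_measurable lebesgue"
  proof (rule borel_measurable_completion_AE)
    show "(\<lambda>x. lim (\<lambda>n. ?u n x)) \<in> borel_measurable lebesgue" by measurable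
    show "AE x in lebesgue. lim (\<lambda>n. ?u n x) = w_mu \<mu> x" using lim by eventually_elim (rule limI)
  qed
  have "(\<integral>\<^sup>+x. ennreal \<bar>w_mu \<mu> x\<bar> \<partial>lebesgue) = (\<integral>\<^sup>+x. liminf (\<lambda>n. ennreal \<bar>?u n x\<bar>) \<partial>lebesgue)"
  proof (rule nn_integral_cong_AE)
    show "AE x in lebesgue. ennreal \<bar>w_mu \<mu> x\<bar> = liminf (\<lambda>n. ennreal \<bar>?u n x\<bar>)"
      using lim
    proof eventually_elim
      case (elim x)
      have "(\<lambda>n. ennreal \<bar>?u n x\<bar>) \<longlonglongrightarrow> ennreal \<bar>w_mu \<mu> x\<bar>" by (intro tendsto_intros elim)
      from lim_imp_Liminf[OF sequentially_bot this] show ?case by simp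
    qed
  qed
  also have "\<dots> \<le> liminf (\<lambda>n. \<integral>\<^sup>+x. ennreal \<bar>?u n x\<bar> \<partial>lebesgue)"
    by (rule nn_integral_liminf) measurable
  also have "\<dots> \<le> ennreal (C\<^sup>2)" by (rule Liminf_le) (use ui in auto)
  finally show ?thesis by (intro integrableI_bounded wm) (auto simp: le_less_trans)
qed

section \<open>Compactness\<close>

text \<open>The sequence \<open>\<delta>\<close> is the same for all \<open>u\<close>. With
  \<open>\<eta>\<close> the cutoff, the gradient of \<open>(1 - \<eta>) * |u|\<close> is
  \<open>1 - \<eta>\<close> times the gradient of \<open>|u|\<close>, whose factor is moved to
  \<open>W\<close>, minus \<open>|u|\<close> times the gradient of \<open>\<eta>\<close>, which is
  of order \<open>1/n\<close>.\<close>

lemma tail_bound: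
  assumes emb: "continuously_embedded_L1 \<mu>"
  shows "\<exists>\<delta>. \<delta> \<longlonglongrightarrow> 0 \<and> (\<forall>n. \<forall>u\<in>H1_mu \<mu>. (LINT x|lebesgue. (1 - cutoff (real (Suc n)) x) * \<bar>u x\<bar>)
      \<le> \<delta> n * hm.nrm u)"
proof -
  obtain C where C: "\<And>u. u \<in> H1_mu \<mu> \<Longrightarrow> integrable lebesgue u"
      "\<And>u. u \<in> H1_mu \<mu> \<Longrightarrow> (LINT x|lebesgue. \<bar>u x\<bar>) \<le> C * H1_mu_norm \<mu> u"
    using emb by (auto simp: continuously_embedded_L1_def L1_norm_def L1_def)
  have "\<exists>W\<in>H1_mu0 \<mu> UNIV. \<forall>\<phi>\<in>H1_mu0 \<mu> UNIV. H1_mu_form \<mu> W \<phi> = (LINT x|lebesgue. \<phi> x)"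
  proof (rule hm.riesz[OF H1_mu0_complete])
    fix u v c assume uv: "u \<in> H1_mu0 \<mu> UNIV" "v \<in> H1_mu0 \<mu> UNIV"
    show "(LINT x|lebesgue. u x + c * v x) = (LINT x|lebesgue. u x) + c * (LINT x|lebesgue. v x)"
      using uv C(1) by simp
  next
    fix u assume u: "u \<in> H1_mu0 \<mu> UNIV"
    have "\<bar>LINT x|lebesgue. u x\<bar> \<le> (LINT x|lebesgue. \<bar>u x\<bar>)" by (rule integral_abs_bound)
    also have "\<dots> \<le> C * hm.nrm u" using u C(2)[of u] H1_mu_norm_eq[of u] by simp
    finally show "\<bar>LINT x|lebesgue. u x\<bar> \<le> C * hm.nrm u" .
  qed
  then obtain W where W: "W \<in> H1_mu0 \<mu> UNIV" and WL:
      "\<And>\<phi>. \<phi> \<in> H1_mu0 \<mu> UNIV \<Longrightarrow> H1_mu_form \<mu> W \<phi> = (LINT x|lebesgue. \<phi> x)" by blast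
  note W' = H1_mu0_D[OF W]
  obtain K where K: "K \<ge> 0" "\<And>e y. e > 0 \<Longrightarrow> norm (tgrad (cutoff e) (y::'a)) \<le> K / e"
    using tgrad_cutoff_bound by metis
  let ?\<eta> = "\<lambda>n. cutoff (real (Suc n)) :: 'a \<Rightarrow> real"
  let ?a = "\<lambda>n. l2n lebesgue (\<lambda>x. (1 - ?\<eta> n x) *\<^sub>R grad W x)"
  let ?b = "\<lambda>n. l2n lebesgue (\<lambda>x. (1 - ?\<eta> n x) *\<^sub>R W x)"
  let ?c = "\<lambda>n. l2n (completion \<mu>) (\<lambda>x. (1 - ?\<eta> n x) *\<^sub>R W x)"
  \<comment> \<open>The four terms bound, in this order, the integrals \<open>b1\<close> to
    \<open>b4\<close> into which the form of \<open>W\<close> and \<open>(1 - \<eta>) * |u|\<close>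
    splits.\<close>
  define \<delta> where "\<delta> n = ?a n + l2n lebesgue (grad W) * (K * (1 / real (Suc n))) + ?b n + ?c n" for n
  have "\<delta> \<longlonglongrightarrow> 0 + l2n lebesgue (grad W) * (K * 0) + 0 + 0" unfolding \<delta>_def
    by (intro tendsto_add tendsto_mult tendsto_const l2n_cutoff_tendsto H1D W'
        continuous_lebesgue_measurable
        continuous_mu_measurable LIMSEQ_Suc[OF lim_1_over_n])
  then have "\<delta> \<longlonglongrightarrow> 0" by simp
  moreover have "(LINT x|lebesgue. (1 - ?\<eta> n x) * \<bar>u x\<bar>) \<le> \<delta> n * hm.nrm u" if "u \<in> H1_mu \<mu>" for n u
  proof -
    from that have u: "u \<in> H1_mu0 \<mu> UNIV" by simp
    let ?p = "\<lambda>x. \<bar>u x\<bar>"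
    note p = H1_mu0_abs[OF u]
    note p' = H1_mu0_D[OF p(1)]
    have e: "real (Suc n) > 0" by simp
    have \<eta>p: "(\<lambda>x. ?\<eta> n x * ?p x) \<in> H1_mu0 \<mu> UNIV"
        by (rule H1_mu0_mono[OF subset_UNIV cutoff_mult[OF p(1) e]])
    \<comment> \<open>Written as a difference because \<open>1 - \<eta>\<close> is not compactly
      supported: membership then comes from \<open>cutoff_mult\<close> and linearity.\<close>
    let ?d = "\<lambda>x. ?p x - ?\<eta> n x * ?p x"
    have d: "?d \<in> H1_mu0 \<mu> UNIV" by (rule hm.diff_mem[OF p(1) \<eta>p])
    note d' = H1_mu0_D[OF d]
    let ?G = "\<lambda>x. (1 - ?\<eta> n x) *\<^sub>R grad W x"
    let ?T = "\<lambda>x. ?p x *\<^sub>R tgrad (?\<eta> n) x"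
    let ?W = "\<lambda>x. (1 - ?\<eta> n x) *\<^sub>R W x"
    note T = l2n_tgrad_cutoff[OF H1D(1)[OF p'(1)] _ K(2)[OF e] e]
    have Ke: "K / real (Suc n) \<ge> 0" using K(1) by simp
    have sG: "sqint lebesgue ?G" and sW: "sqint lebesgue ?W" and mW: "sqint (completion \<mu>) ?W"
      by (intro sqint_1_minus_cutoff H1D W' continuous_lebesgue_measurable continuous_mu_measurable
          e; assumption)+
    note i1 = sqint_inner[OF sG H1D(2)[OF p'(1)]] and i2
        = sqint_inner[OF H1D(2)[OF W'(1)] T(1)[OF Ke]]
      and i3 = sqint_inner[OF sW H1D(1)[OF p'(1)]]
    have "H1_form W ?d = (LINT x|lebesgue. ?G x \<bullet> grad ?p x - grad W x \<bullet> ?T x + ?W x \<bullet> ?p x)"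
      unfolding H1_form_def
    proof (rule integral_cong_AE)
      show "(\<lambda>x. grad W x \<bullet> grad ?d x + W x * ?d x) \<in> borel_measurable lebesgue"
        by (rule borel_measurable_integrable[OF H1_form_integrable[OF W'(1) d'(1)]])
      show "(\<lambda>x. ?G x \<bullet> grad ?p x - grad W x \<bullet> ?T x + ?W x \<bullet> ?p x) \<in> borel_measurable lebesgue"
        by (rule borel_measurable_integrable) (intro Bochner_Integration.integrable_add
            Bochner_Integration.integrable_diff i1 i2 i3)
      show "AE x in lebesgue. grad W x \<bullet> grad ?d x + W x * ?d x = ?G x \<bullet> grad ?p x - grad W x \<bullet> ?T x
          + ?W x \<bullet> ?p x"
        using H1_diff_grad[OF p'(1) H1_mu0_D(1)[OF \<eta>p]] H1_test_mult(2)[OF p'(1)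
            test_function_cutoff[OF e]]
      proof eventually_elim
        case (elim x)
        show ?case unfolding elim by (simp add: algebra_simps)
      qed
    qed
    also have "\<dots> = (LINT x|lebesgue. ?G x \<bullet> grad ?p x) - (LINT x|lebesgue. grad W x \<bullet> ?T x)
        + (LINT x|lebesgue. ?W x \<bullet> ?p x)"
      using i1 i2 i3 by (simp only: Bochner_Integration.integral_add
          Bochner_Integration.integral_diff Bochner_Integration.integrable_diff)
    finally have H: "H1_form W ?d = (LINT x|lebesgue. ?G x \<bullet> grad ?p x) - (LINT x|lebesgue. grad W x
        \<bullet> ?T x) + (LINT x|lebesgue. ?W x \<bullet> ?p x)" .
    have mu: "(LINT x|completion \<mu>. W x * ?d x) = (LINT x|completion \<mu>. ?W x \<bullet> ?p x)"
      by (intro Bochner_Integration.integral_cong) (auto simp: algebra_simps)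
    let ?N = "hm.nrm u"
    have np: "l2n lebesgue ?p \<le> ?N" "l2n lebesgue (grad ?p) \<le> ?N" "l2n (completion \<mu>) ?p \<le> ?N"
      using l2n_le_hm[OF p(1)] l2n_grad_le_hm[OF p(1)] l2n_mu_le_hm[OF p(1)] p(2) by linarith+
    have b1: "\<bar>LINT x|lebesgue. ?G x \<bullet> grad ?p x\<bar> \<le> ?a n * ?N"
      using l2_cauchy_schwarz_inner[OF sG H1D(2)[OF p'(1)]] mult_left_mono[OF np(2), of "?a n"]
          by simp
    have b2: "\<bar>LINT x|lebesgue. grad W x \<bullet> ?T x\<bar>
        \<le> (l2n lebesgue (grad W) * (K * (1 / real (Suc n)))) * ?N"
    proof -
      have "\<bar>LINT x|lebesgue. grad W x \<bullet> ?T x\<bar> \<le> l2n lebesgue (grad W) * l2n lebesgue ?T"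
        by (rule l2_cauchy_schwarz_inner[OF H1D(2)[OF W'(1)] T(1)[OF Ke]])
      also have "\<dots> \<le> l2n lebesgue (grad W) * (K / real (Suc n) * ?N)"
        using order_trans[OF T(2)[OF Ke] mult_left_mono[OF np(1) Ke]] by (intro mult_left_mono) auto
      finally show ?thesis by (simp add: mult.assoc)
    qed
    have b3: "\<bar>LINT x|lebesgue. ?W x \<bullet> ?p x\<bar> \<le> ?b n * ?N"
      by (rule order_trans[OF l2_cauchy_schwarz_inner[OF sW H1D(1)[OF p'(1)]] mult_left_mono[OF
          np(1) l2n_nonneg]])
    have b4: "\<bar>LINT x|completion \<mu>. ?W x \<bullet> ?p x\<bar> \<le> ?c n * ?N"
      by (rule order_trans[OF l2_cauchy_schwarz_inner[OF mW p'(3)] mult_left_mono[OF np(3)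
          l2n_nonneg]])
    have "(LINT x|lebesgue. (1 - ?\<eta> n x) * \<bar>u x\<bar>) = (LINT x|lebesgue. ?d x)"
      by (intro Bochner_Integration.integral_cong) (auto simp: algebra_simps)
    also have "\<dots> = H1_form W ?d + (LINT x|completion \<mu>. W x * ?d x)"
      using WL[OF d] by (simp add: H1_mu_form_def)
    also have "\<dots> \<le> ?a n * ?N + (l2n lebesgue (grad W) * (K * (1 / real (Suc n)))) * ?N + ?b n * ?N
        + ?c n * ?N"
      unfolding H mu using b1 b2 b3 b4 by linarith
    also have "\<dots> = \<delta> n * ?N" by (simp only: \<delta>_def distrib_right)
    finally show ?thesis .
  qed
  ultimately show ?thesis by blast
qed

end

section \<open>Compactness on balls and extraction of subsequences\<close>

text \<open>Any subsequence can be thinned out until its members are pairwise closer than a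
  prescribed \<open>e\<close>; the diagonal over \<open>e = 1/(k+1)\<close> is Cauchy. This lets the
  radius of the ball depend on the accuracy.\<close>

lemma diagonal_cauchy_subsequence:
  fixes d :: "nat \<Rightarrow> nat \<Rightarrow> real"
  assumes "\<And>e. \<And>s :: nat \<Rightarrow> nat. e > 0 \<Longrightarrow> strict_mono s \<Longrightarrow> \<exists>r::nat\<Rightarrow>nat. strict_mono r
      \<and> (\<forall>i j. d (s (r i)) (s (r j)) < e)"
  shows "\<exists>r. strict_mono (r :: nat \<Rightarrow> nat) \<and> (\<forall>e>0. \<exists>N. \<forall>i\<ge>N. \<forall>j\<ge>N. d (r i) (r j) < e)"
proof -
  interpret subseqs "\<lambda>n s. \<forall>i j. d (s i) (s j) < 1 / real (Suc n)"
  proof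
    fix n and s :: "nat \<Rightarrow> nat" assume "strict_mono s"
    then show "\<exists>r::nat\<Rightarrow>nat. strict_mono r \<and> (\<forall>i j. d ((s \<circ> r) i) ((s \<circ> r) j) < 1 / real (Suc n))"
      using assms[of "1 / real (Suc n)" s] by simp
  qed
  \<comment> \<open>From index \<open>Suc k\<close> on, the diagonal sequence runs inside the
    extraction of stage \<open>k\<close>.\<close>
  have h: "d (diagseq (Suc k + i)) (diagseq (Suc k + j)) < 1 / real (Suc k)" for k i j
    using diagseq_holds[of k] by (auto simp: o_def)
  have "\<exists>N. \<forall>i\<ge>N. \<forall>j\<ge>N. d (diagseq i) (diagseq j) < e" if pos: "e > 0" for e
  proof -
    obtain k where k: "1 / real (Suc k) < e" using reals_Archimedean[OF pos]
        by (auto simp: inverse_eq_divide)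
    have "d (diagseq i) (diagseq j) < e" if "i \<ge> Suc k" "j \<ge> Suc k" for i j
      using h[of k "i - Suc k" "j - Suc k"] that k by simp
    then show ?thesis by blast
  qed
  then show ?thesis using subseq_diagseq by blast
qed

lemma moll_diff:
  assumes "e > 0" "sqint lebesgue u" "sqint lebesgue v"
  shows "moll e (\<lambda>x. u x - v x) y = moll e u y - moll e v y"
  using integrable_scaleR_sqint[OF sqint_bump[OF assms(1)] assms(2), of y]
    integrable_scaleR_sqint[OF sqint_bump[OF assms(1)] assms(3), of y]
  by (simp add: moll_def scaleR_diff_right)

text \<open>Rellich: by \<open>H1_moll_close\<close> the sequence is uniformly approximated in $L^2$ by its
  mollifications, to which the Arzela--Ascoli theorem applies.\<close>

lemma rellich_L1_ball:
  fixes u :: "nat \<Rightarrow> 'a::euclidean_space \<Rightarrow> real"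
  assumes u: "\<And>k. u k \<in> H1" and M: "\<And>k. h1.nrm (u k) \<le> M" and R: "R > 0" and e: "e > 0"
  shows "\<exists>r. strict_mono (r :: nat \<Rightarrow> nat) \<and>
    (\<forall>i j. (LINT x|lebesgue. indicator (cball 0 R) x * \<bar>u (r i) x - u (r j) x\<bar>) < e)"
proof -
  let ?S = "cball (0::'a) R"
  let ?i = "\<lambda>x. indicator ?S x :: real"
  define A where "A = l2n lebesgue ?i"
  have A0: "0 \<le> A" by (simp add: A_def)
  have M0: "0 \<le> M" using h1.nrm_nonneg[OF u, of 0] M[of 0] by linarith
  \<comment> \<open>With this radius the mollification error of a difference, whose norm is at most
    \<open>2 * M\<close>, contributes at most \<open>e/4\<close> to the L1 norm on the ball;
    \<open>A\<close> comes from Cauchy-Schwarz and the summand 1 keeps the denominator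
    positive.\<close>
  define a where "a = e / (4 * (A * (2 * M) + 1))"
  have den: "0 < A * (2 * M) + 1" using A0 M0 by (simp add: add_nonneg_pos)
  have a: "a > 0" using e den by (simp add: a_def)
  have aA: "A * (a * (2 * M)) \<le> e / 4"
  proof -
    have "A * (a * (2 * M)) = a * (A * (2 * M))" by simp
    also have "\<dots> \<le> a * (A * (2 * M) + 1)" using a by (intro mult_left_mono) auto
    also have "\<dots> = e / 4"
    proof -
      have "e / (4 * z) * z = e / 4" if "z > 0" for z using that by simp
      from this[OF den] show ?thesis unfolding a_def .
    qed
    finally show ?thesis .
  qed
  \<comment> \<open>The uniform tolerance for the mollified sequence. \<open>A^2\<close> is the
    volume of the ball, so this part also contributes at most \<open>e/4\<close>.\<close>
  define t where "t = e / (8 * (A\<^sup>2 + 1))"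
  have t: "t > 0" using e by (simp add: t_def add_nonneg_pos)
  have tA: "A\<^sup>2 * (2 * t) \<le> e / 4"
  proof -
    have "A\<^sup>2 * (2 * t) \<le> (A\<^sup>2 + 1) * (2 * t)" using t by (intro mult_right_mono) auto
    also have "\<dots> = e / 4"
    proof -
      have z: "A\<^sup>2 + 1 > 0" by (simp add: add_nonneg_pos)
      have "z * (2 * (e / (8 * z))) = e / 4" if "z > 0" for z using that by simp
      from this[OF z] show ?thesis unfolding t_def .
    qed
    finally show ?thesis .
  qed
  have su: "sqint lebesgue (u k)" for k by (rule H1D(1)[OF u])
  have lu: "l2n lebesgue (u k) \<le> M" for k using l2n_le_h1[OF u] M order_trans by blast
  obtain K where K: "K \<ge> 0" "\<And>v x. sqint lebesgue v \<Longrightarrow> norm (moll a v (x::'a) :: real)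
      \<le> K * l2n lebesgue v"
    using moll_bounded[OF a] by blast
  obtain L where L: "L \<ge> 0" "\<And>v x x'. sqint lebesgue v
      \<Longrightarrow> norm (moll a v (x::'a) - moll a v x' :: real) \<le> L * norm (x - x') * l2n lebesgue v"
    using moll_lipschitz[OF a] by blast
  obtain g and r :: "nat \<Rightarrow> nat" where r: "strict_mono r"
    and g: "\<And>e. 0 < e \<Longrightarrow> \<exists>N. \<forall>n x. n \<ge> N \<and> x \<in> ?S \<longrightarrow> norm (moll a (u (r n)) x - g x) < e"
  proof (rule Arzela_Ascoli[of ?S "\<lambda>k. moll a (u k)" "K * M"])
    show "norm (moll a (u k) x) \<le> K * M" for k x
      using order_trans[OF K(2)[OF su] mult_left_mono[OF lu K(1)]] .
    fix x :: 'a and e :: real assume e: "0 < e"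
    have LM: "0 < L * M + 1" using L(1) M0 by (simp add: add_nonneg_pos)
    show "\<exists>d>0. \<forall>n y. y \<in> ?S \<and> norm (x - y) < d \<longrightarrow> norm (moll a (u n) x - moll a (u n) y) < e"
    proof (intro exI[of _ "e / (L * M + 1)"] conjI allI impI)
      fix n y assume y: "y \<in> ?S \<and> norm (x - y) < e / (L * M + 1)"
      have "norm (moll a (u n) x - moll a (u n) y) \<le> L * norm (x - y) * l2n lebesgue (u n)"
          by (rule L(2)[OF su])
      also have "\<dots> \<le> L * norm (x - y) * M" using L(1) by (intro mult_left_mono lu) auto
      also have "\<dots> \<le> norm (x - y) * (L * M + 1)" by (simp add: algebra_simps)
      also have "\<dots> < e" using y LM by (simp add: pos_less_divide_eq)
      finally show "norm (moll a (u n) x - moll a (u n) y) < e" .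
    qed (use e LM in simp)
  qed auto
  obtain N where N: "\<And>n x. n \<ge> N \<Longrightarrow> x \<in> ?S \<Longrightarrow> norm (moll a (u (r n)) x - g x) < t" using g[OF t]
      by blast
  \<comment> \<open>Dropping the first \<open>N\<close> members makes the estimate hold for all
    pairs of indices, as \<open>diagonal_cauchy_subsequence\<close> asks.\<close>
  let ?r = "\<lambda>i. r (i + N)"
  have "strict_mono ?r" using r by (simp add: strict_mono_def)
  moreover have "(LINT x|lebesgue. ?i x * \<bar>u (?r i) x - u (?r j) x\<bar>) < e" for i j
  proof -
    let ?f = "\<lambda>x. u (?r i) x - u (?r j) x"
    have f: "?f \<in> H1" by (rule h1.diff_mem[OF u u])
    note sf = H1D(1)[OF f]
    have fn: "l2n lebesgue (grad ?f) \<le> 2 * M"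
    proof -
      have "l2n lebesgue (grad ?f) \<le> h1.nrm ?f" by (rule l2n_grad_le_h1[OF f])
      also have "\<dots> \<le> h1.nrm (u (?r i)) + h1.nrm (u (?r j))"
        using h1.nrm_triangle[OF u h1.scale_mem[OF u, of "-1"], of "?r i"
            "?r j"] h1.nrm_scale[OF u, of "-1" "?r j"] by simp
      also have "\<dots> \<le> 2 * M" using M[of "?r i"] M[of "?r j"] by linarith
      finally show ?thesis .
    qed
    let ?h = "\<lambda>x. moll a ?f x - ?f x"
    have sh: "sqint lebesgue ?h" by (rule sqint_diff[OF sqint_moll[OF a sf] sf])
    have si: "sqint lebesgue ?i" by (rule sqint_indicator_cball)
    have "l2n lebesgue ?h \<le> a * (2 * M)"
      by (rule order_trans[OF H1_moll_close[OF a H1D[OF f]] mult_left_mono[OF fn]]) (use a in simp)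
    then have 1: "(LINT x|lebesgue. norm (?i x) * norm (?h x)) \<le> A * (a * (2 * M))"
      using l2_cauchy_schwarz[OF si sh] mult_left_mono[of "l2n lebesgue ?h" "a * (2 * M)" A] A0
          by (simp add: A_def)
    have sq: "(\<lambda>x. ?i x * (2 * t)) = (\<lambda>x. (norm (?i x))\<^sup>2 * (2 * t))" by (auto simp: indicator_def)
    have it: "integrable lebesgue (\<lambda>x. ?i x * (2 * t))" unfolding sq using sqint_int[OF si] by simp
    have 2: "(LINT x|lebesgue. ?i x * (2 * t)) = A\<^sup>2 * (2 * t)" unfolding sq A_def l2n_sq by simp
    have "(LINT x|lebesgue. ?i x * \<bar>?f x\<bar>) \<le> (LINT x|lebesgue. norm (?i x) * norm (?h x)
        + ?i x * (2 * t))"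
    proof (rule integral_mono)
      show "integrable lebesgue (\<lambda>x. ?i x * \<bar>?f x\<bar>)" using sqint_norm_mult[OF si sf] by simp
      show "integrable lebesgue (\<lambda>x. norm (?i x) * norm (?h x) + ?i x * (2 * t))"
        by (intro Bochner_Integration.integrable_add sqint_norm_mult[OF si sh] it)
      fix x
      show "?i x * \<bar>?f x\<bar> \<le> norm (?i x) * norm (?h x) + ?i x * (2 * t)"
      proof (cases "x \<in> ?S")
        case True
        have "norm (moll a (u (?r i)) x - g x) < t" "norm (moll a (u (?r j)) x - g x) < t"
          using N[of "i + N" x] N[of "j + N" x] True by auto
        then have "\<bar>moll a ?f x\<bar> < 2 * t" unfolding moll_diff[OF a su su] real_norm_def by linarith
        then have "\<bar>?f x\<bar> \<le> \<bar>?h x\<bar> + 2 * t" by linarith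
        then show ?thesis using True by simp
      qed simp
    qed
    also have "\<dots> = (LINT x|lebesgue. norm (?i x) * norm (?h x)) + (LINT x|lebesgue. ?i x * (2 * t))"
      by (rule Bochner_Integration.integral_add[OF sqint_norm_mult[OF si sh] it])
    also have "\<dots> \<le> e / 4 + e / 4" unfolding 2 using 1 aA tA by linarith
    also have "\<dots> < e" using e by simp
    finally show ?thesis .
  qed
  ultimately show ?thesis by blast
qed

context capacitary_measure
begin

lemma compactly_embedded_if_embedded:
  assumes emb: "continuously_embedded_L1 \<mu>"
  shows "compactly_embedded_L1 \<mu>"
proof -
  have sub: "\<And>u. u \<in> H1_mu \<mu> \<Longrightarrow> integrable lebesgue u" using emb
      by (auto simp: continuously_embedded_L1_def L1_def)
  obtain \<delta> where \<delta>: "\<delta> \<longlonglongrightarrow> 0" and tail: "\<And>n u. u \<in> H1_mu \<mu>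
      \<Longrightarrow> (LINT x|lebesgue. (1 - cutoff (real (Suc n)) x) * \<bar>u x\<bar>) \<le> \<delta> n * hm.nrm u"
    using tail_bound[OF emb] by blast
  have "\<exists>r v. strict_mono r \<and> v \<in> L1 \<and> (\<lambda>n. L1_norm (\<lambda>x. u (r n) x - v x)) \<longlonglongrightarrow> 0"
    if u: "\<And>n::nat. u n \<in> H1_mu \<mu>" and M: "\<And>n. H1_mu_norm \<mu> (u n) \<le> M" for u M
  proof -
    have u0: "u n \<in> H1_mu0 \<mu> UNIV" for n using u by simp
    have uH: "u n \<in> H1" for n by (rule H1_mu0_D(1)[OF u0])
    have uM: "hm.nrm (u n) \<le> M" for n using M[of n] H1_mu_norm_eq[OF u] by simp
    have M0: "0 \<le> M" using hm.nrm_nonneg[OF u0, of 0] uM[of 0] by linarith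
    have df: "(\<lambda>x. u i x - u j x) \<in> H1_mu \<mu>" for i j using hm.diff_mem[OF u0 u0] by simp
    note di = sub[OF df]
    define d where "d i j = (LINT x|lebesgue. \<bar>u i x - u j x\<bar>)" for i j
    have dM: "hm.nrm (\<lambda>x. u i x - u j x) \<le> 2 * M" for i j
      using hm.nrm_triangle[OF u0 hm.scale_mem[OF u0, of "-1"], of i j] hm.nrm_scale[OF u0, of
          "-1" j] uM[of i] uM[of j] by simp
    have "\<exists>r::nat\<Rightarrow>nat. strict_mono r \<and> (\<forall>i j. d (s (r i)) (s (r j)) < e)" if e:
        "e > 0" for e :: real and s :: "nat \<Rightarrow> nat"
    proof -
      \<comment> \<open>The radius is fixed first, from the tail estimate for differences, whose
        norm is at most \<open>2 * M\<close>; the subsequence is then extracted on the ball of that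
        radius.\<close>
      have "(\<lambda>n. \<delta> n * (2 * M)) \<longlonglongrightarrow> 0 * (2 * M)" by (intro tendsto_intros \<delta>)
      then have "\<forall>\<^sub>F n in sequentially. \<delta> n * (2 * M) < e / 2" and
          "\<forall>\<^sub>F n in sequentially. \<bar>\<delta> n\<bar> * (2 * M) < e / 2"
        using order_tendstoD(2)[of "\<lambda>n. \<delta> n * (2 * M)" 0 sequentially "e/2"]
          order_tendstoD(2)[OF tendsto_mult_left_zero[OF tendsto_rabs_zero[OF \<delta>], of "2 * M"], of
              "e/2"] e by auto
      then obtain n where n: "\<bar>\<delta> n\<bar> * (2 * M) < e / 2" unfolding eventually_sequentially by blast
      let ?R = "real (Suc n)"
      obtain r :: "nat \<Rightarrow> nat" where r: "strict_mono r" and rr: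
          "\<And>i j. (LINT x|lebesgue. indicator (cball 0 ?R) x * \<bar>u (s (r i)) x - u (s (r j)) x\<bar>)
          < e / 2"
        using rellich_L1_ball[of "\<lambda>k. u (s k)" M ?R
            "e/2"] uH order_trans[OF h1_nrm_le_hm[OF u0] uM] e by auto
      have "d (s (r i)) (s (r j)) < e" for i j
      proof -
        let ?f = "\<lambda>x. u (s (r i)) x - u (s (r j)) x"
        let ?c = "cutoff ?R :: 'a \<Rightarrow> real"
        have fi: "integrable lebesgue (\<lambda>x. \<bar>?f x\<bar>)" by (rule integrable_abs[OF di])
        have [measurable]: "?c \<in> borel_measurable lebesgue"
            by (rule continuous_lebesgue_measurable[OF continuous_cutoff]) simp
        have fm[measurable]: "(\<lambda>x. \<bar>?f x\<bar>) \<in> borel_measurable lebesgue"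
            by (rule borel_measurable_integrable[OF fi])
        have i1: "integrable lebesgue (\<lambda>x. (1 - ?c x) * \<bar>?f x\<bar>)"
        proof (rule Bochner_Integration.integrable_bound[OF fi])
          show "AE x in lebesgue. norm ((1 - ?c x) * \<bar>?f x\<bar>) \<le> norm \<bar>?f x\<bar>"
            using cutoff_contract[where 'b=real, of ?R] by (intro AE_I2) (simp add: abs_mult)
        qed measurable
        have [measurable]: "cball 0 ?R \<in> sets (lebesgue :: 'a measure)" by simp
        have i2: "integrable lebesgue (\<lambda>x. indicator (cball 0 ?R) x * \<bar>?f x\<bar>)"
        proof (rule Bochner_Integration.integrable_bound[OF fi])
          show "AE x in lebesgue. norm (indicator (cball 0 ?R) x * \<bar>?f x\<bar>) \<le> norm \<bar>?f x\<bar>"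
            by (intro AE_I2) (simp add: indicator_def)
        qed measurable
        have "d (s (r i)) (s (r j)) \<le> (LINT x|lebesgue. (1 - ?c x) * \<bar>?f x\<bar>
            + indicator (cball 0 ?R) x * \<bar>?f x\<bar>)"
          unfolding d_def
        proof (rule integral_mono[OF fi Bochner_Integration.integrable_add[OF i1 i2]])
          fix x :: 'a
          \<comment> \<open>The cutoff lies below the indicator of its ball, so the integral splits
            into a tail and a part on the ball.\<close>
          have "?c x \<le> indicator (cball 0 ?R) x"
            using cutoff_le_1[of ?R x] cutoff_eq_0[of ?R x] by (auto simp: indicator_def)
          then have "?c x * \<bar>?f x\<bar> \<le> indicator (cball 0 ?R) x * \<bar>?f x\<bar>"
              by (intro mult_right_mono) auto
          then show "\<bar>?f x\<bar> \<le> (1 - ?c x) * \<bar>?f x\<bar> + indicator (cball 0 ?R) x * \<bar>?f x\<bar>"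
            by (simp add: algebra_simps)
        qed
        also have "\<dots> = (LINT x|lebesgue. (1 - ?c x) * \<bar>?f x\<bar>)
            + (LINT x|lebesgue. indicator (cball 0 ?R) x * \<bar>?f x\<bar>)"
          by (rule Bochner_Integration.integral_add[OF i1 i2])
        also have "(LINT x|lebesgue. (1 - ?c x) * \<bar>?f x\<bar>) \<le> \<delta> n * hm.nrm ?f" by (rule tail[OF df])
        also have "\<delta> n * hm.nrm ?f \<le> \<bar>\<delta> n\<bar> * (2 * M)"
          using hm.nrm_nonneg[OF hm.diff_mem[OF u0 u0]] by (intro mult_mono dM) auto
        finally show ?thesis using rr[of i j] n by simp
      qed
      with r show ?thesis by blast
    qed
    then obtain r :: "nat \<Rightarrow> nat" where r: "strict_mono r" and cau:
        "\<And>e. e > 0 \<Longrightarrow> \<exists>N. \<forall>i\<ge>N. \<forall>j\<ge>N. d (r i) (r j) < e"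
      using diagonal_cauchy_subsequence[of d] by blast
    have nn: "(\<integral>\<^sup>+x. ennreal (norm (u i x - u j x) ^ 1) \<partial>lebesgue) = ennreal (d i j)" for i j
      using nn_integral_eq_integral[OF integrable_abs[OF di]] by (simp add: d_def)
    have um: "u n \<in> borel_measurable lebesgue" for n
        by (rule borel_measurable_integrable[OF sub[OF u]])
    \<comment> \<open>Completeness of L1, which is the case of exponent 1.\<close>
    have "\<exists>v q. v \<in> borel_measurable lebesgue \<and> strict_mono (q :: nat \<Rightarrow> nat) \<and>
      (AE x in lebesgue. (\<lambda>n. u (r (q n)) x) \<longlonglongrightarrow> v x) \<and>
      (\<forall>e::real>0. \<exists>N. \<forall>n\<ge>N. (\<integral>\<^sup>+x. ennreal (norm (u (r n) x - v x) ^ 1) \<partial>lebesgue) \<le> ennreal e)"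
    proof (rule Lp_complete[OF um zero_less_one])
      fix e :: real assume e: "e > 0"
      obtain N where "\<And>i j. i \<ge> N \<Longrightarrow> j \<ge> N \<Longrightarrow> d (r i) (r j) < e" using cau[OF e] by blast
      then show "\<exists>N. \<forall>m\<ge>N. \<forall>n\<ge>N. (\<integral>\<^sup>+x. ennreal (norm (u (r m) x - u (r n) x) ^ 1) \<partial>lebesgue)
          < ennreal e"
        unfolding nn using e by (intro exI[of _ N]) (auto intro: ennreal_lessI)
    qed
    then obtain v where vm: "v \<in> borel_measurable lebesgue"
      and v: "\<And>e::real. e > 0 \<Longrightarrow> \<exists>N. \<forall>n\<ge>N. (\<integral>\<^sup>+x. ennreal (norm (u (r n) x - v x)) \<partial>lebesgue)
          \<le> ennreal e"
      by auto
    obtain N where "(\<integral>\<^sup>+x. ennreal (norm (u (r N) x - v x)) \<partial>lebesgue) \<le> ennreal 1" using v[of 1]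
        by auto
    then have "integrable lebesgue (\<lambda>x. u (r N) x - v x)"
      using um vm by (intro integrableI_bounded) (auto simp: le_less_trans)
    from Bochner_Integration.integrable_diff[OF sub[OF u] this, of "r N"]
    have vi: "integrable lebesgue v" by simp
    have "(\<lambda>n. L1_norm (\<lambda>x. u (r n) x - v x)) \<longlonglongrightarrow> 0"
    proof (rule LIMSEQ_I)
      fix e :: real assume e: "e > 0"
      then obtain N where N: "\<And>n. n \<ge> N \<Longrightarrow> (\<integral>\<^sup>+x. ennreal (norm (u (r n) x - v x)) \<partial>lebesgue)
          \<le> ennreal (e/2)"
        using v[of "e/2"] by auto
      have "L1_norm (\<lambda>x. u (r n) x - v x) \<le> e/2" if "n \<ge> N" for n
      proof -
        have "integrable lebesgue (\<lambda>x. \<bar>u (r n) x - v x\<bar>)"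
          by (intro integrable_abs Bochner_Integration.integrable_diff sub u vi)
        from nn_integral_eq_integral[OF this] N[OF that] show ?thesis using e
            by (simp add: L1_norm_def)
      qed
      moreover have "0 \<le> L1_norm (\<lambda>x. u (r n) x - v x)" for n by (simp add: L1_norm_def)
      ultimately have "\<forall>n\<ge>N. norm (L1_norm (\<lambda>x. u (r n) x - v x) - 0) < e" using e by fastforce
      then show "\<exists>N. \<forall>n\<ge>N. norm (L1_norm (\<lambda>x. u (r n) x - v x) - 0) < e" by blast
    qed
    then show ?thesis using r vi by (auto simp: L1_def)
  qed
  then show ?thesis using sub unfolding compactly_embedded_L1_def L1_def by blast
qed

end

theorem theorem3p2:
  fixes \<mu> :: "'a::euclidean_space measure"
  assumes "\<mu> \<in> M0"
  shows "(w_mu \<mu> \<in> L1 \<longleftrightarrow> continuously_embedded_L1 \<mu>) \<and>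
    (w_mu \<mu> \<in> L1 \<or> continuously_embedded_L1 \<mu> \<longrightarrow> compactly_embedded_L1 \<mu>)"
proof -
  interpret capacitary_measure \<mu>
    using assms by unfold_locales (auto simp: M0_def)
  have "w_mu \<mu> \<in> L1 \<longleftrightarrow> continuously_embedded_L1 \<mu>"
    using embedded_if_torsion_integrable torsion_integrable_if_embedded by (auto simp: L1_def)
  then show ?thesis using compactly_embedded_if_embedded by blast
qed

end
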